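(* Let $M$ be a simple cographic matroid. The following conditions are equivalent: (1) all roots of the characteristic polynomial $\chi(M;\lambda)$ are integers; (2) $M$ can be constructed by taking parallel connections of copies of points, $M(K_3)$'s, or $M(K_4)$'s at the empty set, a point or a $3$-point line, with the restriction that no line in an $M(K_4)$ can be used more than once in a parallel connection; (3) $M$ is the cycle matroid of a planar chordal graph; (4) $M$ is supersolvable.
   Context: For a matroid $M$ with no loops, $\chi(M;\lambda)=\sum_{X\in L(M)}\mu(\emptyset,X)\lambda^{\mathrm{rank}(M)-\mathrm{rank}(X)}$, where $L(M)$ is the lattice of flats and $\mu$ its Möbius function. A matroid is cographic if it is the dual of the cycle matroid of a graph, and simple if it has no loops and no parallel elements. $M(K_n)$ is the cycle matroid of the complete graph $K_n$. A flat $X$ is modular if for every line $L$ (rank-$2$ flat) with $\mathrm{rank}(X\vee L)=\mathrm{rank}(X)+1$, $X\cap L\neq\emptyset$. A rank-$r$ matroid is supersolvable if it has a maximal chain of flats $X_0\subset X_1\subset\cdots\subset X_r$ with $\mathrm{rank}(X_i)=i$ and each $X_i$ modular. Parallel connection at a common flat (empty set, point, or line) means generalized parallel connection along that flat. A graph is chordal if it has no induced cycle of length greater than $3$. *)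

theory Defs
  imports
    "HOL-Analysis.Analysis"
    "HOL-Computational_Algebra.Polynomial"
    "HOL-Library.Multiset"
begin

section \<open>Matroids\<close>

record 'a pre_matroid =
  ground :: "'a set"
  indep :: "'a set set"

locale matroid =
  fixes M :: "'a pre_matroid"
  assumes finite_ground: "finite (ground M)"
    and indep_subset: "X \<in> indep M \<Longrightarrow> X \<subseteq> ground M"
    and indep_empty: "{} \<in> indep M"
    and indep_mono: "X \<in> indep M \<Longrightarrow> Y \<subseteq> X \<Longrightarrow> Y \<in> indep M"
    and augmentation: "X \<in> indep M \<Longrightarrow> Y \<in> indep M \<Longrightarrow> card X < card Y \<Longrightarrow>
      \<exists>e \<in> Y - X. insert e X \<in> indep M"

definition basis :: "'a pre_matroid \<Rightarrow> 'a set \<Rightarrow> bool" where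
  "basis M B \<longleftrightarrow> B \<in> indep M \<and> (\<forall>X \<in> indep M. B \<subseteq> X \<longrightarrow> X = B)"

definition dual :: "'a pre_matroid \<Rightarrow> 'a pre_matroid" where
  "dual M = \<lparr> ground = ground M,
     indep = {X. \<exists>B. basis M B \<and> X \<subseteq> ground M - B} \<rparr>"

definition restriction :: "'a pre_matroid \<Rightarrow> 'a set \<Rightarrow> 'a pre_matroid" where
  "restriction M S = \<lparr> ground = ground M \<inter> S, indep = {X \<in> indep M. X \<subseteq> S} \<rparr>"

definition isomorphic :: "'a pre_matroid \<Rightarrow> 'b pre_matroid \<Rightarrow> bool" where
  "isomorphic M N \<longleftrightarrow> (\<exists>f. bij_betw f (ground M) (ground N) \<and>
     (\<forall>X \<subseteq> ground M. X \<in> indep M \<longleftrightarrow> f ` X \<in> indep N))"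

definition mrank :: "'a pre_matroid \<Rightarrow> 'a set \<Rightarrow> nat" where
  "mrank M X = Max (card ` {I \<in> indep M. I \<subseteq> X})"

abbreviation rank_of :: "'a pre_matroid \<Rightarrow> nat" where
  "rank_of M \<equiv> mrank M (ground M)"

definition mclosure :: "'a pre_matroid \<Rightarrow> 'a set \<Rightarrow> 'a set" where
  "mclosure M X = {e \<in> ground M. mrank M (insert e X) = mrank M X}"

definition flats :: "'a pre_matroid \<Rightarrow> 'a set set" where
  "flats M = {X. X \<subseteq> ground M \<and> mclosure M X = X}"

definition join :: "'a pre_matroid \<Rightarrow> 'a set \<Rightarrow> 'a set \<Rightarrow> 'a set" where
  "join M X Y = mclosure M (X \<union> Y)"

definition lines :: "'a pre_matroid \<Rightarrow> 'a set set" where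
  "lines M = {L \<in> flats M. mrank M L = 2}"

definition loop :: "'a pre_matroid \<Rightarrow> 'a \<Rightarrow> bool" where
  "loop M e \<longleftrightarrow> e \<in> ground M \<and> {e} \<notin> indep M"

definition parallel :: "'a pre_matroid \<Rightarrow> 'a \<Rightarrow> 'a \<Rightarrow> bool" where
  "parallel M e f \<longleftrightarrow> e \<in> ground M \<and> f \<in> ground M \<and> e \<noteq> f \<and>
     \<not> loop M e \<and> \<not> loop M f \<and> {e, f} \<notin> indep M"

definition simple_matroid :: "'a pre_matroid \<Rightarrow> bool" where
  "simple_matroid M \<longleftrightarrow> (\<nexists>e. loop M e) \<and> (\<nexists>e f. parallel M e f)"


section \<open>The characteristic polynomial\<close>

text \<open>The Moebius function of a family of sets ordered by inclusion. Finiteness of the family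
  makes the recursion well-founded; the value \<open>0\<close> for an infinite family is a dummy.\<close>

function mobius :: "'a set set \<Rightarrow> 'a set \<Rightarrow> 'a set \<Rightarrow> int" where
  "mobius \<L> X Y =
     (if X = Y then 1
      else if finite \<L> \<and> X \<subset> Y then - (\<Sum>Z \<in> {Z \<in> \<L>. X \<subseteq> Z \<and> Z \<subset> Y}. mobius \<L> X Z)
      else 0)"
  by pat_completeness auto
termination
proof (relation "Wellfounded.measure (\<lambda>(\<L>, X, Y). card {W \<in> \<L>. W \<subset> Y})")
  fix \<L> :: "'a set set" and X Y Z
  assume "finite \<L> \<and> X \<subset> Y" and "Z \<in> {Z \<in> \<L>. X \<subseteq> Z \<and> Z \<subset> Y}"
  then have "card {W \<in> \<L>. W \<subset> Z} < card {W \<in> \<L>. W \<subset> Y}"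
    by (intro psubset_card_mono) auto
  then show "((\<L>, X, Z), (\<L>, X, Y)) \<in> Wellfounded.measure (\<lambda>(\<L>, X, Y). card {W \<in> \<L>. W \<subset> Y})"
    by simp
qed simp

declare mobius.simps [simp del]

text \<open>Only meaningful for a matroid without loops: otherwise \<open>{}\<close> is not a flat.\<close>

definition characteristic_poly :: "'a pre_matroid \<Rightarrow> int poly" where
  "characteristic_poly M =
     (\<Sum>X \<in> flats M. monom (mobius (flats M) {} X) (rank_of M - mrank M X))"

definition all_roots_integers :: "int poly \<Rightarrow> bool" where
  "all_roots_integers p \<longleftrightarrow> (\<forall>z :: complex. poly (map_poly of_int p) z = 0 \<longrightarrow> z \<in> \<int>)"


section \<open>Modular flats and supersolvability\<close>

definition modular_flat :: "'a pre_matroid \<Rightarrow> 'a set \<Rightarrow> bool" where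
  "modular_flat M X \<longleftrightarrow> X \<in> flats M \<and>
     (\<forall>L \<in> lines M. mrank M (join M X L) = mrank M X + 1 \<longrightarrow> X \<inter> L \<noteq> {})"

definition supersolvable :: "'a pre_matroid \<Rightarrow> bool" where
  "supersolvable M \<longleftrightarrow> (\<exists>X :: nat \<Rightarrow> 'a set.
     (\<forall>i \<le> rank_of M. modular_flat M (X i) \<and> mrank M (X i) = i) \<and>
     (\<forall>i < rank_of M. X i \<subset> X (Suc i)))"


section \<open>Graphs\<close>

text \<open>Finite undirected graphs; loops (\<open>ends\<close> a singleton) and multiple edges are allowed.\<close>

record ('v, 'e) mgraph =
  verts :: "'v set"
  edges :: "'e set"
  ends :: "'e \<Rightarrow> 'v set"

locale finite_graph =
  fixes G :: "('v, 'e) mgraph"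
  assumes finite_verts: "finite (verts G)"
    and finite_edges: "finite (edges G)"
    and ends_in_verts: "e \<in> edges G \<Longrightarrow> ends G e \<subseteq> verts G"
    and card_ends: "e \<in> edges G \<Longrightarrow> card (ends G e) \<in> {1, 2}"

definition adjacent :: "('v, 'e) mgraph \<Rightarrow> 'v \<Rightarrow> 'v \<Rightarrow> bool" where
  "adjacent G u v \<longleftrightarrow> (\<exists>e \<in> edges G. ends G e = {u, v})"

text \<open>A loop is a cycle of length 1, and two distinct edges with the same two ends form a cycle
  of length 2.\<close>

definition cycle :: "('v, 'e) mgraph \<Rightarrow> 'v list \<Rightarrow> 'e list \<Rightarrow> bool" where
  "cycle G vs es \<longleftrightarrow> es \<noteq> [] \<and> length vs = length es \<and> distinct vs \<and> distinct es \<and>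
     set vs \<subseteq> verts G \<and> set es \<subseteq> edges G \<and>
     (\<forall>i < length es. ends G (es ! i) = {vs ! i, vs ! (Suc i mod length vs)})"

definition cycle_matroid :: "('v, 'e) mgraph \<Rightarrow> 'e pre_matroid" where
  "cycle_matroid G = \<lparr> ground = edges G,
     indep = {X. X \<subseteq> edges G \<and> \<not> (\<exists>vs es. cycle G vs es \<and> set es \<subseteq> X)} \<rparr>"

definition complete_graph :: "nat \<Rightarrow> (nat, nat set) mgraph" where
  "complete_graph n = \<lparr> verts = {..<n}, edges = {e. e \<subseteq> {..<n} \<and> card e = 2}, ends = (\<lambda>e. e) \<rparr>"

text \<open>Vertices are natural numbers because a finite graph has only finitely many of them; the
  edges are the elements of the matroid itself, so that "up to isomorphism" becomes equality.\<close>

definition cographic :: "'a pre_matroid \<Rightarrow> bool" where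
  "cographic M \<longleftrightarrow> (\<exists>G :: (nat, 'a) mgraph. finite_graph G \<and> M = dual (cycle_matroid G))"

definition induced_cycle :: "('v, 'e) mgraph \<Rightarrow> 'v list \<Rightarrow> bool" where
  "induced_cycle G vs \<longleftrightarrow> length vs \<ge> 3 \<and> distinct vs \<and> set vs \<subseteq> verts G \<and>
     (\<forall>i < length vs. \<forall>j < length vs. i \<noteq> j \<longrightarrow>
        (adjacent G (vs ! i) (vs ! j) \<longleftrightarrow>
           j = Suc i mod length vs \<or> i = Suc j mod length vs))"

definition chordal :: "('v, 'e) mgraph \<Rightarrow> bool" where
  "chordal G \<longleftrightarrow> (\<nexists>vs. induced_cycle G vs \<and> length vs > 3)"

text \<open>A drawing of \<open>G\<close> in the plane \<open>\<complex>\<close> without crossings. A simple path may be closed, which is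
  how a loop is drawn; an edge with two distinct ends is drawn as an arc.\<close>

definition plane_drawing ::
  "('v, 'e) mgraph \<Rightarrow> ('v \<Rightarrow> complex) \<Rightarrow> ('e \<Rightarrow> real \<Rightarrow> complex) \<Rightarrow> bool" where
  "plane_drawing G p \<gamma> \<longleftrightarrow> inj_on p (verts G) \<and>
     (\<forall>e \<in> edges G. simple_path (\<gamma> e) \<and>
        {pathstart (\<gamma> e), pathfinish (\<gamma> e)} = p ` ends G e \<and>
        path_image (\<gamma> e) \<inter> p ` verts G = p ` ends G e) \<and>
     (\<forall>e \<in> edges G. \<forall>f \<in> edges G. e \<noteq> f \<longrightarrow>
        path_image (\<gamma> e) \<inter> path_image (\<gamma> f) \<subseteq> p ` (ends G e \<inter> ends G f))"

definition planar :: "('v, 'e) mgraph \<Rightarrow> bool" where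
  "planar G \<longleftrightarrow> (\<exists>p \<gamma>. plane_drawing G p \<gamma>)"


section \<open>Parallel connections\<close>

text \<open>\<open>M\<close> is the generalized parallel connection (Brylawski) of \<open>M1\<close> and \<open>M2\<close> along their common
  flat \<open>T\<close>. The two matroids are glued by sharing the elements of \<open>T\<close>, and a matroid is determined
  by its ground set and its flats. The construction requires \<open>T\<close> to be modular on one side.\<close>

definition gen_parallel_connection ::
  "'a pre_matroid \<Rightarrow> 'a pre_matroid \<Rightarrow> 'a set \<Rightarrow> 'a pre_matroid \<Rightarrow> bool" where
  "gen_parallel_connection M1 M2 T M \<longleftrightarrow>
     matroid M1 \<and> matroid M2 \<and> matroid M \<and>
     T = ground M1 \<inter> ground M2 \<and> T \<in> flats M1 \<and> T \<in> flats M2 \<and>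
     restriction M1 T = restriction M2 T \<and>
     (modular_flat M1 T \<or> modular_flat M2 T) \<and>
     ground M = ground M1 \<union> ground M2 \<and>
     flats M = {X. X \<subseteq> ground M1 \<union> ground M2 \<and>
                   X \<inter> ground M1 \<in> flats M1 \<and> X \<inter> ground M2 \<in> flats M2}"

text \<open>\<open>assembled M \<K> \<U>\<close>: \<open>M\<close> is assembled by parallel connections from points, \<open>M(K\<^sub>3)\<close>'s
  and \<open>M(K\<^sub>4)\<close>'s; \<open>\<K>\<close> is the set of lines of the copies of \<open>M(K\<^sub>4)\<close>, and \<open>\<U>\<close> is the multiset of the
  flats along which connections were made. Glued elements are identified, so a line shared by
  several pieces is one and the same set, and its uses are counted together. The rule \<open>empty\<close>
  is the connection of no pieces at all.\<close>

inductive assembled :: "'a pre_matroid \<Rightarrow> 'a set set \<Rightarrow> 'a set multiset \<Rightarrow> bool" where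
  empty: "assembled \<lparr> ground = {}, indep = {{}} \<rparr> {} {#}"
| point: "assembled \<lparr> ground = {e}, indep = {{}, {e}} \<rparr> {} {#}"
| K3: "matroid N \<Longrightarrow> isomorphic N (cycle_matroid (complete_graph 3)) \<Longrightarrow> assembled N {} {#}"
| K4: "matroid N \<Longrightarrow> isomorphic N (cycle_matroid (complete_graph 4)) \<Longrightarrow>
    assembled N (lines N) {#}"
| connect: "assembled M1 \<K>1 \<U>1 \<Longrightarrow> assembled M2 \<K>2 \<U>2 \<Longrightarrow>
    gen_parallel_connection M1 M2 T M \<Longrightarrow>
    T = {} \<or> mrank M T = 1 \<or> mrank M T = 2 \<and> card T = 3 \<Longrightarrow>
    assembled M (\<K>1 \<union> \<K>2) (add_mset T (\<U>1 + \<U>2))"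

definition parallel_connection_of_cliques :: "'a pre_matroid \<Rightarrow> bool" where
  "parallel_connection_of_cliques M \<longleftrightarrow>
     (\<exists>\<K> \<U>. assembled M \<K> \<U> \<and> (\<forall>L \<in> \<K>. count \<U> L \<le> 1))"

end

theory Submission
 imports Defs "HOL-Computational_Algebra.Fundamental_Theorem_Algebra"
begin

text \<open>All four conditions are equivalent to the existence of a chain of flats from \<open>\<emptyset>\<close> to the ground set in
  which every flat is a modular hyperplane of the next. Stanley's factorization at modular flats turns such
  a chain into a factorization of the characteristic polynomial into linear factors. Conversely, let all
  roots be integers. If \<open>M\<close> is a parallel connection along the empty set, a point or a three-point line,
  chains of the two parts are put together. Otherwise every three-point line is a vertex star of the graph
  dual to \<open>M\<close>; integrality, used through the sum and the sum of squares of the roots, then forces all but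
  at most one vertex of that graph to have degree three, a case that is settled directly.

  Along a chain a graph representing \<open>M\<close> grows by vertices joined to cliques. These have at most three
  vertices, since \<open>M(K\<^sub>5)\<close> and the Fano plane are not cographic, and no triangle lies in three copies of
  \<open>K\<^sub>4\<close>. Hence the graph is assembled from cliques as in (2), and it has a straight-line drawing, which
  grows with an auxiliary point beside every triangle that may still receive a vertex. In the other
  direction, simplicial vertices of a chordal graph yield a chain.\<close>

text \<open>Everything is read off from one family of sets: the cycle space \<open>cycs G\<close> is
  the row space of a binary representation of M, so independence, flats and three-point lines become
  parity statements, and ranks are logarithms of cardinalities. The obstacle in the passage from
  integral roots is that the leading coefficients see only the rank r, the number n of elements and
  the number t of three-point lines. In an inseparable piece the beta invariant is positive, so 1 is
  a simple root and the other r - 1 roots are at least 2. This gives 2r \<le> n + 1 and 2n + 1 \<le>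
  3r + t, hence t \<ge> n - r, which is the number of vertices of the dual graph minus one; and t
  counts cubic vertices there. The excluded configurations all come from one count: minimum degree 3
  in the dual graph gives n \<le> 3r - 3 unless M is free. M(K5) has 10 > 9 elements, the Fano plane
  7 > 6, and three K4 on one triangle have 12 = 12, where equality forces a cubic dual
  graph.\<close>

context matroid
begin

section \<open>Rank, closure and flats of a finite matroid\<close>

abbreviation "E \<equiv> ground M"
abbreviation "rk \<equiv> mrank M"
abbreviation "cl \<equiv> mclosure M"

lemma finite_indep: "X \<in> indep M ==> finite X"
 using indep_subset finite_ground finite_subset by blast

lemma finite_indep_sets: "finite {I \<in> indep M. I \<subseteq> X}"
 by (rule finite_subset[of _ "Pow E"]) (use indep_subset finite_ground in auto)

lemma card_le_mrank: "I \<in> indep M ==> I \<subseteq> X ==> card I \<le> rk X"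
 unfolding mrank_def using finite_indep_sets by (intro Max_ge) auto

lemma indep_extend:
 assumes "J \<in> indep M" "J \<subseteq> X"
 obtains I where "I \<in> indep M" "J \<subseteq> I" "I \<subseteq> X" "card I = rk X"
proof -
 let ?S = "{I \<in> indep M. J \<subseteq> I \<and> I \<subseteq> X}"
 have fin: "finite ?S" using finite_indep_sets[of X] by (rule rev_finite_subset) auto
 have "Max (card ` ?S) \<in> card ` ?S" by (rule Max_in) (use fin assms in auto)
 then obtain I where I0: "I \<in> ?S" "card I = Max (card ` ?S)" by auto
 have I: "I \<in> ?S" "\<And>I'. I' \<in> ?S ==> card I' \<le> card I"
  using I0 fin by auto
 have "rk X \<in> card ` {I \<in> indep M. I \<subseteq> X}"
  unfolding mrank_def by (rule Max_in) (use finite_indep_sets indep_empty in auto)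
 then obtain K where K: "K \<in> indep M" "K \<subseteq> X" "card K = rk X" by auto
 have "card I = rk X"
 proof (rule ccontr)
  assume "card I ~= rk X"
  then have "card I < card K" using card_le_mrank[of I X] I(1) K by auto
  then obtain e where e: "e \<in> K - I" "insert e I \<in> indep M"
   using augmentation[of I K] I K by blast
  then have "card (insert e I) \<le> card I" using I(2)[of "insert e I"] I(1) K(2) e by auto
  then show False using e finite_indep[of I] I by simp
 qed
 then show ?thesis using that I by blast
qed

lemma mrank_obtain:
 obtains I where "I \<in> indep M" "I \<subseteq> X" "card I = rk X"
 by (rule indep_extend[OF indep_empty, of X]) auto

lemma mrank_mono: "X \<subseteq> Y ==> rk X \<le> rk Y"
 by (metis card_le_mrank mrank_obtain order_trans)

lemma mrank_le_card: "finite X ==> rk X \<le> card X"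
 by (metis card_mono mrank_obtain)

lemma mrank_empty [simp]: "rk {} = 0"
 using mrank_le_card[of "{}"] by simp

lemma mrank_submod: "rk (X Un Y) + rk (X Int Y) \<le> rk X + rk Y"
proof -
 obtain I where I: "I \<in> indep M" "I \<subseteq> X Int Y" "card I = rk (X Int Y)" by (rule mrank_obtain)
 obtain J where J: "J \<in> indep M" "I \<subseteq> J" "J \<subseteq> X Un Y" "card J = rk (X Un Y)"
  using indep_extend[of I "X Un Y"] I by blast
 have fJ: "finite J" using J finite_indep by blast
 have 1: "card (J Int X) \<le> rk X" "card (J Int Y) \<le> rk Y"
  using J(1) indep_mono by (auto intro!: card_le_mrank)
 have 2: "card I \<le> card ((J Int X) Int (J Int Y))" using I J fJ by (intro card_mono) auto
 have "(J Int X) Un (J Int Y) = J" using J by auto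
 then have "card J + card ((J Int X) Int (J Int Y)) = card (J Int X) + card (J Int Y)"
  using card_Un_Int[of "J Int X" "J Int Y"] fJ by simp
 then show ?thesis using 1 2 I J by linarith
qed

lemma mrank_insert_le: "rk (insert e X) \<le> rk X + 1"
 using mrank_submod[of X "{e}"] mrank_le_card[of "{e}"] by simp

lemma indep_iff_mrank: "X \<subseteq> E ==> X \<in> indep M \<longleftrightarrow> rk X = card X"
proof
 assume "X \<subseteq> E" "X \<in> indep M"
 then show "rk X = card X"
  using card_le_mrank[of X X] mrank_le_card[of X] finite_indep by force
next
 assume "X \<subseteq> E" "rk X = card X"
 then show "X \<in> indep M"
  by (metis card_subset_eq finite_ground finite_subset mrank_obtain)
qed

lemma cl_subset: "cl X \<subseteq> E" unfolding mclosure_def by auto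

lemma mem_cl: "e \<in> E ==> e \<in> cl X \<longleftrightarrow> rk (insert e X) = rk X"
 unfolding mclosure_def by auto

lemma subset_cl: "X \<subseteq> E ==> X \<subseteq> cl X"
 unfolding mclosure_def by (auto simp: insert_absorb)

lemma mrank_Un_absorb:
 assumes "finite Z" "\<And>e. e \<in> Z ==> rk (insert e X) = rk X"
 shows "rk (X Un Z) = rk X"
 using assms
proof (induction Z)
 case (insert e Z)
 have "rk ((X Un Z) Un insert e X) + rk ((X Un Z) Int insert e X) \<le> rk (X Un Z) + rk (insert e X)"
  by (rule mrank_submod)
 moreover have "(X Un Z) Un insert e X = X Un insert e Z" by auto
 moreover have "rk X \<le> rk ((X Un Z) Int insert e X)" "rk X \<le> rk (X Un insert e Z)"
  by (auto intro!: mrank_mono)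
 ultimately show ?case using insert by fastforce
qed simp

lemma mrank_cl: "X \<subseteq> E ==> rk (cl X) = rk X"
proof -
 assume X: "X \<subseteq> E"
 have "rk (X Un cl X) = rk X"
  by (rule mrank_Un_absorb) (use cl_subset finite_ground finite_subset in \<open>auto simp: mclosure_def\<close>)
 then show ?thesis using subset_cl[OF X] by (simp add: Un_absorb1)
qed

lemma cl_minimal:
 assumes "F \<in> flats M" "X \<subseteq> F" shows "cl X \<subseteq> F"
proof
 fix e assume e: "e \<in> cl X"
 have "rk (F Un insert e X) + rk (F Int insert e X) \<le> rk F + rk (insert e X)" by (rule mrank_submod)
 moreover have "F Un insert e X = insert e F" using assms by auto
 moreover have "rk X \<le> rk (F Int insert e X)" using assms by (auto intro!: mrank_mono)
 moreover have "rk F \<le> rk (insert e F)" by (auto intro!: mrank_mono)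
 moreover have "rk (insert e X) = rk X" using e unfolding mclosure_def by auto
 ultimately have "e \<in> cl F" using e cl_subset by (auto simp: mclosure_def)
 then show "e \<in> F" using assms by (auto simp: flats_def)
qed

lemma cl_flat: "X \<subseteq> E ==> cl X \<in> flats M"
proof -
 assume X: "X \<subseteq> E"
 have "cl (cl X) \<subseteq> cl X"
 proof
  fix e assume e: "e \<in> cl (cl X)"
  then have "rk (insert e (cl X)) = rk X" by (simp add: mclosure_def mrank_cl[OF X, unfolded mclosure_def])
  moreover have "rk X \<le> rk (insert e X)" "rk (insert e X) \<le> rk (insert e (cl X))"
   using subset_cl[OF X] by (auto intro!: mrank_mono)
  ultimately have "rk (insert e X) = rk X" by linarith
  then show "e \<in> cl X" using e cl_subset mem_cl by blast
 qed
 then show ?thesis unfolding flats_def using subset_cl cl_subset by blast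
qed

lemma flat_subset: "F \<in> flats M ==> F \<subseteq> E" unfolding flats_def by auto

lemma flat_insert_rank: "F \<in> flats M ==> e \<in> E ==> e \<notin> F ==> rk (insert e F) = rk F + 1"
 using mrank_insert_le[of e F] mrank_mono[OF subset_insertI, of F e] mem_cl[of e F]
 by (auto simp: flats_def)

lemma flatI: "F \<subseteq> E ==> (\<And>e. e \<in> E ==> e \<notin> F ==> rk (insert e F) ~= rk F) ==> F \<in> flats M"
 unfolding flats_def mclosure_def by (auto simp: insert_absorb)

lemma ground_flat [simp]: "E \<in> flats M" by (rule flatI) auto

lemma flat_Int: "F \<in> flats M ==> F' \<in> flats M ==> F Int F' \<in> flats M"
 using cl_minimal[of F "F Int F'"] cl_minimal[of F' "F Int F'"] subset_cl[of "F Int F'"] cl_flat[of "F Int F'"] flat_subset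
 by (metis Int_lower1 Int_lower2 Int_subset_iff le_infI1 subset_antisym)

lemma flat_psubset_rank: "F \<in> flats M ==> F \<subset> Y ==> Y \<subseteq> E ==> rk F < rk Y"
proof -
 assume a: "F \<in> flats M" "F \<subset> Y" "Y \<subseteq> E"
 then obtain e where "e \<in> Y" "e \<notin> F" by auto
 then have "rk (insert e F) = rk F + 1" "rk (insert e F) \<le> rk Y"
  using a by (intro flat_insert_rank mrank_mono; auto)+
 then show ?thesis by simp
qed

lemma finite_flats: "finite (flats M)"
 by (rule finite_subset[of _ "Pow E"]) (use flat_subset finite_ground in auto)

lemma finite_flat: "F \<in> flats M ==> finite F"
 using flat_subset finite_ground finite_subset by blast

lemma restriction_matroid: "matroid (restriction M S)"
proof
 show "finite (ground (restriction M S))" using finite_ground by (simp add: restriction_def)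
next
 fix X Y assume "X \<in> indep (restriction M S)" "Y \<in> indep (restriction M S)" "card X < card Y"
 then show "\<exists>e\<in>Y - X. insert e X \<in> indep (restriction M S)"
  using augmentation[of X Y] by (auto simp: restriction_def)
qed (use indep_subset indep_empty indep_mono in \<open>auto simp: restriction_def\<close>)

lemma mrank_restriction: "X \<subseteq> S ==> mrank (restriction M S) X = rk X"
 unfolding mrank_def restriction_def by (auto intro!: arg_cong[where f = Max] image_cong)

lemma flats_restriction:
 assumes F: "F \<in> flats M"
 shows "flats (restriction M F) = {X \<in> flats M. X \<subseteq> F}"
proof -
 have FE: "F \<subseteq> E" using F flat_subset by auto
 have *: "mclosure (restriction M F) X = cl X Int F" if "X \<subseteq> F" for X
 proof -
  have "ground (restriction M F) = F" using FE by (auto simp: restriction_def)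
  then show ?thesis using that FE unfolding mclosure_def by (auto simp: mrank_restriction)
 qed
 have "cl X Int F = cl X" if "X \<subseteq> F" for X using cl_minimal[OF F that] by auto
 then show ?thesis using FE * by (auto simp: flats_def restriction_def)
qed

lemma ground_restriction: "S \<subseteq> E ==> ground (restriction M S) = S"
 by (auto simp: restriction_def)

lemma simple_restriction: "simple_matroid M ==> simple_matroid (restriction M S)"
 unfolding simple_matroid_def loop_def parallel_def restriction_def by auto

lemma simple_indep2:
 assumes "simple_matroid M" "e \<in> E" "f \<in> E" shows "{e, f} \<in> indep M"
 using assms unfolding simple_matroid_def loop_def parallel_def
 by (cases "e = f") auto

lemma simple_rank1: "simple_matroid M ==> e \<in> E ==> rk {e} = 1"
 using indep_iff_mrank[of "{e}"] simple_indep2[of e e] by simp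

lemma simple_rank2: "simple_matroid M ==> e \<in> E ==> f \<in> E ==> e ~= f ==> rk {e, f} = 2"
 using indep_iff_mrank[of "{e, f}"] simple_indep2[of e f] by simp

lemma simple_empty_flat: "simple_matroid M ==> {} \<in> flats M"
 by (rule flatI) (auto simp: simple_rank1)

lemma simple_point_flat: "simple_matroid M ==> e \<in> E ==> {e} \<in> flats M"
 by (rule flatI) (auto simp: simple_rank1 simple_rank2)

lemma flat_rank0: "simple_matroid M ==> F \<in> flats M ==> rk F = 0 \<longleftrightarrow> F = {}"
 using flat_psubset_rank[of "{}" F] simple_empty_flat flat_subset mrank_empty by fastforce

lemma flat_rank1: "simple_matroid M ==> F \<in> flats M ==> rk F = 1 \<longleftrightarrow> (\<exists>e\<in>E. F = {e})"
proof
 assume a: "simple_matroid M" "F \<in> flats M" "rk F = 1"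
 then obtain e where e: "e \<in> F" by fastforce
 then have "e \<in> E" using a flat_subset by auto
 moreover have "F = {e}"
  using flat_psubset_rank[of "{e}" F] a e simple_point_flat[of e] flat_subset[of F] simple_rank1[of e] \<open>e \<in> E\<close>
  by fastforce
 ultimately show "\<exists>e\<in>E. F = {e}" by auto
qed (auto simp: simple_rank1)

end

subsection \<open>Steps to a modular hyperplane\<close>

text \<open>In a simple matroid: \<open>X\<close> is a modular hyperplane of the flat \<open>Y\<close>. The definition refers to the
  lattice of flats alone, so that it needs no change in restrictions and parallel connections.\<close>

definition mhstep :: "'a set set => 'a set => 'a set => bool" where
 "mhstep \<F> X Y \<longleftrightarrow> X \<in> \<F> \<and> Y \<in> \<F> \<and> X \<subset> Y \<and>
   (\<forall>e\<in>Y - X. \<forall>f\<in>Y - X. e ~= f --> (\<exists>g\<in>X. \<forall>F\<in>\<F>. e \<in> F --> f \<in> F --> g \<in> F))"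

lemma mhstepD:
 "mhstep \<F> X Y ==> e \<in> Y ==> e \<notin> X ==> f \<in> Y ==> f \<notin> X ==> e ~= f ==>
  \<exists>g\<in>X. \<forall>F\<in>\<F>. e \<in> F --> f \<in> F --> g \<in> F"
 unfolding mhstep_def by simp

text \<open>The three-point lines of a simple matroid (\<open>tri_iff\<close>), written with flats
  alone so that the notion passes between a matroid, its restrictions and its parallel
  connections.\<close>

definition tri :: "'a set set => 'a set => bool" where
 "tri \<F> T \<longleftrightarrow> T \<in> \<F> \<and> card T = 3 \<and>
   (\<forall>e\<in>T. \<forall>f\<in>T. e ~= f --> (\<forall>F\<in>\<F>. e \<in> F --> f \<in> F --> T \<subseteq> F))"

lemma triD:
 "tri \<F> T ==> e \<in> T ==> f \<in> T ==> e ~= f ==> F \<in> \<F> ==> e \<in> F ==> f \<in> F ==> T \<subseteq> F"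
 unfolding tri_def by simp

text \<open>The flats along which parts may be glued in (2). In a simple binary matroid all of them
  are modular (\<open>small_modular\<close>).\<close>

definition small :: "'a set set => 'a set => bool" where
 "small \<F> S \<longleftrightarrow> S = {} \<or> (\<exists>p. S = {p}) \<or> tri \<F> S"

text \<open>A single chain from the empty set would not survive gluing: the chain of one part has to
  begin at the flat along which that part is attached. Hence a chain is demanded from every small
  flat.\<close>

definition chained :: "'a set set => 'a set => bool" where
 "chained \<F> E \<longleftrightarrow> (\<forall>S\<in>\<F>. S \<subseteq> E --> small \<F> S --> (mhstep \<F>)\<^sup>*\<^sup>* S E)"

context matroid
begin

text \<open>For e and f outside X the third point of their line lies in X, so f is in the closure of
  X and e. Thus one element already spans Y over X.\<close>

lemma mhstep_rank:
 assumes st: "mhstep (flats M) X Y" and sim: "simple_matroid M"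
 shows "rk Y = rk X + 1"
proof -
 obtain e where e: "e \<in> Y" "e \<notin> X" using st by (auto simp: mhstep_def)
 have fl: "X \<in> flats M" "Y \<in> flats M" "X \<subset> Y" using st by (auto simp: mhstep_def)
 have eE: "e \<in> E" using e fl flat_subset by auto
 have XE: "insert e X \<subseteq> E" using eE fl flat_subset by auto
 have 3: "rk (insert e X) = rk X + 1" using flat_insert_rank[OF fl(1) eE e(2)] .
 have "f \<in> cl (insert e X)" if f: "f \<in> Y" "f \<notin> insert e X" for f
 proof -
  obtain g where g: "g \<in> X" "\<forall>F\<in>flats M. e \<in> F --> f \<in> F --> g \<in> F"
   using mhstepD[OF st e(1,2) f(1)] f(2) by (metis insertI1 insert_iff)
  have fE: "f \<in> E" using f fl flat_subset by auto
  have gE: "g \<in> E" using g fl flat_subset by auto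
  have ne: "e ~= g" "e ~= f" using g e f by auto
  have "g \<in> cl {e, f}" using g(2) cl_flat[of "{e,f}"] subset_cl[of "{e,f}"] eE fE by auto
  then have 1: "rk (insert g {e, f}) = rk {e, f}" unfolding mclosure_def by auto
  have "rk (insert f (insert e X)) + rk (insert e X Int {g, e, f}) \<le> rk (insert e X) + rk {g, e, f}"
   using mrank_submod[of "insert e X" "{g, e, f}"] g(1)
   by (metis Un_insert_right insert_absorb insert_commute insert_iff sup_bot.right_neutral)
  moreover have "rk {e, g} \<le> rk (insert e X Int {g, e, f})" using g by (intro mrank_mono) auto
  ultimately have "rk (insert f (insert e X)) \<le> rk (insert e X)"
   using simple_rank2[OF sim eE gE ne(1)] simple_rank2[OF sim eE fE ne(2)] 1 by simp
  then show ?thesis using fE mem_cl mrank_mono[of "insert e X" "insert f (insert e X)"] by fastforce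
 qed
 then have "Y \<subseteq> cl (insert e X)" using subset_cl[OF XE] by blast
 then have "rk Y \<le> rk (insert e X)" using mrank_mono mrank_cl[OF XE] by metis
 moreover have "rk (insert e X) \<le> rk Y" using e fl by (intro mrank_mono) auto
 ultimately show ?thesis using 3 by simp
qed

end

context matroid
begin

lemma tri_iff:
 assumes sim: "simple_matroid M"
 shows "tri (flats M) T \<longleftrightarrow> T \<in> flats M \<and> card T = 3 \<and> rk T = 2"
proof
 assume T: "tri (flats M) T"
 then have fl: "T \<in> flats M" and c: "card T = 3" by (auto simp: tri_def)
 obtain a b c where abc: "T = {a,b,c}" "a ~= b" "a ~= c" "b ~= c"
  using c by (auto simp: card_Suc_eq numeral_3_eq_3)
 have E: "{a,b} \<subseteq> E" using fl flat_subset abc by auto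
 have "T \<subseteq> cl {a,b}" using T abc cl_flat[OF E] subset_cl[OF E] unfolding tri_def
  by (metis insert_subset insertI1 insertI2)
 then have "rk T \<le> rk {a,b}" using mrank_mono mrank_cl[OF E] by metis
 moreover have "rk {a,b} \<le> rk T" using abc by (intro mrank_mono) auto
 ultimately show "T \<in> flats M \<and> card T = 3 \<and> rk T = 2"
  using fl c simple_rank2[OF sim, of a b] E abc by simp
next
 assume T: "T \<in> flats M \<and> card T = 3 \<and> rk T = 2"
 have "T \<subseteq> F" if "e \<in> T" "f \<in> T" "e ~= f" "F \<in> flats M" "e \<in> F" "f \<in> F" for e f F
 proof (rule ccontr)
  assume "\<not> T \<subseteq> F"
  then have "rk (T Int F) < rk T" using flat_psubset_rank[of "T Int F" T] flat_Int[of T F] T that flat_subset[of T] by blast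
  moreover have "rk {e,f} \<le> rk (T Int F)" using that by (intro mrank_mono) auto
  moreover have "rk {e,f} = 2" using that T flat_subset[of T] by (intro simple_rank2[OF sim]) auto
  ultimately show False using T by simp
 qed
 then show "tri (flats M) T" using T unfolding tri_def by blast
qed

end

section \<open>Binary matroids given by their row spaces\<close>

lemma even_card_sym_diff:
 assumes "finite X" "finite Y"
 shows "even (card (sym_diff X Y)) \<longleftrightarrow> (even (card X) \<longleftrightarrow> even (card Y))"
proof -
 have "card (sym_diff X Y) = card (X - Y) + card (Y - X)"
  using assms by (intro card_Un_disjoint) auto
 moreover have "card X = card (X - Y) + card (X Int Y)"
  using assms by (subst card_Un_disjoint[symmetric]) (auto intro: arg_cong[where f = card])
 moreover have "card Y = card (Y - X) + card (X Int Y)"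
  using assms by (subst card_Un_disjoint[symmetric]) (auto intro: arg_cong[where f = card])
 ultimately show ?thesis by auto
qed

lemma card3_obtain:
 assumes "card T = 3" "h \<in> T"
 obtains g k where "T = {h, g, k}" "h ~= g" "h ~= k" "g ~= k"
proof -
 have "finite T" using assms(1) by (rule_tac card_ge_0_finite) simp
 then have "card (T - {h}) = 2" using assms by simp
 then obtain g k where "T - {h} = {g, k}" "g ~= k" by (auto simp: card_2_iff)
 then have "T = {h, g, k}" "h ~= g" "h ~= k" "g ~= k" using assms(2) by auto
 then show ?thesis using that by blast
qed

text \<open>\<open>\<C>\<close> is the row space, as a family of supports, of a matrix over the field with two elements whose
  columns represent \<open>M\<close>.\<close>

definition binary_rep :: "'a set set => 'a pre_matroid => bool" where
 "binary_rep \<C> M \<longleftrightarrow> (\<forall>C\<in>\<C>. C \<subseteq> ground M) \<and> {} \<in> \<C> \<and>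
   (\<forall>C\<in>\<C>. \<forall>D\<in>\<C>. sym_diff C D \<in> \<C>) \<and>
   indep M = {X. X \<subseteq> ground M \<and> (\<forall>x\<in>X. \<exists>C\<in>\<C>. C Int X = {x})}"

locale binary_matroid = matroid M for M :: "'a pre_matroid" +
 fixes \<C> :: "'a set set"
 assumes rep: "binary_rep \<C> M"
begin

lemma space_subset: "C \<in> \<C> ==> C \<subseteq> E" using rep unfolding binary_rep_def by blast
lemma space_empty: "{} \<in> \<C>" using rep unfolding binary_rep_def by blast
lemma space_sym_diff: "C \<in> \<C> ==> D \<in> \<C> ==> sym_diff C D \<in> \<C>"
 using rep unfolding binary_rep_def by blast
lemma indep_iff: "X \<in> indep M \<longleftrightarrow> X \<subseteq> E \<and> (\<forall>x\<in>X. \<exists>C\<in>\<C>. C Int X = {x})"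
 using rep unfolding binary_rep_def by blast

lemma indepD: "X \<in> indep M ==> x \<in> X ==> \<exists>C\<in>\<C>. C Int X = {x}"
 unfolding indep_iff by simp

lemma finite_space: "finite \<C>"
 by (rule finite_subset[of _ "Pow E"]) (use space_subset finite_ground in auto)

text \<open>\<open>C\<close> isolates x; a row isolating another element y is corrected by adding
  \<open>C\<close> whenever it contains x.\<close>

lemma indep_insertI:
 assumes I: "I \<in> indep M" and C: "C \<in> \<C>" "x \<in> C" "C Int I = {}"
 shows "insert x I \<in> indep M"
 unfolding indep_iff
proof (intro conjI ballI)
 show "insert x I \<subseteq> E" using I C space_subset indep_subset by auto
next
 fix y assume y: "y \<in> insert x I"
 show "\<exists>C\<in>\<C>. C Int insert x I = {y}"
 proof (cases "y = x")
  case True then show ?thesis using C by auto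
 next
  case False
  then obtain D where D: "D \<in> \<C>" "D Int I = {y}" using indepD[OF I, of y] y by auto
  show ?thesis
  proof (cases "x \<in> D")
   case True
   then have "sym_diff D C Int insert x I = {y}" using C D False y by auto
   then show ?thesis using space_sym_diff[OF D(1) C(1)] by blast
  next
   case False then show ?thesis using D by blast
  qed
 qed
qed

text \<open>Otherwise \<open>indep_insertI\<close> would enlarge the basis inside X. Hence a row is
  determined on X by its trace on a basis.\<close>

lemma avoid_basis:
 assumes I: "I \<in> indep M" "I \<subseteq> X" "card I = rk X" and C: "C \<in> \<C>" "C Int I = {}"
 shows "C Int X = {}"
proof (rule ccontr)
 assume "C Int X ~= {}"
 then obtain x where x: "x \<in> C" "x \<in> X" by auto
 then have "insert x I \<in> indep M" using indep_insertI I C by blast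
 then have "card (insert x I) \<le> rk X" using I x card_le_mrank by auto
 then show False using I C x finite_indep[OF I(1)] by (auto simp: card_insert_if split: if_splits)
qed

lemma indep_pattern:
 assumes "I \<in> indep M" "Z \<subseteq> I" shows "\<exists>C\<in>\<C>. C Int I = Z"
proof -
 have "finite Z" using assms finite_indep finite_subset by blast
 then show ?thesis using assms(2)
 proof (induction Z)
  case empty then show ?case using space_empty by auto
 next
  case (insert z Z)
  then obtain C where C: "C \<in> \<C>" "C Int I = Z" by auto
  obtain D where D: "D \<in> \<C>" "D Int I = {z}" using indepD[OF assms(1), of z] insert.prems by auto
  have "sym_diff C D Int I = insert z Z" using C D insert by auto
  then show ?case using space_sym_diff[OF C(1) D(1)] by blast
 qed
qed

text \<open>Over the field with two elements dimension can be replaced by counting: traces on X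
  correspond to arbitrary subsets of a basis of X.\<close>

lemma card_trace:
 "card ((\<lambda>C. C Int X) ` \<C>) = 2 ^ rk X"
proof -
 obtain I where I: "I \<in> indep M" "I \<subseteq> X" "card I = rk X" using mrank_obtain[of X] .
 have "bij_betw (\<lambda>C. C Int I) ((\<lambda>C. C Int X) ` \<C>) (Pow I)"
 proof (rule bij_betwI')
  fix A B assume "A \<in> (\<lambda>C. C Int X) ` \<C>" "B \<in> (\<lambda>C. C Int X) ` \<C>"
  then obtain C D where CD: "C \<in> \<C>" "D \<in> \<C>" "A = C Int X" "B = D Int X" by auto
  show "(A Int I = B Int I) = (A = B)"
  proof
   assume "A Int I = B Int I"
   then have "sym_diff C D Int I = {}" using CD I by auto
   then have "sym_diff C D Int X = {}" using avoid_basis[OF I] space_sym_diff CD by blast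
   then show "A = B" using CD by auto
  qed auto
 next
  fix Z assume "Z \<in> Pow I"
  then obtain C where "C \<in> \<C>" "C Int I = Z" using indep_pattern[OF I(1)] by auto
  then show "\<exists>A\<in>(\<lambda>C. C Int X) ` \<C>. Z = A Int I" using I by auto
 qed auto
 then show ?thesis using I bij_betw_same_card card_Pow finite_indep by metis
qed

lemma card_space: "card \<C> = 2 ^ rk E"
proof -
 have "(\<lambda>C. C Int E) ` \<C> = (\<lambda>C. C) ` \<C>" by (intro image_cong) (use space_subset in auto)
 then show ?thesis using card_trace[of E] by simp
qed

text \<open>Hyperplanes are complements of minimal nonempty rows and flats are intersections of
  hyperplanes; so flats are the sets whose complement is a union of rows.\<close>

lemma flat_iff: "F \<in> flats M \<longleftrightarrow> F \<subseteq> E \<and> (\<forall>e\<in>E - F. \<exists>C\<in>\<C>. e \<in> C \<and> C Int F = {})"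
proof (intro iffI conjI ballI)
 fix e assume F: "F \<in> flats M" and e: "e \<in> E - F"
 obtain I where I: "I \<in> indep M" "I \<subseteq> F" "card I = rk F" using mrank_obtain .
 obtain J where J: "J \<in> indep M" "I \<subseteq> J" "J \<subseteq> insert e F" "card J = rk (insert e F)"
  using indep_extend[of I "insert e F"] I by blast
 have r: "rk (insert e F) = rk F + 1" using flat_insert_rank F e by auto
 have "e \<in> J"
 proof (rule ccontr)
  assume "e \<notin> J"
  then have "J \<subseteq> F" using J by auto
  then show False using card_le_mrank[of J F] J r by auto
 qed
 then obtain C where C: "C \<in> \<C>" "C Int J = {e}" using indepD[OF J(1), of e] by auto
 then have "C Int I = {}" using J I e by auto
 then have "C Int F = {}" by (rule avoid_basis[OF I C(1)])
 moreover have "e \<in> C" using C by auto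
 ultimately show "\<exists>C\<in>\<C>. e \<in> C \<and> C Int F = {}" using C(1) by blast
next
 assume F: "F \<subseteq> E \<and> (\<forall>e\<in>E - F. \<exists>C\<in>\<C>. e \<in> C \<and> C Int F = {})"
 show "F \<in> flats M"
 proof (rule flatI)
  fix e assume e: "e \<in> E" "e \<notin> F"
  obtain I where I: "I \<in> indep M" "I \<subseteq> F" "card I = rk F" using mrank_obtain .
  obtain C where "C \<in> \<C>" "e \<in> C" "C Int F = {}" using F[THEN conjunct2, rule_format, of e] e by auto
  then have "insert e I \<in> indep M" using indep_insertI I by blast
  then have "card (insert e I) \<le> rk (insert e F)" using I by (intro card_le_mrank) auto
  then show "rk (insert e F) ~= rk F" using I e finite_indep[OF I(1)] by (auto simp: card_insert_if split: if_splits)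
 qed (use F in auto)
qed (use flat_subset in auto)

lemma flatD: "F \<in> flats M ==> e \<in> E ==> e \<notin> F ==> \<exists>C\<in>\<C>. e \<in> C \<and> C Int F = {}"
 unfolding flat_iff by simp

lemma compl_flat: "C \<in> \<C> ==> E - C \<in> flats M" unfolding flat_iff by auto

text \<open>A basis of the complement of D extends by some j to a basis of E; a row isolating j
  vanishes on the smaller basis, hence on the whole complement.\<close>

lemma rank_compl:
 assumes "rk (E - D) < rk E" shows "\<exists>C\<in>\<C>. C ~= {} \<and> C \<subseteq> D"
proof -
 obtain I where I: "I \<in> indep M" "I \<subseteq> E - D" "card I = rk (E - D)" using mrank_obtain .
 obtain J where J: "J \<in> indep M" "I \<subseteq> J" "J \<subseteq> E" "card J = rk E"
  using indep_extend[of I E] I by blast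
 have "I ~= J" using I J assms by auto
 then obtain j where j: "j \<in> J" "j \<notin> I" using J by auto
 then obtain C where C: "C \<in> \<C>" "C Int J = {j}" using indepD[OF J(1), of j] by auto
 then have "C Int I = {}" using J j by auto
 then have "C Int (E - D) = {}" using avoid_basis[OF I C(1)] by auto
 then show ?thesis using C space_subset[OF C(1)] j by (intro bexI[of _ C]) auto
qed

lemma binary_restriction: "S \<subseteq> E ==> binary_matroid (restriction M S) ((\<lambda>C. C Int S) ` \<C>)"
proof -
 assume S: "S \<subseteq> E"
 have "binary_rep ((\<lambda>C. C Int S) ` \<C>) (restriction M S)"
  unfolding binary_rep_def
 proof (intro conjI ballI)
  fix C D assume "C \<in> (\<lambda>C. C Int S) ` \<C>" "D \<in> (\<lambda>C. C Int S) ` \<C>"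
  then obtain C' D' where "C' \<in> \<C>" "D' \<in> \<C>" "C = C' Int S" "D = D' Int S" by auto
  then show "sym_diff C D \<in> (\<lambda>C. C Int S) ` \<C>"
   using space_sym_diff[of C' D'] by (intro image_eqI[of _ _ "sym_diff C' D'"]) auto
 next
  have *: "C Int S Int X = C Int X" if "X \<subseteq> S" for X C using that by auto
  show "indep (restriction M S) = {X. X \<subseteq> ground (restriction M S) \<and> (\<forall>x\<in>X. \<exists>C\<in>(\<lambda>C. C Int S) ` \<C>. C Int X = {x})}"
   using S by (auto simp: restriction_def indep_iff *)
 qed (use space_empty S space_subset in \<open>auto simp: restriction_def\<close>)
 then show ?thesis using restriction_matroid by (simp add: binary_matroid_def binary_matroid_axioms_def)
qed

lemma simple_separate:
 assumes "simple_matroid M" "x \<in> E" "y \<in> E" "x ~= y"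
 shows "\<exists>C\<in>\<C>. x \<in> C \<and> y \<notin> C"
proof -
 obtain C where "C \<in> \<C>" "C Int {x, y} = {x}"
  using indepD[OF simple_indep2[OF assms(1-3)], of x] by auto
 then show ?thesis using assms(4) by (intro bexI[of _ C]) auto
qed

lemma even_triple:
 assumes "a ~= b" "a ~= c" "b ~= c"
 shows "even (card (C Int {a,b,c})) \<longleftrightarrow> (a \<in> C \<longleftrightarrow> (b \<in> C \<longleftrightarrow> c \<notin> C))"
proof -
 have "card (C Int {a,b,c}) = of_bool (a \<in> C) + of_bool (b \<in> C) + of_bool (c \<in> C)"
  using assms by (auto simp: Int_insert_right)
 then show ?thesis by simp
qed

lemmas even_tripleD = even_triple[THEN iffD1, rotated 3]
lemmas even_tripleI = even_triple[THEN iffD2, rotated 3]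

text \<open>The three columns of a three-point line sum to zero; conversely, when three columns sum
  to zero, no other column lies in their span, as columns are distinct and nonzero.\<close>

lemma tri_even:
 assumes sim: "simple_matroid M"
 shows "tri (flats M) T \<longleftrightarrow> T \<subseteq> E \<and> card T = 3 \<and> (\<forall>C\<in>\<C>. even (card (C Int T)))"
proof (intro iffI conjI ballI)
 assume T: "tri (flats M) T"
 show TE: "T \<subseteq> E" using T flat_subset by (auto simp: tri_def)
 show c3: "card T = 3" using T by (auto simp: tri_def)
 fix C assume C: "C \<in> \<C>"
 \<comment> \<open>The complement of a row is a flat, so it cannot contain two points of the line
   without the third.\<close>
 have one: "\<not> (a \<in> D \<and> b \<notin> D \<and> c \<notin> D)" if "D \<in> \<C>" "T = {a,b,c}" "b ~= c" for a b c D
 proof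
  assume "a \<in> D \<and> b \<notin> D \<and> c \<notin> D"
  moreover have "E - D \<in> flats M" using compl_flat that by auto
  moreover have "b \<in> T" "c \<in> T" "b \<in> E" "c \<in> E" "a \<in> T" using TE that by auto
  ultimately show False using triD[OF T, of b c "E - D"] that(3) by blast
 qed
 obtain a b c where abc: "T = {a,b,c}" "a ~= b" "a ~= c" "b ~= c"
  using c3 by (auto simp: card_Suc_eq numeral_3_eq_3)
 have "\<not> (a \<in> C \<and> b \<in> C \<and> c \<in> C)"
 proof
  assume all: "a \<in> C \<and> b \<in> C \<and> c \<in> C"
  obtain D where D: "D \<in> \<C>" "b \<in> D" "a \<notin> D" using simple_separate[OF sim, of b a] TE abc by auto
  then have "c \<in> D" using one[of D b a c] abc by auto
  then show False using one[of "sym_diff C D" a b c] space_sym_diff[OF C D(1)] D all abc by auto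
 qed
 moreover have "{a,b,c} = {b,a,c}" "{a,b,c} = {c,a,b}" by auto
 ultimately have "a \<in> C \<longleftrightarrow> (b \<in> C \<longleftrightarrow> c \<notin> C)" using one[OF C, of a b c] one[OF C, of b a c] one[OF C, of c a b] abc by metis
 then show "even (card (C Int T))" using even_tripleI abc by metis
next
 assume T: "T \<subseteq> E \<and> card T = 3 \<and> (\<forall>C\<in>\<C>. even (card (C Int T)))"
 obtain a b c where abc: "T = {a,b,c}" "a ~= b" "a ~= c" "b ~= c"
  using T by (auto simp: card_Suc_eq numeral_3_eq_3)
 have ev: "a \<in> C \<longleftrightarrow> (b \<in> C \<longleftrightarrow> c \<notin> C)" if "C \<in> \<C>" for C
  by (rule even_tripleD[OF _ abc(2-4)]) (use T abc(1) that in simp)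
 have fl: "T \<in> flats M" unfolding flat_iff
 proof (intro conjI ballI)
  fix x assume x: "x \<in> E - T"
  have xE: "x \<in> E" "a \<in> E" "b \<in> E" "c \<in> E" "x ~= a" "x ~= b" "x ~= c" using x T abc(1) by auto
  obtain A where A: "A \<in> \<C>" "x \<in> A" "a \<notin> A" using simple_separate[OF sim, of x a] xE by auto
  obtain B where B: "B \<in> \<C>" "x \<in> B" "b \<notin> B" using simple_separate[OF sim, of x b] xE by auto
  obtain D where D: "D \<in> \<C>" "x \<in> D" "c \<notin> D" using simple_separate[OF sim, of x c] xE by auto
  note * = A B D
  show "\<exists>C\<in>\<C>. x \<in> C \<and> C Int T = {}"
  proof (cases "A Int T = {} \<or> B Int T = {} \<or> D Int T = {}")
   case True then show ?thesis using * by blast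
  next
   case False
   \<comment> \<open>Each of the three rows meets T in a different pair, so their sum avoids T;
     being a sum of an odd number of rows through x, it still contains x.\<close>
   have "A Int T ~= {}" "B Int T ~= {}" "D Int T ~= {}" using False by simp_all
   then have "b \<in> A" "c \<in> A" "a \<in> B" "c \<in> B" "a \<in> D" "b \<in> D"
    using ev[OF A(1)] ev[OF B(1)] ev[OF D(1)] A(3) B(3) D(3) unfolding abc(1)
    by simp_all
   then have "sym_diff A (sym_diff B D) Int T = {}" using A(3) B(3) D(3) unfolding abc(1) by simp
   moreover have "x \<in> sym_diff A (sym_diff B D)" using * by simp
   moreover have "sym_diff A (sym_diff B D) \<in> \<C>" using A(1) B(1) D(1) by (intro space_sym_diff)
   ultimately show ?thesis by (intro bexI conjI)
  qed
 qed (use T in auto)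
 have "T \<subseteq> F" if H: "e \<in> T" "f \<in> T" "e ~= f" "F \<in> flats M" "e \<in> F" "f \<in> F" for e f F
 proof
  fix g assume g: "g \<in> T"
  show "g \<in> F"
  proof (rule ccontr)
   assume "g \<notin> F"
   moreover have "g \<in> E" using g T by auto
   ultimately obtain C where C: "C \<in> \<C>" "g \<in> C" "C Int F = {}"
    using flatD[OF H(4)] by blast
   then have "e \<notin> C" "f \<notin> C" using H by auto
   then show False using ev[OF C(1)] H(1-3) g abc(1) C(2) by auto
  qed
 qed
 then show "tri (flats M) T" using fl T unfolding tri_def by blast
qed

text \<open>Modularity of points and three-point lines, phrased in the representing space: a flat imposes
  no condition on the trace on \<open>S\<close> other than the obvious one.\<close>

lemma small_pattern:
 assumes sim: "simple_matroid M" and S: "small (flats M) S" "S \<subseteq> E" and F: "F \<in> flats M"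
  and C0: "C0 \<in> \<C>" "C0 Int S Int F = {}"
 shows "\<exists>C\<in>\<C>. C Int F = {} \<and> C Int S = C0 Int S"
proof (cases "C0 Int S = {}")
 case True then show ?thesis using space_empty by auto
next
 case False
 then obtain h where h: "h \<in> C0" "h \<in> S" "h \<notin> F" using C0 by auto
 have ex: "\<exists>C\<in>\<C>. x \<in> C \<and> C Int F = {}" if "x \<in> S" "x \<notin> F" for x
  using flatD[OF F] that S(2) by blast
 obtain C where C: "C \<in> \<C>" "h \<in> C" "C Int F = {}" using ex h by blast
 show ?thesis
 proof (cases "tri (flats M) S")
  case False
  then have "S = {h}" using S h unfolding small_def by auto
  then show ?thesis using C h by (intro bexI[of _ C]) auto
 next
  case True
  then have c3: "card S = 3" and ev: "\<And>C. C \<in> \<C> ==> even (card (C Int S))"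
   using tri_even[OF sim, of S] by simp_all
  obtain g k where gk: "S = {h,g,k}" "h ~= g" "h ~= k" "g ~= k" "k \<in> C0" "g \<notin> C0"
  proof -
   obtain g k where gk: "S = {h,g,k}" "h ~= g" "h ~= k" "g ~= k"
    using card3_obtain[OF c3 h(2)] .
   have "h \<in> C0 \<longleftrightarrow> (g \<in> C0 \<longleftrightarrow> k \<notin> C0)"
    by (rule even_tripleD[OF _ gk(2-4)]) (use ev[OF C0(1)] gk(1) in simp)
   then have *: "g \<in> C0 \<longleftrightarrow> k \<notin> C0" using h by simp
   have sw: "{h,g,k} = {h,k,g}" by auto
   show ?thesis
   proof (cases "g \<in> C0")
    case True then show ?thesis using that[of k g] gk * sw by simp
   next
    case False then show ?thesis using that[of g k] gk * by simp
   qed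
  qed
  have pat: "C0 Int S = {h,k}" using gk h by auto
  have kF: "k \<notin> F" using pat C0 by auto
  have ev': "h \<in> D \<longleftrightarrow> (g \<in> D \<longleftrightarrow> k \<notin> D)" if "D \<in> \<C>" for D
   by (rule even_tripleD[OF _ gk(2-4)]) (use ev[OF that] gk(1) in simp)
  show ?thesis
  proof (cases "k \<in> C")
   case True
   then have "g \<notin> C" using ev'[OF C(1)] C by simp
   then have "C Int S = {h,k}" using True C(2) unfolding gk(1) by auto
   then show ?thesis using C pat by blast
  next
   case False
   obtain D where D: "D \<in> \<C>" "k \<in> D" "D Int F = {}" using ex[of k] gk kF by auto
   show ?thesis
   proof (cases "h \<in> D")
    case True
    then have "g \<notin> D" using ev'[OF D(1)] D by simp
    then have "D Int S = {h,k}" using True D(2) unfolding gk(1) by auto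
    then show ?thesis using D pat by blast
   next
    case hD: False
    \<comment> \<open>Here C has trace h, g and D has trace k, g on S; their sum has the prescribed
      trace h, k.\<close>
    have "g \<in> C" "g \<in> D" using C D False hD ev'[OF C(1)] ev'[OF D(1)] by simp_all
    then have "sym_diff C D Int S = {h,k}" using C(2) D(2) False hD unfolding gk(1) by auto
    moreover have "sym_diff C D Int F = {}" using C D by auto
    ultimately show ?thesis using pat space_sym_diff[OF C(1) D(1)] by (intro bexI[of _ "sym_diff C D"]) simp_all
   qed
  qed
 qed
qed

end

text \<open>The chain of one part, started at the common flat, is united with the other part. The
  elements added in each step stay the same, and so does the third point on the line of two of them.
  A small flat lies inside one part because two of three collinear points lie in the same
  part.\<close>

lemma chained_glue:
 assumes E12: "E1 \<in> \<F>" "E2 \<in> \<F>" and inter: "\<And>X Y. X \<in> \<F> ==> Y \<in> \<F> ==> X Int Y \<in> \<F>"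
  and glue: "\<And>X. X \<subseteq> E1 Un E2 ==> X Int E1 \<in> \<F> ==> X Int E2 \<in> \<F> ==> X \<in> \<F>"
  and sm: "small \<F> (E1 Int E2)"
  and ch: "chained \<F> E1" "chained \<F> E2"
 shows "chained \<F> (E1 Un E2)"
proof -
 have lift: "(mhstep \<F>)\<^sup>*\<^sup>* A (A Un B)"
  if A: "A \<in> \<F>" and B: "B \<in> \<F>" "A Int B = E1 Int E2" "A Un B = E1 Un E2" "chained \<F> B"
   and gl: "\<And>X. X \<subseteq> A Un B ==> X Int A \<in> \<F> ==> X Int B \<in> \<F> ==> X \<in> \<F>" for A B
 proof -
  have TF: "A Int B \<in> \<F>" using inter[OF A B(1)] .
  have "(mhstep \<F>)\<^sup>*\<^sup>* (A Int B) B" using B(4) TF sm B(2) unfolding chained_def by auto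
  moreover have "(mhstep \<F>)\<^sup>*\<^sup>* A (A Un Y)" if "(mhstep \<F>)\<^sup>*\<^sup>* (A Int B) Y" "Y \<subseteq> B" for Y
   using that
  proof (induction rule: rtranclp_induct)
   case base then show ?case by (simp add: Un_absorb2)
  next
   case (step X Y)
   have XY: "X \<subset> Y" "X \<in> \<F>" "Y \<in> \<F>" using step by (auto simp: mhstep_def)
   have TX: "A Int B \<subseteq> X"
    using step(1) by (induction rule: rtranclp_induct) (auto simp: mhstep_def)
   have up: "A Un Z \<in> \<F>" if "Z \<in> \<F>" "A Int B \<subseteq> Z" "Z \<subseteq> B" for Z
   proof (rule gl)
    have "(A Un Z) Int A = A" "(A Un Z) Int B = Z" using that by auto
    then show "(A Un Z) Int A \<in> \<F>" "(A Un Z) Int B \<in> \<F>" using that A by auto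
   qed (use that in auto)
   have "mhstep \<F> (A Un X) (A Un Y)" unfolding mhstep_def
   proof (intro conjI ballI impI)
    show "A Un X \<in> \<F>" "A Un Y \<in> \<F>" using up[of X] up[of Y] XY TX step by auto
    show "A Un X \<subset> A Un Y" using XY TX step(4) by auto
   next
    fix e f assume "e \<in> A Un Y - (A Un X)" "f \<in> A Un Y - (A Un X)" "e ~= f"
    then obtain g where "g \<in> X" "\<forall>F\<in>\<F>. e \<in> F --> f \<in> F --> g \<in> F"
     using mhstepD[OF step(2), of e f] by auto
    then show "\<exists>g\<in>A Un X. \<forall>F\<in>\<F>. e \<in> F --> f \<in> F --> g \<in> F" by auto
   qed
   moreover have "(mhstep \<F>)\<^sup>*\<^sup>* A (A Un X)" using step XY by auto
   ultimately show ?case by simp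
  qed
  ultimately show ?thesis by auto
 qed
 have l1: "(mhstep \<F>)\<^sup>*\<^sup>* E1 (E1 Un E2)" using lift[of E1 E2] E12 ch glue by auto
 have "E2 Int E1 = E1 Int E2" "E2 Un E1 = E1 Un E2" by auto
 then have l2: "(mhstep \<F>)\<^sup>*\<^sup>* E2 (E1 Un E2)" using lift[of E2 E1] E12 ch glue by metis
 show ?thesis unfolding chained_def
 proof (intro ballI impI)
  fix S assume S: "S \<in> \<F>" "S \<subseteq> E1 Un E2" "small \<F> S"
  have "S \<subseteq> E1 \<or> S \<subseteq> E2"
  proof (cases "tri \<F> S")
   case True
   then have "card S = 3" by (simp add: tri_def)
   then obtain a b c where abc: "S = {a,b,c}" "a ~= b" "a ~= c" "b ~= c"
    by (auto simp: card_Suc_eq numeral_3_eq_3)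
   have two: "S \<subseteq> A" if "A \<in> \<F>" "(a \<in> A \<and> b \<in> A) \<or> (a \<in> A \<and> c \<in> A) \<or> (b \<in> A \<and> c \<in> A)" for A
    using that(2) triD[OF True _ _ _ that(1)] abc by (metis insertCI)
   have "a \<in> E1 \<or> a \<in> E2" "b \<in> E1 \<or> b \<in> E2" "c \<in> E1 \<or> c \<in> E2" using S abc by auto
   then show ?thesis using two[OF E12(1)] two[OF E12(2)] by blast
  next
   case False
   then show ?thesis using S unfolding small_def by auto
  qed
  then show "(mhstep \<F>)\<^sup>*\<^sup>* S (E1 Un E2)"
  proof
   assume "S \<subseteq> E1"
   then have "(mhstep \<F>)\<^sup>*\<^sup>* S E1" using ch S unfolding chained_def by auto
   then show ?thesis using l1 by (rule rtranclp_trans)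
  next
   assume "S \<subseteq> E2"
   then have "(mhstep \<F>)\<^sup>*\<^sup>* S E2" using ch S unfolding chained_def by auto
   then show ?thesis using l2 by (rule rtranclp_trans)
  qed
 qed
qed

lemma small_subfamily: "small \<F> S ==> S \<in> \<F>' ==> \<F>' \<subseteq> \<F> ==> small \<F>' S"
 unfolding small_def tri_def by blast

text \<open>A flat of the large family is tested by intersecting it with E1.\<close>

lemma mhstep_superfamily:
 assumes inter: "\<And>X Y. X \<in> \<F> ==> Y \<in> \<F> ==> X Int Y \<in> \<F>" and E1: "E1 \<in> \<F>"
  and st: "mhstep {X \<in> \<F>. X \<subseteq> E1} X Y"
 shows "mhstep \<F> X Y"
 unfolding mhstep_def
proof (intro conjI ballI impI)
 have *: "X \<in> \<F>" "Y \<in> \<F>" "X \<subset> Y" "Y \<subseteq> E1" using st by (auto simp: mhstep_def)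
 then show "X \<in> \<F>" "Y \<in> \<F>" "X \<subset> Y" by auto
 fix e f assume ef: "e \<in> Y - X" "f \<in> Y - X" "e ~= f"
 then obtain g where g: "g \<in> X" "\<forall>F\<in>{X \<in> \<F>. X \<subseteq> E1}. e \<in> F --> f \<in> F --> g \<in> F"
  using mhstepD[OF st, of e f] by auto
 have "g \<in> F" if "F \<in> \<F>" "e \<in> F" "f \<in> F" for F
  using g(2)[rule_format, of "F Int E1"] inter[OF that(1) E1] that ef * by auto
 then show "\<exists>g\<in>X. \<forall>F\<in>\<F>. e \<in> F --> f \<in> F --> g \<in> F" using g by blast
qed

lemma chained_superfamily:
 assumes inter: "\<And>X Y. X \<in> \<F> ==> Y \<in> \<F> ==> X Int Y \<in> \<F>" and E1: "E1 \<in> \<F>"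
  and ch: "chained {X \<in> \<F>. X \<subseteq> E1} E1"
 shows "chained \<F> E1"
 unfolding chained_def
proof (intro ballI impI)
 fix S assume S: "S \<in> \<F>" "S \<subseteq> E1" "small \<F> S"
 then have "(mhstep {X \<in> \<F>. X \<subseteq> E1})\<^sup>*\<^sup>* S E1"
  using ch small_subfamily[OF S(3), of "{X \<in> \<F>. X \<subseteq> E1}"] unfolding chained_def by auto
 then show "(mhstep \<F>)\<^sup>*\<^sup>* S E1"
  using mono_rtranclp[of "mhstep {X \<in> \<F>. X \<subseteq> E1}" "mhstep \<F>"]
   mhstep_superfamily[of \<F> E1, OF inter E1] by blast
qed

text \<open>\<open>\<C>\<close> is the fibre product of its traces on \<open>E1\<close> and \<open>E2\<close>: for a binary matroid this means a
  parallel connection along \<open>E1 \<inter> E2\<close>.\<close>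

definition fibered :: "'a set set => 'a set => 'a set => bool" where
 "fibered \<C> E1 E2 \<longleftrightarrow>
   (\<forall>C\<in>\<C>. \<forall>D\<in>\<C>. C Int (E1 Int E2) = D Int (E1 Int E2) --> (C Int E1) Un (D Int E2) \<in> \<C>)"

lemma fiberedD:
 "fibered \<C> E1 E2 ==> C \<in> \<C> ==> D \<in> \<C> ==> C Int (E1 Int E2) = D Int (E1 Int E2) ==> (C Int E1) Un (D Int E2) \<in> \<C>"
 unfolding fibered_def by simp

lemma fibered_commute: "fibered \<C> E1 E2 ==> fibered \<C> E2 E1"
 unfolding fibered_def by (metis Int_commute Un_commute)

context binary_matroid
begin

lemma small_flat: "simple_matroid M ==> S \<subseteq> E ==> small (flats M) S ==> S \<in> flats M"
 unfolding small_def tri_def using simple_empty_flat simple_point_flat by auto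

context
 fixes E1 E2
 assumes sim: "simple_matroid M" and E12: "E1 Un E2 = E"
  and sm: "small (flats M) (E1 Int E2)" and fib: "fibered \<C> E1 E2"
begin

text \<open>A row avoiding the intersection can be glued to the empty row, which leaves a row inside
  E2 that avoids E1.\<close>

lemma fibered_flat1: "E1 \<in> flats M"
 unfolding flat_iff
proof (intro conjI ballI)
 fix e assume e: "e \<in> E - E1"
 have "E1 Int E2 \<in> flats M" using small_flat[OF sim _ sm] E12 by auto
 then obtain C where C: "C \<in> \<C>" "e \<in> C" "C Int (E1 Int E2) = {}" using flatD[of "E1 Int E2" e] e by auto
 then have "({} Int E1) Un (C Int E2) \<in> \<C>" by (intro fiberedD[OF fib] space_empty) auto
 moreover have "e \<in> C Int E2" "C Int E2 Int E1 = {}" using e E12 C by auto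
 ultimately show "\<exists>C\<in>\<C>. e \<in> C \<and> C Int E1 = {}" by (intro bexI[of _ "C Int E2"]) auto
qed (use E12 in auto)

text \<open>A row C is first chosen correctly on E1 only; \<open>small_pattern\<close> supplies a
  row with the same trace on the intersection that avoids the part of X in E2, and the two are
  glued.\<close>

lemma fibered_glue1:
 assumes X: "X \<subseteq> E" "X Int E1 \<in> flats M" "X Int E2 \<in> flats M" and e: "e \<in> E1" "e \<notin> X"
 shows "\<exists>C\<in>\<C>. e \<in> C \<and> C Int X = {}"
proof -
 obtain C where C: "C \<in> \<C>" "e \<in> C" "C Int (X Int E1) = {}" using flatD[OF X(2), of e] e E12 by auto
 have "\<exists>D\<in>\<C>. D Int (X Int E2) = {} \<and> D Int (E1 Int E2) = C Int (E1 Int E2)"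
  by (rule small_pattern[OF sim sm _ X(3) C(1)]) (use E12 C in auto)
 then obtain D where D: "D \<in> \<C>" "D Int (X Int E2) = {}" "D Int (E1 Int E2) = C Int (E1 Int E2)" by blast
 have "(C Int E1) Un (D Int E2) \<in> \<C>" by (intro fiberedD[OF fib] C D(1) D(3)[symmetric])
 moreover have "((C Int E1) Un (D Int E2)) Int X = {}" using C D by auto
 ultimately show ?thesis using C e by (intro bexI[of _ "(C Int E1) Un (D Int E2)"]) auto
qed

text \<open>Modularity of E1 in the form that Stanley's factorization uses: a flat disjoint from E1
  is skew to it. A row isolating x on one side is corrected by \<open>small_pattern\<close> so that
  it vanishes on the other.\<close>

lemma fibered_skew:
 assumes Y: "Y \<in> flats M" "Y Int E1 = {}" and I: "I \<subseteq> E1" "I \<in> indep M" and J: "J \<subseteq> Y" "J \<in> indep M"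
 shows "I Un J \<in> indep M"
 unfolding indep_iff
proof (intro conjI ballI)
 show "I Un J \<subseteq> E" using I J indep_subset by auto
 have YE: "Y \<subseteq> E" using Y flat_subset by auto
 fix x assume "x \<in> I Un J"
 then show "\<exists>C\<in>\<C>. C Int (I Un J) = {x}"
 proof
  assume x: "x \<in> I"
  obtain C where C: "C \<in> \<C>" "C Int I = {x}" using indepD[OF I(2) x] by auto
  have "\<exists>D\<in>\<C>. D Int Y = {} \<and> D Int (E1 Int E2) = C Int (E1 Int E2)"
   by (rule small_pattern[OF sim sm _ Y(1) C(1)]) (use E12 Y in auto)
  then obtain D where D: "D \<in> \<C>" "D Int Y = {}" "D Int (E1 Int E2) = C Int (E1 Int E2)" by blast
  have "(C Int E1) Un (D Int E2) \<in> \<C>" by (intro fiberedD[OF fib] C D(1) D(3)[symmetric])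
  moreover have "C Int E1 Int J = {}" "D Int E2 Int J = {}" using D J Y by auto
  moreover have "C Int E1 Int I = {x}" using C I by auto
  moreover have "D Int E2 Int I \<subseteq> {x}" using D I C by blast
  ultimately show ?thesis by (intro bexI[of _ "(C Int E1) Un (D Int E2)"]) auto
 next
  assume x: "x \<in> J"
  obtain C where C: "C \<in> \<C>" "C Int J = {x}" using indepD[OF J(2) x] by auto
  have "\<exists>D\<in>\<C>. D Int Y = {} \<and> D Int (E1 Int E2) = C Int (E1 Int E2)"
   by (rule small_pattern[OF sim sm _ Y(1) C(1)]) (use E12 Y in auto)
  then obtain D where D: "D \<in> \<C>" "D Int Y = {}" "D Int (E1 Int E2) = C Int (E1 Int E2)" by blast
  let ?G = "sym_diff C D"
  have G: "?G \<in> \<C>" "?G Int (E1 Int E2) = {}" using space_sym_diff[OF C(1) D(1)] D(3) by auto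
  have "({} Int E1) Un (?G Int E2) \<in> \<C>" by (rule fiberedD[OF fib space_empty G(1)]) (use G(2) in simp)
  moreover have "(?G Int E2) Int I = {}" using G I by auto
  moreover have "(?G Int E2) Int J = {x}"
  proof -
   have "J \<subseteq> E2" using J Y(2) YE E12 by blast
   then show ?thesis using C D(2) J(1) x by blast
  qed
  ultimately show ?thesis by (intro bexI[of _ "?G Int E2"]) auto
 qed
qed

end

lemma fibered_glue:
 assumes "simple_matroid M" "E1 Un E2 = E" "small (flats M) (E1 Int E2)" "fibered \<C> E1 E2"
  "X \<subseteq> E" "X Int E1 \<in> flats M" "X Int E2 \<in> flats M"
 shows "X \<in> flats M"
 unfolding flat_iff
proof (intro conjI ballI)
 fix e assume "e \<in> E - X"
 then consider "e \<in> E1" "e \<notin> X" | "e \<in> E2" "e \<notin> X" using assms(2) by auto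
 then show "\<exists>C\<in>\<C>. e \<in> C \<and> C Int X = {}"
 proof cases
  case 1 then show ?thesis using fibered_glue1[OF assms] by blast
 next
  case 2
  show ?thesis
   by (rule fibered_glue1[of E2 E1, OF assms(1) _ _ fibered_commute[OF assms(4)] assms(5,7,6) 2])
    (use assms(2,3) in \<open>auto simp: Un_commute Int_commute\<close>)
 qed
qed (use assms in auto)

text \<open>A small flat S and the whole ground set are trivially fibered, so
  \<open>fibered_skew\<close> applies to S itself.\<close>

lemma small_skew:
 assumes "simple_matroid M" "small (flats M) S" "S \<subseteq> E"
  "Y \<in> flats M" "Y Int S = {}" "I \<subseteq> S" "I \<in> indep M" "J \<subseteq> Y" "J \<in> indep M"
 shows "I Un J \<in> indep M"
proof -
 have "fibered \<C> S E" unfolding fibered_def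
 proof (intro ballI impI)
  fix C D assume "C \<in> \<C>" "D \<in> \<C>" "C Int (S Int E) = D Int (S Int E)"
  then have "C Int S Un D Int E = D" using assms(3) space_subset[of D] by blast
  then show "C Int S Un D Int E \<in> \<C>" using \<open>D \<in> \<C>\<close> by simp
 qed
 moreover have "S Un E = E" "S Int E = S" using assms(3) by auto
 ultimately show ?thesis using fibered_skew[of S E Y I J] assms by simp
qed

text \<open>Otherwise T and the line would be skew and span rank 4.\<close>

lemma tri_meets_line:
 assumes sim: "simple_matroid M" and T: "tri (flats M) T" and L: "L \<in> flats M" "rk L = 2" and r: "rk (T Un L) \<le> 3"
 shows "T Int L ~= {}"
proof
 assume dis: "T Int L = {}"
 obtain I where I: "I \<in> indep M" "I \<subseteq> T" "card I = rk T" using mrank_obtain .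
 obtain J where J: "J \<in> indep M" "J \<subseteq> L" "card J = rk L" using mrank_obtain .
 have T': "rk T = 2" "T \<subseteq> E" using T tri_iff[OF sim] flat_subset by auto
 have "I Un J \<in> indep M"
  by (rule small_skew[OF sim _ T'(2) L(1) _ I(2,1) J(2,1)]) (use T dis in \<open>auto simp: small_def\<close>)
 then have "card (I Un J) \<le> rk (T Un L)" using I J by (intro card_le_mrank) auto
 moreover have "card (I Un J) = card I + card J"
  using I J dis finite_indep by (intro card_Un_disjoint) auto
 ultimately show False using I J T' L r by simp
qed

text \<open>By \<open>tri_meets_line\<close> a three-point line other than E is a modular hyperplane
  when the rank is at most 3, so the empty set, a point, such a line through it and E form a chain.
  This settles M(K3), M(K4) and the cubic case of integral roots.\<close>

lemma chained_rank3:
 assumes sim: "simple_matroid M" and r: "rk E \<le> 3"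
  and tris: "\<And>p. p \<in> E ==> \<exists>T. tri (flats M) T \<and> p \<in> T"
 shows "chained (flats M) E"
proof -
 have t: "(mhstep (flats M))\<^sup>*\<^sup>* T E" if T: "tri (flats M) T" for T
 proof (cases "T = E")
  case False
  have T': "T \<in> flats M" "rk T = 2" using T tri_iff[OF sim] by auto
  then have TE: "T \<subset> E" using False flat_subset by auto
  have "mhstep (flats M) T E" unfolding mhstep_def
  proof (intro conjI ballI impI)
   fix e f assume ef: "e \<in> E - T" "f \<in> E - T" "e ~= f"
   then have e2: "{e,f} \<subseteq> E" by auto
   have "T Int cl {e,f} ~= {}"
   proof (rule tri_meets_line[OF sim T cl_flat[OF e2]])
    show "rk (cl {e,f}) = 2" using mrank_cl[OF e2] simple_rank2[OF sim, of e f] ef by auto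
    have "rk (T Un cl {e,f}) \<le> rk E" using TE cl_subset by (intro mrank_mono) auto
    then show "rk (T Un cl {e,f}) \<le> 3" using r by simp
   qed
   then obtain g where "g \<in> T" "g \<in> cl {e,f}" by auto
   then show "\<exists>g\<in>T. \<forall>F\<in>flats M. e \<in> F --> f \<in> F --> g \<in> F" using cl_minimal[of _ "{e,f}"] by blast
  qed (use T' TE in auto)
  then show ?thesis by simp
 qed simp
 have p: "(mhstep (flats M))\<^sup>*\<^sup>* {p} E" if p: "p \<in> E" for p
 proof -
  obtain T where T: "tri (flats M) T" "p \<in> T" using tris p by blast
  have "mhstep (flats M) {p} T" unfolding mhstep_def
  proof (intro conjI ballI impI)
   show "T \<in> flats M" using T by (auto simp: tri_def)
   show "{p} \<subset> T" using T by (auto simp: tri_def)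
   fix e f assume "e \<in> T - {p}" "f \<in> T - {p}" "e ~= f"
   then show "\<exists>g\<in>{p}. \<forall>F\<in>flats M. e \<in> F --> f \<in> F --> g \<in> F" using triD[OF T(1), of e f] T(2) by blast
  qed (use simple_point_flat[OF sim p] in auto)
  then show ?thesis using t[OF T(1)] by (meson converse_rtranclp_into_rtranclp)
 qed
 have "(mhstep (flats M))\<^sup>*\<^sup>* {} E"
 proof (cases "E = {}")
  case False
  then obtain q where q: "q \<in> E" by auto
  have "mhstep (flats M) {} {q}" unfolding mhstep_def
   using simple_point_flat[OF sim q] simple_empty_flat[OF sim] by auto
  then show ?thesis using p[OF q] by (meson converse_rtranclp_into_rtranclp)
 qed simp
 then show ?thesis unfolding chained_def using p t by (auto simp: small_def)
qed

end

lemma (in matroid) chained_card1: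
 assumes sim: "simple_matroid M" and c: "card E \<le> 1"
 shows "chained (flats M) E"
proof -
 have "E = {} \<or> (\<exists>q. E = {q})"
  using c finite_ground by (metis One_nat_def card_0_eq card_1_singletonE le_Suc_eq le_zero_eq)
 then show ?thesis
 proof
  assume "\<exists>q. E = {q}"
  then obtain q where q: "E = {q}" by auto
  have st: "mhstep (flats M) {} {q}" unfolding mhstep_def
   using simple_point_flat[OF sim, of q] simple_empty_flat[OF sim] q by auto
  show ?thesis unfolding chained_def
  proof (intro ballI impI)
   fix S assume "S \<subseteq> E"
   then have "S = {} \<or> S = E" using q by auto
   then show "(mhstep (flats M))\<^sup>*\<^sup>* S E" using st q by auto
  qed
 qed (auto simp: chained_def)
qed

subsection \<open>Orthogonal spaces\<close>

definition perp :: "'a set => 'a set set => 'a set set" where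
 "perp U \<D> = {C. C \<subseteq> U \<and> (\<forall>D\<in>\<D>. even (card (C Int D)))}"

definition subspace2 :: "'a set => 'a set set => bool" where
 "subspace2 U \<D> \<longleftrightarrow> \<D> \<subseteq> Pow U \<and> {} \<in> \<D> \<and> (\<forall>C\<in>\<D>. \<forall>D\<in>\<D>. sym_diff C D \<in> \<D>)"

lemma subspace2D: "subspace2 U \<D> ==> C \<in> \<D> ==> D \<in> \<D> ==> sym_diff C D \<in> \<D>"
 unfolding subspace2_def by blast

lemma even_Int_sym_diff:
 assumes "finite D"
 shows "even (card (D Int sym_diff A B)) \<longleftrightarrow> (even (card (D Int A)) \<longleftrightarrow> even (card (D Int B)))"
proof -
 have "D Int sym_diff A B = sym_diff (D Int A) (D Int B)" by auto
 then show ?thesis using even_card_sym_diff[of "D Int A" "D Int B"] assms by simp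
qed

lemma perp_subspace: "finite U ==> subspace2 U (perp U \<D>)"
 unfolding subspace2_def
proof (intro conjI ballI)
 fix C D assume U: "finite U" and CD: "C \<in> perp U \<D>" "D \<in> perp U \<D>"
 have "finite C" "finite D" using CD U finite_subset by (auto simp: perp_def)
 then have "even (card (sym_diff C D Int G))" if "G \<in> \<D>" for G
 proof -
  have "sym_diff C D Int G = sym_diff (C Int G) (D Int G)" by auto
  then show ?thesis using even_card_sym_diff[of "C Int G" "D Int G"] \<open>finite C\<close> \<open>finite D\<close> CD that
   by (auto simp: perp_def)
 qed
 then show "sym_diff C D \<in> perp U \<D>" using CD by (auto simp: perp_def)
qed (auto simp: perp_def)

text \<open>A set orthogonal to all members that avoid e becomes orthogonal to all members, possibly
  after adding e: the sum of two members through e avoids e. For cuts this says how contracting an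
  edge changes the cycle space.\<close>

lemma perp_contract:
 assumes U: "finite U" and \<D>: "subspace2 U \<D>" and e: "e \<in> U"
 shows "perp (U - {e}) {D \<in> \<D>. e \<notin> D} = (\<lambda>C. C - {e}) ` perp U \<D>"
proof (intro equalityI subsetI)
 fix C assume C: "C \<in> perp (U - {e}) {D \<in> \<D>. e \<notin> D}"
 have CU: "C \<subseteq> U - {e}" "finite C" using C U finite_subset by (auto simp: perp_def)
 have ev: "even (card (C Int D))" if "D \<in> \<D>" "e \<notin> D" for D using C that by (auto simp: perp_def)
 show "C \<in> (\<lambda>C. C - {e}) ` perp U \<D>"
 proof (cases "\<forall>D\<in>\<D>. even (card (C Int D))")
  case True
  then show ?thesis using CU by (intro image_eqI[of _ _ C]) (auto simp: perp_def)
 next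
  case False
  then obtain D0 where D0: "D0 \<in> \<D>" "odd (card (C Int D0))" by auto
  have "even (card (insert e C Int D))" if D: "D \<in> \<D>" for D
  proof (cases "e \<in> D")
   case True
   have "e \<in> D0" using ev D0 by auto
   then have "even (card (C Int sym_diff D D0))" using True ev[of "sym_diff D D0"] subspace2D[OF \<D> D D0(1)] by auto
   then have "odd (card (C Int D))" using even_Int_sym_diff[of C D D0] CU D0 by auto
   moreover have "insert e C Int D = insert e (C Int D)" using True by auto
   moreover have "e \<notin> C Int D" "finite (C Int D)" using CU by auto
   ultimately show ?thesis by simp
  next
   case False
   then show ?thesis using ev[OF D] by auto
  qed
  then show ?thesis using CU e by (intro image_eqI[of _ _ "insert e C"]) (auto simp: perp_def)
 qed
next
 fix C assume "C \<in> (\<lambda>C. C - {e}) ` perp U \<D>"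
 then obtain C' where C': "C' \<in> perp U \<D>" "C = C' - {e}" by auto
 have "C Int D = C' Int D" if "e \<notin> D" for D using that C' by auto
 then show "C \<in> perp (U - {e}) {D \<in> \<D>. e \<notin> D}" using C' by (auto simp: perp_def)
qed

text \<open>Induction on U by \<open>perp_contract\<close>. If no member contains e, then e is free
  in the orthogonal space; otherwise exactly half of the members avoid e, and a member through e
  makes the projection of the orthogonal space injective.\<close>

lemma card_perp:
 assumes "finite U" "subspace2 U \<D>"
 shows "card \<D> * card (perp U \<D>) = 2 ^ card U"
 using assms
proof (induction U arbitrary: \<D>)
 case empty
 then have "\<D> = {{}}" by (auto simp: subspace2_def)
 then show ?case by (auto simp: perp_def)
next
 case (insert e U)
 let ?\<D> = "{D \<in> \<D>. e \<notin> D}"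
 have fin\<D>: "finite \<D>" by (rule finite_subset[of _ "Pow (insert e U)"]) (use insert in \<open>auto simp: subspace2_def\<close>)
 have sub: "subspace2 U ?\<D>" using insert.prems unfolding subspace2_def by auto
 have con: "perp U ?\<D> = (\<lambda>C. C - {e}) ` perp (insert e U) \<D>"
  using perp_contract[OF _ insert.prems, of e] insert.hyps by simp
 have IH: "card ?\<D> * card (perp U ?\<D>) = 2 ^ card U" by (rule insert.IH[OF sub])
 have finP: "finite (perp (insert e U) \<D>)" by (rule finite_subset[of _ "Pow (insert e U)"]) (use insert.hyps in \<open>auto simp: perp_def\<close>)
 show ?case
 proof (cases "?\<D> = \<D>")
  case True
  have "perp (insert e U) \<D> = perp U \<D> Un insert e ` perp U \<D>"
  proof (intro equalityI subsetI)
   fix C assume C: "C \<in> perp (insert e U) \<D>"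
   then have "C - {e} \<in> perp U \<D>" using con True by auto
   then show "C \<in> perp U \<D> Un insert e ` perp U \<D>"
    by (cases "e \<in> C") (auto intro: image_eqI[of _ _ "C - {e}"])
  next
   fix C assume C: "C \<in> perp U \<D> Un insert e ` perp U \<D>"
   have "insert e C' Int D = C' Int D" if "D \<in> \<D>" for C' D using that True by auto
   then show "C \<in> perp (insert e U) \<D>" using C by (auto simp: perp_def)
  qed
  moreover have "inj_on (insert e) (perp U \<D>)"
  proof (rule inj_onI)
   fix A B assume "A \<in> perp U \<D>" "B \<in> perp U \<D>" "insert e A = insert e B"
   moreover then have "e \<notin> A" "e \<notin> B" using insert.hyps by (auto simp: perp_def)
   ultimately show "A = B" by (metis insert_ident)
  qed
  moreover have "perp U \<D> Int insert e ` perp U \<D> = {}" using insert.hyps by (auto simp: perp_def)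
  moreover have "finite (perp U \<D>)" using con True finP by simp
  ultimately have "card (perp (insert e U) \<D>) = 2 * card (perp U \<D>)"
   by (simp add: card_Un_disjoint card_image)
  then show ?thesis using IH True insert.hyps by simp
 next
  case False
  then obtain D0 where D0: "D0 \<in> \<D>" "e \<in> D0" by auto
  have "inj_on (\<lambda>C. C - {e}) (perp (insert e U) \<D>)"
  proof (rule inj_onI)
   fix A B assume AB: "A \<in> perp (insert e U) \<D>" "B \<in> perp (insert e U) \<D>" "A - {e} = B - {e}"
   have fin: "finite A" "finite B" using AB insert.hyps finite_subset unfolding perp_def by blast+
   have par: "even (card (C Int D0)) \<longleftrightarrow> (e \<in> C \<longleftrightarrow> odd (card ((C - {e}) Int D0)))" if C: "finite C" for C
   proof (cases "e \<in> C")
    case True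
    have "C Int D0 = insert e ((C - {e}) Int D0)" using True D0 by auto
    then have "card (C Int D0) = card (insert e ((C - {e}) Int D0))" by (rule arg_cong)
    also have "\<dots> = Suc (card ((C - {e}) Int D0))" by (rule card_insert_disjoint) (use C in auto)
    finally show ?thesis using True by simp
   next
    case False
    then have "C - {e} = C" by auto
    then show ?thesis using False by simp
   qed
   have ev: "even (card (A Int D0))" "even (card (B Int D0))" using AB D0 by (auto simp: perp_def)
   have "e \<in> A \<longleftrightarrow> e \<in> B"
    using par[OF fin(1)] par[OF fin(2)] ev unfolding AB(3) by meson
   then show "A = B" using AB(3) by blast
  qed
  then have 1: "card (perp U ?\<D>) = card (perp (insert e U) \<D>)" using con by (simp add: card_image)
  have "bij_betw (sym_diff D0) ?\<D> (\<D> - ?\<D>)"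
  proof (rule bij_betwI[where g = "sym_diff D0"])
   show "sym_diff D0 \<in> ?\<D> \<rightarrow> \<D> - ?\<D>" "sym_diff D0 \<in> \<D> - ?\<D> \<rightarrow> ?\<D>"
    using D0 subspace2D[OF insert.prems D0(1)] by auto
  qed auto
  then have "card (\<D> - ?\<D>) = card ?\<D>" by (simp add: bij_betw_same_card)
  moreover have "card (\<D> - ?\<D>) = card \<D> - card ?\<D>"
   by (rule card_Diff_subset) (use fin\<D> in auto)
  moreover have "card ?\<D> \<le> card \<D>" by (rule card_mono[OF fin\<D>]) auto
  ultimately have "card \<D> = 2 * card ?\<D>" by linarith
  then show ?thesis using IH 1 insert.hyps by simp
 qed
qed

lemma perp_perp:
 assumes "finite U" "subspace2 U \<D>"
 shows "perp U (perp U \<D>) = \<D>"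
proof (rule sym, rule card_subset_eq)
 show "finite (perp U (perp U \<D>))" by (rule finite_subset[of _ "Pow U"]) (use assms in \<open>auto simp: perp_def\<close>)
 show "\<D> \<subseteq> perp U (perp U \<D>)" using assms by (auto simp: perp_def subspace2_def Int_commute)
 have "card \<D> * card (perp U \<D>) = card (perp U \<D>) * card (perp U (perp U \<D>))"
  using card_perp[OF assms] card_perp[OF assms(1) perp_subspace[OF assms(1)]] by metis
 moreover have "card (perp U \<D>) ~= 0" using card_perp[OF assms] by (metis mult_0_right power_not_zero zero_neq_numeral)
 ultimately show "card \<D> = card (perp U (perp U \<D>))" by simp
qed

subsection \<open>Cuts and cycles of a graph\<close>

definition cut :: "('v, 'e) mgraph => 'v set => 'e set" where
 "cut G P = {e \<in> edges G. ends G e Int P ~= {} \<and> \<not> ends G e \<subseteq> P}"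

definition cuts :: "('v, 'e) mgraph => 'e set set" where
 "cuts G = range (cut G)"

text \<open>The cycle space, introduced as the orthogonal space of the cuts and not through cycles.
  A loop of the graph lies in no cut, so it forms a member by itself.\<close>

definition cycs :: "('v, 'e) mgraph => 'e set set" where
 "cycs G = perp (edges G) (cuts G)"

text \<open>Used for a walk once around a cycle, where membership in a vertex set returns to its
  initial value.\<close>

lemma even_card_alternations:
 fixes f :: "nat => bool"
 shows "even (card {i. i < n \<and> f i ~= f (Suc i)}) \<longleftrightarrow> f 0 = f n"
proof (induction n)
 case (Suc n)
 have "{i. i < Suc n \<and> f i ~= f (Suc i)} =
   (if f n ~= f (Suc n) then insert n {i. i < n \<and> f i ~= f (Suc i)} else {i. i < n \<and> f i ~= f (Suc i)})"
  by (auto simp: less_Suc_eq)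
 then show ?case using Suc by auto
qed simp

context finite_graph
begin

lemma ends_pair: "e \<in> edges G ==> \<exists>a b. ends G e = {a, b} \<and> a \<in> verts G \<and> b \<in> verts G"
proof -
 assume e: "e \<in> edges G"
 then have "card (ends G e) = 1 \<or> card (ends G e) = 2" using card_ends by auto
 then obtain a b where "ends G e = {a, b}" by (metis card_1_singletonE card_2_iff insert_absorb2)
 then show ?thesis using ends_in_verts[OF e] by auto
qed

lemma mem_cut_pair: "e \<in> edges G ==> ends G e = {a, b} ==> e \<in> cut G P \<longleftrightarrow> (a \<in> P) ~= (b \<in> P)"
 unfolding cut_def by auto

lemma cut_sym_diff: "sym_diff (cut G P) (cut G Q) = cut G (sym_diff P Q)"
proof (rule set_eqI)
 fix e
 show "e \<in> sym_diff (cut G P) (cut G Q) \<longleftrightarrow> e \<in> cut G (sym_diff P Q)"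
 proof (cases "e \<in> edges G")
  case True
  then obtain a b where "ends G e = {a, b}" using ends_pair by blast
  then have "\<And>P. e \<in> cut G P \<longleftrightarrow> (a \<in> P) ~= (b \<in> P)" using mem_cut_pair[OF True] by blast
  then show ?thesis by auto
 next
  case False then show ?thesis by (auto simp: cut_def)
 qed
qed

lemma subspace_cuts: "subspace2 (edges G) (cuts G)"
 unfolding subspace2_def
proof (intro conjI ballI)
 show "cuts G \<subseteq> Pow (edges G)" by (auto simp: cuts_def cut_def)
 have "cut G {} = {}" by (auto simp: cut_def)
 then show "{} \<in> cuts G" unfolding cuts_def by (metis rangeI)
 fix C D assume "C \<in> cuts G" "D \<in> cuts G"
 then show "sym_diff C D \<in> cuts G" unfolding cuts_def using cut_sym_diff by auto
qed

lemma cut_compl: "cut G (verts G - P) = cut G P"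
proof (rule set_eqI)
 fix e
 show "e \<in> cut G (verts G - P) \<longleftrightarrow> e \<in> cut G P"
 proof (cases "e \<in> edges G")
  case True
  then obtain a b where "ends G e = {a, b}" "a \<in> verts G" "b \<in> verts G" using ends_pair by blast
  then show ?thesis using mem_cut_pair[OF True] by auto
 next
  case False then show ?thesis by (auto simp: cut_def)
 qed
qed

lemma cut_Int_verts: "cut G (P Int verts G) = cut G P"
proof (rule set_eqI)
 fix e
 show "e \<in> cut G (P Int verts G) \<longleftrightarrow> e \<in> cut G P"
 proof (cases "e \<in> edges G")
  case True
  then obtain a b where "ends G e = {a, b}" "a \<in> verts G" "b \<in> verts G" using ends_pair by blast
  then show ?thesis using mem_cut_pair[OF True] by auto
 next
  case False then show ?thesis by (auto simp: cut_def)
 qed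
qed

lemma cycle_even_cut:
 assumes cy: "cycle G vs es"
 shows "even (card (set es Int cut G P))"
proof -
 let ?n = "length es"
 let ?f = "\<lambda>i. vs ! (i mod ?n) \<in> P"
 have n: "?n > 0" "length vs = ?n" "distinct es" using cy by (auto simp: cycle_def)
 have mem: "es ! i \<in> cut G P \<longleftrightarrow> ?f i ~= ?f (Suc i)" if i: "i < ?n" for i
 proof -
  have "es ! i \<in> edges G" "ends G (es ! i) = {vs ! i, vs ! (Suc i mod ?n)}"
   using cy i by (auto simp: cycle_def)
  then show ?thesis using mem_cut_pair i by auto
 qed
 have "set es Int cut G P = (\<lambda>i. es ! i) ` {i. i < ?n \<and> ?f i ~= ?f (Suc i)}"
  using mem by (auto simp: in_set_conv_nth)
 moreover have "inj_on (\<lambda>i. es ! i) {i. i < ?n \<and> ?f i ~= ?f (Suc i)}"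
  using n(3) by (auto intro!: inj_onI simp: nth_eq_iff_index_eq)
 ultimately have "card (set es Int cut G P) = card {i. i < ?n \<and> ?f i ~= ?f (Suc i)}"
  by (simp add: card_image)
 then show ?thesis using even_card_alternations[of ?n ?f] n by simp
qed

text \<open>P consists of the vertices reachable from one end of x by paths in X without x. The
  other end is not reachable, since such a path and x would close to a cycle, so x is the only edge
  of X leaving P.\<close>

lemma no_cycle_cut:
 assumes X: "X \<subseteq> edges G" "\<not> (\<exists>vs es. cycle G vs es \<and> set es \<subseteq> X)" and x: "x \<in> X"
 shows "\<exists>P. cut G P Int X = {x}"
proof -
 obtain a b where ab: "ends G x = {a, b}" "a \<in> verts G" "b \<in> verts G" using ends_pair X x by blast
 define R where "R vs es \<longleftrightarrow> vs ~= [] \<and> hd vs = a \<and> length vs = Suc (length es) \<and> distinct vs \<and> distinct es \<and>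
  set vs \<subseteq> verts G \<and> set es \<subseteq> X - {x} \<and> (\<forall>i<length es. ends G (es ! i) = {vs ! i, vs ! Suc i})" for vs es
 define P where "P = {v. \<exists>vs es. R vs es \<and> last vs = v}"
 have step: "v \<in> P" if u: "u \<in> P" and e: "e \<in> X - {x}" "ends G e = {u, v}" for u v e
 proof -
  obtain vs es where R: "R vs es" "last vs = u" using u by (auto simp: P_def)
  show ?thesis
  proof (cases "v \<in> set vs")
   case True
   then obtain k where k: "k < length vs" "vs ! k = v" by (auto simp: in_set_conv_nth)
   \<comment> \<open>A path that already visits v is cut off at v.\<close>
   have "R (take (Suc k) vs) (take k es)"
    unfolding R_def
   proof (intro conjI allI impI)
    show "hd (take (Suc k) vs) = a" using R k by (cases vs) (auto simp: R_def)
    show "set (take (Suc k) vs) \<subseteq> verts G" "set (take k es) \<subseteq> X - {x}"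
     using R set_take_subset unfolding R_def by fastforce+
   qed (use R k in \<open>auto simp: R_def\<close>)
   moreover have "last (take (Suc k) vs) = v" using k by (simp add: take_Suc_conv_app_nth)
   ultimately show ?thesis unfolding P_def by blast
  next
   case False
   have "v \<in> verts G" using ends_in_verts[of e] e X by auto
   have uv: "u \<in> set vs" using R by (auto simp: R_def)
   have "e \<notin> set es"
   proof
    assume "e \<in> set es"
    then obtain i where i: "i < length es" "es ! i = e" by (auto simp: in_set_conv_nth)
    then have "v \<in> {vs ! i, vs ! Suc i}" using R e by (auto simp: R_def)
    then have "v \<in> set vs" using i R by (auto simp: R_def)
    then show False using False by simp
   qed
   moreover have "ends G ((es @ [e]) ! i) = {(vs @ [v]) ! i, (vs @ [v]) ! Suc i}" if "i < length (es @ [e])" for i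
   proof (cases "i = length es")
    case True
    have "vs ! (length vs - 1) = u" using R by (auto simp: R_def last_conv_nth)
    then show ?thesis using True R e by (simp add: R_def nth_append)
   next
    case False
    then show ?thesis using that R by (auto simp: R_def nth_append)
   qed
   ultimately have "R (vs @ [v]) (es @ [e])"
    using R False \<open>v \<in> verts G\<close> e unfolding R_def by auto
   then show ?thesis unfolding P_def by (metis (mono_tags, lifting) last_snoc mem_Collect_eq)
  qed
 qed
 have "R [a] []" unfolding R_def using ab by auto
 then have aP: "a \<in> P" unfolding P_def by force
 have bP: "b \<notin> P"
 proof
  assume "b \<in> P"
  then obtain vs es where R: "R vs es" "last vs = b" by (auto simp: P_def)
  have "cycle G vs (es @ [x])"
   unfolding cycle_def
  proof (intro conjI allI impI)
   fix i assume i: "i < length (es @ [x])"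
   show "ends G ((es @ [x]) ! i) = {vs ! i, vs ! (Suc i mod length vs)}"
   proof (cases "i = length es")
    case True
    have "vs ! (length vs - 1) = b" "vs ! 0 = a" using R by (auto simp: R_def last_conv_nth hd_conv_nth)
    then show ?thesis using True R ab by (auto simp: R_def nth_append)
   next
    case False
    then show ?thesis using i R by (auto simp: R_def nth_append)
   qed
  qed (use R x X in \<open>auto simp: R_def\<close>)
  moreover have "set (es @ [x]) \<subseteq> X" using R x by (auto simp: R_def)
  ultimately show False using X by blast
 qed
 have "cut G P Int X = {x}"
 proof (intro equalityI subsetI)
  fix e assume e: "e \<in> cut G P Int X"
  then have "e \<in> edges G" by (auto simp: cut_def)
  then obtain u v where uv: "ends G e = {u, v}" using ends_pair by blast
  then have "(u \<in> P) ~= (v \<in> P)" using mem_cut_pair e X by auto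
  then show "e \<in> {x}" using step[of u e v] step[of v e u] e uv by (auto simp: insert_commute)
 next
  fix e assume "e \<in> {x}"
  then show "e \<in> cut G P Int X" using aP bP ab x X mem_cut_pair[of x a b P] by auto
 qed
 then show ?thesis by blast
qed

lemma indep_cycle_matroid_cuts:
 "X \<in> indep (cycle_matroid G) \<longleftrightarrow> X \<subseteq> edges G \<and> (\<forall>x\<in>X. \<exists>D\<in>cuts G. D Int X = {x})"
proof
 assume "X \<in> indep (cycle_matroid G)"
 then have X: "X \<subseteq> edges G" "\<not> (\<exists>vs es. cycle G vs es \<and> set es \<subseteq> X)"
  unfolding cycle_matroid_def by simp_all
 show "X \<subseteq> edges G \<and> (\<forall>x\<in>X. \<exists>D\<in>cuts G. D Int X = {x})"
 proof (intro conjI ballI)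
  fix x assume "x \<in> X"
  then obtain P where P: "cut G P Int X = {x}" using no_cycle_cut[OF X] by blast
  show "\<exists>D\<in>cuts G. D Int X = {x}" using P by (intro bexI[of _ "cut G P"]) (simp_all add: cuts_def)
 qed (rule X(1))
next
 assume X: "X \<subseteq> edges G \<and> (\<forall>x\<in>X. \<exists>D\<in>cuts G. D Int X = {x})"
 have "\<not> (cycle G vs es \<and> set es \<subseteq> X)" for vs es
 proof
  assume c: "cycle G vs es \<and> set es \<subseteq> X"
  then obtain x where x: "x \<in> set es" unfolding cycle_def by (metis last_in_set)
  have "x \<in> X" using x c by blast
  then obtain D where "D \<in> cuts G" "D Int X = {x}" using X[THEN conjunct2] by (meson bspec)
  then obtain P where P: "cut G P Int X = {x}" unfolding cuts_def by (metis imageE)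
  then have "set es Int cut G P = {x}" using c x by auto
  then show False using cycle_even_cut[of vs es P] c by simp
 qed
 then show "X \<in> indep (cycle_matroid G)" using X unfolding cycle_matroid_def by simp
qed

lemma indep_cycle_matroid_cycs:
 "X \<in> indep (cycle_matroid G) \<longleftrightarrow> X \<subseteq> edges G \<and> (\<forall>C\<in>cycs G. C \<subseteq> X --> C = {})"
proof
 assume a: "X \<in> indep (cycle_matroid G)"
 have "C = {}" if C: "C \<in> cycs G" "C \<subseteq> X" for C
 proof (rule ccontr)
  assume "C ~= {}"
  then obtain x where x: "x \<in> C" by auto
  then have "x \<in> X" using C by blast
  then obtain D where D: "D \<in> cuts G" "D Int X = {x}"
   using a[unfolded indep_cycle_matroid_cuts, THEN conjunct2] by (meson bspec)
  then have "C Int D = {x}" using C x by auto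
  moreover have "even (card (C Int D))" using C(1) D(1) by (simp add: cycs_def perp_def)
  ultimately show False by simp
 qed
 moreover have "X \<subseteq> edges G" using a unfolding indep_cycle_matroid_cuts by (rule conjunct1)
 ultimately show "X \<subseteq> edges G \<and> (\<forall>C\<in>cycs G. C \<subseteq> X --> C = {})"
  by simp
next
 assume a: "X \<subseteq> edges G \<and> (\<forall>C\<in>cycs G. C \<subseteq> X --> C = {})"
 have "\<not> (cycle G vs es \<and> set es \<subseteq> X)" for vs es
 proof
  assume c: "cycle G vs es \<and> set es \<subseteq> X"
  then have "set es \<in> cycs G" using cycle_even_cut[of vs es] unfolding cycs_def perp_def cuts_def cycle_def by auto
  then have "set es = {}" using a c by blast
  then show False using c by (auto simp: cycle_def)
 qed
 then show "X \<in> indep (cycle_matroid G)" using a unfolding cycle_matroid_def by simp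
qed

end

context finite_graph
begin

lemma cycs_subset: "C \<in> cycs G ==> C \<subseteq> edges G" by (auto simp: cycs_def perp_def)

lemma subspace_cycs: "subspace2 (edges G) (cycs G)"
 unfolding cycs_def by (rule perp_subspace[OF finite_edges])

lemma cuts_even: "C \<in> cycs G ==> even (card (C Int cut G P))"
 by (auto simp: cycs_def perp_def cuts_def)

text \<open>If a basis B avoids X, the fundamental cycles of the elements of X isolate them.
  Conversely let B be maximal independent outside X; it is a basis of the whole because a member
  isolating y in X can be pushed into B and y.\<close>

lemma indep_dual_cycle_matroid:
 "X \<in> indep (dual (cycle_matroid G)) \<longleftrightarrow> X \<subseteq> edges G \<and> (\<forall>x\<in>X. \<exists>C\<in>cycs G. C Int X = {x})"
proof
 assume "X \<in> indep (dual (cycle_matroid G))"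
 then obtain B where B: "basis (cycle_matroid G) B" "X \<subseteq> edges G - B"
  unfolding dual_def cycle_matroid_def by auto
 have BI: "B \<in> indep (cycle_matroid G)" and max: "\<And>Y. Y \<in> indep (cycle_matroid G) ==> B \<subseteq> Y ==> Y = B"
  using B(1) unfolding basis_def by auto
 show "X \<subseteq> edges G \<and> (\<forall>x\<in>X. \<exists>C\<in>cycs G. C Int X = {x})"
 proof (intro conjI ballI)
  fix x assume x: "x \<in> X"
  have "insert x B \<notin> indep (cycle_matroid G)" using max[of "insert x B"] x B by auto
  moreover have "insert x B \<subseteq> edges G" using x B BI indep_cycle_matroid_cycs[of B] by auto
  ultimately obtain C where C: "C \<in> cycs G" "C \<subseteq> insert x B" "C ~= {}"
   using indep_cycle_matroid_cycs[of "insert x B"] by auto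
  have "x \<in> C"
  proof (rule ccontr)
   assume "x \<notin> C"
   then have "C \<subseteq> B" using C by auto
   then show False using BI C indep_cycle_matroid_cycs[of B] by auto
  qed
  then have "C Int X = {x}" using C B x by auto
  then show "\<exists>C\<in>cycs G. C Int X = {x}" using C by blast
 qed (use B in auto)
next
 assume X: "X \<subseteq> edges G \<and> (\<forall>x\<in>X. \<exists>C\<in>cycs G. C Int X = {x})"
 let ?S = "{B \<in> indep (cycle_matroid G). B \<subseteq> edges G - X}"
 have fin: "finite ?S" by (rule finite_subset[of _ "Pow (edges G)"]) (use finite_edges in auto)
 have "{} \<in> ?S" using indep_cycle_matroid_cycs[of "{}"] by auto
 then have "?S ~= {}" by blast
 from finite_has_maximal[OF fin this]
 obtain B where Bm: "B \<in> ?S" "\<forall>B'\<in>?S. B \<subseteq> B' --> B = B'" ..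
 have B: "B \<in> ?S" "\<And>B'. B' \<in> ?S ==> B \<subseteq> B' ==> B' = B"
  by (rule Bm(1), rule Bm(2)[rule_format, symmetric])
 have cyc: "\<exists>D\<in>cycs G. z \<in> D \<and> D \<subseteq> insert z B" if z: "z \<in> edges G" "z \<notin> X" "z \<notin> B" for z
 proof -
  have "insert z B \<notin> ?S" using B(2)[of "insert z B"] z by auto
  then have "insert z B \<notin> indep (cycle_matroid G)" using z B by auto
  moreover have "insert z B \<subseteq> edges G" using z B by auto
  ultimately obtain D where D: "D \<in> cycs G" "D \<subseteq> insert z B" "D ~= {}"
   using indep_cycle_matroid_cycs[of "insert z B"] by auto
  then have "z \<in> D" using B indep_cycle_matroid_cycs[of B] by auto
  then show ?thesis using D by auto
 qed
 have fund: "\<exists>C\<in>cycs G. y \<in> C \<and> C \<subseteq> insert y B" if y: "y \<in> X" for y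
 proof -
  obtain C0 where C0: "C0 \<in> cycs G \<and> C0 Int X = {y}" using X y by auto
  let ?P = "\<lambda>C. C \<in> cycs G \<and> C Int X = {y}"
  \<comment> \<open>Choose the member with fewest edges outside B and y; any such edge z could be
    removed by adding the member that z closes with B.\<close>
  obtain C where Cm: "?P C \<and> (\<forall>C'. ?P C' --> card (C - insert y B) \<le> card (C' - insert y B))"
   using ex_has_least_nat[of ?P C0 "\<lambda>C. card (C - insert y B)", OF C0] ..
  note C = Cm[THEN conjunct1] and mn = Cm[THEN conjunct2, rule_format]
  have fC: "finite C" using C cycs_subset finite_edges finite_subset by blast
  have "C \<subseteq> insert y B"
  proof (rule ccontr)
   assume "\<not> C \<subseteq> insert y B"
   then obtain z where z: "z \<in> C" "z \<notin> insert y B" by auto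
   then have zz: "z \<in> edges G" "z \<notin> X" using C cycs_subset[of C] by auto
   obtain D where D: "D \<in> cycs G" "z \<in> D" "D \<subseteq> insert z B" using cyc[OF zz] z by auto
   have "sym_diff C D \<in> cycs G" using subspace2D[OF subspace_cycs] C D by auto
   moreover have "sym_diff C D Int X = {y}" using C D zz B by auto
   ultimately have "card (C - insert y B) \<le> card (sym_diff C D - insert y B)" by (intro mn conjI)
   moreover have "sym_diff C D - insert y B \<subset> C - insert y B" using z D by auto
   then have "card (sym_diff C D - insert y B) < card (C - insert y B)" using fC by (intro psubset_card_mono) auto
   ultimately show False by simp
  qed
  then show ?thesis using C by auto
 qed
 have "basis (cycle_matroid G) B" unfolding basis_def
 proof (intro conjI ballI impI)
  show "B \<in> indep (cycle_matroid G)" using B by auto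
  fix Y assume Y: "Y \<in> indep (cycle_matroid G)" "B \<subseteq> Y"
  have YE: "Y \<subseteq> edges G" using Y indep_cycle_matroid_cycs[of Y] by auto
  show "Y = B"
  proof (rule ccontr)
   assume "Y ~= B"
   then obtain y where y: "y \<in> Y" "y \<notin> B" using Y by auto
   have "\<exists>C\<in>cycs G. y \<in> C \<and> C \<subseteq> insert y B"
    using fund[of y] cyc[of y] y YE by (cases "y \<in> X") auto
   then obtain C where "C \<in> cycs G" "y \<in> C" "C \<subseteq> Y" using y Y by blast
   then show False using Y(1) indep_cycle_matroid_cycs[of Y] by auto
  qed
 qed
 then show "X \<in> indep (dual (cycle_matroid G))" using X B unfolding dual_def cycle_matroid_def by auto
qed

lemma ground_dual: "ground (dual (cycle_matroid G)) = edges G"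
 by (simp add: dual_def cycle_matroid_def)

lemma binary_rep_dual: "binary_rep (cycs G) (dual (cycle_matroid G))"
 unfolding binary_rep_def ground_dual
proof (intro conjI)
 show "{} \<in> cycs G" "\<forall>C\<in>cycs G. \<forall>D\<in>cycs G. sym_diff C D \<in> cycs G"
  using subspace_cycs by (simp_all add: subspace2_def)
 show "indep (dual (cycle_matroid G)) = {X. X \<subseteq> edges G \<and> (\<forall>x\<in>X. \<exists>C\<in>cycs G. C Int X = {x})}"
  using indep_dual_cycle_matroid by blast
qed (use cycs_subset in auto)

lemma binary_rep_cycle_matroid: "binary_rep (cuts G) (cycle_matroid G)"
 unfolding binary_rep_def
proof (intro conjI)
 have g: "ground (cycle_matroid G) = edges G" by (simp add: cycle_matroid_def)
 show "\<forall>C\<in>cuts G. C \<subseteq> ground (cycle_matroid G)" unfolding g by (auto simp: cuts_def cut_def)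
 show "{} \<in> cuts G" "\<forall>C\<in>cuts G. \<forall>D\<in>cuts G. sym_diff C D \<in> cuts G"
  using subspace_cuts by (simp_all add: subspace2_def)
 show "indep (cycle_matroid G) = {X. X \<subseteq> ground (cycle_matroid G) \<and> (\<forall>x\<in>X. \<exists>C\<in>cuts G. C Int X = {x})}"
  unfolding g using indep_cycle_matroid_cuts by blast
qed

text \<open>One end is renamed to the other, so the vertex type stays the same. The cuts of the new
  graph are the old cuts that avoid e, and \<open>perp_contract\<close> computes their orthogonal
  space. If e is a loop, the renaming is the identity and e is just deleted.\<close>

lemma contract_edge:
 assumes e: "e \<in> edges G"
 shows "\<exists>G' :: ('v, 'e) mgraph. finite_graph G' \<and> edges G' = edges G - {e} \<and> cycs G' = (\<lambda>C. C - {e}) ` cycs G"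
proof -
 obtain x y where xy: "ends G e = {x, y}" "x \<in> verts G" "y \<in> verts G" using ends_pair[OF e] by blast
 define \<phi> where "\<phi> z = (if z = y then x else z)" for z
 define G' :: "('v, 'e) mgraph" where "G' = \<lparr>verts = \<phi> ` verts G, edges = edges G - {e}, ends = (\<lambda>f. \<phi> ` ends G f)\<rparr>"
 have fg: "finite_graph G'"
 proof
  fix f assume "f \<in> edges G'"
  then have f: "f \<in> edges G" by (simp add: G'_def)
  obtain a b where "ends G f = {a, b}" using ends_pair[OF f] by blast
  then have "ends G' f = {\<phi> a, \<phi> b}" by (simp add: G'_def)
  then show "card (ends G' f) \<in> {1, 2}" by (simp add: card_insert_if)
  show "ends G' f \<subseteq> verts G'" using ends_in_verts[OF f] by (auto simp: G'_def)
 qed (use finite_verts finite_edges in \<open>auto simp: G'_def\<close>)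
 have c1: "cut G' P = cut G (\<phi> -` P)" for P
 proof (rule set_eqI)
  fix f
  show "f \<in> cut G' P \<longleftrightarrow> f \<in> cut G (\<phi> -` P)"
  proof (cases "f = e")
   case True
   have "\<phi> x = x" "\<phi> y = x" by (auto simp: \<phi>_def)
   then show ?thesis using True mem_cut_pair[OF e xy(1), of "\<phi> -` P"] by (auto simp: cut_def G'_def)
  next
   case False
   then show ?thesis by (auto simp: cut_def G'_def)
  qed
 qed
 have c2: "\<phi> -` P = P" if "e \<notin> cut G P" for P
 proof -
  have "x \<in> P \<longleftrightarrow> y \<in> P" using that unfolding mem_cut_pair[OF e xy(1)] by simp
  then show ?thesis by (auto simp: \<phi>_def split: if_splits)
 qed
 have "cuts G' = {D \<in> cuts G. e \<notin> D}"
 proof (intro equalityI subsetI)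
  fix D assume "D \<in> cuts G'"
  then obtain P where P: "D = cut G' P" by (auto simp: cuts_def)
  have "e \<notin> cut G' P" by (auto simp: cut_def G'_def)
  then show "D \<in> {D \<in> cuts G. e \<notin> D}" using P c1[of P] by (auto simp: cuts_def)
 next
  fix D assume "D \<in> {D \<in> cuts G. e \<notin> D}"
  then obtain P where P: "D = cut G P" "e \<notin> cut G P" by (auto simp: cuts_def)
  then show "D \<in> cuts G'" using c1[of P] c2[of P] by (auto simp: cuts_def)
 qed
 then have "cycs G' = (\<lambda>C. C - {e}) ` cycs G"
  unfolding cycs_def using perp_contract[OF finite_edges subspace_cuts e] by (simp add: G'_def)
 then show ?thesis using fg by (intro exI[of _ G']) (simp add: G'_def)
qed

end

text \<open>Deleting an element of the dual matroid is contracting an edge of the graph.\<close>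

lemma cographic_restriction1:
 assumes cg: "cographic M" and e: "e \<in> ground M"
 shows "cographic (restriction M (ground M - {e}))"
proof -
 obtain G :: "(nat, 'a) mgraph" where G: "finite_graph G" "M = dual (cycle_matroid G)"
  using cg unfolding cographic_def by blast
 interpret finite_graph G by fact
 have gr: "ground M = edges G" using G ground_dual by simp
 then obtain G' :: "(nat, 'a) mgraph" where G': "finite_graph G'" "edges G' = edges G - {e}"
  "cycs G' = (\<lambda>C. C - {e}) ` cycs G" using contract_edge e by metis
 interpret G': finite_graph G' by fact
 have "restriction M (ground M - {e}) = dual (cycle_matroid G')"
 proof (rule pre_matroid.equality)
  show "ground (restriction M (ground M - {e})) = ground (dual (cycle_matroid G'))"
   unfolding G'.ground_dual using gr G' by (auto simp: restriction_def)
  show "indep (restriction M (ground M - {e})) = indep (dual (cycle_matroid G'))"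
  proof (rule set_eqI)
   fix X
   show "X \<in> indep (restriction M (ground M - {e})) \<longleftrightarrow> X \<in> indep (dual (cycle_matroid G'))"
   proof (cases "X \<subseteq> edges G - {e}")
    case True
    then have *: "(C - {e}) Int X = C Int X" for C by auto
    have "X \<in> indep (restriction M (ground M - {e})) \<longleftrightarrow> X \<in> indep M"
     using True gr by (simp add: restriction_def)
    also have "\<dots> \<longleftrightarrow> (\<forall>x\<in>X. \<exists>C\<in>cycs G. C Int X = {x})"
    proof -
     have "X \<subseteq> edges G" using True by blast
     then show ?thesis unfolding G(2) indep_dual_cycle_matroid by simp
    qed
    finally show ?thesis unfolding G'.indep_dual_cycle_matroid G'(2,3) using True by (simp add: *)
   next
    case False
    then show ?thesis unfolding G'.indep_dual_cycle_matroid G'(2,3) using gr by (simp add: restriction_def)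
   qed
  qed
 qed simp
 then show ?thesis using G'(1) unfolding cographic_def by (intro exI[of _ G'] conjI)
qed

lemma cographic_restriction:
 assumes M: "matroid M" and cg: "cographic M" and S: "S \<subseteq> ground M"
 shows "cographic (restriction M S)"
proof -
 have fin: "finite (ground M - S)" using matroid.finite_ground[OF M] by auto
 have "\<forall>T. ground M - T = D --> T \<subseteq> ground M --> cographic (restriction M T)" if "finite D" for D
  using that
 proof (induction D)
  case empty
  show ?case
  proof (intro allI impI)
   fix T assume "ground M - T = {}" "T \<subseteq> ground M"
   then have "T = ground M" by auto
   moreover have "restriction M (ground M) = M"
    using matroid.indep_subset[OF M] by (auto simp: restriction_def intro!: pre_matroid.equality)
   ultimately show "cographic (restriction M T)" using cg by simp
  qed
 next
  case (insert d D)
  show ?case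
  proof (intro allI impI)
   fix T assume T: "ground M - T = insert d D" "T \<subseteq> ground M"
   have "ground M - insert d T = D" "insert d T \<subseteq> ground M" using T insert by auto
   then have "cographic (restriction M (insert d T))" using insert by blast
   moreover have g: "ground (restriction M (insert d T)) = insert d T" using T by (auto simp: restriction_def)
   ultimately have "cographic (restriction (restriction M (insert d T)) (insert d T - {d}))"
    using cographic_restriction1[of "restriction M (insert d T)" d] by simp
   moreover have "d \<notin> T" using T by auto
   then have "restriction (restriction M (insert d T)) (insert d T - {d}) = restriction M T"
    by (auto simp: restriction_def intro!: pre_matroid.equality)
   ultimately show "cographic (restriction M T)" by simp
  qed
 qed
 then show ?thesis using fin S by blast
qed

section \<open>Counting vertices and edges in the graph dual to M\<close>

locale cographic_matroid = matroid M + finite_graph G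
 for M :: "'a pre_matroid" and G :: "(nat, 'a) mgraph" +
 assumes is_dual: "M = dual (cycle_matroid G)"
begin

sublocale binary_matroid M "cycs G"
 by unfold_locales (simp add: is_dual binary_rep_dual)

lemma ground_edges: "E = edges G" by (simp add: is_dual ground_dual)

abbreviation "star x \<equiv> cut G {x}"

text \<open>Isolated vertices and vertices carrying only loops influence no cut and would spoil the
  counts.\<close>

definition "V = {x \<in> verts G. star x ~= {}}"

lemma finite_V: "finite V" using finite_verts by (simp add: V_def)

lemma finite_cut: "finite (cut G P)"
 by (rule finite_subset[of _ "edges G"]) (use finite_edges in \<open>auto simp: cut_def\<close>)

lemma mem_star: "e \<in> edges G ==> ends G e = {a, b} ==> e \<in> star x \<longleftrightarrow> a ~= b \<and> (x = a \<or> x = b)"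
 by (subst mem_cut_pair) auto

text \<open>Double counting of incidences; a loop of G lies in no star.\<close>

lemma star_sum: "(\<Sum>x\<in>V. card (star x Int D)) = 2 * card {e \<in> D. card (ends G e) = 2}" if D: "D \<subseteq> edges G"
proof -
 have fD: "finite D" using D finite_edges finite_subset by auto
 have "(\<Sum>x\<in>V. card (star x Int D)) = (\<Sum>x\<in>V. card {e \<in> D. e \<in> star x})"
  by (intro sum.cong) (auto intro!: arg_cong[where f = card])
 also have "\<dots> = (\<Sum>e\<in>D. card {x \<in> V. e \<in> star x})"
  using sum_multicount_gen[of V D "\<lambda>x e. e \<in> star x" "\<lambda>e. card {x \<in> V. e \<in> star x}"] finite_V fD by simp
 also have "\<dots> = (\<Sum>e\<in>D. if card (ends G e) = 2 then 2 else 0)"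
 proof (rule sum.cong)
  fix e assume "e \<in> D"
  then have e: "e \<in> edges G" using D by auto
  then obtain a b where ab: "ends G e = {a, b}" "a \<in> verts G" "b \<in> verts G" using ends_pair by blast
  have "{x \<in> V. e \<in> star x} = (if a ~= b then {a, b} else {})"
   using mem_star[OF e ab(1)] ab by (auto simp: V_def)
  then show "card {x \<in> V. e \<in> star x} = (if card (ends G e) = 2 then 2 else 0)" using ab by (auto simp: card_insert_if)
 qed simp
 also have "\<dots> = 2 * card {e \<in> D. card (ends G e) = 2}"
  by (subst sum.inter_filter[symmetric]) (use fD in auto)
 finally show ?thesis .
qed

text \<open>Stars are cuts and meet every row evenly: a star with one element would be a loop of M,
  and one with two elements a parallel pair.\<close>

lemma star_ge3:
 assumes sim: "simple_matroid M" and x: "x \<in> V" shows "card (star x) \<ge> 3"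
proof (rule ccontr)
 assume "\<not> card (star x) \<ge> 3"
 moreover have "card (star x) ~= 0" using x finite_cut by (auto simp: V_def)
 ultimately have "card (star x) = 1 \<or> card (star x) = 2" by linarith
 then show False
 proof
  assume "card (star x) = 1"
  then obtain e where e: "star x = {e}" by (auto simp: card_1_singleton_iff)
  then have "e \<in> E" unfolding ground_edges by (auto simp: cut_def)
  then obtain C where C: "C \<in> cycs G" "C Int {e, e} = {e}"
   using indepD[OF simple_indep2[OF sim], of e e e] by auto
  then show False using cuts_even[OF C(1), of "{x}"] e by auto
 next
  assume "card (star x) = 2"
  then obtain e f where ef: "star x = {e, f}" "e ~= f" by (auto simp: card_2_iff)
  then have "e \<in> E" "f \<in> E" unfolding ground_edges by (auto simp: cut_def)
  then obtain C where C: "C \<in> cycs G" "e \<in> C" "f \<notin> C" using simple_separate[OF sim, of e f] ef by blast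
  then have "C Int star x = {e}" using ef by auto
  then show False using cuts_even[OF C(1), of "{x}"] by simp
 qed
qed

lemma cut_Int_V: "cut G (P Int V) = cut G P"
proof (rule set_eqI)
 fix e
 show "e \<in> cut G (P Int V) \<longleftrightarrow> e \<in> cut G P"
 proof (cases "e \<in> edges G")
  case True
  then obtain a b where ab: "ends G e = {a, b}" "a \<in> verts G" "b \<in> verts G" using ends_pair by blast
  have "a ~= b ==> a \<in> V \<and> b \<in> V" using mem_star[OF True ab(1)] ab by (auto simp: V_def)
  then show ?thesis using mem_cut_pair[OF True ab(1)] by auto
 next
  case False then show ?thesis by (auto simp: cut_def)
 qed
qed

lemma cuts_image: "cuts G = cut G ` Pow (V - {x0})"
proof (intro equalityI subsetI)
 fix D assume "D \<in> cuts G"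
 then obtain P where P: "D = cut G P" by (auto simp: cuts_def)
 show "D \<in> cut G ` Pow (V - {x0})"
 proof (cases "x0 \<in> P")
  case True
  have "cut G ((verts G - P) Int V) = D" using cut_Int_V cut_compl P by simp
  then show ?thesis using True by (intro image_eqI[of _ _ "(verts G - P) Int V"]) auto
 next
  case False
  then show ?thesis using cut_Int_V[of P] P by (intro image_eqI[of _ _ "P Int V"]) auto
 qed
qed (auto simp: cuts_def)

lemma card_cuts_cycs: "card (cuts G) * 2 ^ rk E = 2 ^ card E"
 using card_perp[OF finite_edges subspace_cuts] card_space by (simp add: cycs_def ground_edges)

text \<open>Up to complement a cut is given by vertices other than x0, so there are at most 2 to the
  power \<open>card V - 1\<close> cuts; compare with \<open>card_cuts_cycs\<close>.\<close>

lemma card_ground_le: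
 assumes "V ~= {}" shows "card E + 1 \<le> rk E + card V"
proof -
 obtain x0 where x0: "x0 \<in> V" using assms by auto
 have "card (cuts G) \<le> card (Pow (V - {x0}))" unfolding cuts_image[of x0]
  by (rule card_image_le) (use finite_V in simp)
 also have "\<dots> = 2 ^ (card V - 1)" using x0 finite_V by (simp add: card_Pow)
 finally have "card (cuts G) * 2 ^ rk E \<le> 2 ^ (card V - 1) * 2 ^ rk E" by (rule mult_right_mono) simp
 then have "(2::nat) ^ card E \<le> 2 ^ (card V - 1 + rk E)" using card_cuts_cycs by (simp add: power_add)
 then have "card E \<le> card V - 1 + rk E" by simp
 moreover have "card V > 0" using assms finite_V by (simp add: card_gt_0_iff)
 ultimately show ?thesis by linarith
qed

lemma V_empty: "V = {} ==> card E = rk E"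
proof -
 assume "V = {}"
 then have "cuts G = {cut G {}}" using cuts_image[of 0] by simp
 then show ?thesis using card_cuts_cycs by simp
qed

lemma star_sum_ge: "simple_matroid M ==> 3 * card V \<le> 2 * card {e \<in> E. card (ends G e) = 2}"
proof -
 assume sim: "simple_matroid M"
 have "(\<Sum>x\<in>V. 3) \<le> (\<Sum>x\<in>V. card (star x Int edges G))"
 proof (rule sum_mono)
  fix x assume "x \<in> V"
  moreover have "star x Int edges G = star x" by (auto simp: cut_def)
  ultimately show "3 \<le> card (star x Int edges G)" using star_ge3[OF sim] by simp
 qed
 then show ?thesis using star_sum[of "edges G"] by (simp add: ground_edges)
qed

text \<open>Eliminate \<open>card V\<close> from 3 card V \<le> 2 card E and card E + 1 \<le> rk E +
  card V. If \<open>V\<close> is empty, all edges are loops and M is free. This bound excludes M(K5)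
  and the Fano plane.\<close>

lemma card_le_rank: "simple_matroid M ==> card E = rk E \<or> card E + 3 \<le> 3 * rk E"
proof -
 assume sim: "simple_matroid M"
 have "card {e \<in> E. card (ends G e) = 2} \<le> card E" using finite_ground by (intro card_mono) auto
 then show ?thesis using star_sum_ge[OF sim] card_ground_le V_empty by linarith
qed

text \<open>Twelve elements of rank five force a cubic graph on eight vertices, which has no room for
  three edge-disjoint triangles.\<close>

lemma no_three_triangles:
 assumes sim: "simple_matroid M" and n: "card E = 12" and r: "rk E \<le> 5"
  and D: "D1 \<in> cycs G" "D2 \<in> cycs G" "D3 \<in> cycs G" "card D1 = 3" "card D2 = 3" "card D3 = 3"
   "D1 Int D2 = {}" "D1 Int D3 = {}" "D2 Int D3 = {}"
 shows False
proof -
 let ?n2 = "card {e \<in> E. card (ends G e) = 2}"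
 have n2: "?n2 \<le> card E" using finite_ground by (intro card_mono) auto
 have "V ~= {}" using V_empty n r by auto
 \<comment> \<open>13 \<le> 5 + card V and 3 card V \<le> 2 * 12 leave only 8.\<close>
 then have v: "card V = 8" "?n2 = 12"
  using card_ground_le star_sum_ge[OF sim] n2 n r by linarith+
 have nl: "{e \<in> E. card (ends G e) = 2} = E" using v n finite_ground by (intro card_subset_eq) auto
 have c3: "card (star x) = 3" if x: "x \<in> V" for x
 proof (rule ccontr)
  assume "card (star x) ~= 3"
  then have gt: "card (star x) > 3" using star_ge3[OF sim x] by simp
  have "(\<Sum>x\<in>V. 3) < (\<Sum>x\<in>V. card (star x))"
   by (rule sum_strict_mono_ex1) (use finite_V star_ge3[OF sim] x gt in auto)
  moreover have "star y Int edges G = star y" for y by (auto simp: cut_def)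
  ultimately show False using star_sum[of "edges G"] v ground_edges by simp
 qed
 \<comment> \<open>In a cubic graph a member of the cycle space has degree 0 or 2 at every vertex,
   so the six half-edges of D meet three vertices.\<close>
 have tv: "card {x \<in> V. star x Int D ~= {}} = 3" if D: "D \<in> cycs G" "card D = 3" for D
 proof -
  have DE: "D \<subseteq> edges G" using D cycs_subset by auto
  have "card (star x Int D) = (if star x Int D ~= {} then 2 else 0)" if x: "x \<in> V" for x
  proof -
   have "card (star x Int D) \<le> 3" using c3[OF x] finite_cut card_mono[of "star x" "star x Int D"] by auto
   moreover have "even (card (star x Int D))" using cuts_even[OF D(1), of "{x}"] by (simp add: Int_commute)
   moreover have "card (star x Int D) = 0 \<longleftrightarrow> star x Int D = {}" using finite_cut by simp
   ultimately show ?thesis by (cases "star x Int D = {}") (auto elim!: evenE)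
  qed
  then have "(\<Sum>x\<in>V. card (star x Int D)) = (\<Sum>x\<in>V. if star x Int D ~= {} then 2 else 0)" by (intro sum.cong) auto
  also have "\<dots> = 2 * card {x \<in> V. star x Int D ~= {}}"
   by (subst sum.inter_filter[symmetric]) (use finite_V in auto)
  finally have "2 * card {x \<in> V. star x Int D ~= {}} = 2 * card {e \<in> D. card (ends G e) = 2}"
   using star_sum[OF DE] by simp
  moreover have "{e \<in> D. card (ends G e) = 2} = D" using nl DE ground_edges by auto
  ultimately show ?thesis using D by simp
 qed
 \<comment> \<open>Two edges of each triangle at a common vertex would need degree 4. Three
   triangles thus occupy nine vertices, but there are only eight.\<close>
 have dis: "{x \<in> V. star x Int D ~= {}} Int {x \<in> V. star x Int D' ~= {}} = {}"
  if D: "D \<in> cycs G" "D' \<in> cycs G" "D Int D' = {}" for D D'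
 proof (rule ccontr)
  assume "\<not> ?thesis"
  then obtain x where x: "x \<in> V" "star x Int D ~= {}" "star x Int D' ~= {}" by auto
  have "even (card (star x Int D))" "even (card (star x Int D'))"
   using cuts_even[OF D(1), of "{x}"] cuts_even[OF D(2), of "{x}"] by (simp_all add: Int_commute)
  moreover have "card (star x Int D) ~= 0" "card (star x Int D') ~= 0" using x finite_cut by auto
  ultimately have "card (star x Int D) \<ge> 2" "card (star x Int D') \<ge> 2" by (auto elim!: evenE)
  moreover have "card (star x Int D) + card (star x Int D') = card ((star x Int D) Un (star x Int D'))"
   using D finite_cut by (intro card_Un_disjoint[symmetric]) auto
  moreover have "\<dots> \<le> card (star x)" using finite_cut by (intro card_mono) auto
  ultimately show False using c3[OF x(1)] by linarith
 qed
 let ?W = "\<lambda>D. {x \<in> V. star x Int D ~= {}}"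
 have "card (?W D1 Un ?W D2 Un ?W D3) = card (?W D1 Un ?W D2) + card (?W D3)"
  using dis[OF D(1,3)] dis[OF D(2,3)] D finite_V by (intro card_Un_disjoint) auto
 also have "card (?W D1 Un ?W D2) = card (?W D1) + card (?W D2)"
  using dis[OF D(1,2)] D finite_V by (intro card_Un_disjoint) auto
 finally have "card (?W D1 Un ?W D2 Un ?W D3) = 9" using tv D by simp
 moreover have "card (?W D1 Un ?W D2 Un ?W D3) \<le> card V" using finite_V by (intro card_mono) auto
 ultimately show False using v by simp
qed

end

subsection \<open>The Moebius function of the lattice of flats\<close>

context matroid
begin

abbreviation "mu X \<equiv> mobius (flats M) {} X"


lemma mu_empty [simp]: "mu {} = 1" by (simp add: mobius.simps)
lemma mu_sum:
 assumes "X \<in> flats M" "X ~= {}"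
 shows "(\<Sum>Z | Z \<in> flats M \<and> Z \<subseteq> X. mu Z) = 0"
proof -
 have "{} \<subset> X" using assms by auto
 then have "mu X = - (\<Sum>Z \<in> {Z \<in> flats M. {} \<subseteq> Z \<and> Z \<subset> X}. mu Z)"
  using assms finite_flats by (subst mobius.simps) simp
 moreover have "{Z. Z \<in> flats M \<and> Z \<subseteq> X} = insert X {Z \<in> flats M. {} \<subseteq> Z \<and> Z \<subset> X}" using assms by auto
 ultimately show ?thesis using finite_flats by simp
qed

text \<open>Identities for the Moebius function are proved below by checking sums over lower
  intervals only.\<close>

lemma mu_unique:
 assumes \<nu>: "\<And>X. X \<in> flats M ==> (\<Sum>Z | Z \<in> flats M \<and> Z \<subseteq> X. \<nu> Z) = (if X = {} then 1 else 0)"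
  and sim: "simple_matroid M" and X: "X \<in> flats M"
 shows "\<nu> X = mu X"
 using X
proof (induction "card X" arbitrary: X rule: less_induct)
 case less
 have eq: "{Z. Z \<in> flats M \<and> Z \<subseteq> X} = insert X {Z \<in> flats M. Z \<subset> X}" using less.prems by auto
 have fin: "finite {Z \<in> flats M. Z \<subset> X}" using finite_flats by auto
 have "(\<Sum>Z\<in>{Z \<in> flats M. Z \<subset> X}. \<nu> Z) = (\<Sum>Z\<in>{Z \<in> flats M. Z \<subset> X}. mu Z)"
  using less.hyps finite_flat[OF less.prems] by (intro sum.cong) (auto intro: psubset_card_mono)
 moreover have "(\<Sum>Z | Z \<in> flats M \<and> Z \<subseteq> X. mu Z) = (if X = {} then 1 else 0)"
 proof (cases "X = {}")
  case True
  then have "{Z. Z \<in> flats M \<and> Z \<subseteq> X} = {{}}" using less.prems by auto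
  then show ?thesis using True by simp
 next
  case False then show ?thesis using mu_sum[OF less.prems] by simp
 qed
 ultimately show ?case using \<nu>[OF less.prems] fin unfolding eq by simp
qed

lemma mu_restriction:
 assumes sim: "simple_matroid M" and F: "F \<in> flats M" and X: "X \<in> flats M" "X \<subseteq> F"
 shows "mobius (flats (restriction M F)) {} X = mu X"
proof -
 interpret N: matroid "restriction M F" by (rule restriction_matroid)
 have fl: "flats (restriction M F) = {X \<in> flats M. X \<subseteq> F}" by (rule flats_restriction[OF F])
 show ?thesis
 proof (rule sym, rule N.mu_unique)
  show "X \<in> flats (restriction M F)" using fl X by auto
  show "simple_matroid (restriction M F)" by (rule simple_restriction[OF sim])
  fix Y assume "Y \<in> flats (restriction M F)"
  then have Y: "Y \<in> flats M" "Y \<subseteq> F" using fl by auto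
  have "{Z. Z \<in> flats (restriction M F) \<and> Z \<subseteq> Y} = {Z. Z \<in> flats M \<and> Z \<subseteq> Y}" using fl Y by auto
  moreover have "{Z. Z \<in> flats M \<and> Z \<subseteq> {}} = {{}}" using simple_empty_flat[OF sim] by auto
  ultimately show "(\<Sum>Z | Z \<in> flats (restriction M F) \<and> Z \<subseteq> Y. mu Z) = (if Y = {} then 1 else 0)"
   using mu_sum[OF Y(1)] by (cases "Y = {}") simp_all
 qed
qed

lemma mu_point:
 assumes "simple_matroid M" "e \<in> E" shows "mu {e} = -1"
proof -
 have "{Z. Z \<in> flats M \<and> Z \<subseteq> {e}} = {{}, {e}}"
  using simple_empty_flat[OF assms(1)] simple_point_flat[OF assms] by auto
 then show ?thesis using mu_sum[OF simple_point_flat[OF assms]] by simp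
qed

text \<open>The join \<open>(G, Y) \<mapsto> G \<or> Y\<close> identifies the lattice with pairs of a flat inside \<open>X\<close> and a flat
  disjoint from \<open>X\<close>, up to fibres over which the Moebius function is multiplicative; this is
  Stanley's factorization for a modular flat \<open>X\<close>.\<close>

context
 fixes X
 assumes sim: "simple_matroid M" and X: "X \<in> flats M"
  and skew: "\<And>Y I J. Y \<in> flats M ==> Y Int X = {} ==> I \<subseteq> X ==> I \<in> indep M ==>
    J \<subseteq> Y ==> J \<in> indep M ==> I Un J \<in> indep M"
begin

lemma skew_rank:
 assumes A: "A \<subseteq> X" and Y: "Y \<in> flats M" "Y Int X = {}"
 shows "rk (A Un Y) = rk A + rk Y"
proof -
 obtain I where I: "I \<in> indep M" "I \<subseteq> A" "card I = rk A" using mrank_obtain .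
 obtain J where J: "J \<in> indep M" "J \<subseteq> Y" "card J = rk Y" using mrank_obtain .
 have "I Un J \<in> indep M" using skew[OF Y _ I(1) J(2,1)] I A by auto
 then have "card (I Un J) \<le> rk (A Un Y)" using I J by (intro card_le_mrank) auto
 moreover have "card (I Un J) = card I + card J"
  using I J Y A finite_indep by (intro card_Un_disjoint) auto
 ultimately show ?thesis using I J mrank_submod[of A Y] by simp
qed

definition disj where "disj = {Y \<in> flats M. Y Int X = {}}"
definition below where "below = {G \<in> flats M. G \<subseteq> X}"

lemma fin_db: "finite disj" "finite below" using finite_flats by (auto simp: disj_def below_def)

lemma join_props:
 assumes "G \<in> below" "Y \<in> disj"
 shows "cl (G Un Y) \<in> flats M" "rk (cl (G Un Y)) = rk G + rk Y" "cl (G Un Y) Int X = G" "G Un Y \<subseteq> cl (G Un Y)"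
proof -
 have G: "G \<in> flats M" "G \<subseteq> X" and Y: "Y \<in> flats M" "Y Int X = {}" using assms by (auto simp: below_def disj_def)
 have GY: "G Un Y \<subseteq> E" using flat_subset G Y by auto
 show 1: "cl (G Un Y) \<in> flats M" by (rule cl_flat[OF GY])
 show 2: "rk (cl (G Un Y)) = rk G + rk Y" using mrank_cl[OF GY] skew_rank[OF G(2) Y] by simp
 show 3: "G Un Y \<subseteq> cl (G Un Y)" by (rule subset_cl[OF GY])
 show "cl (G Un Y) Int X = G"
 proof (rule ccontr)
  assume "cl (G Un Y) Int X ~= G"
  then obtain x where x: "x \<in> cl (G Un Y)" "x \<in> X" "x \<notin> G" using 3 G by auto
  have xE: "x \<in> E" using x X flat_subset by auto
  have "rk (insert x G Un Y) = rk (insert x G) + rk Y" by (rule skew_rank) (use x G Y in auto)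
  moreover have "rk (insert x G) = rk G + 1" by (rule flat_insert_rank[OF G(1) xE x(3)])
  moreover have "rk (insert x (G Un Y)) = rk (G Un Y)" using x xE mem_cl by simp
  ultimately show False using skew_rank[OF G(2) Y] by simp
 qed
qed

text \<open>By \<open>mu_unique\<close> it suffices to sum over all flats below F. The pairs whose
  join lies below F form a product, and its factor over the flats below the meet of F and X vanishes
  unless F is disjoint from X.\<close>

lemma mu_skew:
 assumes F: "F \<in> flats M"
 shows "(\<Sum>p\<in>{p \<in> below \<times> disj. cl (fst p Un snd p) = F}. mu (fst p) * mu (snd p)) = mu F"
proof (rule mu_unique[OF _ sim F])
 fix F assume F: "F \<in> flats M"
 let ?h = "\<lambda>p. mu (fst p) * mu (snd p)"
 let ?c = "\<lambda>p. cl (fst p Un snd p)"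
 let ?B = "{G \<in> flats M. G \<subseteq> F Int X}" let ?D = "{Y \<in> disj. Y \<subseteq> F}"
 have FX: "F Int X \<in> flats M" using flat_Int F X by auto
 have cF: "?c p \<subseteq> F \<longleftrightarrow> fst p \<subseteq> F \<and> snd p \<subseteq> F" if "p \<in> below \<times> disj" for p
 proof
  assume "?c p \<subseteq> F"
  moreover have "fst p Un snd p \<subseteq> ?c p" using join_props(4)[of "fst p" "snd p"] that by auto
  ultimately show "fst p \<subseteq> F \<and> snd p \<subseteq> F" by blast
 next
  assume "fst p \<subseteq> F \<and> snd p \<subseteq> F"
  then show "?c p \<subseteq> F" by (intro cl_minimal[OF F]) auto
 qed
 have eq: "{p \<in> below \<times> disj. ?c p \<subseteq> F} = ?B \<times> ?D"
 proof (rule set_eqI)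
  fix p
  show "p \<in> {p \<in> below \<times> disj. ?c p \<subseteq> F} \<longleftrightarrow> p \<in> ?B \<times> ?D"
  proof (cases "p \<in> below \<times> disj")
   case True then show ?thesis using cF[OF True] by (auto simp: below_def mem_Times_iff)
  next
   case False then show ?thesis by (auto simp: below_def mem_Times_iff)
  qed
 qed
 have "(\<Sum>Z | Z \<in> flats M \<and> Z \<subseteq> F. \<Sum>p\<in>{p \<in> below \<times> disj. ?c p = Z}. ?h p)
   = (\<Sum>Z | Z \<in> flats M \<and> Z \<subseteq> F. \<Sum>p\<in>{p \<in> ?B \<times> ?D. ?c p = Z}. ?h p)"
 proof (rule sum.cong[OF refl])
  fix Z assume "Z \<in> {Z. Z \<in> flats M \<and> Z \<subseteq> F}"
  then have "{p \<in> below \<times> disj. ?c p = Z} = {p \<in> {p \<in> below \<times> disj. ?c p \<subseteq> F}. ?c p = Z}" by auto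
  then show "(\<Sum>p\<in>{p \<in> below \<times> disj. ?c p = Z}. ?h p) = (\<Sum>p\<in>{p \<in> ?B \<times> ?D. ?c p = Z}. ?h p)"
   unfolding eq by simp
 qed
 also have "\<dots> = sum ?h (?B \<times> ?D)"
 proof (rule sum.group)
  show "?c ` (?B \<times> ?D) \<subseteq> {Z. Z \<in> flats M \<and> Z \<subseteq> F}"
  proof (intro image_subsetI)
   fix p assume "p \<in> ?B \<times> ?D"
   then have "p \<in> {p \<in> below \<times> disj. ?c p \<subseteq> F}" unfolding eq .
   then have p: "p \<in> below \<times> disj" "?c p \<subseteq> F" by simp_all
   then have "?c p \<in> flats M" using join_props(1)[of "fst p" "snd p"] by auto
   then show "?c p \<in> {Z. Z \<in> flats M \<and> Z \<subseteq> F}" using p by auto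
  qed
 qed (use finite_flats fin_db in auto)
 also have "\<dots> = (\<Sum>G\<in>?B. mu G) * (\<Sum>Y\<in>?D. mu Y)"
  by (simp add: sum_product sum.cartesian_product case_prod_beta)
 also have "\<dots> = (if F = {} then 1 else 0)"
 proof (cases "F Int X = {}")
  case False
  then show ?thesis using mu_sum[OF FX] by auto
 next
  case True
  have B: "?B = {{}}" unfolding True using simple_empty_flat[OF sim] by auto
  have D: "?D = {Y. Y \<in> flats M \<and> Y \<subseteq> F}" using True by (auto simp: disj_def)
  have "F = {} ==> {Y. Y \<in> flats M \<and> Y \<subseteq> F} = {{}}" using simple_empty_flat[OF sim] by auto
  then show ?thesis using B D mu_sum[OF F] by (cases "F = {}") simp_all
 qed
 finally show "(\<Sum>Z | Z \<in> flats M \<and> Z \<subseteq> F. \<Sum>p\<in>{p \<in> below \<times> disj. ?c p = Z}. ?h p) = (if F = {} then 1 else 0)" .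
qed

text \<open>Group the pairs of \<open>mu_skew\<close> by their join. Ranks add by
  \<open>join_props\<close>, so every monomial splits into a product.\<close>

lemma characteristic_poly_skew:
 "characteristic_poly M = characteristic_poly (restriction M X) *
   (\<Sum>Y\<in>{Y \<in> flats M. Y Int X = {}}. monom (mu Y) (rk E - rk X - rk Y))"
proof -
 let ?h = "\<lambda>p. mu (fst p) * mu (snd p)"
 let ?c = "\<lambda>p. cl (fst p Un snd p)"
 have XE: "X \<subseteq> E" using X flat_subset by auto
 have "characteristic_poly M = (\<Sum>F\<in>flats M. \<Sum>p\<in>{p \<in> below \<times> disj. ?c p = F}. monom (?h p) (rk E - rk (?c p)))"
  unfolding characteristic_poly_def
 proof (rule sum.cong[OF refl])
  fix F assume "F \<in> flats M"
  then have "monom (mu F) (rk E - rk F) =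
    monom (\<Sum>p\<in>{p \<in> below \<times> disj. ?c p = F}. ?h p) (rk E - rk F)" using mu_skew by simp
  also have "\<dots> = (\<Sum>p\<in>{p \<in> below \<times> disj. ?c p = F}. monom (?h p) (rk E - rk F))"
   by (rule poly_eqI) (simp add: coeff_sum coeff_monom)
  also have "\<dots> = (\<Sum>p\<in>{p \<in> below \<times> disj. ?c p = F}. monom (?h p) (rk E - rk (?c p)))"
   by (rule sum.cong) auto
  finally show "monom (mu F) (rk E - rk F) = (\<Sum>p\<in>{p \<in> below \<times> disj. ?c p = F}. monom (?h p) (rk E - rk (?c p)))" .
 qed
 also have "\<dots> = (\<Sum>p\<in>below \<times> disj. monom (?h p) (rk E - rk (?c p)))"
  by (rule sum.group) (use finite_flats fin_db join_props(1) in auto)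
 also have "\<dots> = (\<Sum>p\<in>below \<times> disj. monom (mu (fst p)) (rk X - rk (fst p)) * monom (mu (snd p)) (rk E - rk X - rk (snd p)))"
 proof (rule sum.cong[OF refl])
  fix p assume "p \<in> below \<times> disj"
  then have p: "fst p \<in> below" "snd p \<in> disj" by auto
  have "rk (fst p) \<le> rk X" using p by (intro mrank_mono) (auto simp: below_def)
  moreover have "rk (X Un snd p) = rk X + rk (snd p)" using skew_rank[of X "snd p"] p by (auto simp: disj_def)
  moreover have "rk (X Un snd p) \<le> rk E" using p XE flat_subset by (intro mrank_mono) (auto simp: disj_def)
  ultimately have "rk E - rk (?c p) = (rk X - rk (fst p)) + (rk E - rk X - rk (snd p))"
   using join_props(2)[OF p] by simp
  then show "monom (?h p) (rk E - rk (?c p)) = monom (mu (fst p)) (rk X - rk (fst p)) * monom (mu (snd p)) (rk E - rk X - rk (snd p))"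
   by (simp add: mult_monom)
 qed
 also have "\<dots> = (\<Sum>G\<in>below. monom (mu G) (rk X - rk G)) * (\<Sum>Y\<in>disj. monom (mu Y) (rk E - rk X - rk Y))"
  by (simp add: sum_product sum.cartesian_product case_prod_beta)
 also have "(\<Sum>G\<in>below. monom (mu G) (rk X - rk G)) = characteristic_poly (restriction M X)"
 proof -
  have "ground (restriction M X) = X" using ground_restriction[OF XE] .
  moreover have "flats (restriction M X) = below" using flats_restriction[OF X] by (simp add: below_def)
  ultimately show ?thesis unfolding characteristic_poly_def
   by (intro sum.cong) (auto simp: mrank_restriction mu_restriction[OF sim X, unfolded flats_restriction[OF X]] below_def)
 qed
 finally show ?thesis by (simp add: disj_def)
qed

end

text \<open>A line cannot avoid a modular hyperplane, so only the empty set and the points outside X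
  are disjoint from X. In the second factor of \<open>characteristic_poly_skew\<close> the empty set
  gives the variable and each point the constant -1.\<close>

lemma characteristic_poly_mhstep:
 assumes sim: "simple_matroid M" and st: "mhstep (flats M) X E"
 shows "characteristic_poly M = characteristic_poly (restriction M X) * [:- int (card (E - X)), 1:]"
proof -
 have X: "X \<in> flats M" "X \<subset> E" using st by (auto simp: mhstep_def)
 have r: "rk E = rk X + 1" by (rule mhstep_rank[OF st sim])
 have Y01: "Y = {} \<or> (\<exists>e\<in>E - X. Y = {e})" if Y: "Y \<in> flats M" "Y Int X = {}" for Y
 proof (rule ccontr)
  assume no: "\<not> ?thesis"
  have YE: "Y \<subseteq> E - X" using Y flat_subset by auto
  obtain e where e: "e \<in> Y" using no by auto
  then obtain f where f: "f \<in> Y" "f ~= e" using no YE by blast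
  obtain g where "g \<in> X" "\<forall>F\<in>flats M. e \<in> F --> f \<in> F --> g \<in> F"
   using mhstepD[OF st, of e f] e f YE by auto
  then show False using Y e f by auto
 qed
 have skew: "I Un J \<in> indep M" if *: "Y \<in> flats M" "Y Int X = {}" "I \<subseteq> X" "I \<in> indep M" "J \<subseteq> Y" "J \<in> indep M" for Y I J
 proof (cases "J = {}")
  case False
  then obtain e where e: "J = {e}" "e \<in> E" "e \<notin> X" using Y01[OF *(1,2)] *(5) by auto
  have "rk (insert e I Un X) + rk (insert e I Int X) \<le> rk (insert e I) + rk X" by (rule mrank_submod)
  moreover have "insert e I Un X = insert e X" "insert e I Int X = I" using * e by auto
  moreover have "rk (insert e X) = rk X + 1" by (rule flat_insert_rank[OF X(1) e(2,3)])
  moreover have "rk I = card I" using indep_iff_mrank *(4) indep_subset by blast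
  ultimately have "card (insert e I) \<le> rk (insert e I)" using finite_indep[OF *(4)] by (simp add: card_insert_if)
  moreover have "rk (insert e I) \<le> card (insert e I)" using finite_indep[OF *(4)] by (intro mrank_le_card) simp
  ultimately have "insert e I \<in> indep M" using indep_iff_mrank[of "insert e I"] e indep_subset[OF *(4)] by auto
  then show ?thesis using e by simp
 qed (use * in simp)
 have D: "{Y \<in> flats M. Y Int X = {}} = insert {} ((\<lambda>e. {e}) ` (E - X))"
  using Y01 simple_empty_flat[OF sim] simple_point_flat[OF sim] by blast
 have fin: "finite (E - X)" using finite_ground by auto
 have "(\<Sum>Y\<in>{Y \<in> flats M. Y Int X = {}}. monom (mu Y) (rk E - rk X - rk Y))
   = monom 1 1 + (\<Sum>Y\<in>(\<lambda>e. {e}) ` (E - X). monom (mu Y) (rk E - rk X - rk Y))"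
  unfolding D using fin r by (subst sum.insert) auto
 also have "(\<Sum>Y\<in>(\<lambda>e. {e}) ` (E - X). monom (mu Y) (rk E - rk X - rk Y))
   = (\<Sum>e\<in>E - X. monom (mu {e}) (rk E - rk X - rk {e}))"
  by (subst sum.reindex) (auto simp: inj_on_def)
 also have "\<dots> = (\<Sum>e\<in>E - X. [:-1:])"
  by (rule sum.cong) (use r in \<open>auto simp: mu_point[OF sim] simple_rank1[OF sim] monom_0\<close>)
 also have "\<dots> = [:- int (card (E - X)):]"
  by (simp add: of_nat_poly)
 finally show ?thesis
  using characteristic_poly_skew[OF sim X(1) skew] by (simp add: monom_Suc monom_0 one_pCons)
qed

lemma mhstep_restriction:
 assumes st: "mhstep (flats M) X Y" shows "mhstep (flats (restriction M Y)) X Y"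
proof -
 have Y: "Y \<in> flats M" using st by (simp add: mhstep_def)
 show ?thesis unfolding mhstep_def flats_restriction[OF Y]
 proof (intro conjI ballI impI)
  fix e f assume ef: "e \<in> Y - X" "f \<in> Y - X" "e ~= f"
  then obtain g where g: "g \<in> X" "\<forall>F\<in>flats M. e \<in> F --> f \<in> F --> g \<in> F" using mhstepD[OF st, of e f] by auto
  show "\<exists>g\<in>X. \<forall>F\<in>{X \<in> flats M. X \<subseteq> Y}. e \<in> F --> f \<in> F --> g \<in> F"
   by (rule bexI[OF _ g(1)]) (use g(2) in auto)
 qed (use st in \<open>auto simp: mhstep_def\<close>)
qed

lemma chain_characteristic_poly:
 assumes sim: "simple_matroid M" and ch: "(mhstep (flats M))\<^sup>*\<^sup>* {} Y"
 shows "\<exists>as. characteristic_poly (restriction M Y) = (\<Prod>a\<leftarrow>as. [:- a, 1:])"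
 using ch
proof (induction rule: rtranclp_induct)
 case base
 have e: "{} \<in> flats M" by (rule simple_empty_flat[OF sim])
 have "flats (restriction M {}) = {{}}" using flats_restriction[OF e] e by auto
 then have "characteristic_poly (restriction M {}) = 1"
  by (simp add: characteristic_poly_def mrank_restriction mobius.simps restriction_def[of M "{}"])
 then show ?case by (intro exI[of _ "[]"]) simp
next
 case (step X Y)
 then obtain as where as: "characteristic_poly (restriction M X) = (\<Prod>a\<leftarrow>as. [:- a, 1:])" by auto
 have XY: "X \<subset> Y" "Y \<in> flats M" using step(2) by (auto simp: mhstep_def)
 interpret N: matroid "restriction M Y" by (rule restriction_matroid)
 have g: "N.E = Y" using ground_restriction flat_subset XY by auto
 have "restriction (restriction M Y) X = restriction M X"
  using XY by (auto simp: restriction_def intro!: pre_matroid.equality)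
 moreover have "characteristic_poly (restriction M Y) =
   characteristic_poly (restriction (restriction M Y) X) * [:- int (card (N.E - X)), 1:]"
  by (rule N.characteristic_poly_mhstep[OF simple_restriction[OF sim]])
   (use mhstep_restriction[OF step(2)] g in simp)
 ultimately have "characteristic_poly (restriction M Y) = (\<Prod>a\<leftarrow>int (card (N.E - X)) # as. [:- a, 1:])"
  using as by (simp add: mult.commute)
 then show ?case by blast
qed

lemma restriction_ground: "restriction M E = M"
 using indep_subset by (auto simp: restriction_def intro!: pre_matroid.equality)

end

lemma map_poly_of_int_mult:
 "map_poly of_int (p * q) = (map_poly of_int p :: complex poly) * map_poly of_int q"
 by (rule poly_eqI) (simp add: coeff_map_poly coeff_mult)

lemma all_roots_integers_prod: "all_roots_integers (\<Prod>a\<leftarrow>as. [:- a, 1:])"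
 unfolding all_roots_integers_def
proof (intro allI impI)
 fix z :: complex
 show "poly (map_poly of_int (\<Prod>a\<leftarrow>as. [:- a, 1:])) z = 0 ==> z \<in> \<int>"
 proof (induction as)
  case (Cons a as)
  have "poly (map_poly of_int [:- a, 1:] :: complex poly) z = 0 \<or> poly (map_poly of_int (\<Prod>a\<leftarrow>as. [:- a, 1:])) z = 0"
   using Cons.prems unfolding list.map prod_list.Cons map_poly_of_int_mult by simp
  then show ?case
  proof
   assume "poly (map_poly of_int [:- a, 1:] :: complex poly) z = 0"
   then have "z = of_int a" by (simp add: map_poly_pCons)
   then show ?thesis by simp
  qed (rule Cons.IH)
 qed simp
qed

lemma all_roots_integers_factor:
 assumes "all_roots_integers (p * q)" shows "all_roots_integers p"
using assms unfolding all_roots_integers_def map_poly_of_int_mult by simp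

lemma all_roots_integers_linear_factors:
 assumes "all_roots_integers p" "lead_coeff p = 1"
 shows "\<exists>as. p = (\<Prod>a\<leftarrow>as. [:- a, 1:]) \<and> length as = degree p"
 using assms
proof (induction "degree p" arbitrary: p)
 case 0
 then have "p = 1" by (metis degree_0_id of_int_1 of_int_poly one_pCons)
 then show ?case by (intro exI[of _ "[]"]) simp
next
 case (Suc n)
 have dg: "degree (map_poly of_int p :: complex poly) = degree p" by (rule degree_map_poly) simp
 then have "\<not> constant (poly (map_poly of_int p :: complex poly))" using Suc.hyps(2) by (simp add: constant_degree)
 then obtain z :: complex where z: "poly (map_poly of_int p) z = 0" using fundamental_theorem_of_algebra by blast
 then obtain a where a: "z = of_int a" using Suc.prems unfolding all_roots_integers_def by (metis Ints_cases)
 have "poly (map_poly of_int p) (of_int a :: complex) = of_int (poly p a)"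
  by (simp add: poly_altdef dg coeff_map_poly)
 then have "poly p a = 0" using z a by simp
 then obtain q where q: "p = [:- a, 1:] * q" by (metis dvdE poly_eq_0_iff_dvd)
 have q0: "q ~= 0" using q Suc.prems by auto
 have "degree p = degree [:- a, 1:] + degree q" unfolding q by (rule degree_mult_eq) (use q0 in auto)
 then have d: "degree p = Suc (degree q)" by simp
 have l: "lead_coeff q = 1" using Suc.prems(2) unfolding q lead_coeff_mult by simp
 have "all_roots_integers q" using all_roots_integers_factor[of q "[:- a, 1:]"] Suc.prems(1) q by (simp add: mult.commute)
 then obtain as where "q = (\<Prod>a\<leftarrow>as. [:- a, 1:]) \<and> length as = degree q" using Suc.hyps(1)[of q] Suc.hyps(2) d l by auto
 then show ?case using q d by (intro exI[of _ "a # as"]) simp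
qed

subsection \<open>Rank functions: deletion and contraction\<close>

lemma sum_Pow_insert:
 assumes "finite U" "e \<notin> U"
 shows "sum f (Pow (insert e U)) = sum f (Pow U) + (\<Sum>A\<in>Pow U. f (insert e A))"
proof -
 have inj: "inj_on (insert e) (Pow U)" using assms by (auto simp: inj_on_def insert_ident)
 have "sum f (Pow (insert e U)) = sum f (Pow U Un insert e ` Pow U)" by (simp add: Pow_insert)
 also have "\<dots> = sum f (Pow U) + sum f (insert e ` Pow U)"
  by (rule sum.union_disjoint) (use assms in auto)
 also have "sum f (insert e ` Pow U) = (\<Sum>A\<in>Pow U. f (insert e A))"
  using inj by (simp add: sum.reindex)
 finally show ?thesis .
qed

definition sg :: "'a set => int" where "sg A = (-1) ^ card A"

lemma sg_insert: "finite U ==> A \<subseteq> U ==> e \<notin> U ==> sg (insert e A) = - sg A"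
 using finite_subset[of A U] by (auto simp: sg_def card_insert_if)

lemma sum_sg: "finite U ==> (\<Sum>A\<in>Pow U. sg A) = (if U = {} then 1 else 0)"
proof (cases "U = {}")
 case False
 assume fin: "finite U"
 obtain e where e: "e \<in> U" using False by auto
 then have U: "U = insert e (U - {e})" by auto
 have f: "finite (U - {e})" using fin by auto
 have "(\<Sum>A\<in>Pow (insert e (U - {e})). sg A) = 0"
 proof -
  have "sg (insert e A) = - sg A" if "A \<in> Pow (U - {e})" for A
   using sg_insert[OF f, of A e] that by auto
  then have "(\<Sum>A\<in>Pow (U - {e}). sg (insert e A)) = - (\<Sum>A\<in>Pow (U - {e}). sg A)"
   by (simp add: sum_negf[symmetric])
  then show ?thesis by (subst sum_Pow_insert[OF f]) auto
 qed
 then show ?thesis using U False by simp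
qed (simp add: sg_def)

text \<open>Rank functions of matroids, loops allowed, as plain functions: deletion shrinks U and
  contraction is \<open>con\<close>, so the inductions below need no construction of minors.\<close>

definition rankfun :: "'a set => ('a set => nat) => bool" where
 "rankfun U \<rho> \<longleftrightarrow> finite U \<and> \<rho> {} = 0 \<and>
   (\<forall>A x. A \<subseteq> U --> x \<in> U --> \<rho> A \<le> \<rho> (insert x A) \<and> \<rho> (insert x A) \<le> \<rho> A + 1) \<and>
   (\<forall>A B. A \<subseteq> U --> B \<subseteq> U --> \<rho> (A Un B) + \<rho> (A Int B) \<le> \<rho> A + \<rho> B)"

text \<open>The subtraction does not truncate for a rank function, by monotonicity.\<close>

definition con :: "'a => ('a set => nat) => 'a set => nat" where
 "con e \<rho> A = \<rho> (insert e A) - \<rho> {e}"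

lemma rankfun_insert:
 "rankfun U \<rho> ==> A \<subseteq> U ==> x \<in> U ==> \<rho> A \<le> \<rho> (insert x A) \<and> \<rho> (insert x A) \<le> \<rho> A + 1"
 unfolding rankfun_def by simp

lemma rankfun_submod:
 "rankfun U \<rho> ==> A \<subseteq> U ==> B \<subseteq> U ==> \<rho> (A Un B) + \<rho> (A Int B) \<le> \<rho> A + \<rho> B"
 unfolding rankfun_def by simp

lemma rankfun_mono: "rankfun U \<rho> ==> A \<subseteq> B ==> B \<subseteq> U ==> \<rho> A \<le> \<rho> B"
proof -
 assume r: "rankfun U \<rho>" and AB: "A \<subseteq> B" "B \<subseteq> U"
 have "finite U" using r by (simp add: rankfun_def)
 then have "finite B" by (rule finite_subset[OF AB(2)])
 then have "finite (B - A)" by simp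
 moreover have "\<rho> A \<le> \<rho> (A Un Z)" if "finite Z" "Z \<subseteq> B" for Z
  using that
 proof (induction Z)
  case (insert z Z)
  have "\<rho> (A Un Z) \<le> \<rho> (insert z (A Un Z))" using rankfun_insert[OF r, of "A Un Z" z] insert AB by auto
  then show ?case using insert by simp
 qed simp
 moreover have "A Un (B - A) = B" using AB by auto
 ultimately show ?thesis by (metis Diff_subset)
qed

lemma rankfun_subset: "rankfun U \<rho> ==> U' \<subseteq> U ==> rankfun U' \<rho>"
 unfolding rankfun_def by (simp add: finite_subset subset_iff)

lemma rankfun_con:
 assumes r: "rankfun (insert e U) \<rho>" shows "rankfun U (con e \<rho>)"
proof -
 have ge: "\<rho> {e} \<le> \<rho> (insert e A)" if "A \<subseteq> U" for A using rankfun_mono[OF r, of "{e}" "insert e A"] that by auto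
 show ?thesis unfolding rankfun_def
 proof (intro conjI allI impI)
  show "finite U" using r by (simp add: rankfun_def)
  fix A B assume AB: "A \<subseteq> U" "B \<subseteq> U"
  have "\<rho> (insert e A Un insert e B) + \<rho> (insert e A Int insert e B) \<le> \<rho> (insert e A) + \<rho> (insert e B)"
   by (rule rankfun_submod[OF r]) (use AB in auto)
  moreover have "insert e A Un insert e B = insert e (A Un B)" "insert e A Int insert e B = insert e (A Int B)" by auto
  moreover have "\<rho> {e} \<le> \<rho> (insert e (A Int B))" "\<rho> {e} \<le> \<rho> (insert e (A Un B))"
   by (rule ge, use AB in auto)+
  ultimately show "con e \<rho> (A Un B) + con e \<rho> (A Int B) \<le> con e \<rho> A + con e \<rho> B"
   unfolding con_def using ge[OF AB(1)] ge[OF AB(2)] by simp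
 next
  fix A x assume "A \<subseteq> U" "x \<in> U"
  then have "\<rho> (insert e A) \<le> \<rho> (insert x (insert e A)) \<and> \<rho> (insert x (insert e A)) \<le> \<rho> (insert e A) + 1"
   using rankfun_insert[OF r, of "insert e A" x] by auto
  then show "con e \<rho> A \<le> con e \<rho> (insert x A)" "con e \<rho> (insert x A) \<le> con e \<rho> A + 1"
   using ge[of A] \<open>A \<subseteq> U\<close> unfolding con_def by (auto simp: insert_commute)
 qed (simp add: con_def)
qed

lemma rankfun_cases:
 assumes r: "rankfun (insert e U) \<rho>" "e \<notin> U"
 obtains (loop) "\<And>A. A \<subseteq> U ==> \<rho> (insert e A) = \<rho> A" "\<rho> {e} = 0"
 | (coloop) "\<And>A. A \<subseteq> U ==> \<rho> (insert e A) = \<rho> A + 1" "\<rho> {e} = 1"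
 | (proper) "\<rho> (insert e U) = \<rho> U" "\<And>A. A \<subseteq> U ==> \<rho> (insert e A) = con e \<rho> A + 1" "\<rho> {e} = 1"
proof -
 have 0: "\<rho> {} = 0" using r by (simp add: rankfun_def)
 have e1: "\<rho> {e} \<le> 1" using rankfun_insert[OF r(1), of "{}" e] 0 by simp
 show ?thesis
 proof (cases "\<rho> {e} = 0")
  case True
  have "\<rho> (insert e A) = \<rho> A" if "A \<subseteq> U" for A
  proof -
   have A: "A \<subseteq> insert e U" using that by auto
   then show ?thesis
    using rankfun_submod[OF r(1) A, of "{e}"] rankfun_insert[OF r(1) A, of e] True by simp
  qed
  then show ?thesis using loop True by blast
 next
  case False
  then have e: "\<rho> {e} = 1" using e1 by simp
  show ?thesis
  proof (cases "\<rho> (insert e U) = \<rho> U")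
   case True
   have "\<rho> (insert e A) = con e \<rho> A + 1" if "A \<subseteq> U" for A
   proof -
    have "\<rho> {e} \<le> \<rho> (insert e A)" by (rule rankfun_mono[OF r(1)]) (use that in auto)
    then show ?thesis using e by (simp add: con_def)
   qed
   then show ?thesis using proper True e by blast
  next
   case False
   then have U: "\<rho> (insert e U) = \<rho> U + 1" using rankfun_insert[OF r(1) subset_insertI, of e] by auto
   have "\<rho> (insert e A) = \<rho> A + 1" if A: "A \<subseteq> U" for A
   proof -
    have "\<rho> (insert e A Un U) + \<rho> (insert e A Int U) \<le> \<rho> (insert e A) + \<rho> U"
     by (rule rankfun_submod[OF r(1)]) (use A in auto)
    moreover have "insert e A Un U = insert e U" "insert e A Int U = A" using A r(2) by auto
    ultimately have "\<rho> (insert e A) \<ge> \<rho> A + 1" using U by simp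
    then show ?thesis using rankfun_insert[OF r(1), of A e] A by auto
   qed
   then show ?thesis using coloop e by blast
  qed
 qed
qed

text \<open>Whitney's subset expansion of the characteristic polynomial, evaluated at a
  (\<open>poly_characteristic\<close>).\<close>

definition chi :: "int => 'a set => ('a set => nat) => int" where
 "chi a U \<rho> = (\<Sum>A\<in>Pow U. sg A * a ^ (\<rho> U - \<rho> A))"

text \<open>Deletion and contraction: in the proper case \<open>chi\<close> is the value for the
  deletion minus that for the contraction, whose ranks differ by one, so the signed values add up. A
  coloop contributes the factor a - 1 and a loop gives 0. Strictness comes from the deletion,
  because a contraction may have loops. In a simple matroid this excludes roots a \<le> 0.\<close>

lemma chi_sign:
 assumes "finite U" "rankfun U \<rho>" "a \<le> 0"
 shows "(-1) ^ \<rho> U * chi a U \<rho> \<ge> 0 \<and> ((\<forall>x\<in>U. \<rho> {x} = 1) --> (-1) ^ \<rho> U * chi a U \<rho> > 0)"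
 using assms(1,2)
proof (induction U arbitrary: \<rho>)
 case empty
 then show ?case by (simp add: chi_def sg_def rankfun_def)
next
 case (insert e U)
 let ?R = "\<rho> (insert e U)"
 have del: "rankfun U \<rho>" using rankfun_subset[OF insert.prems] by auto
 have split: "chi a (insert e U) \<rho> = (\<Sum>A\<in>Pow U. sg A * (a ^ (?R - \<rho> A) - a ^ (?R - \<rho> (insert e A))))"
 proof -
  have "chi a (insert e U) \<rho> = (\<Sum>A\<in>Pow U. sg A * a ^ (?R - \<rho> A)) + (\<Sum>A\<in>Pow U. sg (insert e A) * a ^ (?R - \<rho> (insert e A)))"
   unfolding chi_def by (rule sum_Pow_insert[OF insert.hyps])
  also have "(\<Sum>A\<in>Pow U. sg (insert e A) * a ^ (?R - \<rho> (insert e A))) = (\<Sum>A\<in>Pow U. - (sg A * a ^ (?R - \<rho> (insert e A))))"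
   by (rule sum.cong) (use insert.hyps in \<open>auto simp: sg_insert\<close>)
  finally show ?thesis by (simp add: sum_negf sum_subtractf right_diff_distrib)
 qed
 show ?case
 proof (rule rankfun_cases[OF insert.prems insert.hyps(2)])
  assume l: "\<And>A. A \<subseteq> U ==> \<rho> (insert e A) = \<rho> A" "\<rho> {e} = 0"
  then have "chi a (insert e U) \<rho> = 0" unfolding split by (intro sum.neutral) auto
  then show ?thesis using l(2) by auto
 next
  assume c: "\<And>A. A \<subseteq> U ==> \<rho> (insert e A) = \<rho> A + 1" "\<rho> {e} = 1"
  have "chi a (insert e U) \<rho> = (\<Sum>A\<in>Pow U. (a - 1) * (sg A * a ^ (\<rho> U - \<rho> A)))"
   unfolding split
  proof (rule sum.cong[OF refl])
   fix A assume "A \<in> Pow U"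
   then have A: "A \<subseteq> U" by simp
   have "\<rho> A \<le> \<rho> U" by (rule rankfun_mono[OF del A order_refl])
   then have "?R - \<rho> A = Suc (\<rho> U - \<rho> A)" "?R - \<rho> (insert e A) = \<rho> U - \<rho> A"
    using c(1)[OF A] c(1)[of U] by simp_all
   then show "sg A * (a ^ (?R - \<rho> A) - a ^ (?R - \<rho> (insert e A))) = (a - 1) * (sg A * a ^ (\<rho> U - \<rho> A))"
    by (simp add: algebra_simps)
  qed
  then have hC: "chi a (insert e U) \<rho> = (a - 1) * chi a U \<rho>" unfolding chi_def by (simp add: sum_distrib_left)
  have hX: "(-1) ^ ?R = (- ((-1) ^ \<rho> U) :: int)" using c(1)[of U] by simp
  have "(-1) ^ ?R * chi a (insert e U) \<rho> = (1 - a) * ((-1) ^ \<rho> U * chi a U \<rho>)"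
   unfolding hC hX by (simp add: algebra_simps)
  then show ?thesis using insert.IH[OF del] assms(3) by (auto simp: zero_less_mult_iff zero_le_mult_iff)
 next
  assume p: "\<rho> (insert e U) = \<rho> U" "\<And>A. A \<subseteq> U ==> \<rho> (insert e A) = con e \<rho> A + 1" "\<rho> {e} = 1"
  have con: "rankfun U (con e \<rho>)" by (rule rankfun_con[OF insert.prems])
  have RU: "?R = con e \<rho> U + 1" using p(2)[of U] by simp
  have "chi a (insert e U) \<rho> = chi a U \<rho> - chi a U (con e \<rho>)"
   unfolding split unfolding chi_def sum_subtractf[symmetric]
  proof (rule sum.cong[OF refl])
   fix A assume "A \<in> Pow U"
   then have "\<rho> (insert e A) = con e \<rho> A + 1" using p(2) by auto
   then have "?R - \<rho> (insert e A) = con e \<rho> U - con e \<rho> A" "?R - \<rho> A = \<rho> U - \<rho> A"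
    using RU p(1) by simp_all
   then show "sg A * (a ^ (?R - \<rho> A) - a ^ (?R - \<rho> (insert e A))) =
     sg A * a ^ (\<rho> U - \<rho> A) - sg A * a ^ (con e \<rho> U - con e \<rho> A)"
    by (simp only: right_diff_distrib)
  qed
  moreover have "(-1) ^ ?R = (- ((-1) ^ con e \<rho> U) :: int)" using RU by simp
  ultimately have "(-1) ^ ?R * chi a (insert e U) \<rho> = (-1) ^ \<rho> U * chi a U \<rho> + (-1) ^ con e \<rho> U * chi a U (con e \<rho>)"
   using p(1) by (simp add: right_diff_distrib)
  then show ?thesis using insert.IH[OF del] insert.IH[OF con] by auto
 qed
qed

text \<open>Crapo's beta invariant, up to sign the derivative of the characteristic polynomial at
  1.\<close>

definition beta :: "'a set => ('a set => nat) => int" where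
 "beta U \<rho> = (-1) ^ \<rho> U * (\<Sum>A\<in>Pow U. sg A * int (\<rho> A))"

text \<open>Connectedness in terms of rank; the condition on the rank of U excludes a single
  loop.\<close>

definition rconn :: "'a set => ('a set => nat) => bool" where
 "rconn U \<rho> \<longleftrightarrow> U ~= {} \<and> \<rho> U \<ge> 1 \<and> (\<forall>A. A \<subset> U --> A ~= {} --> \<rho> U < \<rho> A + \<rho> (U - A))"

text \<open>Deletion-contraction for beta. The second alternative collects loops and coloops, where
  e splits off and the sum of all signs cancels.\<close>

lemma beta_insert:
 assumes r: "rankfun (insert e U) \<rho>" "e \<notin> U" "U ~= {}"
 shows "(\<rho> (insert e U) = \<rho> U \<and> \<rho> {e} = 1 \<and> beta (insert e U) \<rho> = beta U \<rho> + beta U (con e \<rho>)) \<or>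
  (\<rho> (insert e U) = \<rho> {e} + \<rho> U \<and> beta (insert e U) \<rho> = 0)"
proof -
 have fin: "finite U" using r by (simp add: rankfun_def)
 have split: "(\<Sum>A\<in>Pow (insert e U). sg A * int (\<rho> A)) = (\<Sum>A\<in>Pow U. sg A * (int (\<rho> A) - int (\<rho> (insert e A))))"
 proof -
  have "(\<Sum>A\<in>Pow (insert e U). sg A * int (\<rho> A)) = (\<Sum>A\<in>Pow U. sg A * int (\<rho> A)) + (\<Sum>A\<in>Pow U. sg (insert e A) * int (\<rho> (insert e A)))"
   by (rule sum_Pow_insert[OF fin r(2)])
  also have "(\<Sum>A\<in>Pow U. sg (insert e A) * int (\<rho> (insert e A))) = (\<Sum>A\<in>Pow U. - (sg A * int (\<rho> (insert e A))))"
   by (rule sum.cong) (use fin r(2) in \<open>auto simp: sg_insert\<close>)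
  finally show ?thesis by (simp add: sum_negf sum_subtractf right_diff_distrib)
 qed
 show ?thesis
 proof (rule rankfun_cases[OF r(1,2)])
  assume l: "\<And>A. A \<subseteq> U ==> \<rho> (insert e A) = \<rho> A" "\<rho> {e} = 0"
  then have "beta (insert e U) \<rho> = 0" unfolding beta_def split by (simp add: sum.neutral)
  then show ?thesis using l by simp
 next
  assume c: "\<And>A. A \<subseteq> U ==> \<rho> (insert e A) = \<rho> A + 1" "\<rho> {e} = 1"
  have "(\<Sum>A\<in>Pow U. sg A * (int (\<rho> A) - int (\<rho> (insert e A)))) = (\<Sum>A\<in>Pow U. - sg A)"
   by (rule sum.cong) (use c in auto)
  also have "\<dots> = 0" using sum_sg[OF fin] r(3) by (simp add: sum_negf)
  finally show ?thesis using c by (simp add: beta_def split)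
 next
  assume p: "\<rho> (insert e U) = \<rho> U" "\<And>A. A \<subseteq> U ==> \<rho> (insert e A) = con e \<rho> A + 1" "\<rho> {e} = 1"
  have RU: "\<rho> U = con e \<rho> U + 1" using p(1) p(2)[of U] by simp
  have "(\<Sum>A\<in>Pow U. sg A * (int (\<rho> A) - int (\<rho> (insert e A))))
    = (\<Sum>A\<in>Pow U. sg A * int (\<rho> A) - sg A * int (con e \<rho> A) - sg A)"
   by (rule sum.cong) (use p in \<open>auto simp: algebra_simps\<close>)
  also have "\<dots> = (\<Sum>A\<in>Pow U. sg A * int (\<rho> A)) - (\<Sum>A\<in>Pow U. sg A * int (con e \<rho> A)) - 0"
   using sum_sg[OF fin] r(3) by (simp add: sum_subtractf)
  finally have "beta (insert e U) \<rho> = beta U \<rho> + beta U (con e \<rho>)"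
   unfolding beta_def split p(1) RU by (simp only: power_Suc power_one_right add_0 Suc_eq_plus1[symmetric]) (simp add: ring_distribs)
  then show ?thesis using p by simp
 qed
qed

text \<open>Tutte: deleting or contracting an element keeps a connected matroid connected, by uncrossing a
  separation of the deletion with one of the contraction.\<close>

lemma rconn_delete_or_contract:
 assumes r: "rankfun (insert e U) \<rho>" "e \<notin> U" "U ~= {}" and c: "rconn (insert e U) \<rho>"
  and p: "\<rho> (insert e U) = \<rho> U" "\<rho> {e} = 1"
 shows "rconn U \<rho> \<or> rconn U (con e \<rho>)"
proof (rule ccontr)
 assume no: "\<not> ?thesis"
 have ge: "\<rho> (insert e A) \<ge> 1" if "A \<subseteq> U" for A
  using rankfun_mono[OF r(1), of "{e}" "insert e A"] that p by auto
 have del: "rankfun U \<rho>" using rankfun_subset[OF r(1)] by auto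
 have U1: "\<rho> U \<ge> 1" using ge[of U] p by simp
 have conn: "\<rho> U < \<rho> A + \<rho> (insert e U - A)" if "A \<subseteq> insert e U" "A ~= {}" "A ~= insert e U" for A
  using c that p(1) unfolding rconn_def by auto
 obtain A where A: "A \<subset> U" "A ~= {}" "\<rho> A + \<rho> (U - A) \<le> \<rho> U"
  using no r(3) U1 unfolding rconn_def by (auto simp: not_less)
 \<comment> \<open>A separation of the contraction, written in terms of the original rank function.
   If the contraction has rank 0, any proper part will do, for instance A.\<close>
 have "\<exists>D. D \<subset> U \<and> D ~= {} \<and> \<rho> (insert e D) + \<rho> (insert e (U - D)) \<le> \<rho> U + 1"
 proof (cases "con e \<rho> U \<ge> 1")
  case True
  then obtain D where D: "D \<subset> U" "D ~= {}" "con e \<rho> D + con e \<rho> (U - D) \<le> con e \<rho> U"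
   using no r(3) unfolding rconn_def by (auto simp: not_less)
  then show ?thesis using ge[of D] ge[of "U - D"] ge[of U] p by (intro exI[of _ D]) (auto simp: con_def)
 next
  case False
  then have U: "\<rho> U = 1" using p ge[of U] U1 by (auto simp: con_def)
  have "\<rho> (insert e A) \<le> \<rho> (insert e U)" "\<rho> (insert e (U - A)) \<le> \<rho> (insert e U)"
   using A by (auto intro!: rankfun_mono[OF r(1)])
  then show ?thesis using A U p(1) by (intro exI[of _ A]) auto
 qed
 then obtain D where D: "D \<subset> U" "D ~= {}" "\<rho> (insert e D) + \<rho> (insert e (U - D)) \<le> \<rho> U + 1" by auto
 \<comment> \<open>The two submodular inequalities bound the four ranks on their left by twice the
   rank of U plus 1; connectedness, used for both crossing sets, makes them at least twice the rank
   plus 2.\<close>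
 have key: "(U - A) Int (U - D) = {} \<or> A Int D = {}"
  if A: "A \<subset> U" "\<rho> A + \<rho> (U - A) \<le> \<rho> U" and D: "D \<subset> U" "\<rho> (insert e D) + \<rho> (insert e (U - D)) \<le> \<rho> U + 1" for A D
 proof (rule ccontr)
  assume n: "\<not> ?thesis"
  have "\<rho> (A Un insert e D) + \<rho> (A Int insert e D) \<le> \<rho> A + \<rho> (insert e D)"
   by (rule rankfun_submod[OF r(1)]) (use A D in auto)
  moreover have "\<rho> ((U - A) Un insert e (U - D)) + \<rho> ((U - A) Int insert e (U - D)) \<le> \<rho> (U - A) + \<rho> (insert e (U - D))"
   by (rule rankfun_submod[OF r(1)]) auto
  moreover have "\<rho> U < \<rho> (A Int insert e D) + \<rho> (insert e U - (A Int insert e D))"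
   by (rule conn) (use A D n r(2) in auto)
  moreover have "insert e U - (A Int insert e D) = (U - A) Un insert e (U - D)" using A D r(2) by auto
  moreover have "\<rho> U < \<rho> ((U - A) Int insert e (U - D)) + \<rho> (insert e U - ((U - A) Int insert e (U - D)))"
   by (rule conn) (use A D n r(2) in auto)
  moreover have "insert e U - ((U - A) Int insert e (U - D)) = A Un insert e D" using A D r(2) by auto
  ultimately show False using A(2) D(2) by simp
 qed
 have 1: "(U - A) Int (U - D) = {} \<or> A Int D = {}" by (rule key) (use A D in auto)
 have UD: "U - (U - D) = D" using D by auto
 have 2: "(U - A) Int (U - (U - D)) = {} \<or> A Int (U - D) = {}"
  by (rule key) (use A D UD in \<open>auto simp: add.commute\<close>)
 \<comment> \<open>The alternatives for D and for its complement together force A or D to be empty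
   or all of U.\<close>
 show False using 1 2 A(1,2) D(1,2) UD by blast
qed

text \<open>Induction by \<open>beta_insert\<close>; in the connected case one of the two summands
  is positive by \<open>rconn_delete_or_contract\<close>.\<close>

lemma beta_pos:
 assumes "finite U" "rankfun U \<rho>"
 shows "(U ~= {} --> beta U \<rho> \<ge> 0) \<and> (rconn U \<rho> --> beta U \<rho> > 0)"
 using assms
proof (induction U arbitrary: \<rho>)
 case empty
 then show ?case by (simp add: rconn_def)
next
 case (insert e U)
 show ?case
 proof (cases "U = {}")
  case True
  have "\<rho> {} = 0" "\<rho> {e} \<le> 1" using insert.prems rankfun_insert[OF insert.prems, of "{}" e] by (auto simp: rankfun_def)
  moreover have "(\<Sum>A\<in>Pow {e}. sg A * int (\<rho> A)) = - int (\<rho> {e})"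
   using \<open>\<rho> {} = 0\<close> by (simp add: Pow_insert sg_def)
  ultimately show ?thesis using True unfolding beta_def rconn_def by (cases "\<rho> {e}") auto
 next
  case False
  have del: "rankfun U \<rho>" using rankfun_subset[OF insert.prems] by auto
  have con: "rankfun U (con e \<rho>)" by (rule rankfun_con[OF insert.prems])
  show ?thesis using beta_insert[OF insert.prems insert.hyps(2) False]
  proof
   assume p: "\<rho> (insert e U) = \<rho> U \<and> \<rho> {e} = 1 \<and> beta (insert e U) \<rho> = beta U \<rho> + beta U (con e \<rho>)"
   then show ?thesis
    using insert.IH[OF del] insert.IH[OF con] False
     rconn_delete_or_contract[OF insert.prems insert.hyps(2) False] by auto
  next
   assume z: "\<rho> (insert e U) = \<rho> {e} + \<rho> U \<and> beta (insert e U) \<rho> = 0"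
   have "{e} \<subset> insert e U" using False insert.hyps by auto
   moreover have "insert e U - {e} = U" using insert.hyps by auto
   ultimately have "rconn (insert e U) \<rho> ==> \<rho> (insert e U) < \<rho> {e} + \<rho> U"
    unfolding rconn_def by (metis insert_not_empty)
   then show ?thesis using z by auto
  qed
 qed
qed

subsection \<open>Coefficients and roots of the characteristic polynomial\<close>

context matroid
begin

lemma rankfun_mrank: "rankfun E rk"
 unfolding rankfun_def
 using mrank_insert_le mrank_submod mrank_mono[OF subset_insertI] finite_ground by auto

text \<open>Subsets are grouped by closure; the sum of signs over all subsets of a flat vanishes
  unless the flat is empty.\<close>

lemma mu_whitney:
 assumes sim: "simple_matroid M" and F: "F \<in> flats M"
 shows "(\<Sum>A\<in>{A \<in> Pow E. cl A = F}. sg A) = mu F"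
proof (rule mu_unique[OF _ sim F])
 fix F assume F: "F \<in> flats M"
 have FE: "F \<subseteq> E" using F flat_subset by auto
 have "(\<Sum>Z | Z \<in> flats M \<and> Z \<subseteq> F. \<Sum>A\<in>{A \<in> Pow E. cl A = Z}. sg A)
   = (\<Sum>Z | Z \<in> flats M \<and> Z \<subseteq> F. \<Sum>A\<in>{A \<in> Pow F. cl A = Z}. sg A)"
 proof (rule sum.cong[OF refl])
  fix Z assume "Z \<in> {Z. Z \<in> flats M \<and> Z \<subseteq> F}"
  then have "Z \<subseteq> F" by simp
  have "{A \<in> Pow E. cl A = Z} = {A \<in> Pow F. cl A = Z}"
  proof (rule set_eqI)
   fix A
   have "A \<subseteq> F" if "A \<subseteq> E" "cl A = Z" using subset_cl[OF that(1)] that(2) \<open>Z \<subseteq> F\<close> by blast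
   then show "A \<in> {A \<in> Pow E. cl A = Z} \<longleftrightarrow> A \<in> {A \<in> Pow F. cl A = Z}" using FE by blast
  qed
  then show "(\<Sum>A\<in>{A \<in> Pow E. cl A = Z}. sg A) = (\<Sum>A\<in>{A \<in> Pow F. cl A = Z}. sg A)" by simp
 qed
 also have "\<dots> = sum sg (Pow F)"
 proof (rule sum.group)
  show "finite (Pow F)" using finite_flat[OF F] by simp
  show "finite {Z. Z \<in> flats M \<and> Z \<subseteq> F}" using finite_flats by simp
  show "cl ` Pow F \<subseteq> {Z. Z \<in> flats M \<and> Z \<subseteq> F}"
  proof (rule image_subsetI)
   fix A assume "A \<in> Pow F"
   then show "cl A \<in> {Z. Z \<in> flats M \<and> Z \<subseteq> F}" using cl_minimal[OF F, of A] cl_flat[of A] FE by simp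
  qed
 qed
 also have "\<dots> = (if F = {} then 1 else 0)" by (rule sum_sg[OF finite_flat[OF F]])
 finally show "(\<Sum>Z | Z \<in> flats M \<and> Z \<subseteq> F. \<Sum>A\<in>{A \<in> Pow E. cl A = Z}. sg A) = (if F = {} then 1 else 0)" .
qed

lemma characteristic_poly_whitney:
 assumes sim: "simple_matroid M"
 shows "characteristic_poly M = (\<Sum>A\<in>Pow E. monom (sg A) (rk E - rk A))"
proof -
 have "characteristic_poly M = (\<Sum>F\<in>flats M. \<Sum>A\<in>{A \<in> Pow E. cl A = F}. monom (sg A) (rk E - rk A))"
  unfolding characteristic_poly_def
 proof (rule sum.cong[OF refl])
  fix F assume F: "F \<in> flats M"
  have "monom (mu F) (rk E - rk F) = monom (\<Sum>A\<in>{A \<in> Pow E. cl A = F}. sg A) (rk E - rk F)"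
   using mu_whitney[OF sim F] by simp
  also have "\<dots> = (\<Sum>A\<in>{A \<in> Pow E. cl A = F}. monom (sg A) (rk E - rk F))"
   by (rule poly_eqI) (simp add: coeff_sum coeff_monom)
  also have "\<dots> = (\<Sum>A\<in>{A \<in> Pow E. cl A = F}. monom (sg A) (rk E - rk A))"
  proof (rule sum.cong[OF refl])
   fix A assume "A \<in> {A \<in> Pow E. cl A = F}"
   then have "rk A = rk F" using mrank_cl[of A] by auto
   then show "monom (sg A) (rk E - rk F) = monom (sg A) (rk E - rk A)" by simp
  qed
  finally show "monom (mu F) (rk E - rk F) = (\<Sum>A\<in>{A \<in> Pow E. cl A = F}. monom (sg A) (rk E - rk A))" .
 qed
 also have "\<dots> = (\<Sum>A\<in>Pow E. monom (sg A) (rk E - rk A))"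
 proof (rule sum.group)
  show "cl ` Pow E \<subseteq> flats M" using cl_flat by auto
 qed (use finite_ground finite_flats in auto)
 finally show ?thesis .
qed

lemma poly_characteristic:
 "simple_matroid M ==> poly (characteristic_poly M) a = chi a E rk"
 by (simp add: characteristic_poly_whitney poly_sum poly_monom chi_def)

lemma pderiv_sum: "pderiv (\<Sum>x\<in>A. f x) = (\<Sum>x\<in>A. pderiv (f x))"
 by (induction A rule: infinite_finite_induct) (auto simp: pderiv_add)

text \<open>In the derivative of Whitney's expansion at 1 the rank of E is multiplied by the sum of
  all signs, which is 0. With \<open>beta_pos\<close> this makes 1 a simple root in the connected
  case.\<close>

lemma poly_pderiv_characteristic:
 assumes "simple_matroid M" "E ~= {}"
 shows "(-1) ^ rk E * poly (pderiv (characteristic_poly M)) 1 = - beta E rk"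
proof -
 have "poly (pderiv (characteristic_poly M)) 1 = (\<Sum>A\<in>Pow E. int (rk E - rk A) * sg A)"
  unfolding characteristic_poly_whitney[OF assms(1)] by (simp add: pderiv_sum pderiv_monom poly_sum poly_monom)
 also have "\<dots> = (\<Sum>A\<in>Pow E. int (rk E) * sg A - sg A * int (rk A))"
  by (rule sum.cong) (auto simp: mrank_mono of_nat_diff algebra_simps)
 also have "\<dots> = int (rk E) * (\<Sum>A\<in>Pow E. sg A) - (\<Sum>A\<in>Pow E. sg A * int (rk A))"
  by (simp add: sum_subtractf sum_distrib_left)
 finally show ?thesis using sum_sg[OF finite_ground] assms(2) by (simp add: beta_def)
qed

lemma coeff_characteristic:
 assumes "k \<le> rk E"
 shows "coeff (characteristic_poly M) (rk E - k) = (\<Sum>X\<in>{X \<in> flats M. rk X = k}. mu X)"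
proof -
 have "coeff (characteristic_poly M) (rk E - k) = (\<Sum>X\<in>flats M. if rk E - rk X = rk E - k then mu X else 0)"
  unfolding characteristic_poly_def by (simp add: coeff_sum coeff_monom)
 also have "\<dots> = (\<Sum>X\<in>flats M. if rk X = k then mu X else 0)"
 proof (rule sum.cong[OF refl])
  fix X assume "X \<in> flats M"
  then have "rk X \<le> rk E" using flat_subset mrank_mono by blast
  then have "rk E - rk X = rk E - k \<longleftrightarrow> rk X = k" using assms by linarith
  then show "(if rk E - rk X = rk E - k then mu X else 0) = (if rk X = k then mu X else 0)" by simp
 qed
 also have "\<dots> = (\<Sum>X\<in>{X \<in> flats M. rk X = k}. mu X)"
  by (rule sum.inter_filter[symmetric]) (rule finite_flats)
 finally show ?thesis .
qed

lemma degree_characteristic: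
 assumes sim: "simple_matroid M"
 shows "degree (characteristic_poly M) = rk E" "lead_coeff (characteristic_poly M) = 1"
proof -
 have "{X \<in> flats M. rk X = 0} = {{}}" using flat_rank0[OF sim] simple_empty_flat[OF sim] by auto
 then have c: "coeff (characteristic_poly M) (rk E) = 1" using coeff_characteristic[of 0] by simp
 have "coeff (characteristic_poly M) n = 0" if "n > rk E" for n
  unfolding characteristic_poly_def using that by (auto simp: coeff_sum coeff_monom intro!: sum.neutral)
 then have "degree (characteristic_poly M) \<le> rk E" by (intro degree_le) auto
 moreover have "rk E \<le> degree (characteristic_poly M)" using c by (intro le_degree) simp
 ultimately show "degree (characteristic_poly M) = rk E" by simp
 then show "lead_coeff (characteristic_poly M) = 1" using c by simp
qed

lemma coeff_characteristic1:
 assumes sim: "simple_matroid M" and r: "rk E \<ge> 1"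
 shows "coeff (characteristic_poly M) (rk E - 1) = - int (card E)"
proof -
 have "{X \<in> flats M. rk X = 1} = (\<lambda>e. {e}) ` E"
  using flat_rank1[OF sim] simple_point_flat[OF sim] by auto
 then have "(\<Sum>X\<in>{X \<in> flats M. rk X = 1}. mu X) = (\<Sum>e\<in>E. mu {e})"
  by (simp add: sum.reindex)
 also have "\<dots> = - int (card E)" by (simp add: mu_point[OF sim])
 finally show ?thesis using coeff_characteristic[OF r] by simp
qed

lemma mu_line:
 assumes sim: "simple_matroid M" and L: "L \<in> flats M" "rk L = 2"
 shows "mu L = int (card L) - 1"
proof -
 have LE: "L \<subseteq> E" using L flat_subset by auto
 have ne: "L ~= {}" using L by auto
 have "{Z. Z \<in> flats M \<and> Z \<subseteq> L} = insert L (insert {} ((\<lambda>e. {e}) ` L))"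
 proof (intro equalityI subsetI)
  fix Z assume "Z \<in> {Z. Z \<in> flats M \<and> Z \<subseteq> L}"
  then have Z: "Z \<in> flats M" "Z \<subseteq> L" by auto
  show "Z \<in> insert L (insert {} ((\<lambda>e. {e}) ` L))"
  proof (cases "Z = L")
   case False
   then have "rk Z < 2" using flat_psubset_rank[OF Z(1), of L] Z LE L by auto
   then have "rk Z = 0 \<or> rk Z = 1" by auto
   then show ?thesis using flat_rank0[OF sim Z(1)] flat_rank1[OF sim Z(1)] Z(2) by auto
  qed simp
 next
  fix Z assume "Z \<in> insert L (insert {} ((\<lambda>e. {e}) ` L))"
  then show "Z \<in> {Z. Z \<in> flats M \<and> Z \<subseteq> L}"
   using L simple_empty_flat[OF sim] simple_point_flat[OF sim] LE by auto
 qed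
 moreover have "L \<notin> insert {} ((\<lambda>e. {e}) ` L)" using ne L simple_rank1[OF sim] LE by auto
 moreover have "finite L" using finite_flat L by auto
 moreover from this have "sum mu (insert {} ((\<lambda>e. {e}) ` L)) = mu {} + (\<Sum>e\<in>L. mu {e})"
  by (subst sum.insert) (auto simp: sum.reindex)
 ultimately have "0 = mu L + (mu {} + (\<Sum>e\<in>L. mu {e}))"
  using mu_sum[OF L(1) ne] by simp
 also have "(\<Sum>e\<in>L. mu {e}) = - int (card L)" using LE by (simp add: mu_point[OF sim] subset_iff)
 finally show ?thesis by simp
qed

text \<open>Two distinct points lie on exactly one line.\<close>

lemma sum_lines_choose:
 assumes sim: "simple_matroid M"
 shows "(\<Sum>L\<in>{X \<in> flats M. rk X = 2}. card L choose 2) = card E choose 2"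
proof -
 let ?P = "\<lambda>L. {A. A \<subseteq> L \<and> card A = 2}"
 have fl: "finite L" if "L \<in> flats M" for L using finite_flat that by auto
 have "card (\<Union>L\<in>{X \<in> flats M. rk X = 2}. ?P L) = (\<Sum>L\<in>{X \<in> flats M. rk X = 2}. card (?P L))"
 proof (rule card_UN_disjoint)
  show "\<forall>i\<in>{X \<in> flats M. rk X = 2}. \<forall>j\<in>{X \<in> flats M. rk X = 2}. i ~= j --> ?P i Int ?P j = {}"
  proof (intro ballI impI)
   fix L K assume LK: "L \<in> {X \<in> flats M. rk X = 2}" "K \<in> {X \<in> flats M. rk X = 2}" "L ~= K"
   have "card A ~= 2" if A: "A \<subseteq> L" "A \<subseteq> K" for A
   proof
    assume "card A = 2"
    then obtain e f where ef: "A = {e, f}" "e ~= f" by (auto simp: card_2_iff)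
    have "e \<in> E" "f \<in> E" using ef A LK flat_subset by auto
    then have "rk A = 2" using simple_rank2[OF sim _ _ ef(2)] ef(1) by simp
    moreover have "L Int K \<in> flats M" "L Int K \<subset> L \<or> L Int K \<subset> K" using flat_Int LK by auto
    moreover have "rk A \<le> rk (L Int K)" using A by (intro mrank_mono) auto
    moreover have "L Int K \<subset> L ==> rk (L Int K) < 2" "L Int K \<subset> K ==> rk (L Int K) < 2"
     using flat_psubset_rank[OF calculation(2), of L] flat_psubset_rank[OF calculation(2), of K] LK flat_subset by auto
    ultimately show False by auto
   qed
   then show "?P L Int ?P K = {}" by blast
  qed
 qed (use finite_flats fl in auto)
 also have "\<dots> = (\<Sum>L\<in>{X \<in> flats M. rk X = 2}. card L choose 2)"
  by (rule sum.cong) (use fl in \<open>auto simp: n_subsets\<close>)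
 also have "(\<Union>L\<in>{X \<in> flats M. rk X = 2}. ?P L) = ?P E"
 proof (intro equalityI subsetI)
  fix A assume "A \<in> ?P E"
  then have A: "A \<subseteq> E" "card A = 2" by auto
  then obtain e f where ef: "A = {e, f}" "e ~= f" by (auto simp: card_2_iff)
  have "rk (cl A) = 2" using mrank_cl[OF A(1)] simple_rank2[OF sim, of e f] ef A by auto
  then show "A \<in> (\<Union>L\<in>{X \<in> flats M. rk X = 2}. ?P L)" using cl_flat[OF A(1)] subset_cl[OF A(1)] A(2) by blast
 qed (use flat_subset in blast)
 finally show ?thesis using finite_ground by (simp add: n_subsets)
qed

end

text \<open>On the line a row is determined by its values at a and b, so the column of any further
  point is the sum of these two columns; by simplicity there is at most one such point.\<close>

lemma (in binary_matroid) card_line_le3: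
 assumes sim: "simple_matroid M" and L: "L \<in> flats M" "rk L = 2"
 shows "card L = 2 \<or> card L = 3"
proof -
 have LE: "L \<subseteq> E" and fL: "finite L" using L flat_subset finite_flat by auto
 obtain I where I: "I \<in> indep M" "I \<subseteq> L" "card I = rk L" using mrank_obtain .
 then obtain a b where ab: "I = {a, b}" "a ~= b" using L by (auto simp: card_2_iff)
 have abL: "a \<in> L" "b \<in> L" using I ab by auto
 have zero: "z \<notin> C" if "x \<in> L" "y \<in> L" "x ~= y" "z \<in> L" "C \<in> \<C>" "x \<notin> C" "y \<notin> C" for x y z C
 proof -
  have "C Int L = {}"
   by (rule avoid_basis[OF simple_indep2[OF sim, of x y]])
    (use that LE L simple_rank2[OF sim, of x y] in auto)
  then show ?thesis using that by auto
 qed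
 have third: "x \<in> C \<longleftrightarrow> (a \<in> C) ~= (b \<in> C)" if x: "x \<in> L" "x ~= a" "x ~= b" and C: "C \<in> \<C>" for x C
 proof -
  obtain A where A: "A \<in> \<C>" "A Int I = {a}" using indepD[OF I(1), of a] ab by auto
  then have A': "a \<in> A" "b \<notin> A" using ab by auto
  have xA: "x \<in> A" using zero[of b x a A] A A' x abL ab by auto
  have S: "sym_diff C A \<in> \<C>" using space_sym_diff C A by auto
  have 1: "x \<notin> C" if "a \<in> C" "b \<in> C"
  proof
   assume "x \<in> C"
   then have "a \<notin> sym_diff C A" "x \<notin> sym_diff C A" using that A' xA by auto
   then have "b \<notin> sym_diff C A" using zero[of a x b "sym_diff C A"] S x abL by auto
   then show False using that A' by auto
  qed
  show ?thesis
   using zero[of a b x C] zero[of b x a C] zero[of a x b C] x abL ab C 1 by blast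
 qed
 have "L - {a, b} \<subseteq> {x}" if "x \<in> L - {a, b}" for x
 proof
  fix y assume y: "y \<in> L - {a, b}"
  show "y \<in> {x}"
  proof (rule ccontr)
   assume "y \<notin> {x}"
   moreover have "x \<in> E" "y \<in> E" using that y LE by auto
   ultimately obtain C where "C \<in> \<C>" "x \<in> C" "y \<notin> C" using simple_separate[OF sim, of x y] by auto
   then show False using third[of x C] third[of y C] that y by auto
  qed
 qed
 then have "L = {a, b} \<or> (\<exists>x. x \<notin> {a, b} \<and> L = {a, b, x})" using abL by blast
 then show ?thesis using ab by auto
qed

text \<open>Vieta's formulas; the second elementary symmetric function is rewritten by power sums
  because the bound on the roots involves their squares.\<close>

lemma coeff_linear_factors:
 fixes as :: "int list"
 shows "coeff (\<Prod>a\<leftarrow>as. [:- a, 1:]) (length as) = 1"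
  and "length as = Suc k ==> coeff (\<Prod>a\<leftarrow>as. [:- a, 1:]) k = - sum_list as"
  and "length as = Suc (Suc j) ==>
   2 * coeff (\<Prod>a\<leftarrow>as. [:- a, 1:]) j = (sum_list as)\<^sup>2 - (\<Sum>a\<leftarrow>as. a\<^sup>2)"
proof -
 have deg: "degree (\<Prod>a\<leftarrow>as. [:- a, 1:]) \<le> length as" for as :: "int list"
 proof (induction as)
  case (Cons a as)
  have "degree ([:- a, 1:] * (\<Prod>a\<leftarrow>as. [:- a, 1:])) \<le> degree [:- a, 1:] + degree (\<Prod>a\<leftarrow>as. [:- a, 1:])"
   by (rule degree_mult_le)
  then show ?case using Cons by simp
 qed simp
 have mult: "coeff ([:- a, 1:] * q) n = (case n of 0 => 0 | Suc m => coeff q m) - a * coeff q n" for a :: int and q n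
  by (simp add: coeff_pCons split: nat.split)
 have c0: "coeff (\<Prod>a\<leftarrow>as. [:- a, 1:]) (length as) = 1" for as :: "int list"
 proof (induction as)
  case (Cons a as)
  have "coeff (\<Prod>a\<leftarrow>as. [:- a, 1:]) (Suc (length as)) = 0" using deg[of as] by (intro coeff_eq_0) simp
  then show ?case using Cons unfolding list.map prod_list.Cons mult by simp
 qed simp
 have c1: "length as = Suc k ==> coeff (\<Prod>a\<leftarrow>as. [:- a, 1:]) k = - sum_list as" for as :: "int list" and k
 proof (induction as arbitrary: k)
  case (Cons a as)
  then have k: "k = length as" by simp
  show ?case
  proof (cases as)
   case Nil then show ?thesis using k by simp
  next
   case (Cons b bs)
   then obtain m where m: "k = Suc m" "length as = Suc m" using k by simp
   then show ?thesis using Cons.IH[of m] c0[of as] unfolding list.map prod_list.Cons mult by simp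
  qed
 qed simp
 show "coeff (\<Prod>a\<leftarrow>as. [:- a, 1:]) (length as) = 1" by (rule c0)
 show "length as = Suc k ==> coeff (\<Prod>a\<leftarrow>as. [:- a, 1:]) k = - sum_list as" by (rule c1)
 show "length as = Suc (Suc j) ==>
   2 * coeff (\<Prod>a\<leftarrow>as. [:- a, 1:]) j = (sum_list as)\<^sup>2 - (\<Sum>a\<leftarrow>as. a\<^sup>2)"
 proof (induction as arbitrary: j)
  case (Cons a as)
  then have k: "length as = Suc j" by simp
  have s: "coeff (\<Prod>a\<leftarrow>as. [:- a, 1:]) j = - sum_list as" by (rule c1[OF k])
  show ?case
  proof (cases j)
   case 0
   then obtain b where "as = [b]" using k by (cases as) auto
   then show ?thesis using 0 by (simp add: power2_eq_square algebra_simps)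
  next
   case (Suc m)
   then have "2 * coeff (\<Prod>a\<leftarrow>as. [:- a, 1:]) m = (sum_list as)\<^sup>2 - (\<Sum>a\<leftarrow>as. a\<^sup>2)" using Cons.IH[of m] k by simp
   then show ?thesis using s Suc unfolding list.map prod_list.Cons mult by (simp add: power2_eq_square algebra_simps)
  qed
 qed simp
qed

text \<open>An integer \<open>a\<close> satisfies \<open>(a - 2) (a - 3) \<ge> 0\<close>; summing over the roots turns integrality into a
  lower bound on the number of three-point lines.\<close>

lemma (in binary_matroid) integral_roots_bounds:
 assumes sim: "simple_matroid M" and conn: "rconn E rk" and r2: "rk E \<ge> 2"
  and int: "all_roots_integers (characteristic_poly M)"
 shows "2 * rk E \<le> card E + 1" "2 * card E + 1 \<le> 3 * rk E + card {T. tri (flats M) T}"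
proof -
 let ?p = "characteristic_poly M" and ?L = "{X \<in> flats M. rk X = 2}" and ?T = "{T. tri (flats M) T}"
 have E0: "E ~= {}" using r2 by auto
 obtain as where as: "?p = (\<Prod>a\<leftarrow>as. [:- a, 1:])" "length as = rk E"
  using all_roots_integers_linear_factors[OF int] degree_characteristic[OF sim] by auto
 have root: "poly ?p a = 0 \<longleftrightarrow> a \<in> set as" for a
  unfolding as(1) by (induction as) auto
 \<comment> \<open>A root a \<le> 0 contradicts the strict sign in \<open>chi_sign\<close>.\<close>
 have pos: "a \<ge> 1" if "a \<in> set as" for a
 proof (rule ccontr)
  assume "\<not> a \<ge> 1"
  then have "(-1) ^ rk E * chi a E rk > 0"
   using chi_sign[OF finite_ground rankfun_mrank, of a] simple_rank1[OF sim] by auto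
  moreover have "chi a E rk = 0" using that root[of a] poly_characteristic[OF sim, of a] by simp
  ultimately show False by simp
 qed
 have "chi 1 E rk = 0" using sum_sg[OF finite_ground] E0 by (simp add: chi_def)
 then have "1 \<in> set as" using root poly_characteristic[OF sim] by simp
 then obtain xs ys where "as = xs @ 1 # ys" by (meson split_list)
 then obtain bs where bs: "mset as = mset (1 # bs)" using that[of "xs @ ys"] by simp
 have p1: "?p = [:- 1, 1:] * (\<Prod>a\<leftarrow>bs. [:- a, 1:])"
 proof -
  have pm: "(\<Prod>a\<leftarrow>xs. [:- a, 1:]) = (\<Prod>a\<in>#mset xs. [:- a, 1:])" for xs :: "int list"
   by (induction xs) auto
  have "(\<Prod>a\<leftarrow>as. [:- a, 1:]) = (\<Prod>a\<leftarrow>1 # bs. [:- a, 1:])" unfolding pm bs ..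
  then show ?thesis using as by simp
 qed
 \<comment> \<open>The root 1 is simple, so the remaining roots are at least 2.\<close>
 have "beta E rk > 0" using beta_pos[OF finite_ground rankfun_mrank] conn by simp
 then have "poly (pderiv ?p) 1 ~= 0" using poly_pderiv_characteristic[OF sim E0] by auto
 then have "poly (\<Prod>a\<leftarrow>bs. [:- a, 1:]) 1 ~= 0" unfolding p1 pderiv_mult poly_add poly_mult by (simp add: pderiv_pCons)
 moreover have "poly (\<Prod>a\<leftarrow>bs. [:- a, 1:]) 1 = 0 \<longleftrightarrow> 1 \<in> set bs" by (induction bs) auto
 ultimately have "1 \<notin> set bs" by simp
 moreover have sb: "set as = insert 1 (set bs)" using bs by (metis list.simps(15) set_mset_mset)
 ultimately have ge2: "b \<ge> 2" if "b \<in> set bs" for b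
  using pos[of b] that by (cases "b = 1") auto
 have len: "length bs + 1 = rk E" using bs as(2) by (metis Suc_eq_plus1 length_Cons size_mset)
 have sum1: "sum_list as = 1 + sum_list bs" using bs by (metis sum_list.Cons sum_mset_sum_list)
 have sum2: "(\<Sum>a\<leftarrow>as. a\<^sup>2) = 1 + (\<Sum>b\<leftarrow>bs. b\<^sup>2)"
 proof -
  have sm: "(\<Sum>a\<leftarrow>xs. a\<^sup>2) = (\<Sum>a\<in>#mset xs. a\<^sup>2)" for xs :: "int list"
   by (induction xs) auto
  have "(\<Sum>a\<leftarrow>as. a\<^sup>2) = (\<Sum>a\<leftarrow>1 # bs. a\<^sup>2)" unfolding sm bs ..
  then show ?thesis by simp
 qed
 obtain j where j: "rk E = Suc (Suc j)" using r2 by (metis add_2_eq_Suc le_Suc_ex)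
 have n: "sum_list as = int (card E)"
  using coeff_linear_factors(2)[of as "Suc j"] coeff_characteristic1[OF sim] as j by simp
 \<comment> \<open>The values 1 and 2 on lines of two and three points, written so that the binomial
   coefficients add up to all pairs of points.\<close>
 have muL: "mu L = int (card L choose 2) - (if card L = 3 then 1 else 0)" if "L \<in> ?L" for L
 proof -
  have "card L = 2 \<or> card L = 3" using card_line_le3[OF sim] that by auto
  then show ?thesis using mu_line[OF sim] that by (auto simp: choose_two)
 qed
 have "coeff ?p j = (\<Sum>L\<in>?L. mu L)" using coeff_characteristic[OF r2] j by simp
 also have "\<dots> = (\<Sum>L\<in>?L. int (card L choose 2) - (if card L = 3 then 1 else 0))" by (rule sum.cong[OF refl muL])
 also have "\<dots> = int (\<Sum>L\<in>?L. card L choose 2) - (\<Sum>L\<in>?L. if card L = 3 then 1 else 0)"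
  by (simp add: sum_subtractf)
 also have "(\<Sum>L\<in>?L. if card L = 3 then 1 else 0) = int (card {L \<in> ?L. card L = 3})"
  by (subst sum.inter_filter[symmetric]) (use finite_flats in auto)
 also have "{L \<in> ?L. card L = 3} = ?T" using tri_iff[OF sim] by auto
 finally have "coeff ?p j = int (card E choose 2) - int (card ?T)" using sum_lines_choose[OF sim] by simp
 then have c2: "2 * (int (card E choose 2) - int (card ?T)) = (sum_list as)\<^sup>2 - (\<Sum>a\<leftarrow>as. a\<^sup>2)"
  using coeff_linear_factors(3)[of as j] as j by simp
 have "2 * int (card E choose 2) = int (card E) * (int (card E) - 1)"
 proof -
  have "even (card E * (card E - 1))" by auto
  then have "2 * (card E choose 2) = card E * (card E - 1)" unfolding choose_two by (rule dvd_mult_div_cancel)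
  then have "2 * int (card E choose 2) = int (card E * (card E - 1))" by (metis of_nat_mult of_nat_numeral)
  then show ?thesis by (cases "card E") (simp_all add: algebra_simps)
 qed
 then have sq: "(\<Sum>a\<leftarrow>as. a\<^sup>2) = int (card E) + 2 * int (card ?T)"
  using c2 n by (simp add: power2_eq_square algebra_simps)
 have "(\<forall>b\<in>set xs. 2 \<le> b) --> 2 * int (length xs) \<le> sum_list xs" for xs
  by (induction xs) auto
 then have "2 * int (length bs) \<le> sum_list bs" using ge2 by blast
 then show "2 * rk E \<le> card E + 1" using sum1 n len by linarith
 have "(\<Sum>b\<leftarrow>bs. b\<^sup>2) - 5 * sum_list bs + 6 * int (length bs) = (\<Sum>b\<leftarrow>bs. (b - 2) * (b - 3))"
  by (induction bs) (auto simp: power2_eq_square algebra_simps)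
 moreover have "(\<Sum>b\<leftarrow>bs. (b - 2) * (b - 3)) \<ge> 0"
 proof (rule sum_list_nonneg)
  fix x assume "x \<in> set (map (\<lambda>b. (b - 2) * (b - 3)) bs)"
  then obtain b where "x = (b - 2) * (b - 3)" by auto
  then show "x \<ge> 0" by (cases "b \<le> 2") (auto simp: zero_le_mult_iff)
 qed
 ultimately show "2 * card E + 1 \<le> 3 * rk E + card ?T" using sum1 sum2 n sq len by linarith
qed

subsection \<open>Integral roots give a modular chain\<close>

context binary_matroid
begin

text \<open>Sending a row to its two traces is injective; by \<open>card_trace\<close> and
  \<open>card_space\<close> every pair of traces is hit as soon as the ranks add up.\<close>

lemma rank_separation_fibered:
 assumes A: "A \<subseteq> E" and r: "rk A + rk (E - A) \<le> rk E"
 shows "fibered \<C> A (E - A)"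
 unfolding fibered_def
proof (intro ballI impI)
 fix C D assume CD: "C \<in> \<C>" "D \<in> \<C>"
 let ?P = "((\<lambda>C. C Int A) ` \<C>) \<times> ((\<lambda>C. C Int (E - A)) ` \<C>)"
 let ?f = "\<lambda>C. (C Int A, C Int (E - A))"
 have inj: "inj_on ?f \<C>"
 proof (rule inj_onI)
  fix X Y assume "X \<in> \<C>" "Y \<in> \<C>" "?f X = ?f Y"
  then show "X = Y" using space_subset[of X] space_subset[of Y] by blast
 qed
 have "?f ` \<C> = ?P"
 proof (rule card_seteq)
  show "finite ?P" using finite_space by simp
  have "card ?P = 2 ^ (rk A + rk (E - A))" by (simp add: card_cartesian_product card_trace power_add)
  also have "\<dots> \<le> 2 ^ rk E" using r by simp
  also have "\<dots> = card (?f ` \<C>)" using card_image[OF inj] card_space by simp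
  finally show "card ?P \<le> card (?f ` \<C>)" .
 qed auto
 moreover have "(C Int A, D Int (E - A)) \<in> ?P" using CD by auto
 ultimately have "(C Int A, D Int (E - A)) \<in> ?f ` \<C>" by simp
 then obtain W where W: "W \<in> \<C>" "C Int A = W Int A" "D Int (E - A) = W Int (E - A)" by auto
 then have "C Int A Un D Int (E - A) = W" using space_subset[OF W(1)] A by auto
 then show "C Int A Un D Int (E - A) \<in> \<C>" using W(1) by simp
qed

text \<open>A nontrivial decomposition as a parallel connection along a small flat; the empty flat
  gives direct sums.\<close>

definition separated :: "'a set => 'a set => bool" where
 "separated E1 E2 \<longleftrightarrow> E1 Un E2 = E \<and> E1 ~= E \<and> E2 ~= E \<and> small (flats M) (E1 Int E2) \<and> fibered \<C> E1 E2"

lemma separatedI: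
 "E1 Un E2 = E ==> E1 ~= E ==> E2 ~= E ==> small (flats M) (E1 Int E2) ==> fibered \<C> E1 E2 ==> separated E1 E2"
 unfolding separated_def by simp

lemma separated_commute: "separated E1 E2 ==> separated E2 E1"
 unfolding separated_def by (simp add: Un_commute Int_commute fibered_commute)

text \<open>By \<open>fibered_skew\<close> Stanley's factorization applies to E1, so the polynomial
  of the part divides that of M.\<close>

lemma separated_integral:
 assumes sim: "simple_matroid M" and sep: "separated E1 E2" and int: "all_roots_integers (characteristic_poly M)"
 shows "E1 \<in> flats M" "all_roots_integers (characteristic_poly (restriction M E1))"
proof -
 have E12: "E1 Un E2 = E" "small (flats M) (E1 Int E2)" "fibered \<C> E1 E2" using sep by (auto simp: separated_def)
 show fl: "E1 \<in> flats M" by (rule fibered_flat1[OF sim E12])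
 have eq: "characteristic_poly M = characteristic_poly (restriction M E1) *
   (\<Sum>Y\<in>{Y \<in> flats M. Y Int E1 = {}}. monom (mu Y) (rk E - rk E1 - rk Y))"
  by (rule characteristic_poly_skew[OF sim fl fibered_skew[OF sim E12]])
 show "all_roots_integers (characteristic_poly (restriction M E1))"
  by (rule all_roots_integers_factor[OF int[unfolded eq]])
qed

lemma separated_chained:
 assumes sim: "simple_matroid M" and sep: "separated E1 E2"
  and ch: "chained (flats (restriction M E1)) E1" "chained (flats (restriction M E2)) E2"
 shows "chained (flats M) E"
proof -
 have E12: "E1 Un E2 = E" "small (flats M) (E1 Int E2)" "fibered \<C> E1 E2" using sep by (auto simp: separated_def)
 have E21: "E2 Un E1 = E" "small (flats M) (E2 Int E1)" "fibered \<C> E2 E1" using separated_commute[OF sep] by (auto simp: separated_def)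
 have fl: "E1 \<in> flats M" "E2 \<in> flats M" using fibered_flat1[OF sim E12] fibered_flat1[OF sim E21] by auto
 have c1: "chained (flats M) E1"
  by (rule chained_superfamily[OF flat_Int fl(1) ch(1)[unfolded flats_restriction[OF fl(1)]]])
 have c2: "chained (flats M) E2"
  by (rule chained_superfamily[OF flat_Int fl(2) ch(2)[unfolded flats_restriction[OF fl(2)]]])
 have "chained (flats M) (E1 Un E2)"
  by (rule chained_glue[OF fl flat_Int _ E12(2) c1 c2]) (use fibered_glue[OF sim E12] E12(1) in auto)
 then show ?thesis using E12 by simp
qed

end

context cographic_matroid
begin

definition "edges_in P = {e \<in> edges G. ends G e \<subseteq> P}"
definition "edges_out P = {e \<in> edges G. ends G e Int P = {}}"

lemma in_out: "edges_in P Un edges_out P Un cut G P = edges G" "edges_in P Int cut G P = {}" "edges_out P Int cut G P = {}"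
 "edges_in P Int edges_out P = {}"
proof -
 show "edges_in P Un edges_out P Un cut G P = edges G" by (auto simp: edges_in_def edges_out_def cut_def)
 show "edges_in P Int edges_out P = {}"
 proof (rule ccontr)
  assume "\<not> ?thesis"
  then obtain e where e: "e \<in> edges G" "ends G e \<subseteq> P" "ends G e Int P = {}" by (auto simp: edges_in_def edges_out_def)
  then have "ends G e = {}" by auto
  then show False using card_ends[OF e(1)] by simp
 qed
qed (auto simp: edges_in_def edges_out_def cut_def)

text \<open>Every cut is the sum of a cut by vertices inside P and one by vertices outside. The
  first sees only edges of one part and the second only edges of the other, apart from the common
  cut, where C and D agree.\<close>

lemma fibered_cut: "fibered (cycs G) (edges_in P Un cut G P) (edges_out P Un cut G P)"
 unfolding fibered_def
proof (intro ballI impI)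
 let ?E1 = "edges_in P Un cut G P" and ?E2 = "edges_out P Un cut G P"
 fix C D assume C: "C \<in> cycs G" and D: "D \<in> cycs G" and CD: "C Int (?E1 Int ?E2) = D Int (?E1 Int ?E2)"
 let ?W = "C Int ?E1 Un D Int ?E2"
 have S: "?E1 Int ?E2 = cut G P" using in_out[of P] by auto
 have CT: "C Int cut G P = D Int cut G P" using CD unfolding S .
 have WE: "?W \<subseteq> edges G" using cycs_subset[OF C] cycs_subset[OF D] by auto
 have fW: "finite ?W" using WE finite_edges finite_subset by blast
 have "even (card (?W Int cut G Q))" for Q
 proof -
  have 1: "cut G (Q Int P) \<subseteq> ?E1" by (auto simp: cut_def edges_in_def)
  have "?W Int cut G (Q Int P) = C Int cut G (Q Int P)"
  proof -
   have "edges_out P Int cut G (Q Int P) = {}" by (auto simp: cut_def edges_out_def)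
   then show ?thesis using 1 CT by blast
  qed
  then have e1: "even (card (?W Int cut G (Q Int P)))" using cuts_even[OF C] by simp
  have 2: "cut G (Q - P) \<subseteq> ?E2" by (auto simp: cut_def edges_out_def)
  have "?W Int cut G (Q - P) = D Int cut G (Q - P)"
  proof -
   have "edges_in P Int cut G (Q - P) = {}" by (auto simp: cut_def edges_in_def)
   then show ?thesis using 2 CT by blast
  qed
  then have e2: "even (card (?W Int cut G (Q - P)))" using cuts_even[OF D] by simp
  have "sym_diff (Q Int P) (Q - P) = Q" by auto
  then have "cut G Q = sym_diff (cut G (Q Int P)) (cut G (Q - P))" using cut_sym_diff[of "Q Int P" "Q - P"] by simp
  then show ?thesis using even_Int_sym_diff[OF fW] e1 e2 by simp
 qed
 then show "?W \<in> cycs G" using WE unfolding cycs_def perp_def cuts_def by auto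
qed

lemma cut_tri: "simple_matroid M ==> card (cut G P) = 3 ==> tri (flats M) (cut G P)"
 unfolding tri_even using cuts_even by (auto simp: ground_edges cut_def)

section \<open>Cographic matroids without a separation\<close>

context
 assumes sim: "simple_matroid M" and prime: "\<And>E1 E2. \<not> separated E1 E2" and n2: "card E \<ge> 2"
begin

text \<open>A loop of G is a coloop of M and would split off as a direct summand.\<close>

lemma no_loop: "e \<in> E ==> card (ends G e) = 2"
proof (rule ccontr)
 assume e: "e \<in> E" and "card (ends G e) ~= 2"
 then have "card (ends G e) = 1" using card_ends ground_edges by auto
 then obtain a where "ends G e = {a, a}" by (auto simp: card_1_singleton_iff)
 then have nc: "e \<notin> cut G P" for P using mem_cut_pair[of e a a P] e ground_edges by simp
 have "{e} Int cut G P = {}" for P using nc by auto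
 then have ec: "{e} \<in> cycs G" using e ground_edges unfolding cycs_def perp_def cuts_def by auto
 have "separated {e} (E - {e})"
 proof (rule separatedI)
  show "fibered (cycs G) {e} (E - {e})" unfolding fibered_def
  proof (intro ballI impI)
   fix C D assume "C \<in> cycs G" "D \<in> cycs G"
   then have "sym_diff D {e} \<in> cycs G" "D \<in> cycs G" "D \<subseteq> E" using space_sym_diff ec space_subset by auto
   moreover have "C Int {e} Un D Int (E - {e}) = D \<or> C Int {e} Un D Int (E - {e}) = sym_diff D {e}"
    using \<open>D \<subseteq> E\<close> by (cases "e \<in> C"; cases "e \<in> D") auto
   ultimately show "C Int {e} Un D Int (E - {e}) \<in> cycs G" by metis
  qed
  show "{e} ~= E"
  proof
   assume "{e} = E"
   then have "card E = card {e}" by simp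
   then show False using n2 by simp
  qed
 qed (use e in \<open>auto simp: small_def\<close>)
 then show False using prime by blast
qed

lemma V_nonempty: "V ~= {}"
 using V_empty prime n2
proof -
 obtain e where e: "e \<in> E" using n2 by fastforce
 then have eG: "e \<in> edges G" using ground_edges by simp
 obtain a b where ab: "ends G e = {a, b}" "a \<in> verts G" using ends_pair[OF eG] by blast
 have "a ~= b" using no_loop[OF e] ab by auto
 then have "a \<in> V" using mem_star[OF eG ab(1), of a] ab by (auto simp: V_def)
 then show ?thesis by auto
qed

text \<open>An empty cut would split M into a direct sum.\<close>

lemma cut_nonempty:
 assumes P: "P \<subseteq> V" "P ~= {}" "P ~= V" shows "cut G P ~= {}"
proof
 assume c: "cut G P = {}"
 have edge: "\<exists>e\<in>E. x \<in> ends G e" if x: "x \<in> V" for x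
 proof -
  obtain e where "e \<in> star x" using x by (auto simp: V_def)
  then show ?thesis unfolding ground_edges cut_def by blast
 qed
 have "separated (edges_in P Un cut G P) (edges_out P Un cut G P)"
 proof (rule separatedI)
  show "edges_in P Un cut G P Un (edges_out P Un cut G P) = E" using in_out(1)[of P] ground_edges by auto
  obtain x where x: "x \<in> V" "x \<notin> P" using P by auto
  then obtain e where "e \<in> E" "x \<in> ends G e" using edge by blast
  then show "edges_in P Un cut G P ~= E" using x c by (auto simp: edges_in_def)
  obtain y where y: "y \<in> P" using P by auto
  then obtain f where "f \<in> E" "y \<in> ends G f" using edge P by blast
  then show "edges_out P Un cut G P ~= E" using y c by (auto simp: edges_out_def)
  show "small (flats M) ((edges_in P Un cut G P) Int (edges_out P Un cut G P))"
   using c in_out(4)[of P] by (simp add: small_def)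
 qed (rule fibered_cut)
 then show False using prime by blast
qed

text \<open>With \<open>cut_nonempty\<close>, different vertex sets avoiding x0 have different cuts,
  so the estimate behind \<open>card_ground_le\<close> becomes an equality.\<close>

lemma card_V: "card E + 1 = rk E + card V"
proof -
 obtain x0 where x0: "x0 \<in> V" using V_nonempty by auto
 have inj: "inj_on (cut G) (Pow (V - {x0}))"
 proof (rule inj_onI)
  fix P Q assume PQ: "P \<in> Pow (V - {x0})" "Q \<in> Pow (V - {x0})" "cut G P = cut G Q"
  have "cut G (sym_diff P Q) = {}" using cut_sym_diff[of P Q] PQ by simp
  moreover have "sym_diff P Q \<subseteq> V" "sym_diff P Q ~= V" using PQ x0 by auto
  ultimately have "sym_diff P Q = {}" using cut_nonempty by blast
  then show "P = Q" by blast
 qed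
 have "card (cuts G) = card (Pow (V - {x0}))" unfolding cuts_image[of x0] by (rule card_image[OF inj])
 then have "card (cuts G) = 2 ^ (card V - 1)" using x0 finite_V by (simp add: card_Pow)
 then have "2 ^ (card V - 1 + rk E) = (2::nat) ^ card E" using card_cuts_cycs by (simp add: power_add)
 then have "card V - 1 + rk E = card E" by simp
 moreover have "card V > 0" using x0 finite_V card_gt_0_iff by blast
 ultimately show ?thesis by linarith
qed

text \<open>By double orthogonality a three-point line is a cut. If both sides carry edges, M
  separates along it. If one side carries none, an end of a cut edge on that side has its whole
  star, of size at least 3, inside the cut.\<close>

lemma tri_star:
 assumes T: "tri (flats M) T" shows "\<exists>x\<in>V. T = star x"
proof -
 have T': "T \<subseteq> E" "card T = 3" "\<And>C. C \<in> cycs G ==> even (card (C Int T))" using T tri_even[OF sim] by auto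
 have "T \<in> perp (edges G) (cycs G)" unfolding perp_def using T' ground_edges by (auto simp: Int_commute)
 then have "T \<in> cuts G" unfolding cycs_def perp_perp[OF finite_edges subspace_cuts] .
 then obtain P where P: "T = cut G P" by (auto simp: cuts_def)
 have star: "\<exists>x\<in>V. T = star x" if TP: "T = cut G P" and i: "edges_in P = {}" for P
 proof -
  obtain e where e: "e \<in> T" using T'(2) by fastforce
  then have eG: "e \<in> edges G" using T' ground_edges by auto
  obtain a b where ab: "ends G e = {a, b}" "a \<in> verts G" "b \<in> verts G" using ends_pair[OF eG] by blast
  have "(a \<in> P) ~= (b \<in> P)" using mem_cut_pair[OF eG ab(1)] e TP by auto
  then obtain x where x: "x \<in> P" "x \<in> verts G" "e \<in> star x"
   using ab mem_star[OF eG ab(1)] by auto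
  then have xV: "x \<in> V" by (auto simp: V_def)
  have "star x \<subseteq> T"
  proof
   fix f assume f: "f \<in> star x"
   then have "f \<in> edges G" "f \<notin> edges_in P" "x \<in> ends G f" using i by (auto simp: cut_def)
   then show "f \<in> T" using x(1) unfolding TP by (auto simp: cut_def edges_in_def)
  qed
  moreover have "card T \<le> card (star x)" using star_ge3[OF sim xV] T' by simp
  moreover have "finite T" using T' finite_ground finite_subset by blast
  ultimately have "star x = T" by (rule_tac card_seteq) auto
  then show ?thesis using xV by auto
 qed
 have oi: "edges_out P = edges_in (verts G - P)" for P
  using ends_in_verts by (auto simp: edges_out_def edges_in_def)
 show ?thesis
 proof (cases "edges_in P = {} \<or> edges_out P = {}")
  case True
  then show ?thesis
  proof
   assume "edges_in P = {}" then show ?thesis using star[OF P] by blast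
  next
   assume "edges_out P = {}"
   then have "edges_in (verts G - P) = {}" using oi by simp
   moreover have "T = cut G (verts G - P)" using P cut_compl by simp
   ultimately show ?thesis using star by blast
  qed
 next
  case False
  have "separated (edges_in P Un cut G P) (edges_out P Un cut G P)"
  proof (rule separatedI)
   show "edges_in P Un cut G P Un (edges_out P Un cut G P) = E" using in_out(1)[of P] ground_edges by auto
   show "edges_in P Un cut G P ~= E" "edges_out P Un cut G P ~= E"
   proof -
    obtain e f where e: "e \<in> edges_in P" and f: "f \<in> edges_out P" using False by auto
    then have "e \<in> E" "f \<in> E" by (auto simp: ground_edges edges_in_def edges_out_def)
    moreover have "e \<notin> edges_out P" "e \<notin> cut G P" "f \<notin> edges_in P" "f \<notin> cut G P"
     using e f in_out(2-4)[of P] by auto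
    ultimately show "edges_in P Un cut G P ~= E" "edges_out P Un cut G P ~= E" by auto
   qed
   have "(edges_in P Un cut G P) Int (edges_out P Un cut G P) = cut G P" using in_out[of P] by blast
   then show "small (flats M) ((edges_in P Un cut G P) Int (edges_out P Un cut G P))"
    using T P by (simp add: small_def)
  qed (rule fibered_cut)
  then show ?thesis using prime by blast
 qed
qed

lemma rank_ge2: "rk E \<ge> 2"
proof -
 obtain e f where "e \<in> E" "f \<in> E" "e ~= f" using n2 card_le_Suc0_iff_eq[OF finite_ground] by force
 then have "rk {e,f} = 2" "rk {e,f} \<le> rk E" using simple_rank2[OF sim] mrank_mono[of "{e,f}" E] by auto
 then show ?thesis by simp
qed

lemma prime_rconn: "rconn E rk"
 unfolding rconn_def
proof (intro conjI allI impI)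
 show "E ~= {}" "rk E \<ge> 1" using rank_ge2 by auto
 fix A assume A: "A \<subset> E" "A ~= {}"
 show "rk E < rk A + rk (E - A)"
 proof (rule ccontr)
  assume "\<not> rk E < rk A + rk (E - A)"
  then have "fibered (cycs G) A (E - A)" using rank_separation_fibered[of A] A by auto
  then have "separated A (E - A)" using A by (intro separatedI) (auto simp: small_def)
  then show False using prime by blast
 qed
qed

lemma prime_chained:
 assumes int: "all_roots_integers (characteristic_poly M)"
 shows "chained (flats M) E"
proof -
 let ?V3 = "{x \<in> V. card (star x) = 3}"
 have fV3: "finite ?V3" using finite_V by simp
 have "{T. tri (flats M) T} \<subseteq> star ` ?V3"
 proof
  fix T assume "T \<in> {T. tri (flats M) T}"
  then have T: "tri (flats M) T" by simp
  then obtain x where "x \<in> V" "T = star x" using tri_star by blast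
  moreover have "card T = 3" using T by (simp add: tri_def)
  ultimately show "T \<in> star ` ?V3" by simp
 qed
 then have t: "card {T. tri (flats M) T} \<le> card ?V3"
  using surj_card_le[OF fV3] by blast
 have b1: "2 * rk E \<le> card E + 1" and b2: "2 * card E + 1 \<le> 3 * rk E + card ?V3"
  using integral_roots_bounds[OF sim prime_rconn rank_ge2 int] t by linarith+
 have ss: "(\<Sum>x\<in>V. card (star x)) = 2 * card E"
 proof -
  have "{e \<in> E. card (ends G e) = 2} = E" using no_loop by auto
  moreover have "star x Int E = star x" for x unfolding ground_edges by (auto simp: cut_def)
  ultimately show ?thesis using star_sum[of E] ground_edges by simp
 qed
 have v3: "card ?V3 \<le> card V" using finite_V by (intro card_mono) auto
 \<comment> \<open>Add \<open>b1\<close> and \<open>b2\<close> and replace card E - rk E by card V -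
   1.\<close>
 have v31: "card V \<le> card ?V3 + 1" using b1 b2 card_V by linarith
 show ?thesis
 proof (cases "card ?V3 = card V")
  case True
  then have "?V3 = V" using finite_V by (intro card_subset_eq) auto
  then have s3: "card (star x) = 3" if "x \<in> V" for x using that by auto
  then have "3 * card V = 2 * card E" using ss by simp
  \<comment> \<open>3 card V = 2 card E and \<open>card_V\<close> give card V = 2 rk E - 2;
    inserting this in \<open>b2\<close> leaves rk E \<le> 3.\<close>
  then have "rk E \<le> 3" using b2 True card_V by linarith
  moreover have "\<exists>T. tri (flats M) T \<and> p \<in> T" if p: "p \<in> E" for p
  proof -
   have pG: "p \<in> edges G" using p ground_edges by simp
   obtain a b where ab: "ends G p = {a, b}" "a \<in> verts G" using ends_pair[OF pG] by blast
   have "a ~= b" using no_loop[OF p] ab by auto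
   then have pa: "p \<in> star a" using mem_star[OF pG ab(1), of a] by simp
   then have "a \<in> V" using ab by (auto simp: V_def)
   then show ?thesis using cut_tri[OF sim s3] pa by blast
  qed
  ultimately show ?thesis by (rule chained_rank3[OF sim])
 next
  case False
  then have c: "card ?V3 + 1 = card V" using v3 v31 by linarith
  have "card (V - ?V3) = 1" using c finite_V fV3 by (subst card_Diff_subset) auto
  then obtain y where y: "V - ?V3 = {y}" by (auto simp: card_1_singleton_iff)
  have yV: "y \<in> V" "card (star y) ~= 3" using y by auto
  have s3: "card (star x) = 3" if "x \<in> V" "x ~= y" for x using that y by auto
  have "(\<Sum>x\<in>V. card (star x)) = card (star y) + (\<Sum>x\<in>V - {y}. card (star x))"
   using finite_V yV by (simp add: sum.remove)
  also have "(\<Sum>x\<in>V - {y}. card (star x)) = 3 * (card V - 1)" using s3 yV finite_V by simp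
  finally have "2 * card E = card (star y) + 3 * (card V - 1)" using ss by simp
  \<comment> \<open>The exceptional vertex y has more edges than there are vertices, so two of them
    run to the same cubic vertex x. With the third edge g at x they form a three-point line attached
    to the rest at the point g, which is a separation.\<close>
  then have big: "card (star y) > card V" using b2 c card_V by linarith
  define oth where "oth e = (THE x. ends G e = {x, y})" for e
  have oth: "ends G e = {oth e, y} \<and> oth e \<in> V - {y}" if e: "e \<in> star y" for e
  proof -
   have eG: "e \<in> edges G" using e by (auto simp: cut_def)
   obtain a b where ab: "ends G e = {a, b}" "a \<in> verts G" "b \<in> verts G" using ends_pair[OF eG] by blast
   obtain x where x: "ends G e = {x, y}" "x ~= y" "x \<in> verts G" using mem_star[OF eG ab(1), of y] e ab by auto
   have "oth e = x" unfolding oth_def by (rule the_equality) (use x in \<open>auto simp: doubleton_eq_iff\<close>)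
   moreover have "e \<in> star x" using mem_star[OF eG x(1), of x] x by simp
   ultimately show ?thesis using x by (auto simp: V_def)
  qed
  have "\<not> inj_on oth (star y)"
  proof
   assume "inj_on oth (star y)"
   then have "card (star y) \<le> card (V - {y})" by (rule card_inj_on_le) (use oth finite_V in auto)
   also have "\<dots> \<le> card V" using finite_V by (intro card_mono) auto
   finally show False using big by simp
  qed
  then obtain e f where ef: "e \<in> star y" "f \<in> star y" "e ~= f" "oth e = oth f" by (auto simp: inj_on_def)
  define x where "x = oth e"
  have xy: "ends G e = {x, y}" "ends G f = {x, y}" "x \<in> V" "x ~= y" using oth ef by (auto simp: x_def)
  have efG: "e \<in> edges G" "f \<in> edges G" using ef by (auto simp: cut_def)
  have "e \<in> star x" "f \<in> star x" using mem_star[OF efG(1) xy(1), of x] mem_star[OF efG(2) xy(2), of x] xy by auto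
  then obtain g where g: "star x = {e, f, g}" "g ~= e" "g ~= f"
  proof -
   obtain h k where hk: "star x = {e, h, k}" "e ~= h" "e ~= k" "h ~= k"
    using card3_obtain[OF s3[OF xy(3,4)] \<open>e \<in> star x\<close>] .
   have "f = h \<or> f = k" using \<open>f \<in> star x\<close> ef(3) hk(1) by auto
   then show ?thesis
   proof
    assume "f = h" then show ?thesis using that[of k] hk by auto
   next
    assume "f = k" then show ?thesis using that[of h] hk by (auto simp: insert_commute)
   qed
  qed
  have same: "e \<in> cut G P \<longleftrightarrow> f \<in> cut G P" for P
   using mem_cut_pair[OF efG(1) xy(1)] mem_cut_pair[OF efG(2) xy(2)] by simp
  have "even (card ({e, f} Int cut G P))" for P
   using same[of P] ef(3) by (cases "e \<in> cut G P") auto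
  then have efc: "{e, f} \<in> cycs G" using efG unfolding cycs_def perp_def cuts_def by auto
  have gG: "g \<in> edges G" using g by (auto simp: cut_def)
  have par: "(e \<in> C \<longleftrightarrow> (f \<in> C \<longleftrightarrow> g \<notin> C))" if "C \<in> cycs G" for C
   by (rule even_tripleD) (use cuts_even[OF that, of "{x}"] g ef(3) in auto)
  have "separated {e, f, g} (E - {e, f})"
  proof (rule separatedI)
   show "fibered (cycs G) {e, f, g} (E - {e, f})" unfolding fibered_def
   proof (intro ballI impI)
    fix C D assume C: "C \<in> cycs G" and D: "D \<in> cycs G"
     and CD: "C Int ({e, f, g} Int (E - {e, f})) = D Int ({e, f, g} Int (E - {e, f}))"
    have "{e, f, g} Int (E - {e, f}) = {g}" using g gG ground_edges by auto
    then have gg: "g \<in> C \<longleftrightarrow> g \<in> D" using CD by auto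
    have DE: "D \<subseteq> E" by (rule space_subset[OF D])
    have S: "sym_diff D {e, f} \<in> cycs G" by (rule space_sym_diff[OF D efc])
    \<comment> \<open>On e, f, g a row is determined by its values at e and g, so the glued set is D
      or D plus the two-edge cycle e, f.\<close>
    let ?W = "C Int {e, f, g} Un D Int (E - {e, f})"
    have W: "?W = (C Int {e, f}) Un (D - {e, f})" using DE gg g by auto
    show "?W \<in> cycs G"
    proof (cases "e \<in> C \<longleftrightarrow> e \<in> D")
     case True
     then have "f \<in> C \<longleftrightarrow> f \<in> D" using par[OF C] par[OF D] gg by blast
     then have "?W = D" unfolding W using True by auto
     then show ?thesis using D by simp
    next
     case False
     then have "f \<in> C \<longleftrightarrow> f \<notin> D" using par[OF C] par[OF D] gg by blast
     then have "?W = sym_diff D {e, f}" unfolding W using False by auto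
     then show ?thesis using S by simp
    qed
   qed
   have "card V \<ge> 3 \<or> card V \<le> 2" by auto
   have "card (star y) \<ge> 3" using star_ge3[OF sim yV(1)] .
   then have "card (star y) \<ge> 4" using yV(2) by simp
   moreover have "card (star y) \<le> card E" unfolding ground_edges using finite_edges by (intro card_mono) (auto simp: cut_def)
   moreover have "card {e, f, g} \<le> 3" by (simp add: card_insert_if)
   ultimately show "{e, f, g} ~= E" by auto
   show "{e, f, g} Un (E - {e, f}) = E" using efG gG ground_edges by auto
   show "E - {e, f} ~= E" using efG ground_edges by auto
   have "{e, f, g} Int (E - {e, f}) = {g}" using g gG ground_edges by auto
   then show "small (flats M) ({e, f, g} Int (E - {e, f}))" by (simp add: small_def)
  qed
  then show ?thesis using prime by blast
 qed
qed

end

end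

text \<open>Induction on the size of the ground set: a separation hands integrality to both parts
  and glues their chains, and inseparable matroids are settled by \<open>prime_chained\<close> and
  \<open>chained_card1\<close>.\<close>

theorem integral_roots_chained:
 assumes "matroid M" "simple_matroid M" "cographic M" "all_roots_integers (characteristic_poly M)"
 shows "chained (flats M) (ground M)"
 using assms
proof (induction "card (ground M)" arbitrary: M rule: less_induct)
 case (less M)
 obtain G :: "(nat, 'a) mgraph" where G: "finite_graph G" "M = dual (cycle_matroid G)"
  using less.prems(3) unfolding cographic_def by blast
 interpret cographic_matroid M G
  using less.prems(1) G by (simp add: cographic_matroid_def cographic_matroid_axioms_def)
 show ?case
 proof (cases "\<exists>E1 E2. separated E1 E2")
  case True
  then obtain E1 E2 where sep: "separated E1 E2" by blast
  have sub: "chained (flats (restriction M F)) F" if s: "separated F F'" for F F'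
  proof -
   have F: "F \<in> flats M" "all_roots_integers (characteristic_poly (restriction M F))"
    using separated_integral[OF less.prems(2) s less.prems(4)] by auto
   have FE: "F \<subset> E" using s by (auto simp: separated_def)
   have g: "ground (restriction M F) = F" using FE by (intro ground_restriction) auto
   have "card F < card E" using FE finite_ground by (rule psubset_card_mono[rotated])
   then have "chained (flats (restriction M F)) (ground (restriction M F))"
    using less.hyps[of "restriction M F"] restriction_matroid simple_restriction[OF less.prems(2)]
     cographic_restriction[OF less.prems(1,3)] F FE g by auto
   then show ?thesis using g by simp
  qed
  show ?thesis by (rule separated_chained[OF less.prems(2) sep sub[OF sep] sub[OF separated_commute[OF sep]]])
 next
  case False
  show ?thesis
  proof (cases "card E \<ge> 2")
   case True
   show ?thesis using prime_chained[OF less.prems(2) _ True less.prems(4)] False by blast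
  next
   case False
   then show ?thesis by (intro chained_card1[OF less.prems(2)]) simp
  qed
 qed
qed

subsection \<open>Supersolvable matroids\<close>

context matroid
begin

lemma modular_flat_iff:
 assumes X: "X \<in> flats M"
 shows "modular_flat M X \<longleftrightarrow> (\<forall>L. L \<in> flats M --> rk L = 2 --> rk (X Un L) = rk X + 1 --> X Int L ~= {})"
proof -
 have "rk (join M X L) = rk (X Un L)" if "L \<in> flats M" for L
  unfolding join_def using that X flat_subset by (intro mrank_cl) auto
 then show ?thesis using X unfolding modular_flat_def lines_def by auto
qed

text \<open>A line inside Y is met by the definition of a step. A line leaving Y meets Y in a point
  p by modularity of Y; if p were outside X, then X and p would span an element of the line outside
  Y.\<close>

lemma mhstep_modular:
 assumes sim: "simple_matroid M" and st: "mhstep (flats M) X Y" and Y: "modular_flat M Y"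
 shows "modular_flat M X"
proof -
 have XY: "X \<in> flats M" "Y \<in> flats M" "X \<subset> Y" using st by (auto simp: mhstep_def)
 have r: "rk Y = rk X + 1" by (rule mhstep_rank[OF st sim])
 show ?thesis unfolding modular_flat_iff[OF XY(1)]
 proof (intro allI impI)
  fix L assume L: "L \<in> flats M" "rk L = 2" and XL: "rk (X Un L) = rk X + 1"
  have LE: "L \<subseteq> E" using L flat_subset by auto
  show "X Int L ~= {}"
  proof (cases "L \<subseteq> Y")
   case True
   have "card L \<ge> 2" using mrank_le_card[OF finite_flat[OF L(1)]] L by simp
   then obtain e f where ef: "e \<in> L" "f \<in> L" "e ~= f"
    using card_le_Suc0_iff_eq[OF finite_flat[OF L(1)]] by force
   show ?thesis
   proof (cases "e \<in> X \<or> f \<in> X")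
    case False
    then obtain g where "g \<in> X" "\<forall>F\<in>flats M. e \<in> F --> f \<in> F --> g \<in> F"
     using mhstepD[OF st, of e f] ef True by blast
    then show ?thesis using L(1) ef by blast
   qed (use ef in auto)
  next
   case False
   then obtain l where l: "l \<in> L" "l \<notin> Y" by auto
   have "rk (Y Un (X Un L)) + rk (Y Int (X Un L)) \<le> rk Y + rk (X Un L)" by (rule mrank_submod)
   moreover have "rk X \<le> rk (Y Int (X Un L))" using XY by (intro mrank_mono) auto
   moreover have "Y Un (X Un L) = Y Un L" using XY by auto
   moreover have "rk (insert l Y) = rk Y + 1" using flat_insert_rank[OF XY(2)] l LE by auto
   moreover have "rk (insert l Y) \<le> rk (Y Un L)" using l by (intro mrank_mono) auto
   ultimately have "rk (Y Un L) = rk Y + 1" using XL by simp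
   then obtain p where p: "p \<in> Y" "p \<in> L" using Y L unfolding modular_flat_iff[OF XY(2)] by blast
   have "p \<in> X"
   proof (rule ccontr)
    assume "p \<notin> X"
    then have rp: "rk (insert p X) = rk X + 1" using flat_insert_rank[OF XY(1)] p LE by auto
    have "rk (insert l (insert p X)) \<le> rk (X Un L)" using p l by (intro mrank_mono) auto
    moreover have "rk (insert p X) \<le> rk (insert l (insert p X))" by (rule mrank_mono) auto
    ultimately have "l \<in> cl (insert p X)" using XL rp l LE mem_cl[of l "insert p X"] by auto
    moreover have "cl (insert p X) \<subseteq> Y" by (rule cl_minimal[OF XY(2)]) (use XY p in auto)
    ultimately show False using l by auto
   qed
   then show ?thesis using p by auto
  qed
 qed
qed

text \<open>Two points of X (i+1) outside X i span a line that raises the rank of X i by one, so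
  modularity supplies the third point. Conversely modularity descends from the ground set by
  \<open>mhstep_modular\<close>.\<close>

lemma supersolvable_iff:
 assumes sim: "simple_matroid M"
 shows "supersolvable M \<longleftrightarrow> (mhstep (flats M))\<^sup>*\<^sup>* {} E"
proof
 assume "supersolvable M"
 then obtain X where X: "\<forall>i\<le>rk E. modular_flat M (X i) \<and> rk (X i) = i" "\<forall>i<rk E. X i \<subset> X (Suc i)"
  unfolding supersolvable_def by blast
 have fl: "X i \<in> flats M" if "i \<le> rk E" for i using X(1) that by (auto simp: modular_flat_def)
 have rX: "rk (X i) = i" if "i \<le> rk E" for i using X(1) that by auto
 have 0: "X 0 = {}" using flat_rank0[OF sim fl[of 0]] rX[of 0] by simp
 have E: "X (rk E) = E"
  using flat_psubset_rank[OF fl[of "rk E"], of E] rX[of "rk E"] flat_subset[OF fl[of "rk E"]] by auto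
 have st: "mhstep (flats M) (X i) (X (Suc i))" if i: "i < rk E" for i
  unfolding mhstep_def
 proof (intro conjI ballI impI)
  show "X i \<in> flats M" "X (Suc i) \<in> flats M" "X i \<subset> X (Suc i)" using fl i X(2) by auto
  fix e f assume ef: "e \<in> X (Suc i) - X i" "f \<in> X (Suc i) - X i" "e ~= f"
  have S: "X (Suc i) \<in> flats M" using fl i by auto
  have efE: "{e, f} \<subseteq> E" using ef flat_subset[OF S] by auto
  let ?L = "cl {e, f}"
  have L: "?L \<in> flats M" "rk ?L = 2" using cl_flat[OF efE] mrank_cl[OF efE] simple_rank2[OF sim _ _ ef(3)] efE by auto
  have "?L \<subseteq> X (Suc i)" by (rule cl_minimal[OF S]) (use ef in auto)
  then have "rk (X i Un ?L) \<le> rk (X (Suc i))" using X(2) i by (intro mrank_mono) auto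
  moreover have "rk (insert e (X i)) = rk (X i) + 1" using flat_insert_rank[OF fl] i ef efE by auto
  moreover have "rk (insert e (X i)) \<le> rk (X i Un ?L)" using subset_cl[OF efE] by (intro mrank_mono) auto
  ultimately have "rk (X i Un ?L) = rk (X i) + 1" using rX[of i] rX[of "Suc i"] i by auto
  moreover have "modular_flat M (X i)" using X(1) i by auto
  ultimately obtain g where "g \<in> X i" "g \<in> ?L" using L modular_flat_iff[OF fl[of i]] i by auto
  then show "\<exists>g\<in>X i. \<forall>F\<in>flats M. e \<in> F --> f \<in> F --> g \<in> F" using cl_minimal[of _ "{e,f}"] by blast
 qed
 have "(mhstep (flats M))\<^sup>*\<^sup>* (X 0) (X i)" if "i \<le> rk E" for i
  using that
 proof (induction i)
  case (Suc i)
  then show ?case using st[of i] by (auto intro: rtranclp.rtrancl_into_rtrancl)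
 qed simp
 then show "(mhstep (flats M))\<^sup>*\<^sup>* {} E" using 0 E by (metis order_refl)
next
 assume "(mhstep (flats M))\<^sup>*\<^sup>* {} E"
 then obtain n where "(mhstep (flats M) ^^ n) {} E" by (metis rtranclp_imp_relpowp)
 then obtain X where X: "X 0 = {}" "X n = E" "\<forall>i<n. mhstep (flats M) (X i) (X (Suc i))"
  unfolding relpowp_fun_conv by blast
 have r: "rk (X i) = i" if "i \<le> n" for i
  using that
 proof (induction i)
  case 0 then show ?case using X(1) by simp
 next
  case (Suc i)
  have "mhstep (flats M) (X i) (X (Suc i))" using X(3) Suc.prems by simp
  then show ?case using mhstep_rank[OF _ sim] Suc by fastforce
 qed
 then have n: "n = rk E" using X(2) by (metis order_refl)
 have mE: "modular_flat M E" unfolding modular_flat_iff[OF ground_flat]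
 proof (intro allI impI)
  fix L assume "L \<in> flats M" "rk L = 2"
  then show "E Int L ~= {}" using flat_subset[of L] by (auto simp: Int_absorb1)
 qed
 have "modular_flat M (X (n - j))" if "j \<le> n" for j
  using that
 proof (induction j)
  case 0 then show ?case using mE X(2) by simp
 next
  case (Suc j)
  then have "Suc (n - Suc j) = n - j" "n - Suc j < n" by auto
  then have "mhstep (flats M) (X (n - Suc j)) (X (n - j))" using X(3) by metis
  then show ?case using mhstep_modular[OF sim] Suc by simp
 qed
 then have "modular_flat M (X i)" if "i \<le> n" for i using that by (metis diff_diff_cancel diff_le_self)
 then show "supersolvable M" unfolding supersolvable_def
  using X(3) r n by (intro exI[of _ X]) (auto simp: mhstep_def)
qed

lemma simple_if_flats:
 assumes "{} \<in> flats M" "\<And>e. e \<in> E ==> {e} \<in> flats M"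
 shows "simple_matroid M"
proof -
 have r1: "rk {e} = 1" if "e \<in> E" for e using flat_insert_rank[OF assms(1) that] by simp
 have "{e} \<in> indep M" if "e \<in> E" for e using indep_iff_mrank[of "{e}"] r1[OF that] that by simp
 moreover have "{e, f} \<in> indep M" if "e \<in> E" "f \<in> E" "e ~= f" for e f
  using flat_insert_rank[OF assms(2)[OF that(1)] that(2)] r1[OF that(1)] that
   indep_iff_mrank[of "{f, e}"] by (auto simp: insert_commute)
 ultimately show ?thesis unfolding simple_matroid_def loop_def parallel_def by blast
qed

end

subsection \<open>Parallel connections of cliques have modular chains\<close>

text \<open>The flats of M1 and of M2 are the flats of M below their ground sets, so chains of the
  parts are chains in M and \<open>chained_glue\<close> applies.\<close>

lemma gen_parallel_connection_chained:
 assumes g: "gen_parallel_connection M1 M2 T M"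
  and T: "T = {} \<or> mrank M T = 1 \<or> mrank M T = 2 \<and> card T = 3"
  and 1: "simple_matroid M1" "chained (flats M1) (ground M1)"
  and 2: "simple_matroid M2" "chained (flats M2) (ground M2)"
 shows "matroid M \<and> simple_matroid M \<and> chained (flats M) (ground M)"
proof -
 interpret M1: matroid M1 using g by (simp add: gen_parallel_connection_def)
 interpret M2: matroid M2 using g by (simp add: gen_parallel_connection_def)
 interpret M: matroid M using g by (simp add: gen_parallel_connection_def)
 have Td: "T = M1.E Int M2.E" "T \<in> flats M1" "T \<in> flats M2" and res: "restriction M1 T = restriction M2 T"
  and gr: "M.E = M1.E Un M2.E"
  and fl: "flats M = {X. X \<subseteq> M1.E Un M2.E \<and> X Int M1.E \<in> flats M1 \<and> X Int M2.E \<in> flats M2}"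
  using g unfolding gen_parallel_connection_def by blast+
 have TT: "{X \<in> flats M1. X \<subseteq> T} = {X \<in> flats M2. X \<subseteq> T}"
  using M1.flats_restriction[OF Td(2)] M2.flats_restriction[OF Td(3)] res by simp
 have f1: "flats M1 = {X \<in> flats M. X \<subseteq> M1.E}"
 proof (intro equalityI subsetI)
  fix X assume X: "X \<in> flats M1"
  then have XE: "X \<subseteq> M1.E" by (rule M1.flat_subset)
  have "X Int T \<in> {X \<in> flats M1. X \<subseteq> T}" using M1.flat_Int[OF X Td(2)] by simp
  then have "X Int T \<in> flats M2" unfolding TT by simp
  moreover have "X Int M2.E = X Int T" "X Int M1.E = X" using XE Td by auto
  ultimately show "X \<in> {X \<in> flats M. X \<subseteq> M1.E}" using X XE by (auto simp: fl)
 qed (auto simp: fl Int_absorb2)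
 have f2: "flats M2 = {X \<in> flats M. X \<subseteq> M2.E}"
 proof (intro equalityI subsetI)
  fix X assume X: "X \<in> flats M2"
  then have XE: "X \<subseteq> M2.E" by (rule M2.flat_subset)
  have "X Int T \<in> {X \<in> flats M2. X \<subseteq> T}" using M2.flat_Int[OF X Td(3)] by simp
  then have "X Int T \<in> flats M1" unfolding TT[symmetric] by simp
  moreover have "X Int M1.E = X Int T" "X Int M2.E = X" using XE Td by auto
  ultimately show "X \<in> {X \<in> flats M. X \<subseteq> M2.E}" using X XE by (auto simp: fl)
 qed (auto simp: fl Int_absorb2)
 have E12: "M1.E \<in> flats M" "M2.E \<in> flats M" using M1.ground_flat M2.ground_flat f1 f2 by auto
 have sim: "simple_matroid M"
 proof (rule M.simple_if_flats)
  show "{} \<in> flats M" using M1.simple_empty_flat[OF 1(1)] f1 by auto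
  fix e assume "e \<in> M.E"
  then show "{e} \<in> flats M"
   using M1.simple_point_flat[OF 1(1), of e] M2.simple_point_flat[OF 2(1), of e] f1 f2 gr by auto
 qed
 have TF: "T \<in> flats M" using Td f1 by auto
 have sm: "small (flats M) (M1.E Int M2.E)"
  using T M.flat_rank1[OF sim TF] M.tri_iff[OF sim, of T] TF unfolding Td(1)[symmetric] small_def by blast
 have c1: "chained (flats M) M1.E"
  by (rule chained_superfamily[OF M.flat_Int E12(1) 1(2)[unfolded f1]])
 have c2: "chained (flats M) M2.E"
  by (rule chained_superfamily[OF M.flat_Int E12(2) 2(2)[unfolded f2]])
 have "chained (flats M) (M1.E Un M2.E)"
 proof (rule chained_glue[OF E12 M.flat_Int _ sm c1 c2])
  fix X assume X: "X \<subseteq> M1.E Un M2.E" "X Int M1.E \<in> flats M" "X Int M2.E \<in> flats M"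
  have "X Int M1.E \<in> flats M1" unfolding f1 using X(2) by simp
  moreover have "X Int M2.E \<in> flats M2" unfolding f2 using X(3) by simp
  ultimately show "X \<in> flats M" unfolding fl using X(1) by simp
 qed
 then show ?thesis using sim gr M.matroid_axioms by simp
qed

lemma finite_complete_graph: "finite_graph (complete_graph n)"
proof
 fix e assume "e \<in> edges (complete_graph n)"
 then show "ends (complete_graph n) e \<subseteq> verts (complete_graph n)" "card (ends (complete_graph n) e) \<in> {1, 2}"
  by (auto simp: complete_graph_def)
next
 show "finite (edges (complete_graph n))"
  by (rule finite_subset[of _ "Pow {..<n}"]) (auto simp: complete_graph_def)
qed (auto simp: complete_graph_def)

text \<open>The isomorphism pulls the cuts of the complete graph back to a row space of N. Cuts are
  given by sets of vertices other than 0, so the rank is at most n - 1 \<le> 3; every edge lies in a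
  triangle, and \<open>chained_rank3\<close> applies.\<close>

lemma complete_graph_chained:
 assumes N: "matroid N" and iso: "isomorphic N (cycle_matroid (complete_graph n))" and n: "n \<in> {3, 4}"
 shows "simple_matroid N \<and> chained (flats N) (ground N)"
proof -
 let ?K = "complete_graph n"
 interpret K: finite_graph ?K by (rule finite_complete_graph)
 interpret matroid N by fact
 have gK: "ground (cycle_matroid ?K) = edges ?K" by (simp add: cycle_matroid_def)
 have eK: "edges ?K = {e. e \<subseteq> {..<n} \<and> card e = 2}" "ends ?K = (\<lambda>e. e)" "verts ?K = {..<n}" by (auto simp: complete_graph_def)
 obtain f where f: "bij_betw f E (edges ?K)" and ind: "\<And>X. X \<subseteq> E ==> X \<in> indep N \<longleftrightarrow> f ` X \<in> indep (cycle_matroid ?K)"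
  using iso unfolding isomorphic_def gK by blast
 have inj: "inj_on f E" and im: "f ` E = edges ?K" using f by (auto simp: bij_betw_def)
 define pull where "pull D = {e \<in> E. f e \<in> D}" for D
 have pull_trace: "f ` (pull D Int X) = D Int f ` X" if "X \<subseteq> E" for X D using that by (auto simp: pull_def)
 have sing: "pull D Int X = {x} \<longleftrightarrow> D Int f ` X = {f x}" if X: "X \<subseteq> E" "x \<in> X" for D X x
 proof
  assume "D Int f ` X = {f x}"
  then have "f ` (pull D Int X) = f ` {x}" using pull_trace[OF X(1)] by simp
  then show "pull D Int X = {x}" by (rule inj_on_image_eq_iff[OF inj, THEN iffD1, rotated 2]) (use X in \<open>auto simp: pull_def\<close>)
 next
  assume "pull D Int X = {x}"
  then show "D Int f ` X = {f x}" using pull_trace[OF X(1), of D] by simp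
 qed
 have rep: "binary_rep (pull ` cuts ?K) N" unfolding binary_rep_def
 proof (intro conjI ballI)
  show "{} \<in> pull ` cuts ?K" using K.subspace_cuts by (auto simp: subspace2_def pull_def intro!: image_eqI[of _ _ "{}"])
  fix C D assume "C \<in> pull ` cuts ?K" "D \<in> pull ` cuts ?K"
  then obtain C' D' where CD: "C' \<in> cuts ?K" "D' \<in> cuts ?K" "C = pull C'" "D = pull D'" by auto
  have "sym_diff C D = pull (sym_diff C' D')" unfolding CD by (auto simp: pull_def)
  then show "sym_diff C D \<in> pull ` cuts ?K" using subspace2D[OF K.subspace_cuts CD(1,2)] by simp
 next
  show "indep N = {X. X \<subseteq> ground N \<and> (\<forall>x\<in>X. \<exists>C\<in>pull ` cuts ?K. C Int X = {x})}"
  proof (rule set_eqI)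
   fix X
   show "X \<in> indep N \<longleftrightarrow> X \<in> {X. X \<subseteq> ground N \<and> (\<forall>x\<in>X. \<exists>C\<in>pull ` cuts ?K. C Int X = {x})}"
   proof (cases "X \<subseteq> E")
    case True
    then have "f ` X \<subseteq> edges ?K" using im by auto
    then have "X \<in> indep N \<longleftrightarrow> (\<forall>x\<in>X. \<exists>D\<in>cuts ?K. D Int f ` X = {f x})"
     unfolding ind[OF True] K.indep_cycle_matroid_cuts by simp
    then show ?thesis using True sing[OF True] by simp
   next
    case False then show ?thesis using indep_subset by blast
   qed
  qed
 qed (auto simp: pull_def)
 interpret B: binary_matroid N "pull ` cuts ?K" by unfold_locales (rule rep)
 have sim: "simple_matroid N"
 proof -
  have i2: "{e, e'} \<in> indep N" if e: "e \<in> E" "e' \<in> E" for e e'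
  proof -
   have ex: "\<exists>C\<in>pull ` cuts ?K. C Int {x, y} = {x}" if xy: "x \<in> E" "y \<in> E" for x y
   proof -
    have fx: "f x \<in> edges ?K" "f y \<in> edges ?K" using im xy by auto
    obtain a where a: "a \<in> f x" "x ~= y --> a \<notin> f y"
    proof (cases "x = y")
     case True
     have "f x ~= {}" using fx(1) eK by auto
     then show ?thesis using that True by auto
    next
     case False
     then have "f x ~= f y" using inj xy by (auto simp: inj_on_def)
     moreover have "card (f x) = card (f y)" "finite (f y)" using fx eK finite_subset by auto
     ultimately have "\<not> f x \<subseteq> f y" using card_subset_eq by blast
     then show ?thesis using that by auto
    qed
    have "card (f x) = 2" using fx eK by auto
    then have "\<not> f x \<subseteq> {a}" using card_mono[of "{a}" "f x"] by auto
    then have "f x \<in> cut ?K {a}" "x ~= y --> f y \<notin> cut ?K {a}" using a fx eK by (auto simp: cut_def)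
    then have "pull (cut ?K {a}) Int {x, y} = {x}" using xy by (auto simp: pull_def)
    then show ?thesis unfolding cuts_def by blast
   qed
   have "{e, e'} = {e', e}" by auto
   then show ?thesis unfolding B.indep_iff using ex[OF e] ex[OF e(2,1)] e by auto
  qed
  then have "{e} \<in> indep N" if "e \<in> E" for e using i2[OF that that] by simp
  then show ?thesis using i2 unfolding simple_matroid_def loop_def parallel_def by blast
 qed
 have "cuts ?K \<subseteq> cut ?K ` Pow {1..<n}"
 proof
  fix D assume "D \<in> cuts ?K"
  then obtain P where P: "D = cut ?K P" by (auto simp: cuts_def)
  show "D \<in> cut ?K ` Pow {1..<n}"
  proof (cases "0 \<in> P")
   case True
   then have "{..<n} - P \<subseteq> {1..<n}" by (auto simp: Suc_le_eq intro: gr0I)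
   then show ?thesis using K.cut_compl[of P] P eK by (intro image_eqI[of _ _ "{..<n} - P"]) auto
  next
   case False
   then have "P Int {..<n} \<subseteq> {1..<n}" by (auto simp: Suc_le_eq intro: gr0I)
   then show ?thesis using K.cut_Int_verts[of P] P eK by (intro image_eqI[of _ _ "P Int {..<n}"]) auto
  qed
 qed
 then have "card (cuts ?K) \<le> card (cut ?K ` Pow {1..<n})" by (intro card_mono) auto
 also have "\<dots> \<le> card (Pow {1..<n})" by (rule card_image_le) simp
 also have "\<dots> = 2 ^ (n - 1)" by (simp add: card_Pow)
 finally have "card (cuts ?K) \<le> 2 ^ (n - 1)" .
 moreover have "finite (cuts ?K)" by (rule finite_subset[of _ "Pow (edges ?K)"]) (use K.finite_edges in \<open>auto simp: cuts_def cut_def\<close>)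
 then have "card (pull ` cuts ?K) \<le> card (cuts ?K)" by (rule card_image_le)
 ultimately have "2 ^ rk E \<le> (2::nat) ^ (n - 1)" using B.card_space by linarith
 then have "rk E \<le> n - 1" by simp
 then have r: "rk E \<le> 3" using n by auto
 have tri: "\<exists>T. tri (flats N) T \<and> p \<in> T" if p: "p \<in> E" for p
 proof -
  have "f p \<in> edges ?K" using im p by auto
  then obtain a b where ab: "f p = {a, b}" "a ~= b" "a < n" "b < n" unfolding eK by (auto simp: card_2_iff)
  have "\<exists>c. c < n \<and> c ~= a \<and> c ~= b"
  proof (rule ccontr)
   assume "\<not> ?thesis"
   then have "{..<n} \<subseteq> {a, b}" by auto
   then have "card {..<n} \<le> card {a, b}" by (intro card_mono) auto
   moreover have "card {a, b} \<le> 2" by (simp add: card_insert_if)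
   ultimately show False using n by auto
  qed
  then obtain c where c: "c < n" "c ~= a" "c ~= b" by auto
  have "{a, c} \<in> f ` E" "{b, c} \<in> f ` E" using ab c im unfolding eK by auto
  then obtain q r where qr: "q \<in> E" "f q = {a, c}" "r \<in> E" "f r = {b, c}" by (metis imageE)
  have ne: "p ~= q" "p ~= r" "q ~= r" using ab c qr by (auto simp: doubleton_eq_iff)
  have fE: "{a,b} \<in> edges ?K" "{a,c} \<in> edges ?K" "{b,c} \<in> edges ?K" using ab c unfolding eK by auto
  have "even (card (C Int {p, q, r}))" if C: "C \<in> pull ` cuts ?K" for C
  proof (rule B.even_tripleI[OF _ ne])
   obtain P where P: "C = pull (cut ?K P)" using C by (auto simp: cuts_def)
   have m: "{x, y} \<in> cut ?K P \<longleftrightarrow> (x \<in> P) ~= (y \<in> P)" if "{x, y} \<in> edges ?K" for x y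
    by (rule K.mem_cut_pair[OF that]) (simp add: eK)
   show "p \<in> C \<longleftrightarrow> (q \<in> C \<longleftrightarrow> r \<notin> C)"
    unfolding P pull_def using p qr ab m[OF fE(1)] m[OF fE(2)] m[OF fE(3)] by auto
  qed
  then have "tri (flats N) {p, q, r}" unfolding B.tri_even[OF sim] using p qr ne by auto
  then show ?thesis by blast
 qed
 show ?thesis using sim B.chained_rank3[OF sim r tri] by simp
qed

theorem assembled_chained:
 fixes M :: "'a pre_matroid"
 assumes "assembled M \<K> \<U>"
 shows "matroid M \<and> simple_matroid M \<and> chained (flats M) (ground M)"
 using assms
proof induction
 case empty
 interpret matroid "\<lparr>ground = {}, indep = {{}}\<rparr> :: 'a pre_matroid" by unfold_locales auto
 have "simple_matroid (\<lparr>ground = {}, indep = {{}}\<rparr> :: 'a pre_matroid)" by (auto simp: simple_matroid_def loop_def parallel_def)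
 then show ?case using chained_card1 matroid_axioms by simp
next
 case (point e)
 interpret matroid "\<lparr>ground = {e}, indep = {{}, {e}}\<rparr>" by unfold_locales auto
 have "simple_matroid \<lparr>ground = {e}, indep = {{}, {e}}\<rparr>" by (auto simp: simple_matroid_def loop_def parallel_def)
 then show ?case using chained_card1 matroid_axioms by simp
next
 case (K3 N)
 then show ?case using complete_graph_chained[of N 3] by simp
next
 case (K4 N)
 then show ?case using complete_graph_chained[of N 4] by simp
next
 case (connect M1 \<K>1 \<U>1 M2 \<K>2 \<U>2 T M)
 then show ?case using gen_parallel_connection_chained[of M1 M2 T M] by blast
qed

subsection \<open>From a modular chain to a chordal graph\<close>

text \<open>A perfect elimination order read backwards: each new vertex is joined to a clique of
  earlier vertices. The bound 3 on the clique comes from \<open>mhstep_card\<close>.\<close>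

inductive peo :: "('v => 'v => bool) => 'v set => bool" for A where
 peo_empty: "peo A {}"
| peo_insert: "peo A V ==> v \<notin> V ==> card {u \<in> V. A v u} \<le> 3 ==>
  (\<And>u w. u \<in> V ==> w \<in> V ==> A v u ==> A v w ==> u ~= w ==> A u w) ==> peo A (insert v V)"

lemma peo_finite: "peo A V ==> finite V" by (induction rule: peo.induct) auto

lemma peo_cong:
 assumes "peo A V" "\<And>u w. u \<in> V ==> w \<in> V ==> A u w \<longleftrightarrow> A' u w" shows "peo A' V"
 using assms
proof (induction rule: peo.induct)
 case (peo_insert V v)
 have eq: "{u \<in> V. A' v u} = {u \<in> V. A v u}" using peo_insert.prems by auto
 show ?case
 proof (rule peo.peo_insert)
  show "peo A' V" using peo_insert.IH peo_insert.prems by auto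
  show "card {u \<in> V. A' v u} \<le> 3" using eq peo_insert.hyps by simp
  fix u w assume "u \<in> V" "w \<in> V" "A' v u" "A' v w" "u ~= w"
  then show "A' u w" using peo_insert.hyps(4)[of u w] peo_insert.prems by blast
 qed (rule peo_insert.hyps)
qed (rule peo.peo_empty)

context binary_matroid
begin

lemma mhstep_tri:
 assumes sim: "simple_matroid M" and st: "mhstep (flats M) X Y" and ef: "e \<in> Y - X" "f \<in> Y - X" "e ~= f"
 shows "\<exists>g\<in>X. tri (flats M) {e, f, g}"
proof -
 obtain g where g: "g \<in> X" "\<forall>F\<in>flats M. e \<in> F --> f \<in> F --> g \<in> F" using mhstepD[OF st, of e f] ef by auto
 have XY: "X \<in> flats M" "Y \<in> flats M" using st by (auto simp: mhstep_def)
 have efE: "{e, f} \<subseteq> E" using ef flat_subset[OF XY(2)] by auto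
 have L: "cl {e, f} \<in> flats M" "rk (cl {e, f}) = 2"
  using cl_flat[OF efE] mrank_cl[OF efE] simple_rank2[OF sim _ _ ef(3)] efE by auto
 have sub: "{e, f, g} \<subseteq> cl {e, f}" using g(2) L(1) subset_cl[OF efE] by auto
 have c3: "card {e, f, g} = 3" using ef g(1) by (auto simp: card_insert_if)
 have "card (cl {e, f}) \<le> 3" using card_line_le3[OF sim L] by auto
 then have "{e, f, g} = cl {e, f}" using sub c3 finite_flat[OF L(1)] by (intro card_seteq) auto
 then have "tri (flats M) {e, f, g}" unfolding tri_iff[OF sim] using L c3 by simp
 then show ?thesis using g(1) by blast
qed

lemma tri_mem:
 assumes sim: "simple_matroid M" and T: "tri (flats M) {e, f, g}" and C: "C \<in> \<C>"
 shows "g \<in> C \<longleftrightarrow> (e \<in> C) ~= (f \<in> C)"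
proof -
 have T': "card {e, f, g} = 3" "even (card (C Int {e, f, g}))" using T C unfolding tri_even[OF sim] by auto
 have "e ~= f" "e ~= g" "f ~= g" using T'(1) by (auto simp: card_insert_if split: if_splits)
 then show ?thesis using even_tripleD[OF T'(2)] by auto
qed

end

context cographic_matroid
begin

lemma restriction_rep:
 assumes Z: "Z \<subseteq> E"
 obtains G' where "cographic_matroid (restriction M Z) G'"
proof -
 have "cographic M" unfolding cographic_def using is_dual finite_graph_axioms by blast
 then have "cographic (restriction M Z)" using cographic_restriction[OF matroid_axioms _ Z] by blast
 then obtain G' :: "(nat, 'a) mgraph" where "finite_graph G'" "restriction M Z = dual (cycle_matroid G')"
  unfolding cographic_def by blast
 then have "cographic_matroid (restriction M Z) G'"
  unfolding cographic_matroid_def cographic_matroid_axioms_def using restriction_matroid by blast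
 then show ?thesis using that by blast
qed

lemma card_le_rank_subset:
 assumes sim: "simple_matroid M" and Z: "Z \<subseteq> E"
 shows "card Z = rk Z \<or> card Z + 3 \<le> 3 * rk Z"
proof -
 obtain G' where "cographic_matroid (restriction M Z) G'" using restriction_rep[OF Z] .
 then interpret N: cographic_matroid "restriction M Z" G' .
 have "N.E = Z" by (rule ground_restriction[OF Z])
 moreover have "mrank (restriction M Z) Z = rk Z" by (rule mrank_restriction) simp
 ultimately show ?thesis using N.card_le_rank[OF simple_restriction[OF sim]] by simp
qed

text \<open>Four elements outside a modular hyperplane would produce \<open>M(K\<^sub>5)\<close> or the Fano plane, both of
  which have too many elements for their rank.\<close>

lemma mhstep_card:
 assumes sim: "simple_matroid M" and st: "mhstep (flats M) X Y"
 shows "card (Y - X) \<le> 3"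
proof (rule ccontr)
 assume "\<not> card (Y - X) \<le> 3"
 then have "4 \<le> card (Y - X)" by simp
 then obtain D where D: "D \<subseteq> Y - X" "card D = 4" by (meson obtain_subset_with_card_n)
 then obtain e1 e2 e3 e4 where e: "D = {e1, e2, e3, e4}" "e1 ~= e2" "e1 ~= e3" "e1 ~= e4" "e2 ~= e3" "e2 ~= e4" "e3 ~= e4"
  by (auto simp: card_Suc_eq numeral_eq_Suc)
 have eD: "e1 \<in> Y - X" "e2 \<in> Y - X" "e3 \<in> Y - X" "e4 \<in> Y - X" using D e by auto
 have XY: "X \<in> flats M" "Y \<in> flats M" using st by (auto simp: mhstep_def)
 have YE: "Y \<subseteq> E" and XE: "X \<subseteq> E" using XY flat_subset by auto
 obtain g12 where g12: "g12 \<in> X" "tri (flats M) {e1, e2, g12}" using mhstep_tri[OF sim st eD(1,2) e(2)] by blast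
 obtain g13 where g13: "g13 \<in> X" "tri (flats M) {e1, e3, g13}" using mhstep_tri[OF sim st eD(1,3) e(3)] by blast
 obtain g14 where g14: "g14 \<in> X" "tri (flats M) {e1, e4, g14}" using mhstep_tri[OF sim st eD(1,4) e(4)] by blast
 obtain g23 where g23: "g23 \<in> X" "tri (flats M) {e2, e3, g23}" using mhstep_tri[OF sim st eD(2,3) e(5)] by blast
 obtain g24 where g24: "g24 \<in> X" "tri (flats M) {e2, e4, g24}" using mhstep_tri[OF sim st eD(2,4) e(6)] by blast
 obtain g34 where g34: "g34 \<in> X" "tri (flats M) {e3, e4, g34}" using mhstep_tri[OF sim st eD(3,4) e(7)] by blast
 note m12 = tri_mem[OF sim g12(2)] and m13 = tri_mem[OF sim g13(2)] and m14 = tri_mem[OF sim g14(2)]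
  and m23 = tri_mem[OF sim g23(2)] and m24 = tri_mem[OF sim g24(2)] and m34 = tri_mem[OF sim g34(2)]
 have sep: "\<exists>C\<in>cycs G. (x \<in> C) ~= (y \<in> C)" if "x \<in> Y" "y \<in> Y" "x ~= y" for x y
  using simple_separate[OF sim, of x y] that YE by blast
 have eY: "e1 \<in> Y" "e2 \<in> Y" "e3 \<in> Y" "e4 \<in> Y" using eD by auto
 \<comment> \<open>If two third points with a common index agreed, the columns of the two remaining
   elements would be equal.\<close>
 have n1: "g12 ~= g13" using sep[OF eY(2,3) e(5)] m12 m13 by blast
 have n2: "g12 ~= g23" using sep[OF eY(1,3) e(3)] m12 m23 by blast
 have n3: "g13 ~= g23" using sep[OF eY(1,2) e(2)] m13 m23 by blast
 have n4: "g12 ~= g14" using sep[OF eY(2,4) e(6)] m12 m14 by blast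
 have n5: "g12 ~= g24" using sep[OF eY(1,4) e(4)] m12 m24 by blast
 have n6: "g13 ~= g14" using sep[OF eY(3,4) e(7)] m13 m14 by blast
 have n7: "g13 ~= g34" using sep[OF eY(1,4) e(4)] m13 m34 by blast
 have n8: "g14 ~= g24" using sep[OF eY(1,2) e(2)] m14 m24 by blast
 have n9: "g14 ~= g34" using sep[OF eY(1,3) e(3)] m14 m34 by blast
 have n10: "g23 ~= g24" using sep[OF eY(3,4) e(7)] m23 m24 by blast
 have n11: "g23 ~= g34" using sep[OF eY(2,4) e(6)] m23 m34 by blast
 have n12: "g24 ~= g34" using sep[OF eY(2,3) e(5)] m24 m34 by blast
 have DE: "D \<subseteq> E" using D YE by auto
 have gcl: "g \<in> cl D" if "tri (flats M) {x, y, g}" "x \<in> D" "y \<in> D" "x ~= y" for x y g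
  using triD[OF that(1), of x y "cl D"] that subset_cl[OF DE] cl_flat[OF DE] by auto
 have gc: "g12 \<in> cl D" "g13 \<in> cl D" "g14 \<in> cl D" "g23 \<in> cl D" "g24 \<in> cl D" "g34 \<in> cl D"
  by (rule gcl[OF g12(2)] gcl[OF g13(2)] gcl[OF g14(2)] gcl[OF g23(2)] gcl[OF g24(2)] gcl[OF g34(2)];
    use e in simp)+
 have bound: "card Z = rk Z \<or> card Z + 3 \<le> 3 * rk Z" "rk Z \<le> rk D" if "Z \<subseteq> cl D" for Z
  using card_le_rank_subset[OF sim, of Z] that cl_subset mrank_mono[OF that] mrank_cl[OF DE] by auto
 have rD: "rk D \<le> 4" using mrank_le_card[of D] D e by simp
 show False
 proof (cases "rk D = 4")
  case True
  \<comment> \<open>A row isolating e1 separates the third points of complementary pairs, so there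
    are ten elements of rank at most 4, against the bound 9.\<close>
  then have "D \<in> indep M" using indep_iff_mrank[OF DE] D by simp
  have odd: "\<exists>C\<in>cycs G. C Int D = {e1}" by (rule indepD[OF \<open>D \<in> indep M\<close>]) (simp add: e)
  then obtain C where C: "C \<in> cycs G" "C Int D = {e1}" by blast
  have Ce: "e1 \<in> C" "e2 \<notin> C" "e3 \<notin> C" "e4 \<notin> C" using C(2) e by auto
  have d: "g12 ~= g34" "g13 ~= g24" "g14 ~= g23"
   using m12[OF C(1)] m34[OF C(1)] m13[OF C(1)] m24[OF C(1)] m14[OF C(1)] m23[OF C(1)] Ce by auto
  let ?Z = "{e1, e2, e3, e4} Un {g12, g13, g14, g23, g24, g34}"
  have "card {g12, g13, g14, g23, g24, g34} = 6"
   using n1 n2 n3 n4 n5 n6 n7 n8 n9 n10 n11 n12 d by (simp add: card_insert_if)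
  moreover have "card {e1, e2, e3, e4} = 4" using e by (simp add: card_insert_if)
  moreover have "{e1, e2, e3, e4} Int {g12, g13, g14, g23, g24, g34} = {}"
   using eD g12(1) g13(1) g14(1) g23(1) g24(1) g34(1) by auto
  ultimately have c: "card ?Z = 10" by (subst card_Un_disjoint) auto
  have "?Z \<subseteq> cl D" using subset_cl[OF DE] gc e(1) by auto
  then show False using bound[of ?Z] c rD by auto
 next
  case False
  \<comment> \<open>Seven elements of rank at most 3, against the bound 6.\<close>
  let ?Z = "{e1, e2, e3, e4} Un {g12, g13, g23}"
  have "card {g12, g13, g23} = 3" using n1 n2 n3 by simp
  moreover have "card {e1, e2, e3, e4} = 4" using e by (simp add: card_insert_if)
  moreover have "{e1, e2, e3, e4} Int {g12, g13, g23} = {}"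
   using eD g12(1) g13(1) g23(1) by auto
  ultimately have c: "card ?Z = 7" by (subst card_Un_disjoint) auto
  have "?Z \<subseteq> cl D" using subset_cl[OF DE] gc e(1) by auto
  then show False using bound[of ?Z] c rD False by auto
 qed
qed

text \<open>The cycle matroid of H is the restriction of M to X, expressed as equality of row
  spaces, together with an elimination order of H.\<close>

definition represents :: "(nat, 'a) mgraph => 'a set => bool" where
 "represents H X \<longleftrightarrow> finite_graph H \<and> edges H = X \<and> cuts H = (\<lambda>C. C Int X) ` cycs G \<and> peo (adjacent H) (verts H)"

text \<open>The new elements become edges from a new vertex v to the vertices
  \<open>\<phi> e\<close>. The third point g on the line of e and f joins \<open>\<phi> e\<close> to
  \<open>\<phi> f\<close>, so e, f, g form a triangle.\<close>

lemma represents_extend: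
 assumes sim: "simple_matroid M" and st: "mhstep (flats M) X Y" and H: "represents H X"
  and \<phi>: "inj_on \<phi> (Y - X)" "\<phi> ` (Y - X) \<subseteq> verts H"
   "\<And>e f. e \<in> Y - X ==> f \<in> Y - X ==> e ~= f ==>
     \<exists>g\<in>X. ends H g = {\<phi> e, \<phi> f} \<and> (\<forall>C\<in>cycs G. g \<in> C \<longleftrightarrow> (e \<in> C) ~= (f \<in> C))"
 shows "\<exists>H'. represents H' Y"
proof -
 have H': "finite_graph H" "edges H = X" "cuts H = (\<lambda>C. C Int X) ` cycs G" "peo (adjacent H) (verts H)"
  using H by (auto simp: represents_def)
 interpret H: finite_graph H by fact
 have XY: "X \<in> flats M" "Y \<in> flats M" "X \<subset> Y" using st by (auto simp: mhstep_def)
 have YE: "Y \<subseteq> E" using XY flat_subset by auto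
 obtain v where v: "v \<notin> verts H" using H.finite_verts ex_new_if_finite infinite_UNIV_nat by blast
 define K where "K = \<lparr>verts = insert v (verts H), edges = Y, ends = (\<lambda>e. if e \<in> X then ends H e else {\<phi> e, v})\<rparr>"
 have Ks: "verts K = insert v (verts H)" "edges K = Y" "\<And>e. e \<in> X ==> ends K e = ends H e"
  "\<And>e. e \<in> Y - X ==> ends K e = {\<phi> e, v}" by (auto simp: K_def)
 have fK: "finite_graph K"
 proof
  show "finite (verts K)" using H.finite_verts Ks by simp
  show "finite (edges K)" using YE finite_ground finite_subset Ks by auto
  fix e assume "e \<in> edges K"
  then have "e \<in> X \<or> e \<in> Y - X" using Ks by auto
  then have "ends K e \<subseteq> verts K \<and> card (ends K e) \<in> {1, 2}"
  proof
   assume "e \<in> X"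
   then show ?thesis using Ks H.ends_in_verts[of e] H.card_ends[of e] H'(2) by auto
  next
   assume "e \<in> Y - X"
   then show ?thesis using Ks \<phi>(2) by (auto simp: card_insert_if)
  qed
  then show "ends K e \<subseteq> verts K" "card (ends K e) \<in> {1, 2}" by auto
 qed
 interpret K: finite_graph K by fact
 have cX: "cut K P Int X = cut H P" for P
  using Ks H'(2) XY by (auto simp: cut_def)
 have cD: "e \<in> cut K P \<longleftrightarrow> (\<phi> e \<in> P) ~= (v \<in> P)" if "e \<in> Y - X" for e P
  using K.mem_cut_pair[of e "\<phi> e" v P] Ks that by auto
 obtain e0 where e0: "e0 \<in> Y - X" using XY by auto
 \<comment> \<open>On the new elements a row is determined by its trace on X and its value at
   e0.\<close>
 have rel: "(f \<in> C \<longleftrightarrow> ((\<phi> e0 \<in> P) ~= (\<phi> f \<in> P)) ~= (e0 \<in> C))" if f: "f \<in> Y - X" and C: "C \<in> cycs G" "C Int X = cut H P" for f C P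
 proof (cases "f = e0")
  case False
  then obtain g where g: "g \<in> X" "ends H g = {\<phi> e0, \<phi> f}" "g \<in> C \<longleftrightarrow> (e0 \<in> C) ~= (f \<in> C)"
   using \<phi>(3)[OF e0 f] C(1) by metis
  have "g \<in> cut H P \<longleftrightarrow> (\<phi> e0 \<in> P) ~= (\<phi> f \<in> P)" using H.mem_cut_pair[OF _ g(2)] g(1) H'(2) by simp
  moreover have "g \<in> C \<longleftrightarrow> g \<in> cut H P" using C(2) g(1) by blast
  ultimately show ?thesis using g(3) by blast
 qed simp
 have v_free: "cut H (insert v P) = cut H P" "cut H (P - {v}) = cut H P" for P
 proof -
  have "insert v P Int verts H = P Int verts H" "(P - {v}) Int verts H = P Int verts H" using v by auto
  then show "cut H (insert v P) = cut H P" "cut H (P - {v}) = cut H P" using H.cut_Int_verts by metis+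
 qed
 have "e0 \<in> E" "e0 \<notin> X" using e0 YE by auto
 \<comment> \<open>This row plays the role of the star of v; adding it changes the value at e0 and
   nothing on X.\<close>
 then obtain CD where CD: "CD \<in> cycs G" "e0 \<in> CD" "CD Int X = {}" using flatD[OF XY(1)] by blast
 have eqI: "C Int Y = cut K P" if C: "C \<in> cycs G" "C Int X = cut H P" "e0 \<in> C \<longleftrightarrow> e0 \<in> cut K P" for C P
 proof (rule set_eqI)
  fix f
  show "f \<in> C Int Y \<longleftrightarrow> f \<in> cut K P"
  proof (cases "f \<in> Y")
   case True
   show ?thesis
   proof (cases "f \<in> X")
    case True then show ?thesis using C(2) cX[of P] XY by blast
   next
    case False
    then have f: "f \<in> Y - X" using True by auto
    show ?thesis using rel[OF f C(1,2)] cD[OF f, of P] cD[OF e0, of P] C(3) True by blast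
   qed
  next
   case False then show ?thesis by (auto simp: cut_def Ks)
  qed
 qed
 have "cuts K = (\<lambda>C. C Int Y) ` cycs G"
 proof (intro equalityI subsetI)
  fix D assume "D \<in> cuts K"
  then obtain P where P: "D = cut K P" by (auto simp: cuts_def)
  have "cut H P \<in> (\<lambda>C. C Int X) ` cycs G" using H'(3) by (auto simp: cuts_def)
  then obtain C where C: "C \<in> cycs G" "C Int X = cut H P" by auto
  show "D \<in> (\<lambda>C. C Int Y) ` cycs G"
  proof (cases "e0 \<in> C \<longleftrightarrow> e0 \<in> cut K P")
   case True
   then show ?thesis using eqI[OF C True] C(1) P by auto
  next
   case False
   have "sym_diff C CD \<in> cycs G" by (rule space_sym_diff[OF C(1) CD(1)])
   moreover have "sym_diff C CD Int X = cut H P" using C(2) CD(3) by auto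
   moreover have "e0 \<in> sym_diff C CD \<longleftrightarrow> e0 \<in> cut K P" using False CD(2) by auto
   ultimately show ?thesis using eqI[of "sym_diff C CD" P] P by blast
  qed
 next
  fix D assume "D \<in> (\<lambda>C. C Int Y) ` cycs G"
  then obtain C where C: "C \<in> cycs G" "D = C Int Y" by auto
  have "C Int X \<in> cuts H" using C H'(3) by auto
  then obtain P where P: "C Int X = cut H P" by (auto simp: cuts_def)
  \<comment> \<open>Putting v inside or outside P does not change the cut of H, but exactly one
    choice gives the right value at e0.\<close>
  have P1: "C Int X = cut H (P - {v})" "C Int X = cut H (insert v P)" using P v_free by auto
  have nv: "\<phi> e0 ~= v" using \<phi>(2) e0 v by auto
  have "e0 \<in> cut K (P - {v}) \<longleftrightarrow> e0 \<notin> cut K (insert v P)" using cD[OF e0] nv by auto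
  then consider "e0 \<in> C \<longleftrightarrow> e0 \<in> cut K (P - {v})" | "e0 \<in> C \<longleftrightarrow> e0 \<in> cut K (insert v P)" by blast
  then have "\<exists>P. C Int Y = cut K P"
  proof cases
   case 1 then show ?thesis using eqI[OF C(1) P1(1)] by blast
  next
   case 2 then show ?thesis using eqI[OF C(1) P1(2)] by blast
  qed
  then show "D \<in> cuts K" using C(2) by (auto simp: cuts_def)
 qed
 moreover have "peo (adjacent K) (verts K)"
 proof -
  have old: "adjacent H u w \<longleftrightarrow> adjacent K u w" if "u \<in> verts H" "w \<in> verts H" for u w
  proof
   assume "adjacent H u w"
   then obtain e where e: "e \<in> X" "ends H e = {u, w}" by (auto simp: adjacent_def H'(2))
   then have "e \<in> edges K" "ends K e = {u, w}" using Ks XY(3) by auto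
   then show "adjacent K u w" unfolding adjacent_def by blast
  next
   assume "adjacent K u w"
   then obtain e where e: "e \<in> Y" "ends K e = {u, w}" by (auto simp: adjacent_def Ks)
   have "e \<in> X"
   proof (rule ccontr)
    assume "e \<notin> X"
    then have "v \<in> {u, w}" using e Ks(4)[of e] by auto
    then show False using that v by auto
   qed
   then show "adjacent H u w" using e Ks(3) H'(2) by (auto simp: adjacent_def)
  qed
  have nb: "\<exists>e\<in>Y - X. u = \<phi> e" if u: "u \<in> verts H" "adjacent K v u" for u
  proof -
   obtain e where e: "e \<in> Y" "ends K e = {v, u}" using u by (auto simp: adjacent_def Ks)
   have "e \<notin> X"
   proof
    assume "e \<in> X"
    then have "v \<in> verts H" using e Ks(3) H.ends_in_verts[of e] H'(2) by auto
    then show False using v by simp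
   qed
   then have "{v, u} = {\<phi> e, v}" "e \<in> Y - X" using e Ks(4)[of e] by auto
   then show ?thesis using u v by (auto simp: doubleton_eq_iff)
  qed
  have "peo (adjacent K) (insert v (verts H))"
  proof (rule peo.peo_insert[OF _ v])
   show "peo (adjacent K) (verts H)" by (rule peo_cong[OF H'(4) old])
   have "{u \<in> verts H. adjacent K v u} \<subseteq> \<phi> ` (Y - X)" using nb by blast
   moreover have fD: "finite (Y - X)" using YE finite_ground finite_subset by blast
   ultimately have "card {u \<in> verts H. adjacent K v u} \<le> card (\<phi> ` (Y - X))" by (intro card_mono) auto
   also have "\<dots> \<le> card (Y - X)" by (rule card_image_le[OF fD])
   finally show "card {u \<in> verts H. adjacent K v u} \<le> 3" using mhstep_card[OF sim st] by simp
  next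
   fix u w assume uw: "u \<in> verts H" "w \<in> verts H" "adjacent K v u" "adjacent K v w" "u ~= w"
   obtain e f where ef: "e \<in> Y - X" "u = \<phi> e" "f \<in> Y - X" "w = \<phi> f" using nb uw by meson
   then obtain g where "g \<in> X" "ends H g = {u, w}" using \<phi>(3)[of e f] uw(5) by blast
   then have "adjacent H u w" using H'(2) by (auto simp: adjacent_def)
   then show "adjacent K u w" using old uw by blast
  qed
  then show ?thesis using Ks by simp
 qed
 ultimately have "represents K Y" unfolding represents_def using fK Ks by simp
 then show ?thesis by blast
qed

lemma represents_pair:
 assumes sim: "simple_matroid M" and H: "represents H X" and X: "X \<subseteq> E" and g: "g \<in> X"
 obtains a b where "ends H g = {a, b}" "a ~= b" "a \<in> verts H" "b \<in> verts H"
proof -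
 have H': "finite_graph H" "edges H = X" "cuts H = (\<lambda>C. C Int X) ` cycs G"
  using H by (auto simp: represents_def)
 interpret H: finite_graph H by fact
 obtain a b where ab: "ends H g = {a, b}" "a \<in> verts H" "b \<in> verts H" using H.ends_pair g H'(2) by blast
 have "{g, g} \<in> indep M" using simple_indep2[OF sim, of g g] g X by auto
 then obtain C where "C \<in> cycs G" "C Int {g, g} = {g}" using indepD[of "{g,g}" g] by auto
 then have "g \<in> C Int X" "C Int X \<in> cuts H" using g H'(3) by auto
 then obtain P where "g \<in> cut H P" by (auto simp: cuts_def)
 then have "a ~= b" using H.mem_cut_pair[of g a b P] ab g H'(2) by auto
 then show ?thesis using that ab by blast
qed

lemma represents_separate:
 assumes sim: "simple_matroid M" and H: "represents H X" and X: "X \<subseteq> E" and g: "g \<in> X" "h \<in> X" "g ~= h"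
 shows "ends H g ~= ends H h"
proof
 assume eq: "ends H g = ends H h"
 have H': "cuts H = (\<lambda>C. C Int X) ` cycs G" "edges H = X" using H by (auto simp: represents_def)
 obtain C where C: "C \<in> cycs G" "g \<in> C" "h \<notin> C" using simple_separate[OF sim, of g h] g X by blast
 then have "C Int X \<in> cuts H" using H' by auto
 then obtain P where "C Int X = cut H P" by (auto simp: cuts_def)
 then have "g \<in> cut H P" "h \<notin> cut H P" using C g by auto
 then show False using eq g H'(2) by (auto simp: cut_def)
qed

text \<open>A single new element becomes a bridge, for which an isolated vertex is supplied first.
  For two, the third point is an edge whose ends receive them. For three, the three third points
  form a triangle of H, whose corners receive them.\<close>

lemma chain_represents:
 assumes sim: "simple_matroid M" and ch: "(mhstep (flats M))\<^sup>*\<^sup>* {} Y"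
 shows "\<exists>H. represents H Y"
 using ch
proof (induction rule: rtranclp_induct)
 case base
 let ?H = "\<lparr>verts = {}, edges = {}, ends = (\<lambda>_. {})\<rparr> :: (nat, 'a) mgraph"
 have "finite_graph ?H" by unfold_locales auto
 moreover have "cuts ?H = {{}}" by (auto simp: cuts_def cut_def)
 moreover have "(\<lambda>C. C Int {}) ` cycs G = {{}}" using space_empty by auto
 ultimately have "represents ?H {}" unfolding represents_def by (simp add: peo.peo_empty)
 then show ?case by blast
next
 case (step X Y)
 then obtain H where H: "represents H X" by blast
 have H': "finite_graph H" "edges H = X" "cuts H = (\<lambda>C. C Int X) ` cycs G" "peo (adjacent H) (verts H)"
  using H by (auto simp: represents_def)
 interpret H: finite_graph H by fact
 have XY: "X \<in> flats M" "Y \<in> flats M" "X \<subset> Y" using step(2) by (auto simp: mhstep_def)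
 have XE: "X \<subseteq> E" and YE: "Y \<subseteq> E" using XY flat_subset by auto
 note pr = represents_pair[OF sim H XE]
 have fD: "finite (Y - X)" using YE finite_ground finite_subset by blast
 moreover have "Y - X ~= {}" using XY by auto
 ultimately have "card (Y - X) ~= 0" by simp
 then consider "card (Y - X) = 1" | "card (Y - X) = 2" | "card (Y - X) = 3"
  using mhstep_card[OF sim step(2)] by linarith
 then show ?case
 proof cases
  case 1
  then obtain e where e: "Y - X = {e}" by (auto simp: card_1_singleton_iff)
  obtain w where w: "w \<notin> verts H" using H.finite_verts ex_new_if_finite infinite_UNIV_nat by blast
  let ?H = "H\<lparr>verts := insert w (verts H)\<rparr>"
  have "finite_graph ?H"
   by unfold_locales (use H.finite_verts H.finite_edges H.ends_in_verts H.card_ends in auto)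
  moreover have "cut ?H P = cut H P" for P by (simp add: cut_def)
  then have "cuts ?H = cuts H" by (simp add: cuts_def)
  moreover have adj: "adjacent ?H = adjacent H" by (intro ext) (simp add: adjacent_def)
  moreover have "peo (adjacent H) (insert w (verts H))"
  proof (rule peo.peo_insert[OF H'(4) w])
   have no: "\<not> adjacent H w u" for u using H.ends_in_verts w by (auto simp: adjacent_def)
   then show "card {u \<in> verts H. adjacent H w u} \<le> 3" by simp
   show "adjacent H w u ==> adjacent H u x" for u x using no by simp
  qed
  ultimately have "represents ?H X" using H' by (simp add: represents_def)
  then show ?thesis by (rule represents_extend[OF sim step(2), of _ "\<lambda>_. w"]) (use e in auto)
 next
  case 2
  then obtain e f where ef: "Y - X = {e, f}" "e ~= f" by (auto simp: card_2_iff)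
  then obtain g where g: "g \<in> X" "tri (flats M) {e, f, g}" using mhstep_tri[OF sim step(2), of e f] by auto
  obtain a b where ab: "ends H g = {a, b}" "a ~= b" "a \<in> verts H" "b \<in> verts H" using pr[OF g(1)] .
  have ba: "ends H g = {b, a}" using ab by auto
  note m = tri_mem[OF sim g(2)]
  show ?thesis
  proof (rule represents_extend[OF sim step(2) H, of "\<lambda>x. if x = e then a else b"])
   fix x y assume "x \<in> Y - X" "y \<in> Y - X" "x ~= y"
   then have "x = e \<and> y = f \<or> x = f \<and> y = e" using ef by auto
   then show "\<exists>g\<in>X. ends H g = {if x = e then a else b, if y = e then a else b} \<and> (\<forall>C\<in>cycs G. g \<in> C \<longleftrightarrow> (x \<in> C) ~= (y \<in> C))"
    using g(1) ab ba ef(2) m by (intro bexI[of _ g]) auto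
  qed (use ef ab in \<open>auto simp: inj_on_def\<close>)
 next
  case 3
  then obtain e f h where efh: "Y - X = {e, f, h}" "e ~= f" "e ~= h" "f ~= h"
   by (auto simp: card_Suc_eq numeral_3_eq_3)
  obtain p where p: "p \<in> X" "tri (flats M) {e, f, p}" using mhstep_tri[OF sim step(2), of e f] efh by auto
  obtain q where q: "q \<in> X" "tri (flats M) {e, h, q}" using mhstep_tri[OF sim step(2), of e h] efh by auto
  obtain r where r: "r \<in> X" "tri (flats M) {f, h, r}" using mhstep_tri[OF sim step(2), of f h] efh by auto
  note mp = tri_mem[OF sim p(2)] and mq = tri_mem[OF sim q(2)] and mr = tri_mem[OF sim r(2)]
  have YY: "e \<in> E" "f \<in> E" "h \<in> E" using efh(1) YE by auto
  have pq: "p ~= q" using simple_separate[OF sim YY(2,3) efh(4)] mp mq by blast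
  have prr: "p ~= r" using simple_separate[OF sim YY(1,3) efh(3)] mp mr by blast
  have cutpqr: "p \<in> cut H P \<longleftrightarrow> (q \<in> cut H P) ~= (r \<in> cut H P)" for P
  proof -
   have "cut H P \<in> (\<lambda>C. C Int X) ` cycs G" using H'(3) by (auto simp: cuts_def)
   then obtain C where C: "C \<in> cycs G" "cut H P = C Int X" by auto
   then show ?thesis using mp[OF C(1)] mq[OF C(1)] mr[OF C(1)] p(1) q(1) r(1) by blast
  qed
  have mem: "g \<in> cut H {x} \<longleftrightarrow> x \<in> ends H g" if g: "g \<in> X" for g x
  proof -
   obtain a b where "ends H g = {a, b}" "a ~= b" using pr[OF g] .
   then show ?thesis using H.mem_cut_pair[of g a b "{x}"] g H'(2) by auto
  qed
  \<comment> \<open>The columns of p, q, r sum to zero, so every vertex lies on none or two of these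
    edges.\<close>
  have star: "x \<in> ends H p \<longleftrightarrow> (x \<in> ends H q) ~= (x \<in> ends H r)" for x
   using cutpqr[of "{x}"] mem p(1) q(1) r(1) by blast
  obtain x y where xy: "ends H p = {x, y}" "x ~= y" "x \<in> verts H" "y \<in> verts H" using pr[OF p(1)] .
  have two: "ends H g = {s, t}" if g: "g \<in> X" "s \<in> ends H g" "t \<in> ends H g" "s ~= t" for g s t
  proof -
   obtain a b where "ends H g = {a, b}" "a ~= b" using pr[OF g(1)] .
   then show ?thesis using g by auto
  qed
  have nq: "\<not> (x \<in> ends H q \<and> y \<in> ends H q)"
   using two[OF q(1), of x y] xy represents_separate[OF sim H XE p(1) q(1) pq] by auto
  have nr: "\<not> (x \<in> ends H r \<and> y \<in> ends H r)"
   using two[OF r(1), of x y] xy represents_separate[OF sim H XE p(1) r(1) prr] by auto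
  obtain a b where ab: "ends H p = {a, b}" "a ~= b" "a \<in> ends H q" "b \<in> ends H r" "a \<notin> ends H r" "b \<notin> ends H q"
  proof (cases "x \<in> ends H q")
   case True
   then show ?thesis using that[of x y] xy nq star[of x] star[of y] by auto
  next
   case False
   then show ?thesis using that[of y x] xy nr star[of x] star[of y] by (auto simp: insert_commute)
  qed
  obtain c where c: "ends H q = {a, c}" "c ~= a"
  proof -
   obtain s t where "ends H q = {s, t}" "s ~= t" using pr[OF q(1)] .
   then show ?thesis using that[of s] that[of t] ab(3) by (auto simp: insert_commute)
  qed
  have cb: "c ~= b" using c ab by auto
  have "c \<in> ends H r" using star[of c] c ab cb by auto
  then have rr: "ends H r = {b, c}" using two[OF r(1) ab(4) _ cb[symmetric]] by simp
  have cv: "a \<in> verts H" "b \<in> verts H" "c \<in> verts H"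
   using H.ends_in_verts p(1) q(1) ab(1) c(1) H'(2) by blast+
  let ?\<phi> = "\<lambda>x. if x = e then a else if x = f then b else c"
  show ?thesis
  proof (rule represents_extend[OF sim step(2) H, of ?\<phi>])
   fix x y assume "x \<in> Y - X" "y \<in> Y - X" "x ~= y"
   then consider "x = e" "y = f" | "x = f" "y = e" | "x = e" "y = h" | "x = h" "y = e" | "x = f" "y = h" | "x = h" "y = f"
    using efh by auto
   then show "\<exists>g\<in>X. ends H g = {?\<phi> x, ?\<phi> y} \<and> (\<forall>C\<in>cycs G. g \<in> C \<longleftrightarrow> (x \<in> C) ~= (y \<in> C))"
   proof cases
    case 1 then show ?thesis using p(1) mp ab(1) efh by (intro bexI[of _ p]) auto
   next
    case 2 then show ?thesis using p(1) mp ab(1) efh by (intro bexI[of _ p]) auto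
   next
    case 3 then show ?thesis using q(1) mq c(1) efh by (intro bexI[of _ q]) auto
   next
    case 4 then show ?thesis using q(1) mq c(1) efh by (intro bexI[of _ q]) auto
   next
    case 5 then show ?thesis using r(1) mr rr efh by (intro bexI[of _ r]) auto
   next
    case 6 then show ?thesis using r(1) mr rr efh by (intro bexI[of _ r]) auto
   qed
  qed (use efh ab(2) c(2) cb cv in \<open>auto simp: inj_on_def\<close>)
 qed
qed

end

subsection \<open>Assembling the graph from cliques\<close>

definition common :: "('v => 'v => bool) => 'v set => 'v set => 'v set" where
 "common A S T = {x \<in> S. \<forall>t\<in>T. A x t}"

definition clique :: "('v => 'v => bool) => 'v set => bool" where
 "clique A T \<longleftrightarrow> (\<forall>u\<in>T. \<forall>w\<in>T. u ~= w --> A u w)"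

lemma cliqueD: "clique A T ==> u \<in> T ==> w \<in> T ==> u ~= w ==> A u w"
 unfolding clique_def by simp

text \<open>The set \<open>R\<close> records the triangles that lie in exactly one \<open>K\<^sub>4\<close>: these are the triangles along which a
  further \<open>K\<^sub>4\<close> may be attached. A triangle that is a maximal clique never enters \<open>R\<close>; if it is to lie
  in a \<open>K\<^sub>4\<close>, the whole \<open>K\<^sub>4\<close> is attached along an edge at once.\<close>

inductive ctree :: "('v => 'v => bool) => 'v set => 'v set set => bool" for A where
 ct0: "ctree A {} {}"
| ct1: "ctree A V R ==> v \<notin> V ==> {u \<in> V. A v u} = {} ==> ctree A (insert v V) R"
| ct2: "ctree A V R ==> v \<notin> V ==> {u \<in> V. A v u} = {a} ==> ctree A (insert v V) R"
| ct3: "ctree A V R ==> v \<notin> V ==> {u \<in> V. A v u} = {a, b} ==> a ~= b ==> A a b ==> ctree A (insert v V) R"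
| ct4: "ctree A V R ==> v \<notin> V ==> w \<notin> V ==> v ~= w ==> A v w ==> {u \<in> V. A v u} = {a, b} ==>
   {u \<in> V. A w u} = {a, b} ==> a ~= b ==> A a b ==>
   ctree A (insert w (insert v V)) (R Un {{a,b,v}, {a,b,w}, {a,v,w}, {b,v,w}})"
| ct5: "ctree A V R ==> v \<notin> V ==> {u \<in> V. A v u} = {a, b, c} ==> {a, b, c} \<in> R ==> card {a, b, c} = 3 ==>
   clique A {a, b, c} ==>
   ctree A (insert v V) ((R - {{a, b, c}}) Un {{a,b,v}, {a,c,v}, {b,c,v}})"

definition unique_K4 :: "('v => 'v => bool) => 'v set => 'v set set" where
 "unique_K4 A S = {T. T \<subseteq> S \<and> card T = 3 \<and> clique A T \<and> card (common A S T) = 1}"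

text \<open>Vertices taken off the elimination order but not yet attached: each is the only one
  completing its triangle in V to a K4, and waits until a vertex of that triangle is
  removed.\<close>

definition pendant :: "('v => 'v => bool) => 'v set => 'v set => bool" where
 "pendant A V W \<longleftrightarrow> finite W \<and> W Int V = {} \<and> (\<forall>w\<in>W. \<forall>x\<in>W. \<not> A w x) \<and>
   (\<forall>w\<in>W. card {u \<in> V. A w u} = 3 \<and> clique A {u \<in> V. A w u} \<and>
    card (common A (V Un W) {u \<in> V. A w u}) = 1)"

lemma common_mono: "finite S ==> S' \<subseteq> S ==> card (common A S' T) \<le> card (common A S T)"
 unfolding common_def by (intro card_mono) auto

locale chordal_K4 =
 fixes A :: "'v => 'v => bool" and U :: "'v set"
 assumes sym: "A x y \<longleftrightarrow> A y x" and irrefl: "\<not> A x x" and finU: "finite U"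
  and K4_le2: "T \<subseteq> U ==> card T = 3 ==> clique A T ==> card (common A U T) \<le> 2"
begin

lemma common_insert: "common A (insert v S) T = (if \<forall>t\<in>T. A v t then insert v (common A S T) else common A S T)"
 unfolding common_def by auto

lemma common_insert_no: "\<not> (\<forall>t\<in>T. A v t) ==> common A (insert v S) T = common A S T"
 unfolding common_def by auto

lemma unique_K4_insert:
 assumes S: "finite S" "v \<notin> S" and N: "card {u \<in> S. A v u} \<le> 2"
 shows "{T \<in> unique_K4 A (insert v S). v \<notin> T} = unique_K4 A S"
proof -
 have "common A (insert v S) T = common A S T" if T: "T \<subseteq> S" "card T = 3" for T
 proof -
  have "\<not> (\<forall>t\<in>T. A v t)"
  proof
   assume "\<forall>t\<in>T. A v t"
   then have "T \<subseteq> {u \<in> S. A v u}" using T by auto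
   then have "card T \<le> card {u \<in> S. A v u}" using S by (intro card_mono) auto
   then show False using T N by simp
  qed
  then show ?thesis by (rule common_insert_no)
 qed
 note eq = this
 show ?thesis
 proof (rule set_eqI)
  fix T
  show "T \<in> {T \<in> unique_K4 A (insert v S). v \<notin> T} \<longleftrightarrow> T \<in> unique_K4 A S"
  proof (cases "T \<subseteq> S \<and> card T = 3")
   case True then show ?thesis using eq[of T] S(2) by (auto simp: unique_K4_def)
  next
   case False then show ?thesis by (auto simp: unique_K4_def)
  qed
 qed
qed

lemma unique_K4_at:
 assumes "T \<in> unique_K4 A (insert v S)" "v \<in> T" "v \<notin> S"
 shows "\<exists>x y z. T = {x, y, v} \<and> x \<in> S \<and> y \<in> S \<and> x ~= y \<and> A v x \<and> A v y \<and> A x y \<and> z \<in> S \<and> A z x \<and> A z y \<and> A v z"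
proof -
 have T: "T \<subseteq> insert v S" "card T = 3" "clique A T" "card (common A (insert v S) T) = 1"
  using assms by (auto simp: unique_K4_def)
 have "finite T" using T(2) by (rule_tac card_ge_0_finite) simp
 then have "card (T - {v}) = 2" using T(2) assms(2) by simp
 then obtain x y where xy: "T - {v} = {x, y}" "x ~= y" by (auto simp: card_2_iff)
 obtain z where z: "z \<in> common A (insert v S) T" using T(4) by fastforce
 have "z ~= v" using z assms(2) irrefl by (auto simp: common_def)
 moreover have "z \<in> insert v S" "\<forall>t\<in>T. A z t" using z by (auto simp: common_def)
 moreover have xyT: "x \<in> T" "y \<in> T" "x ~= v" "y ~= v" using xy by auto
 moreover have "T = {x, y, v}" using xy assms(2) by auto
 ultimately show ?thesis using T(1,3) xy(2) assms(2) sym unfolding clique_def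
  by (intro exI[of _ x] exI[of _ y] exI[of _ z]) auto
qed

text \<open>The elimination order may attach v to a triangle that lies in no K4 so far, which
  \<open>ctree\<close> does not offer. Such a v is moved to the pendant set W. When later a vertex v
  of the triangle of some w in W is removed, its neighbours in V are the other two corners, and v
  and w are attached together along this edge (\<open>ct4\<close>). If the triangle at v does lie in
  a K4 already, it lies in exactly one, since two is the maximum, and \<open>ct5\<close>
  applies.\<close>

theorem peo_ctree:
 assumes "peo A V" "pendant A V W" "V Un W \<subseteq> U"
 shows "ctree A (V Un W) (unique_K4 A (V Un W))"
 using assms
proof (induction V arbitrary: W rule: peo.induct)
 case peo_empty
 have "W = {}"
 proof (rule ccontr)
  assume "W ~= {}"
  then obtain w where "w \<in> W" by auto
  then show False using peo_empty by (auto simp: pendant_def)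
 qed
 moreover have "unique_K4 A {} = {}" by (auto simp: unique_K4_def)
 ultimately show ?case by (simp add: ctree.ct0)
next
 case (peo_insert V v)
 let ?S = "V Un W"
 have finV: "finite V" using peo_finite[OF peo_insert.hyps(1)] .
 have finW: "finite W" and disW: "W Int insert v V = {}" and indW: "\<And>w x. w \<in> W ==> x \<in> W ==> \<not> A w x"
  using peo_insert.prems(1) by (auto simp: pendant_def)
 have finS: "finite ?S" using finV finW by simp
 have vS: "v \<notin> ?S" using peo_insert.hyps(2) disW by auto
 have SU: "insert v ?S \<subseteq> U" using peo_insert.prems(2) by auto
 let ?K = "{u \<in> V. A v u}"
 have Kcl: "clique A ?K" using peo_insert.hyps(4) by (auto simp: clique_def)
 have finK: "finite ?K" using finV by simp
 have pW: "card {u \<in> insert v V. A w u} = 3" "clique A {u \<in> insert v V. A w u}"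
  "card (common A (insert v ?S) {u \<in> insert v V. A w u}) = 1" if "w \<in> W" for w
  using peo_insert.prems(1) that by (auto simp: pendant_def)
 have att: "\<exists>a b. {u \<in> insert v V. A w u} = {a, b, v} \<and> a ~= b \<and> a \<in> ?K \<and> b \<in> ?K \<and> {u \<in> V. A w u} = {a, b}"
  if w: "w \<in> W" "A w v" for w
 proof -
  let ?T = "{u \<in> insert v V. A w u}"
  have "v \<in> ?T" using w by simp
  then obtain a b where ab: "?T = {v, a, b}" "v ~= a" "v ~= b" "a ~= b"
   using card3_obtain[OF pW(1)[OF w(1)], of v] by metis
  have aT: "a \<in> ?T" "b \<in> ?T" "v \<in> ?T" using ab(1) by auto
  have "A v a" "A v b"
   by (rule cliqueD[OF pW(2)[OF w(1)] aT(3,1) ab(2)], rule cliqueD[OF pW(2)[OF w(1)] aT(3,2) ab(3)])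
  moreover have "a \<in> V" "b \<in> V" using aT ab by auto
  moreover have "{u \<in> V. A w u} = ?T - {v}" using peo_insert.hyps(2) by auto
  then have "{u \<in> V. A w u} = {a, b}" unfolding ab(1) using ab by auto
  moreover have "?T = {a, b, v}" unfolding ab(1) by blast
  ultimately show ?thesis using ab(4) by (intro exI[of _ a] exI[of _ b]) simp
 qed
 have noatt: "{u \<in> insert v V. A w u} = {u \<in> V. A w u}" if "\<not> A w v" for w using that by auto
 have keep: "pendant A V W'" if W': "W' \<subseteq> W" "\<And>w. w \<in> W' ==> \<not> A w v" for W'
  unfolding pendant_def
 proof (intro conjI ballI)
  show "finite W'" using finite_subset[OF W'(1) finW] .
  show "W' Int V = {}" using W'(1) disW by auto
  fix w assume w: "w \<in> W'"
  then have wW: "w \<in> W" "\<not> A w v" using W' by auto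
  show "card {u \<in> V. A w u} = 3" "clique A {u \<in> V. A w u}" using pW[OF wW(1)] noatt[OF wW(2)] by simp_all
  have "card (common A (V Un W') {u \<in> V. A w u}) \<le> card (common A (insert v ?S) {u \<in> V. A w u})"
   by (rule common_mono) (use finS W'(1) in auto)
  then have le: "card (common A (V Un W') {u \<in> V. A w u}) \<le> 1" using pW(3)[OF wW(1)] noatt[OF wW(2)] by simp
  have "w \<in> common A (V Un W') {u \<in> V. A w u}" using w by (auto simp: common_def)
  moreover have "finite (common A (V Un W') {u \<in> V. A w u})"
   using finV finite_subset[OF W'(1) finW] by (simp add: common_def)
  ultimately have "card (common A (V Un W') {u \<in> V. A w u}) ~= 0" by auto
  then show "card (common A (V Un W') {u \<in> V. A w u}) = 1" using le by simp
  fix x assume "x \<in> W'"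
  then show "\<not> A w x" using indW wW(1) W'(1) by auto
 qed
 have goal: "insert v V Un W = insert v ?S" by auto
 have NS: "{u \<in> ?S. A v u} = ?K" if "\<And>w. w \<in> W ==> \<not> A w v"
  using that sym by auto
 show ?case
 proof (cases "card ?K = 3")
  case True
  \<comment> \<open>Otherwise the triangle a, b, v of w would be completed to a K4 both by w and by
    the third neighbour k of v.\<close>
  have no: "\<not> A w v" if w: "w \<in> W" for w
  proof
   assume "A w v"
   then obtain a b where ab: "{u \<in> insert v V. A w u} = {a, b, v}" "a ~= b" "a \<in> ?K" "b \<in> ?K"
    using att[OF w] by blast
   have "card (?K - {a, b}) = 1" using True ab finK by (subst card_Diff_subset) auto
   then obtain k where "?K - {a, b} = {k}" using card_1_singletonE by blast
   then have "k \<in> ?K - {a, b}" by (simp only: singletonI)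
   then have k: "k \<in> ?K" "k ~= a" "k ~= b" by simp_all
   have "A k a" "A k b" using cliqueD[OF Kcl] ab k by auto
   moreover have "A k v" using k(1) sym by simp
   ultimately have "k \<in> common A (insert v ?S) {a, b, v}" using k by (auto simp: common_def)
   moreover have "w \<in> common A (insert v ?S) {a, b, v}" using w ab(1) by (auto simp: common_def)
   moreover have "k ~= w" using k disW w by auto
   moreover have "finite (common A (insert v ?S) {a, b, v})" using finS by (simp add: common_def)
   ultimately have "card {k, w} \<le> card (common A (insert v ?S) {a, b, v})" by (intro card_mono) auto
   then show False using pW(3)[OF w] ab(1) \<open>k ~= w\<close> by simp
  qed
  have pend: "pendant A V W" using keep[of W] no by auto
  have N: "{u \<in> ?S. A v u} = ?K" using NS no by blast
  have KS: "?K \<subseteq> ?S" by auto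
  show ?thesis
  proof (cases "common A ?S ?K = {}")
   case True': True
   \<comment> \<open>Only v completes the triangle of its neighbours to a K4, so v becomes
     pendant.\<close>
   have "pendant A V (insert v W)" unfolding pendant_def
   proof (intro conjI ballI)
    show "finite (insert v W)" using finW by simp
    show "insert v W Int V = {}" using disW peo_insert.hyps(2) by auto
    fix w x assume "w \<in> insert v W" "x \<in> insert v W"
    moreover have "\<not> A v y" if "y \<in> W" for y using no[OF that] sym by simp
    ultimately show "\<not> A w x" using indW no irrefl by auto
   next
    fix w assume w: "w \<in> insert v W"
    have un: "V Un insert v W = insert v ?S" by auto
    show "card {u \<in> V. A w u} = 3" "clique A {u \<in> V. A w u}"
     using w True Kcl pW noatt no by auto
    show "card (common A (V Un insert v W) {u \<in> V. A w u}) = 1"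
    proof (cases "w = v")
     case True
     then show ?thesis unfolding un using True' by (simp add: common_insert)
    next
     case False
     then have "w \<in> W" using w by simp
     then show ?thesis unfolding un using pW(3) noatt[OF no] by metis
    qed
   qed
   moreover have "V Un insert v W = insert v V Un W" by auto
   ultimately show ?thesis using peo_insert.IH[of "insert v W"] SU by auto
  next
   case False
   have IH: "ctree A ?S (unique_K4 A ?S)" using peo_insert.IH[OF pend] SU by auto
   have "card (common A (insert v ?S) ?K) \<le> card (common A U ?K)"
    by (rule common_mono) (use SU finU in auto)
   also have "\<dots> \<le> 2" using K4_le2[of ?K] SU True Kcl by auto
   finally have le: "card (common A (insert v ?S) ?K) \<le> 2" .
   have ci: "common A (insert v ?S) ?K = insert v (common A ?S ?K)" by (simp add: common_insert)
   have finC: "finite (common A ?S ?K)" using finS by (simp add: common_def)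
   have "v \<notin> common A ?S ?K" using vS by (auto simp: common_def)
   then have "card (insert v (common A ?S ?K)) = Suc (card (common A ?S ?K))" using finC by simp
   moreover have "card (common A ?S ?K) ~= 0" using False finC by simp
   ultimately have c1: "card (common A ?S ?K) = 1" "card (common A (insert v ?S) ?K) = 2"
    using le unfolding ci by linarith+
   obtain a b c where abc: "?K = {a, b, c}" "a ~= b" "a ~= c" "b ~= c"
    using True by (auto simp: card_Suc_eq numeral_3_eq_3)
   have KR: "{a, b, c} \<in> unique_K4 A ?S" using KS True Kcl c1(1) unfolding abc(1)[symmetric] by (simp add: unique_K4_def)
   have vn: "A v a" "A v b" "A v c" "a \<in> V" "b \<in> V" "c \<in> V" using abc(1) by auto
   have ac: "A a b" "A a c" "A b c" using cliqueD[OF Kcl[unfolded abc(1)]] abc(2-4) by auto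
   have at: "{x, y, v} \<in> unique_K4 A (insert v ?S)"
    if xyz: "{x, y, z} = {a, b, c}" "x ~= y" "x ~= z" "y ~= z" for x y z
   proof -
    have X: "A v x" "A v y" "A v z" "A x y" "A z x" "A z y" "x \<in> V" "y \<in> V" "z \<in> V"
    proof -
     have m: "x \<in> ?K" "y \<in> ?K" "z \<in> ?K" unfolding abc(1) xyz(1)[symmetric] by simp_all
     then show "A v x" "A v y" "A v z" "x \<in> V" "y \<in> V" "z \<in> V" by simp_all
     show "A x y" by (rule cliqueD[OF Kcl m(1,2) xyz(2)])
     show "A z x" by (rule cliqueD[OF Kcl m(3,1) xyz(3)[symmetric]])
     show "A z y" by (rule cliqueD[OF Kcl m(3,2) xyz(4)[symmetric]])
    qed
    have "common A (insert v ?S) {x, y, v} = {z}"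
    proof (intro equalityI subsetI)
     fix t assume t: "t \<in> common A (insert v ?S) {x, y, v}"
     then have "t ~= v" "t \<in> ?S" "A v t" using irrefl sym by (auto simp: common_def)
     then have "t \<in> {a, b, c}" using N abc(1) by auto
     moreover have "t ~= x" "t ~= y" using t irrefl by (auto simp: common_def)
     ultimately show "t \<in> {z}" using xyz(1) by auto
    qed (use X sym in \<open>auto simp: common_def\<close>)
    moreover have "card {x, y, v} = 3" using xyz X vS by (auto simp: card_insert_if)
    moreover have "clique A {x, y, v}" using X sym by (auto simp: clique_def)
    ultimately show ?thesis using X by (auto simp: unique_K4_def)
   qed
   have "unique_K4 A (insert v ?S) = (unique_K4 A ?S - {{a, b, c}}) Un {{a,b,v}, {a,c,v}, {b,c,v}}"
   proof (intro equalityI subsetI)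
    fix T assume T: "T \<in> unique_K4 A (insert v ?S)"
    show "T \<in> (unique_K4 A ?S - {{a, b, c}}) Un {{a,b,v}, {a,c,v}, {b,c,v}}"
    proof (cases "v \<in> T")
     case True
     then obtain x y where xy: "T = {x, y, v}" "x \<in> ?S" "y \<in> ?S" "x ~= y" "A v x" "A v y"
      using unique_K4_at[OF T _ vS] by blast
     then have "x \<in> {a, b, c}" "y \<in> {a, b, c}" using N abc(1) by auto
     then show ?thesis using xy(1,4) by auto
    next
     case False
     have ne: "T ~= {a, b, c}" using T c1(2) unfolding abc(1)[symmetric] by (auto simp: unique_K4_def)
     have T': "T \<subseteq> ?S" "card T = 3" "clique A T" "card (common A (insert v ?S) T) = 1"
      using T False by (auto simp: unique_K4_def)
     have "\<not> (\<forall>t\<in>T. A v t)"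
     proof
      assume "\<forall>t\<in>T. A v t"
      then have "T \<subseteq> ?K" using T'(1) N by blast
      then have "T = ?K" using T'(2) True finK by (intro card_subset_eq) auto
      then show False using ne abc(1) by simp
     qed
     then show ?thesis using T' ne by (simp add: unique_K4_def common_insert_no)
    qed
   next
    fix T assume "T \<in> (unique_K4 A ?S - {{a, b, c}}) Un {{a,b,v}, {a,c,v}, {b,c,v}}"
    then show "T \<in> unique_K4 A (insert v ?S)"
    proof
     assume T: "T \<in> unique_K4 A ?S - {{a, b, c}}"
     then have T': "T \<subseteq> ?S" "card T = 3" "clique A T" "card (common A ?S T) = 1" "T ~= {a,b,c}" by (auto simp: unique_K4_def)
     have "\<not> (\<forall>t\<in>T. A v t)"
     proof
      assume "\<forall>t\<in>T. A v t"
      then have "T \<subseteq> ?K" using T'(1) N by blast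
      then have "T = ?K" using T'(2) True finK by (intro card_subset_eq) auto
      then show False using T'(5) abc(1) by simp
     qed
     then show ?thesis using T' by (auto simp: unique_K4_def common_insert_no)
    next
     have "{a, c, b} = {a, b, c}" "{b, c, a} = {a, b, c}" by auto
     moreover assume "T \<in> {{a,b,v}, {a,c,v}, {b,c,v}}"
     ultimately show ?thesis using at[of a b c] at[of a c b] at[of b c a] abc(2-4) by auto
    qed
   qed
   moreover have "ctree A (insert v ?S) ((unique_K4 A ?S - {{a, b, c}}) Un {{a,b,v}, {a,c,v}, {b,c,v}})"
    by (rule ctree.ct5[OF IH vS _ KR]) (use N abc Kcl True in auto)
   ultimately show ?thesis unfolding goal by simp
  qed
 next
  case False
  then have K2: "card ?K \<le> 2" using peo_insert.hyps(3) by simp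
  show ?thesis
  proof (cases "\<exists>w\<in>W. A w v")
   case False
   then have no: "\<And>w. w \<in> W ==> \<not> A w v" by auto
   have N: "{u \<in> ?S. A v u} = ?K" using NS no by blast
   have IH: "ctree A ?S (unique_K4 A ?S)" using peo_insert.IH[OF keep[of W]] no SU by auto
   have "v \<notin> T" if T: "T \<in> unique_K4 A (insert v ?S)" for T
   proof
    assume "v \<in> T"
    then obtain x y z where xyz: "x \<in> ?S" "y \<in> ?S" "x ~= y" "A v x" "A v y" "z \<in> ?S" "A z x" "A z y" "A v z"
     using unique_K4_at[OF T _ vS] by blast
    then have "{x, y, z} \<subseteq> ?K" using N by blast
    moreover have "card {x, y, z} = 3" using xyz irrefl by (auto simp: card_insert_if)
    ultimately show False using card_mono[OF finK, of "{x,y,z}"] K2 by simp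
   qed
   then have R: "unique_K4 A (insert v ?S) = unique_K4 A ?S"
    using unique_K4_insert[OF finS vS] N K2 by auto
   have "card ?K = 0 \<or> card ?K = 1 \<or> card ?K = 2" using K2 by auto
   then show ?thesis
   proof (elim disjE)
    assume "card ?K = 0"
    then have "?K = {}" using finK by simp
    with N have "{u \<in> ?S. A v u} = {}" by (rule trans)
    then show ?thesis unfolding goal R by (rule ctree.ct1[OF IH vS])
   next
    assume "card ?K = 1"
    then obtain a where "?K = {a}" by (auto simp: card_1_singleton_iff)
    with N have "{u \<in> ?S. A v u} = {a}" by (rule trans)
    then show ?thesis unfolding goal R by (rule ctree.ct2[OF IH vS])
   next
    assume "card ?K = 2"
    then obtain a b where ab: "?K = {a, b}" "a ~= b" by (auto simp: card_2_iff)
    then have "A a b" using Kcl by (auto simp: clique_def)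
    moreover have "{u \<in> ?S. A v u} = {a, b}" using N ab(1) by (rule trans)
    ultimately show ?thesis unfolding goal R using ctree.ct3[OF IH vS _ ab(2)] by blast
   qed
  next
   case True
   then obtain w where w: "w \<in> W" "A w v" by auto
   obtain a b where ab: "{u \<in> insert v V. A w u} = {a, b, v}" "a ~= b" "a \<in> ?K" "b \<in> ?K" "{u \<in> V. A w u} = {a, b}"
    using att[OF w] by blast
   have "{a, b} = ?K" by (rule card_seteq[OF finK]) (use ab(2-4) K2 in simp_all)
   then have Kab: "?K = {a, b}" by simp
   let ?W = "W - {w}" and ?S' = "V Un (W - {w})"
   \<comment> \<open>Two pendant vertices adjacent to v would both complete the triangle a, b,
     v.\<close>
   have no: "\<not> A x v" if x: "x \<in> ?W" for x
   proof
    assume "A x v"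
    then obtain a' b' where ab': "{u \<in> insert v V. A x u} = {a', b', v}" "a' ~= b'" "a' \<in> ?K" "b' \<in> ?K"
     using att[of x] x by blast
    then have eq: "{a', b', v} = {a, b, v}" unfolding Kab by auto
    have "x \<in> common A (insert v ?S) {a, b, v}" using ab'(1) x eq by (auto simp: common_def)
    moreover have "w \<in> common A (insert v ?S) {a, b, v}" using ab(1) w by (auto simp: common_def)
    moreover have "finite (common A (insert v ?S) {a, b, v})" using finS by (simp add: common_def)
    ultimately have "card {x, w} \<le> card (common A (insert v ?S) {a, b, v})" by (intro card_mono) auto
    then show False using pW(3)[OF w(1)] ab(1) x by simp
   qed
   have IH: "ctree A ?S' (unique_K4 A ?S')" using peo_insert.IH[OF keep[of ?W]] no SU by auto
   have vS': "v \<notin> ?S'" "w \<notin> insert v ?S'" using vS w disW by auto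
   have Nv: "{u \<in> ?S'. A v u} = {a, b}" using no Kab sym by auto
   have Nw: "{u \<in> ?S'. A w u} = {a, b}" using ab(5) indW[OF w(1)] by auto
   have Nw': "{u \<in> insert v ?S'. A w u} = {a, b, v}" using Nw w(2) by auto
   have Avs: "A a b" "A v a" "A v b" "A w a" "A w b" "A v w" "a \<in> V" "b \<in> V"
    using Kcl ab w Kab sym by (auto simp: clique_def)
   have eqS: "insert v V Un W = insert w (insert v ?S')" using w by auto
   have finS': "finite (insert v ?S')" using finS by auto
   have cl: "common A (insert w (insert v ?S')) {x, y, z} = {t}"
    if xyz: "{x, y, z, t} = {a, b, v, w}" "card {x, y, z, t} = 4" "z = v \<or> z = w" for x y z t
   proof (intro equalityI subsetI)
    fix s assume s: "s \<in> common A (insert w (insert v ?S')) {x, y, z}"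
    then have sn: "s ~= x" "s ~= y" "s ~= z" "A s z" "s \<in> insert w (insert v ?S')" using irrefl by (auto simp: common_def)
    then have "s \<in> {a, b, v, w}" using xyz(3) Nv Nw sym by blast
    then have "s \<in> {x, y, z, t}" using xyz(1) by simp
    then show "s \<in> {t}" using sn by simp
   next
    fix s assume "s \<in> {t}"
    then have s: "s = t" by simp
    have "t \<notin> {x, y, z}" using xyz(2) by (auto simp: card_insert_if split: if_splits)
    moreover have "clique A {a, b, v, w}" using Avs sym by (auto simp: clique_def)
    moreover have "t \<in> {a,b,v,w}" "x \<in> {a,b,v,w}" "y \<in> {a,b,v,w}" "z \<in> {a,b,v,w}" using xyz(1) by blast+
    ultimately show "s \<in> common A (insert w (insert v ?S')) {x, y, z}"
     unfolding s common_def clique_def using Avs(7,8) by blast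
   qed
   have c4: "card {a, b, v, w} = 4" using ab(2) Avs vS vS' disW w by (auto simp: card_insert_if)
   have in4: "{x, y, z} \<in> unique_K4 A (insert w (insert v ?S'))"
    if xyz: "{x, y, z, t} = {a, b, v, w}" "z = v \<or> z = w" for x y z t
   proof -
    have c: "card {x, y, z, t} = 4" using xyz c4 by simp
    have "card {x, y, z} = 3" using c by (auto simp: card_insert_if split: if_splits)
    moreover have "clique A {a, b, v, w}" using Avs sym by (auto simp: clique_def)
    then have "clique A {x, y, z}" using xyz(1) unfolding clique_def by blast
    moreover have "{x, y, z} \<subseteq> {a, b, v, w}" using xyz(1) by blast
    then have "{x, y, z} \<subseteq> insert w (insert v ?S')" using Avs(7,8) by auto
    ultimately show ?thesis using cl[OF xyz(1) c xyz(2)] by (simp add: unique_K4_def)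
   qed
   have "unique_K4 A (insert w (insert v ?S')) = unique_K4 A ?S' Un {{a,b,v}, {a,b,w}, {a,v,w}, {b,v,w}}"
   proof (intro equalityI subsetI)
    fix T assume T: "T \<in> unique_K4 A (insert w (insert v ?S'))"
    show "T \<in> unique_K4 A ?S' Un {{a,b,v}, {a,b,w}, {a,v,w}, {b,v,w}}"
    proof (cases "w \<in> T")
     case True
     then obtain x y where xy: "T = {x, y, w}" "x \<in> insert v ?S'" "y \<in> insert v ?S'" "x ~= y" "A w x" "A w y"
      using unique_K4_at[OF T _ vS'(2)] by blast
     then have "x \<in> {a, b, v}" "y \<in> {a, b, v}" using Nw' by auto
     then show ?thesis using xy(1,4) by auto
    next
     case wF: False
     show ?thesis
     proof (cases "v \<in> T")
      case True
      have T': "T \<subseteq> insert v ?S'" "card T = 3" "clique A T" using T wF by (auto simp: unique_K4_def)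
      have "T - {v} \<subseteq> {u \<in> ?S'. A v u}" using T'(1) cliqueD[OF T'(3) True] by auto
      then have "T \<subseteq> {a, b, v}" unfolding Nv by auto
      moreover have "card {a, b, v} = 3" using c4 by (auto simp: card_insert_if split: if_splits)
      ultimately have "T = {a, b, v}" using T'(2) by (intro card_subset_eq) auto
      then show ?thesis by simp
     next
      case False
      have T': "T \<subseteq> ?S'" "card T = 3" "clique A T" "card (common A (insert w (insert v ?S')) T) = 1"
       using T wF False by (auto simp: unique_K4_def)
      have "\<not> T \<subseteq> {a, b}" using T'(2) card_mono[of "{a,b}" T] ab(2) by auto
      then have "\<not> (\<forall>t\<in>T. A w t)" "\<not> (\<forall>t\<in>T. A v t)" using T'(1) Nv Nw by blast+
      then show ?thesis using T' by (simp add: unique_K4_def common_insert_no)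
     qed
    qed
   next
    fix T assume "T \<in> unique_K4 A ?S' Un {{a,b,v}, {a,b,w}, {a,v,w}, {b,v,w}}"
    then show "T \<in> unique_K4 A (insert w (insert v ?S'))"
    proof
     assume T: "T \<in> unique_K4 A ?S'"
     have T': "T \<subseteq> ?S'" "card T = 3" "clique A T" "card (common A ?S' T) = 1"
      using T by (auto simp: unique_K4_def)
     have "\<not> T \<subseteq> {a, b}" using T'(2) card_mono[of "{a,b}" T] ab(2) by auto
     then have "\<not> (\<forall>t\<in>T. A w t)" "\<not> (\<forall>t\<in>T. A v t)" using T'(1) Nv Nw by blast+
     then show ?thesis using T' by (auto simp: unique_K4_def common_insert_no)
    next
     have "{a, b, v, w} = {a, b, v, w}" "{a, b, w, v} = {a, b, v, w}" "{a, v, w, b} = {a, b, v, w}" "{b, v, w, a} = {a, b, v, w}" by auto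
     moreover assume "T \<in> {{a,b,v}, {a,b,w}, {a,v,w}, {b,v,w}}"
     ultimately show ?thesis using in4[of a b v w] in4[of a b w v] in4[of a v w b] in4[of b v w a] by auto
    qed
   qed
   moreover have "ctree A (insert w (insert v ?S')) (unique_K4 A ?S' Un {{a,b,v}, {a,b,w}, {a,v,w}, {b,v,w}})"
    by (rule ctree.ct4[OF IH vS'(1)]) (use vS' Avs Nv Nw ab(2) in auto)
   ultimately show ?thesis unfolding eqS by simp
  qed
 qed
qed

end

lemma (in binary_matroid) small_modular:
 assumes sim: "simple_matroid M" and S: "small (flats M) S" "S \<subseteq> E"
 shows "modular_flat M S"
proof -
 have fl: "S \<in> flats M" by (rule small_flat[OF sim S(2,1)])
 show ?thesis unfolding modular_flat_iff[OF fl]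
 proof (intro allI impI)
  fix L assume L: "L \<in> flats M" "rk L = 2" and r: "rk (S Un L) = rk S + 1"
  consider "S = {}" | p where "S = {p}" | "tri (flats M) S" using S(1) unfolding small_def by blast
  then show "S Int L ~= {}"
  proof cases
   case 1
   then show ?thesis using r L by simp
  next
   case 2
   then have "rk (insert p L) = rk L" using r L simple_rank1[OF sim, of p] S(2) by simp
   then have "p \<in> L" using flat_insert_rank[OF L(1), of p] 2 S(2) by auto
   then show ?thesis using 2 by auto
  next
   case 3
   have "rk S = 2" using 3 tri_iff[OF sim] by simp
   then show ?thesis using tri_meets_line[OF sim 3 L] r by simp
  qed
 qed
qed

section \<open>A graph H whose cycle matroid is the cographic matroid M\<close>

locale cographic_graph = cographic_matroid M G for M :: "'a pre_matroid" and G :: "(nat, 'a) mgraph" +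
 fixes H :: "(nat, 'a) mgraph"
 assumes sim: "simple_matroid M" and repr: "represents H E"
begin

lemma Hfg: "finite_graph H" and edgesH: "edges H = E" and peoH: "peo (adjacent H) (verts H)"
 using repr by (auto simp: represents_def)

sublocale H: finite_graph H by (rule Hfg)

abbreviation "adj \<equiv> adjacent H"

lemma cutsH: "cuts H = cycs G"
proof -
 have "(\<lambda>C. C Int E) ` cycs G = (\<lambda>C. C) ` cycs G" by (rule image_cong) (use space_subset in auto)
 then show ?thesis using repr by (simp add: represents_def)
qed

lemma M_cycle: "M = cycle_matroid H"
proof (rule pre_matroid.equality)
 show "ground M = ground (cycle_matroid H)" by (simp add: cycle_matroid_def edgesH)
 show "indep M = indep (cycle_matroid H)"
  by (rule set_eqI) (simp only: indep_iff H.indep_cycle_matroid_cuts cutsH edgesH)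
qed simp

lemma pair: assumes "e \<in> E" obtains a b where "ends H e = {a, b}" "a ~= b" "a \<in> verts H" "b \<in> verts H"
 by (rule represents_pair[OF sim repr order_refl assms]) blast

lemma pair_ex: "e \<in> E ==> \<exists>a b. ends H e = {a, b} \<and> a ~= b"
 by (rule pair) blast+

lemma ends_inj: "e \<in> E ==> f \<in> E ==> ends H e = ends H f ==> e = f"
 using represents_separate[OF sim repr order_refl] by blast

lemma adj_sym: "adj x y \<longleftrightarrow> adj y x" by (auto simp: adjacent_def insert_commute)

lemma clique_insert: "clique adj Q ==> (\<And>u. u \<in> Q ==> adj v u) ==> clique adj (insert v Q)"
 unfolding clique_def by (metis adj_sym insertE)

lemma not_adj_outside: "(\<And>u. u \<in> Q ==> adj v u ==> u \<in> S) ==> u \<in> Q - S ==> \<not> adj u v"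
 using adj_sym by blast

lemma clique_empty: "clique adj {}"
 by (simp add: clique_def)

lemma adj_irrefl: "\<not> adj x x"
proof
 assume "adj x x"
 then obtain e where e: "e \<in> E" "ends H e = {x, x}" by (auto simp: adjacent_def edgesH)
 obtain a b where "ends H e = {a, b}" "a ~= b" by (rule pair[OF e(1)])
 then show False using e(2) by auto
qed

text \<open>The choice is unique for adjacent vertices, because simplicity of M excludes parallel
  edges (\<open>ends_inj\<close>).\<close>

definition edge :: "nat => nat => 'a" where "edge u w = (SOME e. e \<in> E \<and> ends H e = {u, w})"

lemma edge: assumes "adj u w" shows "edge u w \<in> E" "ends H (edge u w) = {u, w}"
proof -
 have "\<exists>e. e \<in> E \<and> ends H e = {u, w}" using assms by (auto simp: adjacent_def edgesH)
 then have "edge u w \<in> E \<and> ends H (edge u w) = {u, w}" unfolding edge_def by (rule someI_ex)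
 then show "edge u w \<in> E" "ends H (edge u w) = {u, w}" by auto
qed

lemma edge_eq: "e \<in> E ==> ends H e = {u, w} ==> e = edge u w \<and> adj u w"
proof -
 assume e: "e \<in> E" "ends H e = {u, w}"
 then have a: "adj u w" by (auto simp: adjacent_def edgesH)
 then show ?thesis using ends_inj[OF e(1) edge(1)[OF a]] edge(2)[OF a] e by simp
qed

lemma mem_cutH: "adj u w ==> edge u w \<in> cut H P \<longleftrightarrow> (u \<in> P) ~= (w \<in> P)"
 using H.mem_cut_pair[of "edge u w" u w P] edge edgesH by simp

definition EU :: "nat set => 'a set" where "EU U = {e \<in> E. ends H e \<subseteq> U}"

lemma EU_subset: "EU U \<subseteq> E" by (auto simp: EU_def)

lemma EU_mono: "U \<subseteq> U' ==> EU U \<subseteq> EU U'" by (auto simp: EU_def)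

text \<open>The star of an end x outside U is a row that contains the edge and avoids all edges
  inside U.\<close>

lemma EU_flat: "EU U \<in> flats M"
 unfolding flat_iff
proof (intro conjI ballI)
 fix e assume e: "e \<in> E - EU U"
 then obtain a b where ab: "ends H e = {a, b}" "a ~= b" using pair_ex[of e] by blast
 obtain x where x: "x \<in> ends H e" "x \<notin> U" using e by (auto simp: EU_def)
 have "e \<in> cut H {x}" using H.mem_cut_pair[of e a b "{x}"] ab x e edgesH by auto
 moreover have "cut H {x} Int EU U = {}" using x(2) by (auto simp: cut_def EU_def)
 moreover have "cut H {x} \<in> cycs G" using cutsH by (auto simp: cuts_def)
 ultimately show "\<exists>C\<in>cycs G. e \<in> C \<and> C Int EU U = {}" by blast
qed (rule EU_subset)

lemma EU_insert:
 assumes "v \<notin> B"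
 shows "EU (insert v B) = EU B Un edge v ` {u \<in> B. adj v u}"
proof (intro equalityI subsetI)
 fix e assume e: "e \<in> EU (insert v B)"
 then have eE: "e \<in> E" "ends H e \<subseteq> insert v B" by (auto simp: EU_def)
 obtain a b where ab: "ends H e = {a, b}" "a ~= b" using pair_ex[OF eE(1)] by blast
 show "e \<in> EU B Un edge v ` {u \<in> B. adj v u}"
 proof (cases "v \<in> ends H e")
  case True
  then obtain u where u: "ends H e = {v, u}" "u ~= v" using ab by auto
  then show ?thesis using edge_eq[OF eE(1) u(1)] eE(2) by auto
 next
  case False
  then show ?thesis using eE by (auto simp: EU_def)
 qed
next
 fix e assume "e \<in> EU B Un edge v ` {u \<in> B. adj v u}"
 then show "e \<in> EU (insert v B)" using edge by (auto simp: EU_def)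
qed

lemma EU_empty: "EU {} = {}"
 using pair by (auto simp: EU_def elim!: H.ends_pair[THEN exE])

lemma EU_single: "EU {a} = {}"
 using EU_insert[of a "{}"] EU_empty by auto

lemma EU_pair: "adj a b ==> EU {a, b} = {edge a b}"
proof -
 assume ab: "adj a b"
 then have "a ~= b" using adj_irrefl by auto
 then have "EU {a, b} = EU {b} Un edge a ` {u \<in> {b}. adj a u}" using EU_insert[of a "{b}"] by auto
 then show ?thesis using ab EU_single by auto
qed

lemma triangle_tri:
 assumes a: "adj a b" "adj a c" "adj b c"
 shows "tri (flats M) {edge a b, edge a c, edge b c}"
proof -
 have ne: "a ~= b" "a ~= c" "b ~= c" using a adj_irrefl by auto
 have en: "ends H (edge a b) = {a,b}" "ends H (edge a c) = {a,c}" "ends H (edge b c) = {b,c}" using a edge(2) by auto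
 have d: "edge a b ~= edge a c" "edge a b ~= edge b c" "edge a c ~= edge b c"
  using en ne by (metis doubleton_eq_iff)+
 have "even (card (C Int {edge a b, edge a c, edge b c}))" if C: "C \<in> cycs G" for C
 proof (rule even_tripleI[OF _ d])
  obtain P where "C = cut H P" using C unfolding cutsH[symmetric] by (auto simp: cuts_def)
  then show "edge a b \<in> C \<longleftrightarrow> (edge a c \<in> C \<longleftrightarrow> edge b c \<notin> C)" using a mem_cutH by auto
 qed
 then show ?thesis unfolding tri_even[OF sim] using edge(1) a d by auto
qed

lemma EU_triangle:
 assumes a: "adj a b" "adj a c" "adj b c"
 shows "EU {a, b, c} = {edge a b, edge a c, edge b c}" "card (EU {a, b, c}) = 3"
proof -
 have "a \<notin> {b, c}" using a adj_irrefl by auto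
 then have "EU {a, b, c} = EU {b, c} Un edge a ` {u \<in> {b, c}. adj a u}" by (rule EU_insert)
 then show "EU {a, b, c} = {edge a b, edge a c, edge b c}" using EU_pair[OF a(3)] a by auto
 then show "card (EU {a, b, c}) = 3" using triangle_tri[OF a] by (simp add: tri_def)
qed

lemma triangle_obtain:
 assumes "card T = 3" "clique adj T"
 obtains a b c where "T = {a, b, c}" "adj a b" "adj a c" "adj b c"
proof -
 obtain a b c where "T = {a, b, c}" "a ~= b" "a ~= c" "b ~= c" using assms(1) by (auto simp: card_Suc_eq numeral_3_eq_3)
 then show ?thesis using that[of a b c] cliqueD[OF assms(2)] by auto
qed

text \<open>Three K4 on a triangle have 12 edges and rank 5, the extremal case of
  \<open>card_le_rank\<close>. The three edges at each of the additional vertices form a row of the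
  restriction, that is, a triangle in its dual graph, against
  \<open>no_three_triangles\<close>.\<close>

lemma K4_le2:
 assumes T: "T \<subseteq> verts H" "card T = 3" "clique adj T"
 shows "card (common adj (verts H) T) \<le> 2"
proof (rule ccontr)
 assume "\<not> ?thesis"
 then have "3 \<le> card (common adj (verts H) T)" by simp
 then obtain X where X: "X \<subseteq> common adj (verts H) T" "card X = 3" by (meson obtain_subset_with_card_n)
 obtain a b c where abc: "T = {a, b, c}" "adj a b" "adj a c" "adj b c" using triangle_obtain[OF T(2,3)] .
 have Xadj: "adj x a" "adj x b" "adj x c" if "x \<in> X" for x using X(1) that abc(1) by (auto simp: common_def)
 have XT: "x \<notin> T" if "x \<in> X" for x using Xadj[OF that] adj_irrefl abc(1) by auto
 define TE where "TE = {edge a b, edge a c, edge b c}"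
 define D where "D x = {edge x a, edge x b, edge x c}" for x
 have nabc: "a ~= b" "a ~= c" "b ~= c" using abc adj_irrefl by auto
 have DE: "D x \<subseteq> E" if "x \<in> X" for x using edge(1) Xadj[OF that] by (auto simp: D_def)
 have TEE: "TE \<subseteq> E" using edge(1) abc by (auto simp: TE_def)
 have cTE: "card TE = 3" using EU_triangle[OF abc(2-4)] by (simp add: TE_def)
 have endsD: "x \<in> ends H e \<and> ends H e \<subseteq> insert x T" if "e \<in> D x" "x \<in> X" for e x
  using that edge(2) Xadj[OF that(2)] abc(1) by (auto simp: D_def)
 have endsT: "ends H e \<subseteq> T" if "e \<in> TE" for e
  using that edge(2) abc by (auto simp: TE_def)
 have cD: "card (D x) = 3" if x: "x \<in> X" for x
 proof -
  have "ends H (edge x a) = {x,a}" "ends H (edge x b) = {x,b}" "ends H (edge x c) = {x,c}" using edge(2) Xadj[OF x] by auto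
  then have "edge x a ~= edge x b" "edge x a ~= edge x c" "edge x b ~= edge x c" using nabc by (metis doubleton_eq_iff)+
  then show ?thesis by (simp add: D_def)
 qed
 have disT: "D x Int TE = {}" if "x \<in> X" for x using endsD[OF _ that] endsT XT[OF that] by blast
 have disD: "D x Int D y = {}" if "x \<in> X" "y \<in> X" "x ~= y" for x y
  using endsD[OF _ that(1)] endsD[OF _ that(2)] XT[OF that(1)] that(3) by blast
 define Z where "Z = TE Un (\<Union>x\<in>X. D x)"
 have finX: "finite X" using X(2) by (rule_tac card_ge_0_finite) simp
 have ZE: "Z \<subseteq> E" using TEE DE by (auto simp: Z_def)
 have "card (\<Union>x\<in>X. D x) = (\<Sum>x\<in>X. card (D x))"
  by (rule card_UN_disjoint) (use finX disD in \<open>auto simp: D_def\<close>)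
 then have cU: "card (\<Union>x\<in>X. D x) = 9" using cD X(2) by simp
 have "TE Int (\<Union>x\<in>X. D x) = {}" using disT by blast
 then have cZ: "card Z = 12" unfolding Z_def using cU cTE finX by (subst card_Un_disjoint) (auto simp: TE_def D_def)
 have tricl: "r \<in> cl J" if "J \<subseteq> E" "tri (flats M) {p, q, r}" "p \<in> cl J" "q \<in> cl J" "p ~= q" for J p q r
  using triD[OF that(2), of p q "cl J"] that cl_flat[OF that(1)] by auto
 \<comment> \<open>Two edges of the triangle and one edge at each vertex of Y span the rest.\<close>
 have rkb: "rk (TE Un (\<Union>x\<in>Y. D x)) \<le> 2 + card Y" if Y: "Y \<subseteq> X" for Y
 proof -
  have finY: "finite Y" using Y finX finite_subset by auto
  let ?J = "{edge a b, edge a c} Un (\<lambda>x. edge x a) ` Y"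
  have JE: "?J \<subseteq> E" using TEE DE Y by (auto simp: TE_def D_def)
  note s = subset_cl[OF JE]
  have ne: "edge a b ~= edge a c" using cTE by (auto simp: TE_def card_insert_if split: if_splits)
  have bc: "edge b c \<in> cl ?J" by (rule tricl[OF JE triangle_tri[OF abc(2-4)] _ _ ne]) (use s in auto)
  have "D x \<subseteq> cl ?J" if x: "x \<in> Y" for x
  proof -
   have xX: "x \<in> X" using x Y by auto
   note xa = Xadj[OF xX]
   have 1: "edge x a \<in> cl ?J" using s x by auto
   have dn: "edge x a ~= edge a b" "edge x a ~= edge a c" using disT[OF xX] by (auto simp: D_def TE_def)
   have t1: "tri (flats M) {edge x a, edge a b, edge x b}"
    using triangle_tri[OF xa(1,2) abc(2)] by (simp add: insert_commute)
   have t2: "tri (flats M) {edge x a, edge a c, edge x c}"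
    using triangle_tri[OF xa(1,3) abc(3)] by (simp add: insert_commute)
   have "edge x b \<in> cl ?J" by (rule tricl[OF JE t1 1 _ dn(1)]) (use s in auto)
   moreover have "edge x c \<in> cl ?J" by (rule tricl[OF JE t2 1 _ dn(2)]) (use s in auto)
   ultimately show ?thesis using 1 by (simp add: D_def)
  qed
  then have "TE Un (\<Union>x\<in>Y. D x) \<subseteq> cl ?J" using bc s by (auto simp: TE_def)
  then have "rk (TE Un (\<Union>x\<in>Y. D x)) \<le> rk ?J" using mrank_mono mrank_cl[OF JE] by metis
  also have "\<dots> \<le> card ?J" using finY by (intro mrank_le_card) simp
  also have "\<dots> \<le> card {edge a b, edge a c} + card ((\<lambda>x. edge x a) ` Y)" by (rule card_Un_le)
  also have "\<dots> \<le> 2 + card Y" using card_image_le[OF finY] by (intro add_mono) (auto simp: card_insert_if)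
  finally show ?thesis .
 qed
 \<comment> \<open>The lower bound is \<open>card_le_rank_subset\<close> for 12 elements.\<close>
 have rZ: "rk Z = 5" using card_le_rank_subset[OF sim ZE] cZ rkb[of X] X(2) by (simp add: Z_def)
 obtain G' where G': "cographic_matroid (restriction M Z) G'" using restriction_rep[OF ZE] .
 then interpret N: cographic_matroid "restriction M Z" G' .
 interpret N2: binary_matroid "restriction M Z" "(\<lambda>C. C Int Z) ` cycs G" by (rule binary_restriction[OF ZE])
 have NE: "N.E = Z" by (rule ground_restriction[OF ZE])
 have Nsim: "simple_matroid (restriction M Z)" by (rule simple_restriction[OF sim])
 have Nr: "mrank (restriction M Z) Y = rk Y" if "Y \<subseteq> Z" for Y by (rule mrank_restriction[OF that])
 have Ntri: "tri (flats (restriction M Z)) T'" if T': "tri (flats M) T'" "T' \<subseteq> Z" for T'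
  unfolding N2.tri_even[OF Nsim] NE
 proof (intro conjI ballI)
  have m: "card T' = 3" "\<forall>C\<in>cycs G. even (card (C Int T'))" using T'(1) unfolding tri_even[OF sim] by auto
  then show "card T' = 3" by simp
  fix C assume "C \<in> (\<lambda>C. C Int Z) ` cycs G"
  then obtain C' where "C' \<in> cycs G" "C = C' Int Z" by auto
  moreover have "C' Int Z Int T' = C' Int T'" using T'(2) by auto
  ultimately show "even (card (C Int T'))" using m(2) by simp
 qed (rule T'(2))
 \<comment> \<open>Without \<open>D x\<close> the rank is at most 4, so a nonempty row lies inside
   \<open>D x\<close>. The triangles through x with the edges of \<open>TE\<close> force it to be
   all of \<open>D x\<close>.\<close>
 have Dc: "D x \<in> cycs G'" if x: "x \<in> X" for x
 proof -
  have xa: "adj x a" "adj x b" "adj x c" using Xadj[OF x] by auto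
  have Zx: "Z - D x = TE Un (\<Union>y\<in>X - {x}. D y)" using disT[OF x] disD[OF x] by (auto simp: Z_def)
  have "rk (Z - D x) \<le> 2 + card (X - {x})" unfolding Zx by (rule rkb) auto
  then have "rk (Z - D x) < rk Z" using rZ X(2) x finX by simp
  then have "mrank (restriction M Z) (N.E - D x) < mrank (restriction M Z) N.E" using Nr NE by simp
  then obtain C where C: "C \<in> cycs G'" "C ~= {}" "C \<subseteq> D x" using N.rank_compl by blast
  have in3: "edge x y \<in> C \<longleftrightarrow> edge x z \<in> C" if y: "adj x y" "adj x z" "adj y z" "edge y z \<in> TE" "edge x y \<in> D x" "edge x z \<in> D x" for y z
  proof -
   have "tri (flats M) {edge x y, edge x z, edge y z}" by (rule triangle_tri[OF y(1-3)])
   moreover have "{edge x y, edge x z, edge y z} \<subseteq> Z" using y x by (auto simp: Z_def)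
   ultimately have "tri (flats (restriction M Z)) {edge x y, edge x z, edge y z}" by (rule Ntri)
   then have "edge y z \<in> C \<longleftrightarrow> (edge x y \<in> C) ~= (edge x z \<in> C)" using N.tri_mem[OF Nsim _ C(1)] by blast
   moreover have "edge y z \<notin> C" using C(3) y(4) disT[OF x] by auto
   ultimately show ?thesis by blast
  qed
  have "edge x a \<in> C \<longleftrightarrow> edge x b \<in> C" "edge x a \<in> C \<longleftrightarrow> edge x c \<in> C"
   using in3[of a b] in3[of a c] xa abc by (auto simp: TE_def D_def)
  then have "C = D x" using C(2,3) by (auto simp: D_def)
  then show ?thesis using C(1) by simp
 qed
 obtain x1 x2 x3 where x: "X = {x1, x2, x3}" "x1 ~= x2" "x1 ~= x3" "x2 ~= x3" using X(2) by (auto simp: card_Suc_eq numeral_3_eq_3)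
 then have xX: "x1 \<in> X" "x2 \<in> X" "x3 \<in> X" by auto
 show False
  by (rule N.no_three_triangles[OF Nsim _ _ Dc[OF xX(1)] Dc[OF xX(2)] Dc[OF xX(3)] cD[OF xX(1)] cD[OF xX(2)] cD[OF xX(3)]
     disD[OF xX(1,2) x(2)] disD[OF xX(1,3) x(3)] disD[OF xX(2,3) x(4)]])
   (use NE cZ rZ Nr in auto)
qed

sublocale chordal_K4 adj "verts H"
 by unfold_locales (use adj_sym adj_irrefl H.finite_verts K4_le2 in auto)

lemma graph_ctree: "ctree adj (verts H) (unique_K4 adj (verts H))"
 using peo_ctree[OF peoH, of "{}"] by (simp add: pendant_def)

lemma clique_isomorphic:
 assumes Q: "Q \<subseteq> verts H" "clique adj Q"
 shows "isomorphic (restriction M (EU Q)) (cycle_matroid (complete_graph (card Q)))"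
proof -
 let ?K = "complete_graph (card Q)"
 interpret K: finite_graph ?K by (rule finite_complete_graph)
 have eK: "edges ?K = {e. e \<subseteq> {..<card Q} \<and> card e = 2}" "ends ?K = (\<lambda>e. e)" by (auto simp: complete_graph_def)
 have finQ: "finite Q" using Q H.finite_verts finite_subset by auto
 obtain h where h: "bij_betw h Q {0..<card Q}" using ex_bij_betw_finite_nat[OF finQ] by blast
 have hinj: "inj_on h Q" and him: "h ` Q = {..<card Q}" using h by (auto simp: bij_betw_def atLeast0LessThan)
 define f where "f e = h ` ends H e" for e
 have gr: "ground (restriction M (EU Q)) = EU Q" by (rule ground_restriction[OF EU_subset])
 have grK: "ground (cycle_matroid ?K) = edges ?K" by (simp add: cycle_matroid_def)
 have fin: "f e \<in> edges ?K" if e: "e \<in> EU Q" for e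
 proof -
  have e': "e \<in> E" "ends H e \<subseteq> Q" using e by (auto simp: EU_def)
  obtain a b where ab: "ends H e = {a, b}" "a ~= b" using pair_ex[OF e'(1)] by blast
  have "a \<in> Q" "b \<in> Q" using ab e' by auto
  then have "h a ~= h b" "h a < card Q" "h b < card Q" using hinj ab(2) him by (auto simp: inj_on_def)
  then show ?thesis using ab by (simp add: f_def eK)
 qed
 have finj: "inj_on f (EU Q)"
 proof (rule inj_onI)
  fix x y assume xy: "x \<in> EU Q" "y \<in> EU Q" "f x = f y"
  then have "ends H x = ends H y" using inj_on_image_eq_iff[OF hinj, of "ends H x" "ends H y"] by (auto simp: f_def EU_def)
  then show "x = y" using ends_inj xy by (auto simp: EU_def)
 qed
 have fim: "f ` EU Q = edges ?K"
 proof (intro equalityI subsetI)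
  fix d assume "d \<in> edges ?K"
  then obtain i j where d: "d = {i, j}" "i ~= j" "i < card Q" "j < card Q" by (auto simp: eK card_2_iff)
  then have "i \<in> h ` Q" "j \<in> h ` Q" using him by auto
  then obtain a b where ab: "a \<in> Q" "b \<in> Q" "h a = i" "h b = j" by auto
  then have "adj a b" using cliqueD[OF Q(2)] d(2) by auto
  then have "edge a b \<in> EU Q" "f (edge a b) = d" using edge ab d by (auto simp: EU_def f_def)
  then show "d \<in> f ` EU Q" by blast
 qed (use fin in auto)
 have cutf: "e \<in> cut H P \<longleftrightarrow> f e \<in> cut ?K P'" if e: "e \<in> EU Q" and PP: "\<And>u. u \<in> Q ==> u \<in> P \<longleftrightarrow> h u \<in> P'" for e P P'
 proof -
  have e': "e \<in> edges H" "ends H e \<subseteq> Q" using e edgesH by (auto simp: EU_def)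
  obtain a b where ab: "ends H e = {a, b}" using H.ends_pair[OF e'(1)] by blast
  have "f e = {h a, h b}" using ab by (simp add: f_def)
  then have "f e \<in> cut ?K P' \<longleftrightarrow> (h a \<in> P') ~= (h b \<in> P')"
   using K.mem_cut_pair[OF fin[OF e], of "h a" "h b" P'] by (simp add: eK)
  then show ?thesis using H.mem_cut_pair[OF e'(1) ab] PP ab e' by auto
 qed
 show ?thesis unfolding isomorphic_def gr grK
 proof (intro exI[of _ f] conjI allI impI)
  show "bij_betw f (EU Q) (edges ?K)" using finj fim by (simp add: bij_betw_def)
  fix X assume X: "X \<subseteq> EU Q"
  have im: "D Int f ` X = f ` {e \<in> X. f e \<in> D}" for D by auto
  have sing: "f ` Y = {f x} \<longleftrightarrow> Y = {x}" if "Y \<subseteq> X" "x \<in> X" for Y x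
   using inj_on_image_eq_iff[OF finj, of Y "{x}"] that X by auto
  have "X \<in> indep M \<longleftrightarrow> (\<forall>x\<in>X. \<exists>C\<in>cuts H. C Int X = {x})"
  proof -
   have "X \<subseteq> E" using X EU_subset by blast
   then show ?thesis unfolding indep_iff cutsH by simp
  qed
  also have "\<dots> \<longleftrightarrow> (\<forall>x\<in>X. \<exists>D\<in>cuts ?K. D Int f ` X = {f x})"
  proof (rule ball_cong[OF refl])
   fix x assume x: "x \<in> X"
   show "(\<exists>C\<in>cuts H. C Int X = {x}) \<longleftrightarrow> (\<exists>D\<in>cuts ?K. D Int f ` X = {f x})"
   proof
    assume "\<exists>C\<in>cuts H. C Int X = {x}"
    then obtain P where P: "cut H P Int X = {x}" by (auto simp: cuts_def)
    have "u \<in> P \<longleftrightarrow> h u \<in> h ` (P Int Q)" if "u \<in> Q" for u using that hinj by (auto simp: inj_on_def)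
    then have "{e \<in> X. f e \<in> cut ?K (h ` (P Int Q))} = cut H P Int X" using cutf[of _ P] X by blast
    then have "cut ?K (h ` (P Int Q)) Int f ` X = {f x}" unfolding im using P by simp
    then show "\<exists>D\<in>cuts ?K. D Int f ` X = {f x}" by (auto simp: cuts_def)
   next
    assume "\<exists>D\<in>cuts ?K. D Int f ` X = {f x}"
    then obtain P' where P': "cut ?K P' Int f ` X = {f x}" by (auto simp: cuts_def)
    have "{e \<in> X. f e \<in> cut ?K P'} = cut H {u \<in> Q. h u \<in> P'} Int X" using cutf[of _ "{u \<in> Q. h u \<in> P'}" P'] X by blast
    moreover have "{e \<in> X. f e \<in> cut ?K P'} = {x}" using P' sing[of "{e \<in> X. f e \<in> cut ?K P'}" x] x unfolding im by auto
    ultimately show "\<exists>C\<in>cuts H. C Int X = {x}" by (auto simp: cuts_def)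
   qed
  qed
  also have "\<dots> \<longleftrightarrow> f ` X \<in> indep (cycle_matroid ?K)"
  proof -
   have "f ` X \<subseteq> edges ?K" using fin X by blast
   then show ?thesis unfolding K.indep_cycle_matroid_cuts by simp
  qed
  finally show "X \<in> indep (restriction M (EU Q)) \<longleftrightarrow> f ` X \<in> indep (cycle_matroid ?K)"
   using X by (simp add: restriction_def)
 qed
qed

lemma clique_assembled:
 assumes Q: "Q \<subseteq> verts H" "clique adj Q" "card Q \<in> {2, 3, 4}"
 shows "\<exists>\<K>. assembled (restriction M (EU Q)) \<K> {#} \<and> (\<forall>L\<in>\<K>. 2 \<le> card L)"
proof -
 have m: "matroid (restriction M (EU Q))" by (rule restriction_matroid)
 have iso: "isomorphic (restriction M (EU Q)) (cycle_matroid (complete_graph (card Q)))" by (rule clique_isomorphic[OF Q(1,2)])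
 consider "card Q = 2" | "card Q = 3" | "card Q = 4" using Q(3) by auto
 then show ?thesis
 proof cases
  case 1
  then obtain a b where ab: "Q = {a, b}" "a ~= b" by (auto simp: card_2_iff)
  then have "adj a b" using cliqueD[OF Q(2)] by auto
  then have EQ: "EU Q = {edge a b}" "edge a b \<in> E" using EU_pair edge(1) ab by auto
  have "{edge a b} \<in> indep M" using simple_indep2[OF sim EQ(2) EQ(2)] by simp
  then have "restriction M (EU Q) = \<lparr>ground = {edge a b}, indep = {{}, {edge a b}}\<rparr>"
   using EQ indep_empty by (auto simp: restriction_def subset_singleton_iff)
  then show ?thesis using assembled.point[of "edge a b"] by (intro exI[of _ "{}"]) auto
 next
  case 2
  then show ?thesis using assembled.K3[OF m] iso by (intro exI[of _ "{}"]) auto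
 next
  case 3
  then have "assembled (restriction M (EU Q)) (lines (restriction M (EU Q))) {#}" using assembled.K4[OF m] iso by simp
  moreover have "2 \<le> card L" if "L \<in> lines (restriction M (EU Q))" for L
  proof -
   interpret N: matroid "restriction M (EU Q)" by fact
   have "L \<in> flats (restriction M (EU Q))" "mrank (restriction M (EU Q)) L = 2" using that by (auto simp: lines_def)
   then show ?thesis using N.mrank_le_card[OF N.finite_flat] by metis
  qed
  ultimately show ?thesis by blast
 qed
qed

lemma small_clique:
 assumes S: "clique adj S" "card S \<le> 3" "finite S"
 shows "small (flats M) (EU S)"
  "EU S = {} \<or> rk (EU S) = 1 \<or> rk (EU S) = 2 \<and> card (EU S) = 3"
  "card S \<le> 2 ==> card (EU S) \<le> 1"
proof -
 consider "card S = 0" | "card S = 1" | "card S = 2" | "card S = 3" using S(2) by linarith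
 then have "small (flats M) (EU S) \<and> (EU S = {} \<or> rk (EU S) = 1 \<or> rk (EU S) = 2 \<and> card (EU S) = 3) \<and> (card S \<le> 2 --> card (EU S) \<le> 1)"
 proof cases
  case 1 then show ?thesis using S EU_empty by (simp add: small_def)
 next
  case 2
  then obtain a where "S = {a}" by (auto simp: card_1_singleton_iff)
  then show ?thesis using EU_single by (simp add: small_def)
 next
  case 3
  then obtain a b where ab: "S = {a, b}" "a ~= b" by (auto simp: card_2_iff)
  then have "adj a b" using cliqueD[OF S(1)] by auto
  then show ?thesis using ab EU_pair edge(1) simple_rank1[OF sim] by (simp add: small_def)
 next
  case 4
  then obtain a b c where abc: "S = {a, b, c}" "adj a b" "adj a c" "adj b c" using triangle_obtain[OF _ S(1)] by blast
  then have t: "tri (flats M) (EU S)" using triangle_tri[OF abc(2-4)] EU_triangle[OF abc(2-4)] by simp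
  then show ?thesis using 4 tri_iff[OF sim] by (simp add: small_def)
 qed
 then show "small (flats M) (EU S)"
  "EU S = {} \<or> rk (EU S) = 1 \<or> rk (EU S) = 2 \<and> card (EU S) = 3"
  "card S \<le> 2 ==> card (EU S) \<le> 1" by auto
qed

text \<open>Rows with the same trace on the clique come from vertex sets that agree on S up to
  complement, since all pairs in S are joined. After complementing one of them the two vertex sets
  can be united, which proves fibredness.\<close>

lemma gen_parallel_connection_clique:
 assumes BQ: "B \<subseteq> verts H" "Q \<subseteq> verts H" and S: "B Int Q = S" "clique adj S" "card S \<le> 3"
  and cross: "\<And>u w. u \<in> B - S ==> w \<in> Q - S ==> \<not> adj u w"
 shows "gen_parallel_connection (restriction M (EU B)) (restriction M (EU Q)) (EU S) (restriction M (EU (B Un Q)))"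
proof -
 have finS: "finite S" using BQ(1) S(1) H.finite_verts finite_subset by blast
 note sm = small_clique[OF S(2,3) finS]
 have g: "ground (restriction M (EU U)) = EU U" for U by (rule ground_restriction[OF EU_subset])
 have fl: "flats (restriction M (EU U)) = {X \<in> flats M. X \<subseteq> EU U}" for U by (rule flats_restriction[OF EU_flat])
 have EI: "EU B Int EU Q = EU S" using S(1) by (auto simp: EU_def)
 have EUn: "EU (B Un Q) = EU B Un EU Q"
 proof (intro equalityI subsetI)
  fix e assume e: "e \<in> EU (B Un Q)"
  then have eE: "e \<in> E" "ends H e \<subseteq> B Un Q" by (auto simp: EU_def)
  obtain a b where ab: "ends H e = {a, b}" using pair_ex[OF eE(1)] by blast
  have "adj a b" "adj b a" using edge_eq[OF eE(1) ab] adj_sym by auto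
  then have "\<not> (a \<in> B - S \<and> b \<in> Q - S)" "\<not> (b \<in> B - S \<and> a \<in> Q - S)" using cross by auto
  then have "{a, b} \<subseteq> B \<or> {a, b} \<subseteq> Q" using eE(2) ab S(1) by auto
  then show "e \<in> EU B Un EU Q" using eE(1) ab by (auto simp: EU_def)
 qed (use EU_mono in blast)
 have subS: "EU S \<subseteq> EU B" "EU S \<subseteq> EU Q" using S(1) by (auto intro!: EU_mono)
 interpret NQ: binary_matroid "restriction M (EU Q)" "(\<lambda>C. C Int EU Q) ` cycs G" by (rule binary_restriction[OF EU_subset])
 interpret N: binary_matroid "restriction M (EU (B Un Q))" "(\<lambda>C. C Int EU (B Un Q)) ` cycs G" by (rule binary_restriction[OF EU_subset])
 have simQ: "simple_matroid (restriction M (EU Q))" and simN: "simple_matroid (restriction M (EU (B Un Q)))"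
  by (rule simple_restriction[OF sim])+
 have mod: "modular_flat (restriction M (EU Q)) (EU S)"
  by (rule NQ.small_modular[OF simQ]) (use small_subfamily[OF sm(1)] fl EU_flat subS g in auto)
 have fib: "fibered ((\<lambda>C. C Int EU (B Un Q)) ` cycs G) (EU B) (EU Q)"
  unfolding fibered_def
 proof (intro ballI impI)
  fix C D assume "C \<in> (\<lambda>C. C Int EU (B Un Q)) ` cycs G" "D \<in> (\<lambda>C. C Int EU (B Un Q)) ` cycs G"
   and CD: "C Int (EU B Int EU Q) = D Int (EU B Int EU Q)"
  then obtain P1 P2 where P: "C = cut H P1 Int EU (B Un Q)" "D = cut H P2 Int EU (B Un Q)"
   unfolding cutsH[symmetric] by (auto simp: cuts_def)
  have eqS: "e \<in> cut H P1 \<longleftrightarrow> e \<in> cut H P2" if "e \<in> EU S" for e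
   using CD that unfolding EI P using subS EUn by auto
  have pairS: "(u \<in> P1) = (w \<in> P1) \<longleftrightarrow> (u \<in> P2) = (w \<in> P2)" if uw: "u \<in> S" "w \<in> S" for u w
  proof (cases "u = w")
   case False
   then have a: "adj u w" using cliqueD[OF S(2)] uw by auto
   then have "edge u w \<in> EU S" using edge uw by (auto simp: EU_def)
   then show ?thesis using eqS mem_cutH[OF a] by blast
  qed simp
  obtain P3 where P3: "cut H P3 = cut H P2" "P3 Int S = P1 Int S"
  proof (cases "P2 Int S = P1 Int S")
   case True then show ?thesis using that by blast
  next
   case False
   then obtain s where s: "s \<in> S" "(s \<in> P2) ~= (s \<in> P1)" by auto
   have "(verts H - P2) Int S = P1 Int S" using pairS[OF s(1)] s BQ S(1) by blast
   then show ?thesis using that[of "verts H - P2"] H.cut_compl by blast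
  qed
  define P4 where "P4 = (P1 Int B) Un (P3 Int Q)"
  have P4V: "P4 Int B = P1 Int B" using P3(2) S(1) by (auto simp: P4_def)
  have P4Q: "P4 Int Q = P3 Int Q" using P3(2) S(1) by (auto simp: P4_def)
  have loc: "cut H R Int EU U = cut H R' Int EU U" if "R Int U = R' Int U" for R R' U
   using that by (auto simp: cut_def EU_def)
  have "cut H P4 Int EU B = cut H P1 Int EU B" "cut H P4 Int EU Q = cut H P2 Int EU Q"
   using loc[OF P4V] loc[OF P4Q] P3(1) by auto
  then have "C Int EU B Un D Int EU Q = cut H P4 Int EU (B Un Q)" unfolding P EUn by blast
  then show "C Int EU B Un D Int EU Q \<in> (\<lambda>C. C Int EU (B Un Q)) ` cycs G"
   unfolding cutsH[symmetric] by (auto simp: cuts_def)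
 qed
 have smN: "small (flats (restriction M (EU (B Un Q)))) (EU B Int EU Q)"
  unfolding EI
 proof (rule small_subfamily[OF sm(1)])
  have "EU S \<subseteq> EU (B Un Q)" using S(1) by (intro EU_mono) auto
  then show "EU S \<in> flats (restriction M (EU (B Un Q)))" unfolding fl using EU_flat by simp
  show "flats (restriction M (EU (B Un Q))) \<subseteq> flats M" unfolding fl by simp
 qed
 have flN: "flats (restriction M (EU (B Un Q))) =
   {X. X \<subseteq> EU B Un EU Q \<and> X Int EU B \<in> flats (restriction M (EU B)) \<and> X Int EU Q \<in> flats (restriction M (EU Q))}"
 proof (intro equalityI subsetI)
  fix X assume "X \<in> flats (restriction M (EU (B Un Q)))"
  then have "X \<in> flats M" "X \<subseteq> EU (B Un Q)" unfolding fl by auto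
  then show "X \<in> {X. X \<subseteq> EU B Un EU Q \<and> X Int EU B \<in> flats (restriction M (EU B)) \<and> X Int EU Q \<in> flats (restriction M (EU Q))}"
   unfolding fl unfolding EUn using flat_Int[OF _ EU_flat] by auto
 next
  fix X assume "X \<in> {X. X \<subseteq> EU B Un EU Q \<and> X Int EU B \<in> flats (restriction M (EU B)) \<and> X Int EU Q \<in> flats (restriction M (EU Q))}"
  then have X: "X \<subseteq> EU B Un EU Q" "X Int EU B \<in> flats M" "X Int EU Q \<in> flats M" unfolding fl by auto
  show "X \<in> flats (restriction M (EU (B Un Q)))"
  proof (rule N.fibered_glue[OF simN _ smN fib])
   show "EU B Un EU Q = N.E" "X \<subseteq> N.E" unfolding g unfolding EUn using X(1) by auto
   show "X Int EU B \<in> flats (restriction M (EU (B Un Q)))" "X Int EU Q \<in> flats (restriction M (EU (B Un Q)))"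
    unfolding fl unfolding EUn using X by auto
  qed
 qed
 have res: "restriction (restriction M (EU B)) (EU S) = restriction (restriction M (EU Q)) (EU S)"
  using subS by (auto simp: restriction_def intro!: pre_matroid.equality)
 show ?thesis
  unfolding gen_parallel_connection_def g
 proof (intro conjI)
  show "EU S = EU B Int EU Q" "EU (B Un Q) = EU B Un EU Q" using EI EUn by auto
  show "EU S \<in> flats (restriction M (EU B))" "EU S \<in> flats (restriction M (EU Q))" using fl EU_flat subS by auto
 qed (use restriction_matroid res mod flN in auto)
qed

text \<open>The invariant behind (2): triangles in R have not been used for a connection, and a flat
  with at least two elements has been used at most once. As lines of an M(K4) have at least two
  elements, repeated use of points and of the empty set is harmless.\<close>

definition good :: "nat set => nat set set => bool" where
 "good B R \<longleftrightarrow> (\<exists>\<K> \<U>. assembled (restriction M (EU B)) \<K> \<U> \<and> (\<forall>L\<in>\<K>. 2 \<le> card L) \<and>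
   (\<forall>T. T \<in># \<U> --> T \<subseteq> EU B \<and> (card T \<le> 1 \<or> count \<U> T \<le> 1)) \<and>
   (\<forall>T\<in>R. T \<subseteq> B \<and> card T = 3 \<and> clique adj T \<and> count \<U> (EU T) = 0))"

lemma good_attach:
 assumes gd: "good B R" and BQ: "B \<subseteq> verts H" "Q \<subseteq> verts H"
  and S: "B Int Q = S" "card S \<le> 3" "card S = 3 ==> S \<in> R" and Q: "clique adj Q" "card Q \<in> {2, 3, 4}"
  and cross: "\<And>u w. u \<in> B - S ==> w \<in> Q - S ==> \<not> adj u w"
  and R': "\<And>T. T \<in> R' ==> T \<in> R \<and> T ~= S \<or> T \<subseteq> Q \<and> card T = 3 \<and> \<not> T \<subseteq> B"
 shows "good (B Un Q) R'"
proof -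
 from gd obtain \<K> \<U> where k: "assembled (restriction M (EU B)) \<K> \<U>" "\<forall>L\<in>\<K>. 2 \<le> card L"
  and k3: "\<forall>T. T \<in># \<U> --> T \<subseteq> EU B \<and> (card T \<le> 1 \<or> count \<U> T \<le> 1)"
  and k4: "\<forall>T\<in>R. T \<subseteq> B \<and> card T = 3 \<and> clique adj T \<and> count \<U> (EU T) = 0"
  unfolding good_def by (elim exE conjE)
 note KU = k k3[rule_format] k4[rule_format]
 obtain \<K>' where K': "assembled (restriction M (EU Q)) \<K>' {#}" "\<forall>L\<in>\<K>'. 2 \<le> card L"
  using clique_assembled[OF BQ(2) Q] by blast
 have Scl: "clique adj S" using Q(1) S(1) unfolding clique_def by blast
 have finS: "finite S" using BQ(1) S(1) H.finite_verts finite_subset by blast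
 note sm = small_clique[OF Scl S(2) finS]
 have SV: "EU S \<subseteq> EU (B Un Q)" using S(1) by (intro EU_mono) auto
 have rkS: "mrank (restriction M (EU (B Un Q))) (EU S) = rk (EU S)" by (rule mrank_restriction[OF SV])
 have "assembled (restriction M (EU (B Un Q))) (\<K> Un \<K>') (add_mset (EU S) (\<U> + {#}))"
  by (rule assembled.connect[OF KU(1) K'(1) gen_parallel_connection_clique[OF BQ S(1) Scl S(2) cross]])
   (use sm(2) rkS in auto)
 then have as: "assembled (restriction M (EU (B Un Q))) (\<K> Un \<K>') (add_mset (EU S) \<U>)" by simp
 have tri3: "card (EU T) = 3 \<and> \<Union> (ends H ` EU T) = T" if T: "card T = 3" "clique adj T" for T
 proof -
  obtain a b c where abc: "T = {a, b, c}" "adj a b" "adj a c" "adj b c" using triangle_obtain[OF T] .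
  have "\<Union> (ends H ` EU T) = T" unfolding abc(1) EU_triangle(1)[OF abc(2-4)] using edge(2) abc by auto
  then show ?thesis using EU_triangle(2)[OF abc(2-4)] abc(1) by simp
 qed
 show ?thesis unfolding good_def
 proof (rule exI[of _ "\<K> Un \<K>'"], rule exI[of _ "add_mset (EU S) \<U>"], intro conjI ballI allI impI)
  show "assembled (restriction M (EU (B Un Q))) (\<K> Un \<K>') (add_mset (EU S) \<U>)" by (rule as)
  show "2 \<le> card L" if "L \<in> \<K> Un \<K>'" for L using that KU(2) K'(2) by auto
  fix T assume T: "T \<in># add_mset (EU S) \<U>"
  show "T \<subseteq> EU (B Un Q)" using T KU(3)[of T] SV EU_mono[of B "B Un Q"] by auto
  show "card T \<le> 1 \<or> count (add_mset (EU S) \<U>) T \<le> 1"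
  proof (cases "T = EU S")
   case True
   show ?thesis
   proof (cases "card S \<le> 2")
    case True then show ?thesis using sm(3) \<open>T = EU S\<close> by simp
   next
    case False
    then have "S \<in> R" using S by simp
    then show ?thesis using KU(4)[of S] True by simp
   qed
  next
   case False
   then show ?thesis using T KU(3)[of T] by auto
  qed
 next
  fix T assume "T \<in> R'"
  then have cs: "T \<in> R \<and> T ~= S \<or> T \<subseteq> Q \<and> card T = 3 \<and> \<not> T \<subseteq> B" by (rule R')
  have cl: "T \<subseteq> B Un Q" "card T = 3" "clique adj T" using cs KU(4)[of T] Q(1) unfolding clique_def by blast+
  then show "T \<subseteq> B Un Q" "card T = 3" "clique adj T" by auto
  have t3: "card (EU T) = 3" "\<Union> (ends H ` EU T) = T" using tri3[OF cl(2,3)] by auto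
  have "T ~= S" using cs S(1) by auto
  have ne: "EU T ~= EU S"
  proof
   assume eq: "EU T = EU S"
   then have "card S = 3" using t3(1) sm(3) S(2) by (cases "card S \<le> 2") auto
   then have "T = S" using tri3[OF _ Scl] t3(2) eq by simp
   then show False using \<open>T ~= S\<close> by simp
  qed
  have "count \<U> (EU T) = 0"
  proof (cases "T \<in> R")
   case True then show ?thesis using KU(4) by simp
  next
   case False
   then have "\<not> T \<subseteq> B" using cs by auto
   then have "\<not> EU T \<subseteq> EU B" using t3(2) by (auto simp: EU_def)
   then show ?thesis using KU(3) by (meson count_inI)
  qed
  then show "count (add_mset (EU S) \<U>) (EU T) = 0" using ne by simp
 qed
qed

lemma ctree_good:
 assumes "ctree adj B R" "B \<subseteq> verts H"
 shows "good B R"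
 using assms
proof induction
 case ct0
 have "restriction M (EU {}) = \<lparr>ground = {}, indep = {{}}\<rparr>"
  using EU_empty indep_empty by (auto simp: restriction_def)
 then show ?case unfolding good_def using assembled.empty by (intro exI[of _ "{}"] exI[of _ "{#}"]) auto
next
 case (ct1 B R v)
 have eq: "EU (insert v B) = EU B" unfolding EU_insert[OF ct1.hyps(2)] ct1.hyps(3) by simp
 have gd: "good B R" using ct1 by auto
 then obtain \<K> \<U> where "assembled (restriction M (EU B)) \<K> \<U>" "\<forall>L\<in>\<K>. 2 \<le> card L"
  "\<forall>T. T \<in># \<U> --> T \<subseteq> EU B \<and> (card T \<le> 1 \<or> count \<U> T \<le> 1)"
  "\<forall>T\<in>R. T \<subseteq> B \<and> card T = 3 \<and> clique adj T \<and> count \<U> (EU T) = 0"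
  unfolding good_def by (elim exE conjE)
 then show ?case unfolding good_def eq by (intro exI[of _ \<K>] exI[of _ \<U>]) auto
next
 case (ct2 B R v a)
 have a: "a \<in> B" "adj v a" "\<And>u. u \<in> B ==> adj v u ==> u = a" using ct2.hyps(3) by auto
 have "good (B Un {v, a}) R"
 proof (rule good_attach[where S = "{a}" and R = R])
  show "clique adj {v, a}" by (intro clique_insert clique_empty) (use a(2) in auto)
  show "card {v, a} \<in> {2, 3, 4}" using a(2) adj_irrefl by (auto simp: card_insert_if)
  fix T assume "T \<in> R"
  moreover have "card T = 3" using ct2.IH ct2.prems \<open>T \<in> R\<close> by (auto simp: good_def)
  ultimately show "T \<in> R \<and> T ~= {a} \<or> T \<subseteq> {v, a} \<and> card T = 3 \<and> \<not> T \<subseteq> B" by auto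
 next
  show "good B R" "B \<subseteq> verts H" using ct2.IH ct2.prems by simp_all
  show "{v, a} \<subseteq> verts H" "B Int {v, a} = {a}" using ct2.prems ct2.hyps(2) a(1) by blast+
  fix u w assume uw: "u \<in> B - {a}" "w \<in> {v, a} - {a}"
  have "u \<in> {a}" if "u \<in> B" "adj v u" for u using a(3)[OF that] by simp
  then have "\<not> adj u v" using uw(1) by (rule not_adj_outside)
  moreover have "w = v" using uw(2) by auto
  ultimately show "\<not> adj u w" by simp
 qed simp_all
 moreover have "B Un {v, a} = insert v B" using a(1) by auto
 ultimately show ?case by simp
next
 case (ct3 B R v a b)
 have a: "a \<in> B" "b \<in> B" "adj v a" "adj v b" "\<And>u. u \<in> B ==> adj v u ==> u = a \<or> u = b" using ct3.hyps(3) by auto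
 have "good (B Un {v, a, b}) R"
 proof (rule good_attach[where S = "{a, b}" and R = R])
  show "clique adj {v, a, b}" by (intro clique_insert clique_empty) (use a(3,4) ct3.hyps(5) in auto)
  show "card {v, a, b} \<in> {2, 3, 4}" using a(1,2) ct3.hyps(2,4) by (auto simp: card_insert_if)
  show "card {a, b} \<le> 3" "card {a, b} = 3 ==> {a, b} \<in> R" by (auto simp: card_insert_if split: if_splits)
  fix T assume "T \<in> R"
  moreover have "card T = 3" using ct3.IH ct3.prems \<open>T \<in> R\<close> by (auto simp: good_def)
  ultimately show "T \<in> R \<and> T ~= {a, b} \<or> T \<subseteq> {v, a, b} \<and> card T = 3 \<and> \<not> T \<subseteq> B"
   by (auto simp: card_insert_if split: if_splits)
 next
  show "good B R" "B \<subseteq> verts H" using ct3.IH ct3.prems by simp_all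
  show "{v, a, b} \<subseteq> verts H" "B Int {v, a, b} = {a, b}" using ct3.prems ct3.hyps(2) a(1,2) by auto
  fix u w assume uw: "u \<in> B - {a, b}" "w \<in> {v, a, b} - {a, b}"
  have "u \<in> {a, b}" if "u \<in> B" "adj v u" for u using a(5)[OF that] by simp
  then have "\<not> adj u v" using uw(1) by (rule not_adj_outside)
  moreover have "w = v" using uw(2) by auto
  ultimately show "\<not> adj u w" by simp
 qed
 moreover have "B Un {v, a, b} = insert v B" using a(1,2) by auto
 ultimately show ?case by simp
next
 case (ct4 B R v w a b)
 have a: "a \<in> B" "b \<in> B" "adj v a" "adj v b" "\<And>u. u \<in> B ==> adj v u ==> u = a \<or> u = b" using ct4.hyps(6) by auto
 have aw: "adj w a" "adj w b" "\<And>u. u \<in> B ==> adj w u ==> u = a \<or> u = b" using ct4.hyps(7) by auto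
 have n: "a ~= v" "a ~= w" "b ~= v" "b ~= w" using a(1,2) ct4.hyps(2,3) by auto
 have "good (B Un {v, w, a, b}) (R Un {{a,b,v}, {a,b,w}, {a,v,w}, {b,v,w}})"
 proof (rule good_attach[where S = "{a, b}" and R = R])
  show "clique adj {v, w, a, b}" by (intro clique_insert clique_empty) (use a(3,4) aw(1,2) ct4.hyps(5,9) in auto)
  show "card {v, w, a, b} \<in> {2, 3, 4}" using n ct4.hyps(4,8) by (auto simp: card_insert_if)
  show "card {a, b} \<le> 3" "card {a, b} = 3 ==> {a, b} \<in> R" by (auto simp: card_insert_if split: if_splits)
  fix T assume "T \<in> R Un {{a,b,v}, {a,b,w}, {a,v,w}, {b,v,w}}"
  then consider "T \<in> R" | "T \<in> {{a,b,v}, {a,b,w}, {a,v,w}, {b,v,w}}" by auto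
  then show "T \<in> R \<and> T ~= {a, b} \<or> T \<subseteq> {v, w, a, b} \<and> card T = 3 \<and> \<not> T \<subseteq> B"
  proof cases
   case 1
   moreover have "card T = 3" using ct4.IH ct4.prems 1 by (auto simp: good_def)
   ultimately show ?thesis by (auto simp: card_insert_if split: if_splits)
  next
   case 2
   then show ?thesis using n ct4.hyps(2,3,4,8) by (auto simp: card_insert_if)
  qed
 next
  show "good B R" "B \<subseteq> verts H" using ct4.IH ct4.prems by simp_all
  show "{v, w, a, b} \<subseteq> verts H" "B Int {v, w, a, b} = {a, b}" using ct4.prems ct4.hyps(2,3) a(1,2) by auto
  fix u x assume "u \<in> B - {a, b}" "x \<in> {v, w, a, b} - {a, b}"
  then have u: "u \<in> B - {a, b}" and x: "x = v \<or> x = w" by auto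
  have "u \<in> {a, b}" if "u \<in> B" "adj v u" for u using a(5)[OF that] by simp
  then have "\<not> adj u v" using u by (rule not_adj_outside)
  have "u \<in> {a, b}" if "u \<in> B" "adj w u" for u using aw(3)[OF that] by simp
  then have "\<not> adj u w" using u by (rule not_adj_outside)
  then show "\<not> adj u x" using x \<open>\<not> adj u v\<close> by auto
 qed
 moreover have "B Un {v, w, a, b} = insert w (insert v B)" using a(1,2) by auto
 ultimately show ?case by simp
next
 case (ct5 B R v a b c)
 have a: "a \<in> B" "b \<in> B" "c \<in> B" "adj v a" "adj v b" "adj v c" "\<And>u. u \<in> B ==> adj v u ==> u \<in> {a, b, c}"
  using ct5.hyps(3) by auto
 have n: "a ~= v" "b ~= v" "c ~= v" "a ~= b" "a ~= c" "b ~= c" using a(1-3) ct5.hyps(2,5) by (auto simp: card_insert_if split: if_splits)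
 have "good (B Un {v, a, b, c}) ((R - {{a, b, c}}) Un {{a,b,v}, {a,c,v}, {b,c,v}})"
 proof (rule good_attach[where S = "{a, b, c}" and R = R])
  show "clique adj {v, a, b, c}" by (rule clique_insert[OF ct5.hyps(6)]) (use a(4-6) in auto)
  show "card {v, a, b, c} \<in> {2, 3, 4}" using n by (auto simp: card_insert_if)
  fix T assume "T \<in> (R - {{a, b, c}}) Un {{a,b,v}, {a,c,v}, {b,c,v}}"
  then show "T \<in> R \<and> T ~= {a, b, c} \<or> T \<subseteq> {v, a, b, c} \<and> card T = 3 \<and> \<not> T \<subseteq> B"
   using n ct5.hyps(2) by (auto simp: card_insert_if)
 next
  show "good B R" "B \<subseteq> verts H" using ct5.IH ct5.prems by simp_all
  show "{v, a, b, c} \<subseteq> verts H" "B Int {v, a, b, c} = {a, b, c}" using ct5.prems ct5.hyps(2) a(1-3) by auto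
  show "card {a, b, c} \<le> 3" "{a, b, c} \<in> R" using ct5.hyps(4,5) by simp_all
  fix u w assume uw: "u \<in> B - {a, b, c}" "w \<in> {v, a, b, c} - {a, b, c}"
  have "u \<in> {a, b, c}" if "u \<in> B" "adj v u" for u using a(7)[OF that] by simp
  then have "\<not> adj u v" using uw(1) by (rule not_adj_outside)
  moreover have "w = v" using uw(2) by auto
  ultimately show "\<not> adj u w" by simp
 qed
 moreover have "B Un {v, a, b, c} = insert v B" using a(1-3) by auto
 ultimately show ?case by simp
qed

theorem parallel_connection_of_cliques: "parallel_connection_of_cliques M"
proof -
 have "EU (verts H) = E" using H.ends_in_verts edgesH by (auto simp: EU_def)
 then have "good (verts H) (unique_K4 adj (verts H)) --> ?thesis"
  unfolding good_def parallel_connection_of_cliques_def restriction_ground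
 proof (intro impI, elim exE conjE)
  fix \<K> \<U>
  assume eq: "EU (verts H) = E" and as: "assembled (restriction M (EU (verts H))) \<K> \<U>" and K: "\<forall>L\<in>\<K>. 2 \<le> card L"
   and U: "\<forall>T. T \<in># \<U> --> T \<subseteq> EU (verts H) \<and> (card T \<le> 1 \<or> count \<U> T \<le> 1)"
  have "assembled M \<K> \<U>" using as unfolding eq restriction_ground .
  moreover have "count \<U> L \<le> 1" if "L \<in> \<K>" for L
  proof (cases "L \<in># \<U>")
   case True
   then have "card L \<le> 1 \<or> count \<U> L \<le> 1" using U by blast
   moreover have "2 \<le> card L" using K that by blast
   ultimately show ?thesis by linarith
  next
   case False then show ?thesis by (simp add: not_in_iff)
  qed
  ultimately show "\<exists>\<K> \<U>. assembled M \<K> \<U> \<and> (\<forall>L\<in>\<K>. count \<U> L \<le> 1)" by blast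
 qed
 then show ?thesis using ctree_good[OF graph_ctree] by blast
qed

end

subsection \<open>Chordal graphs have simplicial vertices\<close>

definition hole :: "('v => 'v => bool) => 'v list => bool" where
 "hole A vs \<longleftrightarrow> length vs > 3 \<and> distinct vs \<and> (\<forall>i<length vs. \<forall>j<length vs. i ~= j -->
   (A (vs ! i) (vs ! j) \<longleftrightarrow> j = Suc i mod length vs \<or> i = Suc j mod length vs))"

lemma Suc_mod: "j < n ==> Suc j mod n = (if Suc j = n then 0 else Suc j)"
 by auto

lemma holeD: "hole A vs ==> i < length vs ==> j < length vs ==> i ~= j ==>
  A (vs ! i) (vs ! j) \<longleftrightarrow> j = Suc i mod length vs \<or> i = Suc j mod length vs"
 unfolding hole_def by simp

lemma chordal_iff: "chordal G \<longleftrightarrow> (\<forall>vs. set vs \<subseteq> verts G --> \<not> hole (adjacent G) vs)"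
proof -
 have "induced_cycle G vs \<and> length vs > 3 \<longleftrightarrow> set vs \<subseteq> verts G \<and> hole (adjacent G) vs" for vs
  unfolding induced_cycle_def hole_def by (auto simp: less_imp_le_nat)
 then show ?thesis unfolding chordal_def by blast
qed

text \<open>The last vertex of a hole in the order has two neighbours on the hole, and the order
  makes them adjacent although they are not consecutive.\<close>

lemma peo_no_hole:
 assumes "peo A B" "set vs \<subseteq> B" "hole A vs" shows False
 using assms
proof (induction rule: peo.induct)
 case peo_empty
 then show ?case by (auto simp: hole_def)
next
 case (peo_insert B v)
 let ?n = "length vs"
 have n: "?n > 3" and dist: "distinct vs" using peo_insert.prems by (auto simp: hole_def)
 show ?case
 proof (cases "v \<in> set vs")
  case False
  then show ?thesis using peo_insert.IH peo_insert.prems by blast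
 next
  case True
  then obtain k where k: "k < ?n" "vs ! k = v" by (auto simp: in_set_conv_nth)
  define j where "j = (if Suc k = ?n then 0 else Suc k)"
  define i where "i = (if k = 0 then ?n - 1 else k - 1)"
  have ij: "i < ?n" "j < ?n" "i ~= k" "j ~= k" "i ~= j" using k n by (auto simp: i_def j_def split: if_splits)
  have m: "Suc i mod ?n = k" "Suc k mod ?n = j" using k n Suc_mod[OF ij(1)] Suc_mod[OF k(1)] by (auto simp: i_def j_def)
  have nij: "\<not> (j = Suc i mod ?n \<or> i = Suc j mod ?n)"
   using m(1) ij Suc_mod[OF ij(2)] k n by (auto simp: i_def j_def split: if_splits)
  have "A v (vs ! i)" "A v (vs ! j)"
   using holeD[OF peo_insert.prems(2) k(1) ij(1)] holeD[OF peo_insert.prems(2) k(1) ij(2)] m ij k(2) by auto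
  moreover have "vs ! i ~= v" "vs ! j ~= v" "vs ! i ~= vs ! j"
   using nth_eq_iff_index_eq[OF dist] ij k by auto
  moreover have "vs ! i \<in> insert v B" "vs ! j \<in> insert v B" using ij(1,2) peo_insert.prems(1) by (meson nth_mem subsetD)+
  ultimately have "A (vs ! i) (vs ! j)" using peo_insert.hyps(4)[of "vs ! i" "vs ! j"] by auto
  then show ?thesis using holeD[OF peo_insert.prems(2) ij(1,2,5)] nij by simp
 qed
qed

definition walk_in :: "('v => 'v => bool) => 'v set => 'v => 'v => bool" where
 "walk_in A U = (\<lambda>a b. a \<in> U \<and> b \<in> U \<and> A a b)\<^sup>*\<^sup>*"

text \<open>Only the inner vertices are confined to U, and repetitions are allowed; minimal length
  later excludes repetitions and chords.\<close>

definition inner_path :: "('v => 'v => bool) => 'v set => 'v => 'v => 'v list => bool" where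
 "inner_path A U a b p \<longleftrightarrow> length p \<ge> 2 \<and> p ! 0 = a \<and> p ! (length p - 1) = b \<and>
   (\<forall>i. 0 < i --> i < length p - 1 --> p ! i \<in> U) \<and> (\<forall>i. Suc i < length p --> A (p ! i) (p ! Suc i))"

lemma inner_path_exists:
 assumes w: "walk_in A U x y" and "x \<in> U" "A a x" "A y b"
 shows "\<exists>p. inner_path A U a b p"
proof -
 have "\<exists>q. q ~= [] \<and> q ! 0 = a \<and> last q = y \<and> length q \<ge> 2 \<and> (\<forall>i. 0 < i --> i < length q --> q ! i \<in> U) \<and>
   (\<forall>i. Suc i < length q --> A (q ! i) (q ! Suc i))"
  using w unfolding walk_in_def
 proof (induction rule: rtranclp_induct)
  case base
  show ?case by (rule exI[of _ "[a, x]"]) (use assms in \<open>auto simp: less_Suc_eq nth_Cons split: nat.split\<close>)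
 next
  case (step y z)
  then obtain q where q: "q ~= []" "q ! 0 = a" "last q = y" "length q \<ge> 2" "\<forall>i. 0 < i --> i < length q --> q ! i \<in> U"
   "\<forall>i. Suc i < length q --> A (q ! i) (q ! Suc i)" by blast
  have ly: "q ! (length q - 1) = y" using q(1,3) by (simp add: last_conv_nth)
  show ?case
  proof (rule exI[of _ "q @ [z]"], intro conjI allI impI)
   fix i assume i: "Suc i < length (q @ [z])"
   show "A ((q @ [z]) ! i) ((q @ [z]) ! Suc i)"
   proof (cases "Suc i < length q")
    case True then show ?thesis using q(6) by (simp add: nth_append)
   next
    case False
    then have "i = length q - 1" using i by auto
    then show ?thesis using ly step(2) q(1) by (simp add: nth_append)
   qed
  next
   fix i assume "0 < i" "i < length (q @ [z])"
   then show "(q @ [z]) ! i \<in> U" using q(5) step(2) by (auto simp: nth_append less_Suc_eq)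
  qed (use q in \<open>auto simp: nth_append\<close>)
 qed
 then obtain q where q: "q ~= []" "q ! 0 = a" "last q = y" "length q \<ge> 2" "\<forall>i. 0 < i --> i < length q --> q ! i \<in> U"
   "\<forall>i. Suc i < length q --> A (q ! i) (q ! Suc i)" by blast
 have ly: "q ! (length q - 1) = y" using q(1,3) by (simp add: last_conv_nth)
 have "inner_path A U a b (q @ [b])" unfolding inner_path_def
 proof (intro conjI allI impI)
  fix i assume i: "Suc i < length (q @ [b])"
  show "A ((q @ [b]) ! i) ((q @ [b]) ! Suc i)"
  proof (cases "Suc i < length q")
   case True then show ?thesis using q(6) by (simp add: nth_append)
  next
   case False
   then have "i = length q - 1" using i by auto
   then show ?thesis using ly assms(4) q(1) by (simp add: nth_append)
  qed
 qed (use q in \<open>auto simp: nth_append\<close>)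
 then show ?thesis by blast
qed

lemma inner_path_shortcut:
 assumes p: "inner_path A U a b p" and ij: "Suc i < j" "j < length p" "A (p ! i) (p ! j)"
 shows "\<exists>p'. inner_path A U a b p' \<and> length p' < length p"
proof -
 let ?p = "take (Suc i) p @ drop j p"
 have len: "length ?p = Suc i + (length p - j)" using ij by simp
 have nth: "?p ! k = (if k \<le> i then p ! k else p ! (k - Suc i + j))" if "k < length ?p" for k
  using that ij by (auto simp: nth_append add.commute)
 have "inner_path A U a b ?p" unfolding inner_path_def
 proof (intro conjI allI impI)
  show "length ?p \<ge> 2" using ij len by linarith
  have "p ~= []" using ij by auto
  then show "?p ! 0 = a" using p by (simp add: inner_path_def nth_append)
  define k where "k = length ?p - 1"
  have k: "k < length ?p" "\<not> k \<le> i" "k - Suc i + j = length p - 1" unfolding k_def using len ij by linarith+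
  have "?p ! k = p ! (k - Suc i + j)" using nth[OF k(1)] k(2) by presburger
  also have "\<dots> = p ! (length p - 1)" unfolding k(3) by (rule refl)
  also have "\<dots> = b" using p by (simp add: inner_path_def)
  finally show "?p ! (length ?p - 1) = b" unfolding k_def .
 next
  fix k assume k: "0 < k" "k < length ?p - 1"
  then have "k < length ?p" by simp
  moreover have "\<not> k \<le> i ==> k - Suc i + j < length p - 1" using k len ij by linarith
  moreover have "k \<le> i ==> k < length p - 1" using ij by linarith
  ultimately show "?p ! k \<in> U" using nth[of k] p k ij by (auto simp: inner_path_def)
 next
  fix k assume k: "Suc k < length ?p"
  consider "Suc k \<le> i" | "k = i" | "k > i" by linarith
  then show "A (?p ! k) (?p ! Suc k)"
  proof cases
   case 1
   then have "Suc k < length p" using ij by linarith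
   then show ?thesis using nth[of k] nth[of "Suc k"] k 1 p by (simp add: inner_path_def)
  next
   case 2
   then show ?thesis using nth[of k] nth[of "Suc k"] k ij by simp
  next
   case 3
   then have "Suc k - Suc i + j = Suc (k - Suc i + j)" "Suc (k - Suc i + j) < length p" using k len by linarith+
   then show ?thesis using nth[of k] nth[of "Suc k"] k 3 p by (simp add: inner_path_def)
  qed
 qed
 moreover have "length ?p < length p" using len ij by linarith
 ultimately show ?thesis by blast
qed

text \<open>Dirac's argument as an induction. Take a connected U containing x, maximal such that
  some vertex is neither in U nor adjacent to it. By maximality every vertex of the boundary N of U
  is adjacent to all of \<open>far U\<close>. N is a clique: two nonadjacent boundary vertices, a
  shortest path between them through U and a vertex of \<open>far U\<close> would form a hole. A
  simplicial vertex of \<open>far U\<close> has its other neighbours in N and so is simplicial in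
  B.\<close>

theorem simplicial_vertex:
 fixes A :: "'v => 'v => bool"
 assumes sym: "\<And>x y. A x y ==> A y x" and irrefl: "\<And>x. \<not> A x x"
 shows "finite B ==> B ~= {} ==> (\<And>vs. set vs \<subseteq> B ==> \<not> hole A vs) ==>
  \<exists>v\<in>B. clique A {u \<in> B. A v u}"
proof (induction "card B" arbitrary: B rule: less_induct)
 case less
 show ?case
 proof (cases "clique A B")
  case True
  obtain v where v: "v \<in> B" using less.prems(2) by blast
  have "clique A {u \<in> B. A v u}" using cliqueD[OF True] by (simp add: clique_def)
  then show ?thesis using v by blast
 next
  case False
  then obtain x y where xy: "x \<in> B" "y \<in> B" "x ~= y" "\<not> A x y" by (auto simp: clique_def)
  define far where "far U = {w \<in> B. w \<notin> U \<and> (\<forall>u\<in>U. \<not> A w u)}" for U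
  define S where "S = {U. U \<subseteq> B \<and> x \<in> U \<and> (\<forall>u\<in>U. walk_in A U x u) \<and> far U ~= {}}"
  have finS: "finite S" by (rule finite_subset[of _ "Pow B"]) (use less.prems(1) in \<open>auto simp: S_def\<close>)
  have "\<not> A y x" using xy(4) sym by blast
  then have "{x} \<in> S" using xy by (auto simp: S_def far_def walk_in_def)
  then have "S ~= {}" by blast
  from finite_has_maximal[OF finS this]
  obtain U where U: "U \<in> S" and Umax: "\<forall>U'\<in>S. U \<subseteq> U' --> U = U'" by blast
  have UB: "U \<subseteq> B" "x \<in> U" "far U ~= {}" and Uw: "\<And>u. u \<in> U ==> walk_in A U x u" using U by (auto simp: S_def)
  define N where "N = {b \<in> B. b \<notin> U \<and> (\<exists>u\<in>U. A b u)}"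
  have mono: "walk_in A U' s t" if "walk_in A U s t" "U \<subseteq> U'" for U U' s t
  proof -
   have "(\<lambda>a b. a \<in> U \<and> b \<in> U \<and> A a b)\<^sup>*\<^sup>* \<le> (\<lambda>a b. a \<in> U' \<and> b \<in> U' \<and> A a b)\<^sup>*\<^sup>*"
    by (rule rtranclp_mono) (use that(2) in auto)
   then show ?thesis using that(1) unfolding walk_in_def by blast
  qed
  have wsym: "walk_in A U t s" if "walk_in A U s t" for s t
  proof -
   have "symp (\<lambda>a b. a \<in> U \<and> b \<in> U \<and> A a b)" using sym by (auto simp: symp_def)
   then have "symp ((\<lambda>a b. a \<in> U \<and> b \<in> U \<and> A a b)\<^sup>*\<^sup>*)" by (rule symp_rtranclp)
   then show ?thesis using that unfolding walk_in_def by (rule sympD)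
  qed
  have joined: "A b w" if b: "b \<in> N" and w: "w \<in> far U" for b w
  proof (rule ccontr)
   assume n: "\<not> A b w"
   obtain u where u: "u \<in> U" "A b u" and bB: "b \<in> B" "b \<notin> U" using b by (auto simp: N_def)
   have "walk_in A (insert b U) x u" using mono[OF Uw[OF u(1)]] by auto
   then have "walk_in A (insert b U) x b" unfolding walk_in_def
    by (rule rtranclp.rtrancl_into_rtrancl) (use u sym in auto)
   then have "\<forall>t\<in>insert b U. walk_in A (insert b U) x t" using mono[OF Uw] by blast
   moreover have "\<not> A w b" using n sym by blast
   then have "w \<in> far (insert b U)" using w b n by (auto simp: far_def N_def)
   ultimately have "insert b U \<in> S" using UB bB by (auto simp: S_def)
   then have "U = insert b U" using Umax by blast
   then show False using bB by blast
  qed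
  obtain w0 where w0: "w0 \<in> far U" using UB by blast
  have w0B: "w0 \<in> B" "w0 \<notin> U" "\<And>u. u \<in> U ==> \<not> A w0 u" using w0 by (auto simp: far_def)
  have Ncl: "clique A N"
  proof (rule ccontr)
   assume "\<not> clique A N"
   then obtain b1 b2 where b: "b1 \<in> N" "b2 \<in> N" "b1 ~= b2" "\<not> A b1 b2" by (auto simp: clique_def)
   obtain u1 u2 where u: "u1 \<in> U" "A b1 u1" "u2 \<in> U" "A b2 u2" using b by (auto simp: N_def)
   have "walk_in A U u1 u2" using wsym[OF Uw[OF u(1)]] Uw[OF u(3)] unfolding walk_in_def by (rule rtranclp_trans)
   then obtain p0 where p0: "inner_path A U b1 b2 p0" using inner_path_exists[of A U u1 u2 b1 b2] u sym by blast
   obtain p where p: "inner_path A U b1 b2 p" and pm: "\<And>p'. inner_path A U b1 b2 p' ==> length p \<le> length p'"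
    using ex_has_least_nat[of "inner_path A U b1 b2" p0 length, OF p0] by blast
   let ?m = "length p"
   have p': "?m \<ge> 2" "p ! 0 = b1" "p ! (?m - 1) = b2" "\<And>i. 0 < i ==> i < ?m - 1 ==> p ! i \<in> U"
    "\<And>i. Suc i < ?m ==> A (p ! i) (p ! Suc i)" using p by (auto simp: inner_path_def)
   have nochord: "\<not> A (p ! i) (p ! j)" if "Suc i < j" "j < ?m" for i j
    using inner_path_shortcut[OF p that] pm by (meson not_le)
   have m3: "?m \<ge> 3"
   proof (rule ccontr)
    assume "\<not> ?m \<ge> 3"
    then have "?m = 2" using p'(1) by simp
    then show False using p'(5)[of 0] p'(2,3) b(4) by simp
   qed
   have neq: "p ! i ~= p ! j" if ij: "i < j" "j < ?m" for i j
   proof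
    assume eq: "p ! i = p ! j"
    show False
    proof (cases "Suc j < ?m")
     case True
     then have "A (p ! i) (p ! Suc j)" using p'(5)[of j] eq by simp
     then show False using nochord[of i "Suc j"] ij True by simp
    next
     case False
     then have j: "j = ?m - 1" using ij by simp
     show False
     proof (cases "i = 0")
      case True then show False using eq j p'(2,3) b(3) by simp
     next
      case False
      then have "A (p ! (i - 1)) (p ! j)" using p'(5)[of "i - 1"] eq ij by simp
      then show False using nochord[of "i - 1" j] ij False by simp
     qed
    qed
   qed
   have adjp: "A (p ! i) (p ! j) \<longleftrightarrow> j = Suc i \<or> i = Suc j" if ij: "i < ?m" "j < ?m" "i ~= j" for i j
   proof -
    consider "j = Suc i" | "i = Suc j" | "Suc i < j" | "Suc j < i" using ij by linarith
    then show ?thesis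
    proof cases
     case 1 then show ?thesis using p'(5)[of i] that by simp
    next
     case 2 then show ?thesis using p'(5)[of j] that sym by simp
    next
     case 3 then show ?thesis using nochord[of i j] that by simp
    next
     case 4 then show ?thesis using nochord[of j i] that sym by (metis Suc_lessD less_irrefl not_less_eq)
    qed
   qed
   have pB: "p ! k \<in> B \<and> p ! k ~= w0 \<and> (A w0 (p ! k) \<longleftrightarrow> k = 0 \<or> k = ?m - 1)" if k: "k < ?m" for k
   proof (cases "k = 0 \<or> k = ?m - 1")
    case True
    then have "p ! k = b1 \<or> p ! k = b2" using p' by auto
    then have pk: "p ! k \<in> N" using b by auto
    have "A w0 (p ! k)" using joined[OF pk w0] sym by blast
    then show ?thesis using pk irrefl True by (auto simp: N_def)
   next
    case False
    then have "p ! k \<in> U" using p'(4)[of k] k by auto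
    then show ?thesis using UB w0B False by auto
   qed
   let ?vs = "w0 # p"
   have "distinct p" unfolding distinct_conv_nth using neq by (metis linorder_neqE_nat)
   moreover have "w0 \<notin> set p" using pB by (auto simp: in_set_conv_nth)
   ultimately have "distinct ?vs" by simp
   moreover have "A (?vs ! i) (?vs ! j) \<longleftrightarrow> j = Suc i mod length ?vs \<or> i = Suc j mod length ?vs"
    if ij: "i < length ?vs" "j < length ?vs" "i ~= j" for i j
   proof -
    have Sm: "Suc i mod length ?vs = (if i = ?m then 0 else Suc i)" "Suc j mod length ?vs = (if j = ?m then 0 else Suc j)"
     using Suc_mod[OF ij(1)] Suc_mod[OF ij(2)] by auto
    show ?thesis
    proof (cases i)
     case 0
     then obtain l where l: "j = Suc l" "l < ?m" using ij by (cases j) auto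
     have "A w0 (p ! l) \<longleftrightarrow> l = 0 \<or> l = ?m - 1" using pB[OF l(2)] by blast
     then show ?thesis unfolding Sm using 0 l m3 by auto
    next
     case (Suc k)
     then have k: "k < ?m" using ij by simp
     show ?thesis
     proof (cases j)
      case 0
      have "A (p ! k) w0 \<longleftrightarrow> A w0 (p ! k)" using sym by blast
      moreover have "A w0 (p ! k) \<longleftrightarrow> k = 0 \<or> k = ?m - 1" using pB[OF k] by blast
      ultimately show ?thesis unfolding Sm using 0 Suc k m3 by auto
     next
      case (Suc l)
      then have l: "l < ?m" "k ~= l" using ij \<open>i = Suc k\<close> by auto
      show ?thesis unfolding Sm unfolding \<open>i = Suc k\<close> Suc nth_Cons_Suc adjp[OF k l] using k l by auto
     qed
    qed
   qed
   ultimately have "hole A ?vs" unfolding hole_def using m3 by simp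
   moreover have "set ?vs \<subseteq> B" using w0B pB by (auto simp: in_set_conv_nth)
   ultimately show False using less.prems(3) by blast
  qed
  have farB: "far U \<subset> B" using UB by (auto simp: far_def)
  then have "card (far U) < card B" using less.prems(1) by (intro psubset_card_mono)
  moreover have "finite (far U)" using farB less.prems(1) finite_subset by blast
  moreover have "\<not> hole A vs" if "set vs \<subseteq> far U" for vs using less.prems(3) that farB by blast
  ultimately obtain v where v: "v \<in> far U" "clique A {u \<in> far U. A v u}" using less.hyps[of "far U"] UB(3) by blast
  have split: "u \<in> {u \<in> far U. A v u} \<or> u \<in> N" if "u \<in> B" "A v u" for u
  proof -
   have "u \<notin> U" using v(1) that by (auto simp: far_def)
   then show ?thesis using that by (auto simp: far_def N_def)
  qed
  have "clique A {u \<in> B. A v u}" unfolding clique_def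
  proof (intro ballI impI)
   fix s t assume st: "s \<in> {u \<in> B. A v u}" "t \<in> {u \<in> B. A v u}" "s ~= t"
   consider "s \<in> N" "t \<in> N" | "s \<in> N" "t \<in> far U" | "s \<in> far U" "t \<in> N"
    | "s \<in> {u \<in> far U. A v u}" "t \<in> {u \<in> far U. A v u}" using split st by blast
   then show "A s t"
   proof cases
    case 1 then show ?thesis using cliqueD[OF Ncl] st by blast
   next
    case 2 then show ?thesis using joined by blast
   next
    case 3 then show ?thesis using joined sym by blast
   next
    case 4 then show ?thesis using cliqueD[OF v(2)] st by blast
   qed
  qed
  then show ?thesis using v(1) farB by blast
 qed
qed

text \<open>Removing a simplicial vertex v from U leaves the edges of a modular hyperplane: two
  edges at v are completed to a triangle by an edge between their other ends. If v has no edges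
  inside U, there is no step.\<close>

theorem chordal_chain:
 assumes M: "matroid (cycle_matroid H)" and sim: "simple_matroid (cycle_matroid H)" and fg: "finite_graph H" and ch: "chordal H"
 shows "(mhstep (flats (cycle_matroid H)))\<^sup>*\<^sup>* {} (edges H)"
proof -
 interpret H: finite_graph H by fact
 interpret M: matroid "cycle_matroid H" by fact
 interpret B: binary_matroid "cycle_matroid H" "cuts H" by unfold_locales (rule H.binary_rep_cycle_matroid)
 have gr: "M.E = edges H" by (simp add: cycle_matroid_def)
 let ?A = "adjacent H"
 have pair: "\<exists>a b. ends H e = {a, b} \<and> a ~= b" if e: "e \<in> edges H" for e
 proof -
  obtain a b where ab: "ends H e = {a, b}" using H.ends_pair[OF e] by blast
  have "{e, e} \<in> indep (cycle_matroid H)" using M.simple_indep2[OF sim, of e e] e gr by auto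
  then obtain C where "C \<in> cuts H" "C Int {e, e} = {e}" using B.indepD[of "{e, e}" e] by auto
  then obtain P where "e \<in> cut H P" by (auto simp: cuts_def)
  then show ?thesis using H.mem_cut_pair[OF e ab] ab by auto
 qed
 have sym: "?A u w ==> ?A w u" for u w by (auto simp: adjacent_def insert_commute)
 have irr: "\<not> ?A u u" for u
 proof
  assume "?A u u"
  then obtain e where e: "e \<in> edges H" "ends H e = {u, u}" by (auto simp: adjacent_def)
  then show False using pair[OF e(1)] by auto
 qed
 define EV where "EV U = {e \<in> edges H. ends H e \<subseteq> U}" for U
 have flat: "EV U \<in> flats (cycle_matroid H)" for U unfolding B.flat_iff
 proof (intro conjI ballI)
  fix e assume e: "e \<in> M.E - EV U"
  then have eH: "e \<in> edges H" using gr by simp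
  obtain a b where ab: "ends H e = {a, b}" "a ~= b" using pair[OF eH] by blast
  obtain t where t: "t \<in> ends H e" "t \<notin> U" using e gr by (auto simp: EV_def)
  have "e \<in> cut H {t}" using H.mem_cut_pair[OF eH ab(1)] ab t by auto
  moreover have "cut H {t} Int EV U = {}" using t by (auto simp: cut_def EV_def)
  ultimately show "\<exists>C\<in>cuts H. e \<in> C \<and> C Int EV U = {}" by (auto simp: cuts_def)
 qed (auto simp: EV_def gr)
 have "(mhstep (flats (cycle_matroid H)))\<^sup>*\<^sup>* {} (EV U)" if "finite U" "U \<subseteq> verts H" for U
  using that
 proof (induction "card U" arbitrary: U)
  case 0
  then have "EV U = {}" using pair by (fastforce simp: EV_def)
  then show ?case by simp
 next
  case (Suc n)
  then have "U ~= {}" by auto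
  moreover have "\<not> hole ?A vs" if "set vs \<subseteq> U" for vs using ch Suc.prems(2) that unfolding chordal_iff by blast
  ultimately obtain v where v: "v \<in> U" "clique ?A {u \<in> U. ?A v u}"
   using simplicial_vertex[of ?A U, OF sym irr Suc.prems(1)] by blast
  have "card (U - {v}) = n" using Suc.hyps(2) Suc.prems(1) v(1) by simp
  then have IH: "(mhstep (flats (cycle_matroid H)))\<^sup>*\<^sup>* {} (EV (U - {v}))" using Suc.hyps(1)[of "U - {v}"] Suc.prems by auto
  have sub: "EV (U - {v}) \<subseteq> EV U" by (auto simp: EV_def)
  show ?case
  proof (cases "EV (U - {v}) = EV U")
   case True then show ?thesis using IH by simp
  next
   case False
   have nb: "\<exists>a. ends H e = {v, a} \<and> a \<in> U \<and> ?A v a" if e: "e \<in> EV U - EV (U - {v})" for e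
   proof -
    have eH: "e \<in> edges H" "ends H e \<subseteq> U" "\<not> ends H e \<subseteq> U - {v}" using e by (auto simp: EV_def)
    obtain a b where ab: "ends H e = {a, b}" "a ~= b" using pair[OF eH(1)] by blast
    then have "\<exists>t. ends H e = {v, t} \<and> t \<in> U" using eH by auto
    then show ?thesis using eH(1) by (auto simp: adjacent_def)
   qed
   have "mhstep (flats (cycle_matroid H)) (EV (U - {v})) (EV U)" unfolding mhstep_def
   proof (intro conjI ballI impI flat)
    show "EV (U - {v}) \<subset> EV U" using sub False by blast
    fix e f assume ef: "e \<in> EV U - EV (U - {v})" "f \<in> EV U - EV (U - {v})" "e ~= f"
    obtain a where a: "ends H e = {v, a}" "a \<in> U" "?A v a" using nb[OF ef(1)] by blast
    obtain b where b: "ends H f = {v, b}" "b \<in> U" "?A v b" using nb[OF ef(2)] by blast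
    have efH: "e \<in> edges H" "f \<in> edges H" using ef by (auto simp: EV_def)
    have "a ~= b"
    proof
     assume "a = b"
     obtain C where C: "C \<in> cuts H" "e \<in> C" "f \<notin> C" using B.simple_separate[OF sim, of e f] efH gr ef(3) by auto
     then obtain P where P: "C = cut H P" by (auto simp: cuts_def)
     show False using C unfolding P H.mem_cut_pair[OF efH(1) a(1)] H.mem_cut_pair[OF efH(2) b(1)] \<open>a = b\<close> by simp
    qed
    then have "?A a b" using cliqueD[OF v(2), of a b] a b by simp
    then obtain g where g: "g \<in> edges H" "ends H g = {a, b}" by (auto simp: adjacent_def)
    have "a ~= v" "b ~= v" using a(3) b(3) irr by auto
    then have gE: "g \<in> EV (U - {v})" using g a(2) b(2) by (auto simp: EV_def)
    have "g \<in> F" if F: "F \<in> flats (cycle_matroid H)" "e \<in> F" "f \<in> F" for F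
    proof (rule ccontr)
     assume "g \<notin> F"
     then obtain C where C: "C \<in> cuts H" "g \<in> C" "C Int F = {}" using B.flatD[OF F(1), of g] g(1) gr by auto
     then obtain P where P: "C = cut H P" by (auto simp: cuts_def)
     have "e \<notin> cut H P" "f \<notin> cut H P" "g \<in> cut H P" using C F P by auto
     then show False
      unfolding H.mem_cut_pair[OF efH(1) a(1)] H.mem_cut_pair[OF efH(2) b(1)] H.mem_cut_pair[OF g(1,2)] by simp
    qed
    then show "\<exists>g\<in>EV (U - {v}). \<forall>F\<in>flats (cycle_matroid H). e \<in> F --> f \<in> F --> g \<in> F" using gE by blast
   qed
   then show ?thesis using IH by (rule rtranclp.rtrancl_into_rtrancl[rotated])
  qed
 qed
 moreover have "EV (verts H) = edges H" using H.ends_in_verts by (auto simp: EV_def)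
 ultimately show ?thesis using H.finite_verts by (metis order_refl)
qed

subsection \<open>Straight-line drawings\<close>

definition cross :: "complex => complex => real" where
 "cross z w = Re z * Im w - Im z * Re w"

lemma cross_linear [simp]:
 "cross (x + y) z = cross x z + cross y z" "cross z (x + y) = cross z x + cross z y"
 "cross (x - y) z = cross x z - cross y z" "cross z (x - y) = cross z x - cross z y"
 "cross (t *\<^sub>R x) z = t * cross x z" "cross z (t *\<^sub>R x) = t * cross z x" "cross x x = 0"
 "cross (- x) z = - cross x z" "cross z (- x) = - cross z x" "cross 0 z = 0" "cross z 0 = 0"
 by (simp_all add: cross_def algebra_simps)

lemma cross_commute: "cross x y = - cross y x"
 by (simp add: cross_def)

lemma cross_independent:
 assumes "cross p u ~= 0" "s *\<^sub>R p + t *\<^sub>R u = 0"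
 shows "s = 0 \<and> t = 0"
proof -
 have "cross (s *\<^sub>R p + t *\<^sub>R u) u = 0" "cross p (s *\<^sub>R p + t *\<^sub>R u) = 0" using assms(2) by simp_all
 then show ?thesis using assms(1) by simp
qed

text \<open>The closed cone spanned by p and u; the arguments are offsets from a common point of the
  drawing.\<close>

definition incone :: "complex => complex => complex => bool" where
 "incone x p u \<longleftrightarrow> (\<exists>s t. 0 \<le> s \<and> 0 \<le> t \<and> x = s *\<^sub>R p + t *\<^sub>R u)"

text \<open>By Cramer's rule the coordinates of x in the basis p, u are \<open>cross x u\<close> and
  \<open>cross p x\<close> divided by \<open>cross p u\<close>.\<close>

lemma not_incone:
 assumes "cross p x * cross p u < 0 \<or> cross x u * cross p u < 0"
 shows "\<not> incone x p u"
proof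
 assume "incone x p u"
 then obtain s t where st: "0 \<le> s" "0 \<le> t" "x = s *\<^sub>R p + t *\<^sub>R u" by (auto simp: incone_def)
 have "cross p x * cross p u = t * (cross p u * cross p u)" "cross x u * cross p u = s * (cross p u * cross p u)"
  using st(3) by simp_all
 moreover have "0 \<le> t * (cross p u * cross p u)" "0 \<le> s * (cross p u * cross p u)" using st(1,2) by simp_all
 ultimately show False using assms by linarith
qed

lemma not_incone_scale:
 assumes "\<not> incone x p u" "0 < e"
 shows "\<not> incone (e *\<^sub>R x) p u"
proof
 assume "incone (e *\<^sub>R x) p u"
 then obtain s t where st: "0 \<le> s" "0 \<le> t" "e *\<^sub>R x = s *\<^sub>R p + t *\<^sub>R u" by (auto simp: incone_def)
 have "x = (1 / e) *\<^sub>R (e *\<^sub>R x)" using assms(2) by simp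
 also have "\<dots> = (s / e) *\<^sub>R p + (t / e) *\<^sub>R u" unfolding st(3) by (simp add: scaleR_add_right)
 finally have "x = (s / e) *\<^sub>R p + (t / e) *\<^sub>R u" .
 moreover have "0 \<le> s / e" "0 \<le> t / e" using st(1,2) assms(2) by simp_all
 ultimately show False using assms(1) unfolding incone_def by blast
qed

lemma in_segment_offset:
 fixes q x z y :: complex
 assumes "q \<in> closed_segment x z"
 shows "\<exists>s. 0 \<le> s \<and> s \<le> 1 \<and> q - y = (1 - s) *\<^sub>R (x - y) + s *\<^sub>R (z - y)"
proof -
 obtain s where "0 \<le> s" "s \<le> 1" "q = (1 - s) *\<^sub>R x + s *\<^sub>R z" using assms by (auto simp: in_segment)
 then show ?thesis by (intro exI[of _ s]) (simp add: algebra_simps)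
qed

lemma segments_meet_at_end:
 assumes "cross (p - r) (x - r) ~= 0"
 shows "closed_segment p r Int closed_segment x r \<subseteq> {r}"
proof
 fix q assume q: "q \<in> closed_segment p r Int closed_segment x r"
 obtain s where s: "q - r = (1 - s) *\<^sub>R (p - r) + s *\<^sub>R (r - r)" using in_segment_offset[of q p r r] q by blast
 obtain t where t: "q - r = (1 - t) *\<^sub>R (x - r) + t *\<^sub>R (r - r)" using in_segment_offset[of q x r r] q by blast
 have "(t - 1) *\<^sub>R (x - r) = - ((1 - t) *\<^sub>R (x - r))" by (simp add: algebra_simps)
 then have "(1 - s) *\<^sub>R (p - r) + (t - 1) *\<^sub>R (x - r) = 0" using s t by simp
 from cross_independent[OF assms this] show "q \<in> {r}" using s by simp
qed

text \<open>Vertices are identified with their positions and edges with pairs of positions, so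
  auxiliary points are treated like vertices.\<close>

definition drawing :: "complex set => (complex => complex => bool) => bool" where
 "drawing P L \<longleftrightarrow> finite P \<and>
  (\<forall>x y. L x y --> L y x \<and> x \<in> P \<and> x ~= y \<and> closed_segment x y Int P \<subseteq> {x, y}) \<and>
  (\<forall>x y z w. L x y --> L z w --> {x, y} ~= {z, w} -->
    closed_segment x y Int closed_segment z w \<subseteq> {x, y} Int {z, w})"

lemma drawingD:
 assumes "drawing P L"
 shows drawing_finite: "finite P"
  and drawing_edge: "L x y ==> L y x" "L x y ==> x \<in> P" "L x y ==> y \<in> P" "L x y ==> x ~= y"
  and drawing_point: "L x y ==> closed_segment x y Int P \<subseteq> {x, y}"
  and drawing_disjoint: "L x y ==> L z w ==> {x, y} ~= {z, w} ==>
    closed_segment x y Int closed_segment z w \<subseteq> {x, y} Int {z, w}"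
proof -
 note a = assms[unfolded drawing_def]
 show "finite P" using a by simp
 show "L x y ==> L y x" "L x y ==> x \<in> P" "L x y ==> x ~= y" using a by simp_all
 show "y \<in> P" if "L x y" using a[THEN conjunct2, THEN conjunct1] \<open>L x y\<close> by metis
 show "L x y ==> closed_segment x y Int P \<subseteq> {x, y}" using a by simp
 show "L x y ==> L z w ==> {x, y} ~= {z, w} ==>
    closed_segment x y Int closed_segment z w \<subseteq> {x, y} Int {z, w}" using a by simp
qed

definition attach :: "(complex => complex => bool) => complex => complex set => complex => complex => bool" where
 "attach L w S x y \<longleftrightarrow> L x y \<or> x = w \<and> y \<in> S \<or> y = w \<and> x \<in> S"

lemma attach_cases:
 assumes "attach L w S x y"
 obtains "L x y" | t where "t \<in> S" "{x, y} = {w, t}" "closed_segment x y = closed_segment w t"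
 using assms unfolding attach_def by (auto simp: closed_segment_commute insert_commute)

lemma drawing_attach:
 assumes d: "drawing P L" and w: "w \<notin> P" and S: "S \<subseteq> P"
  and F1: "\<And>t. t \<in> S ==> closed_segment w t Int P \<subseteq> {t}"
  and F2: "\<And>x z. L x z ==> w \<notin> closed_segment x z"
  and F3: "\<And>t x z. t \<in> S ==> L x z ==> closed_segment w t Int closed_segment x z \<subseteq> {t} Int {x, z}"
  and F4: "\<And>t t'. t \<in> S ==> t' \<in> S ==> t ~= t' ==> closed_segment w t Int closed_segment w t' \<subseteq> {w}"
 shows "drawing (insert w P) (attach L w S)"
 unfolding drawing_def
proof (intro conjI allI impI)
 show "finite (insert w P)" using drawing_finite[OF d] by simp
 fix x y assume e: "attach L w S x y"
 show "attach L w S y x" using e drawing_edge(1)[OF d] by (auto simp: attach_def)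
 show "x \<in> insert w P" using e S drawing_edge(2)[OF d] by (auto simp: attach_def)
 show "x ~= y" using e S w drawing_edge(4)[OF d] by (auto simp: attach_def)
 show "closed_segment x y Int insert w P \<subseteq> {x, y}" using e
 proof (cases rule: attach_cases)
  case 1
  then show ?thesis using F2[OF 1] drawing_point[OF d 1] by blast
 next
  case (2 t)
  then show ?thesis using F1[OF 2(1)] by blast
 qed
next
 fix x y z v assume e: "attach L w S x y" "attach L w S z v" and ne: "{x, y} ~= {z, v}"
 show "closed_segment x y Int closed_segment z v \<subseteq> {x, y} Int {z, v}" using e(1)
 proof (cases rule: attach_cases)
  case 1
  show ?thesis using e(2)
  proof (cases rule: attach_cases)
   case i: 1
   then show ?thesis using drawing_disjoint[OF d 1 i ne] by blast
  next
   case (2 t)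
   show ?thesis using F3[OF 2(1) 1] 2(2) unfolding 2(3) by blast
  qed
 next
  case (2 t)
  show ?thesis using e(2)
  proof (cases rule: attach_cases)
   case 1
   show ?thesis using F3[OF 2(1) 1] 2(2) unfolding 2(3) by blast
  next
   case i: (2 t')
   have "t ~= t'" using ne 2(2) i(2) by auto
   then show ?thesis using F4[OF 2(1) i(1)] 2(2) i(2) unfolding 2(3) i(3) by blast
  qed
 qed
qed

text \<open>A compact segment has positive distance from a disjoint closed set, and a small shift of
  one end does not bridge it.\<close>

lemma segment_escapes:
 fixes y t u :: complex
 assumes "closed K" "closed_segment y t Int K = {}"
 shows "eventually (\<lambda>e. closed_segment (y + e *\<^sub>R u) t Int K = {}) (at_right 0)"
proof -
 obtain d where d: "d > 0" "\<And>p q. p \<in> closed_segment y t ==> q \<in> K ==> d \<le> dist p q"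
  using separate_compact_closed[OF compact_segment assms] by blast
 have pos: "0 < d / (norm u + 1)" using d(1) by (simp add: add_nonneg_pos)
 show ?thesis
 proof (rule eventually_at_rightI[OF _ pos])
  fix e assume "e \<in> {0<..<d / (norm u + 1)}"
  then have e: "0 < e" "e * (norm u + 1) < d"
   by (auto simp: pos_less_divide_eq add_nonneg_pos)
  have "q \<notin> K" if qs: "q \<in> closed_segment (y + e *\<^sub>R u) t" for q
  proof
   assume q: "q \<in> K"
   obtain s where s: "0 \<le> s" "s \<le> 1" "q = (1 - s) *\<^sub>R (y + e *\<^sub>R u) + s *\<^sub>R t"
    using qs by (auto simp: in_segment)
   have "(1 - s) *\<^sub>R y + s *\<^sub>R t \<in> closed_segment y t" using s by (auto simp: in_segment)
   from d(2)[OF this q] have "d \<le> norm ((1 - s) *\<^sub>R y + s *\<^sub>R t - q)" by (simp add: dist_norm)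
   also have "(1 - s) *\<^sub>R y + s *\<^sub>R t - q = - (((1 - s) * e) *\<^sub>R u)" by (simp add: s(3) algebra_simps)
   also have "norm \<dots> = (1 - s) * e * norm u" using s e by simp
   also have "\<dots> \<le> 1 * e * norm u" using s e by (intro mult_right_mono) auto
   also have "\<dots> < d" using e by (simp add: algebra_simps)
   finally show False by simp
  qed
  then show "closed_segment (y + e *\<^sub>R u) t Int K = {}" by blast
 qed
qed

lemma eventually_affine_nonzero:
 fixes A B :: real
 assumes "A ~= 0 \<or> B ~= 0"
 shows "eventually (\<lambda>e. A + e * B ~= 0) (at_right 0)"
proof (cases "B = 0")
 case True then show ?thesis using assms by simp
next
 case False
 show ?thesis
 proof (rule eventually_at_rightI)
  show "0 < (if - A / B > 0 then - A / B else 1)" by simp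
  fix e assume e: "e \<in> {0<..<(if - A / B > 0 then - A / B else 1)}"
  show "A + e * B ~= 0"
  proof
   assume "A + e * B = 0"
   then have "e = - A / B" using False by (simp add: field_simps)
   then show False using e by (auto split: if_splits)
  qed
 qed
qed

text \<open>Seen from y, no two points of S appear in the same or in opposite directions.\<close>

definition spread :: "complex => complex set => bool" where
 "spread y S \<longleftrightarrow> (\<forall>s\<in>S. \<forall>t\<in>S. s ~= t --> cross (s - y) (t - y) ~= 0)"

lemma spreadD: "spread y S ==> s \<in> S ==> t \<in> S ==> s ~= t ==> cross (s - y) (t - y) ~= 0"
 by (simp add: spread_def)

text \<open>Edges and points away from the new edges stay at a positive distance from them; the cone condition
  keeps the new triangle \<open>y\<close>, \<open>r\<close>, \<open>y + e u\<close> free of the other edges at \<open>y\<close>.\<close>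

lemma drawing_insert:
 assumes d: "drawing P L" and Q: "\<And>r. r \<in> Q ==> L y r" "Q ~= {}" and spr: "spread y Q"
  and dir: "\<And>r. r \<in> Q ==> cross (r - y) u ~= 0"
  and cone: "\<And>r x. r \<in> Q ==> L y x ==> x ~= r ==> \<not> incone (x - y) (r - y) u"
  and S: "S \<subseteq> insert y Q"
 shows "\<exists>e>0. y + e *\<^sub>R u \<notin> P \<and> drawing (insert (y + e *\<^sub>R u) P) (attach L (y + e *\<^sub>R u) S) \<and>
  spread (y + e *\<^sub>R u) (insert y Q)"
proof -
 let ?S = "insert y Q"
 have QP: "Q \<subseteq> P" using Q(1) drawing_edge(3)[OF d] by blast
 have finP: "finite P" by (rule drawing_finite[OF d])
 have finQ: "finite Q" by (rule finite_subset[OF QP finP])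
 obtain r0 where r0: "r0 \<in> Q" using Q(2) by blast
 have yP: "y \<in> P" using drawing_edge(2)[OF d Q(1)[OF r0]] .
 have SP: "?S \<subseteq> P" using QP yP by blast
 have yQ: "y \<notin> Q" using Q(1) drawing_edge(4)[OF d] by blast
 have u0: "u ~= 0" using dir[OF r0] by auto
 \<comment> \<open>Three conditions that hold for all small shifts: segments missing the segment
   from y to t also miss the shifted one; the shifted point, r and a further point are not
   collinear; and the shifted point sees Q spread.\<close>
 define esc where "esc e \<longleftrightarrow> (\<forall>t\<in>?S. \<forall>x\<in>P. \<forall>z\<in>P. closed_segment y t Int closed_segment x z = {} -->
  closed_segment (y + e *\<^sub>R u) t Int closed_segment x z = {})" for e
 define tra where "tra e \<longleftrightarrow> (\<forall>r\<in>Q. \<forall>x\<in>P. x ~= r --> cross (y - r) (x - r) + e * cross u (x - r) ~= 0)" for e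
 define spd where "spd e \<longleftrightarrow> (\<forall>r\<in>Q. \<forall>s\<in>Q. r ~= s -->
  cross (r - y) (s - y) + e * (cross (s - y) u - cross (r - y) u) ~= 0)" for e
 have ev1: "eventually esc (at_right 0)" unfolding esc_def
 proof (intro eventually_ball_finite ballI)
  fix t x z assume "t \<in> ?S" "x \<in> P" "z \<in> P"
  show "eventually (\<lambda>e. closed_segment y t Int closed_segment x z = {} -->
    closed_segment (y + e *\<^sub>R u) t Int closed_segment x z = {}) (at_right 0)"
  proof (cases "closed_segment y t Int closed_segment x z = {}")
   case True
   then show ?thesis using segment_escapes[OF closed_segment True, of u] by simp
  qed simp
 qed (use finP finQ in auto)
 have ev2: "eventually tra (at_right 0)" unfolding tra_def
 proof (intro eventually_ball_finite ballI)
  fix r x assume r: "r \<in> Q" and x: "x \<in> P"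
  show "eventually (\<lambda>e. x ~= r --> cross (y - r) (x - r) + e * cross u (x - r) ~= 0) (at_right 0)"
  proof (cases "x = r")
   case False
   have "cross (y - r) (x - r) ~= 0 \<or> cross u (x - r) ~= 0"
   proof (rule ccontr)
    assume "\<not> ?thesis"
    then have c: "cross (y - r) (x - r) = 0" "cross u (x - r) = 0" by auto
    define X where "X = x - r"
    define Y where "Y = y - r"
    have XY: "Re Y * Im X = Im Y * Re X" "Re u * Im X = Im u * Re X"
     using c by (simp_all add: cross_def X_def Y_def)
    have "cross (r - y) u = - cross Y u" by (simp add: Y_def)
    then have ne: "Re Y * Im u ~= Im Y * Re u" using dir[OF r] by (simp add: cross_def)
    have "X ~= 0" using False by (simp add: X_def)
    then have "Re X ~= 0 \<or> Im X ~= 0" by (simp add: complex_eq_iff)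
    moreover have "Re X * (Re Y * Im u - Im Y * Re u) = 0" "Im X * (Re Y * Im u - Im Y * Re u) = 0"
     using XY by algebra+
    ultimately show False using ne by simp
   qed
   from eventually_affine_nonzero[OF this] show ?thesis by simp
  qed simp
 qed (use finP finQ in auto)
 have ev3: "eventually spd (at_right 0)" unfolding spd_def
 proof (intro eventually_ball_finite ballI)
  fix r s assume rs: "r \<in> Q" "s \<in> Q"
  show "eventually (\<lambda>e. r ~= s --> cross (r - y) (s - y) + e * (cross (s - y) u - cross (r - y) u) ~= 0) (at_right 0)"
  proof (cases "r = s")
   case False
   have "cross (r - y) (s - y) ~= 0" by (rule spreadD[OF spr rs False])
   then show ?thesis using eventually_affine_nonzero[of "cross (r - y) (s - y)"] by simp
  qed simp
 qed (use finQ in auto)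
 have "eventually (\<lambda>e::real. 0 < e) (at_right 0)" by (rule eventually_at_right_less)
 then have "eventually (\<lambda>e. 0 < e \<and> esc e \<and> tra e \<and> spd e) (at_right 0)" using ev1 ev2 ev3 by eventually_elim simp
 then have "\<exists>e. 0 < e \<and> esc e \<and> tra e \<and> spd e" by (rule eventually_happens'[OF trivial_limit_at_right_real])
 then obtain e where e: "0 < e" and esc: "esc e" and tra: "tra e" and spd: "spd e" by blast
 define w where "w = y + e *\<^sub>R u"
 have wy: "w - y = e *\<^sub>R u" by (simp add: w_def)
 have ne: "w ~= y" using e u0 by (simp add: w_def)
 have E: "closed_segment w t Int closed_segment x z = {}"
  if "t \<in> ?S" "x \<in> P" "z \<in> P" "closed_segment y t Int closed_segment x z = {}" for t x z
  using esc that unfolding esc_def w_def by blast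
 have tr: "cross (w - r) (x - r) ~= 0" if "r \<in> Q" "x \<in> P" "x ~= r" for r x
 proof -
  have "w - r = (y - r) + e *\<^sub>R u" by (simp add: w_def)
  then have eq: "cross (w - r) (x - r) = cross (y - r) (x - r) + e * cross u (x - r)" by (simp only: cross_linear) (simp add: algebra_simps)
  have "cross (y - r) (x - r) + e * cross u (x - r) ~= 0" using tra that unfolding tra_def by blast
  then show ?thesis unfolding eq .
 qed
 have sp: "cross (r - w) (s - w) ~= 0" if "r \<in> Q" "s \<in> Q" "r ~= s" for r s
 proof -
  have "r - w = (r - y) - e *\<^sub>R u" "s - w = (s - y) - e *\<^sub>R u" by (simp_all add: w_def)
  then have "cross (r - w) (s - w) = cross (r - y) (s - y) - e * cross u (s - y) - e * cross (r - y) u"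
   by (simp only: cross_linear) (simp add: algebra_simps)
  also have "cross u (s - y) = - cross (s - y) u" by (rule cross_commute)
  finally have "cross (r - w) (s - w) = cross (r - y) (s - y) + e * (cross (s - y) u - cross (r - y) u)"
   by (simp add: algebra_simps)
  moreover have "cross (r - y) (s - y) + e * (cross (s - y) u - cross (r - y) u) ~= 0"
   using spd that unfolding spd_def by blast
  ultimately show ?thesis by (rule ssubst)
 qed
 have sp': "cross (y - w) (r - w) ~= 0" if "r \<in> Q" for r
 proof -
  have "y - w = - (e *\<^sub>R u)" "r - w = (r - y) - e *\<^sub>R u" by (simp_all add: w_def)
  then have "cross (y - w) (r - w) = - (e * cross u (r - y))"
   by (simp only: cross_linear) (simp add: algebra_simps)
  moreover have "cross u (r - y) ~= 0" using dir[OF that] cross_commute[of u "r - y"] by argo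
  ultimately show ?thesis using e by (metis less_irrefl mult_eq_0_iff neg_equal_0_iff_equal)
 qed
 have wP: "w \<notin> P"
 proof
  assume "w \<in> P"
  then have "closed_segment w y Int closed_segment w w = {}" using ne by (intro E) auto
  then show False by simp
 qed
 \<comment> \<open>An overlap at y would put x in the direction u, against the cone condition or,
   for x in Q, the choice of u.\<close>
 have at_y: "closed_segment w y Int closed_segment y x \<subseteq> {y}" if x: "L y x" for x
 proof
  fix q assume q: "q \<in> closed_segment w y Int closed_segment y x"
  obtain s where s: "0 \<le> s" "s \<le> 1" "q - y = (1 - s) *\<^sub>R (w - y) + s *\<^sub>R (y - y)"
   using in_segment_offset[of q w y y] q by blast
  obtain t where t: "0 \<le> t" "t \<le> 1" "q - y = (1 - t) *\<^sub>R (y - y) + t *\<^sub>R (x - y)"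
   using in_segment_offset[of q y x y] q by blast
  have eq: "t *\<^sub>R (x - y) = ((1 - s) * e) *\<^sub>R u" using s t by (simp add: wy)
  have "t = 0"
  proof (rule ccontr)
   assume t0: "t ~= 0"
   have "(1 / t) *\<^sub>R t *\<^sub>R (x - y) = ((1 - s) * e / t) *\<^sub>R u" unfolding eq by simp
   then have x': "x - y = ((1 - s) * e / t) *\<^sub>R u" using t0 by simp
   show False
   proof (cases "x \<in> Q")
    case True
    have "cross (x - y) u = 0" by (simp only: x' cross_linear)
    then show False using dir[OF True] by blast
   next
    case False
    have "0 \<le> (1 - s) * e / t" using s t e by simp
    then have "incone (x - y) (r0 - y) u" unfolding incone_def using x'
     by (intro exI[of _ 0] exI[of _ "(1 - s) * e / t"]) simp
    then show False using cone[OF r0 x] False r0 by blast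
   qed
  qed
  then show "q \<in> {y}" using t by simp
 qed
 have at_r: "closed_segment w r Int closed_segment y r \<subseteq> {r}" if r: "r \<in> Q" for r
  by (rule segments_meet_at_end) (use tr[OF r yP] r yQ in blast)
 \<comment> \<open>A common point would exhibit x - y as a nonnegative combination of r - y and
   u.\<close>
 have at_yx: "closed_segment w r Int closed_segment y x = {}" if r: "r \<in> Q" and x: "L y x" "x ~= r" for r x
 proof (rule ccontr)
  assume "\<not> ?thesis"
  then obtain q where q: "q \<in> closed_segment w r" "q \<in> closed_segment y x" by blast
  obtain s where s: "0 \<le> s" "s \<le> 1" "q - y = (1 - s) *\<^sub>R (w - y) + s *\<^sub>R (r - y)"
   using in_segment_offset[OF q(1), of y] by blast
  obtain t where t: "0 \<le> t" "t \<le> 1" "q - y = (1 - t) *\<^sub>R (y - y) + t *\<^sub>R (x - y)"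
   using in_segment_offset[OF q(2), of y] by blast
  have eq: "t *\<^sub>R (x - y) = s *\<^sub>R (r - y) + ((1 - s) * e) *\<^sub>R u" using s t by (simp add: wy)
  show False
  proof (cases "t = 0")
   case True
   then have "s *\<^sub>R (r - y) + ((1 - s) * e) *\<^sub>R u = 0" using eq by simp
   from cross_independent[OF dir[OF r] this] show False using e by auto
  next
   case False
   have "(1 / t) *\<^sub>R t *\<^sub>R (x - y) = (s / t) *\<^sub>R (r - y) + ((1 - s) * e / t) *\<^sub>R u"
    unfolding eq by (simp add: scaleR_add_right)
   then have "x - y = (s / t) *\<^sub>R (r - y) + ((1 - s) * e / t) *\<^sub>R u" using False by simp
   moreover have "0 \<le> s / t" "0 \<le> (1 - s) * e / t" using s t e by simp_all
   ultimately have "incone (x - y) (r - y) u" unfolding incone_def by blast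
   then show False using cone[OF r x] by blast
  qed
 qed
 have "drawing (insert w P) (attach L w S)"
 proof (rule drawing_attach[OF d wP])
  show "S \<subseteq> P" using S SP by blast
 next
  fix t assume "t \<in> S"
  then have t: "t \<in> ?S" using S by blast
  show "closed_segment w t Int P \<subseteq> {t}"
  proof
   fix z assume z: "z \<in> closed_segment w t Int P"
   show "z \<in> {t}"
   proof (rule ccontr)
    assume zt: "z \<notin> {t}"
    have "z \<notin> closed_segment y t"
    proof
     assume zy: "z \<in> closed_segment y t"
     show False
     proof (cases "t = y")
      case True then show False using zy zt by simp
     next
      case False
      then have tQ: "t \<in> Q" using t by blast
      then have "z \<in> {t}" using at_r[OF tQ] zy z by blast
      then show False using zt by blast
     qed
    qed
    then have "closed_segment w t Int closed_segment z z = {}" using z by (intro E[OF t]) auto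
    then show False using z by simp
   qed
  qed
 next
  fix x z assume xz: "L x z"
  show "w \<notin> closed_segment x z"
  proof
   assume wxz: "w \<in> closed_segment x z"
   consider "x = y" | "z = y" | "x ~= y" "z ~= y" by blast
   then show False
   proof cases
    case 1 then show False using at_y[of z] xz wxz ne by auto
   next
    case 2
    then have "L y x" using xz drawing_edge(1)[OF d] by blast
    then show False using at_y[of x] 2 wxz ne by (auto simp: closed_segment_commute)
   next
    case 3
    have "y \<notin> closed_segment x z" using drawing_point[OF d xz] yP 3 by blast
    then have "closed_segment w y Int closed_segment x z = {}"
     using drawing_edge(2,3)[OF d xz] by (intro E) auto
    then show False using wxz by auto
   qed
  qed
 next
  fix t x z assume "t \<in> S" and xz: "L x z"
  then have t: "t \<in> ?S" using S by blast
  have xzP: "x \<in> P" "z \<in> P" using drawing_edge(2,3)[OF d xz] by auto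
  \<comment> \<open>One orientation of the edge x z is enough; the other follows by
    symmetry.\<close>
  have key: "closed_segment w t Int closed_segment x z \<subseteq> {t} Int {x, z}" if xz: "L x z" "x = y \<or> z ~= y \<and> x ~= t" for x z
  proof -
   have xzP: "x \<in> P" "z \<in> P" using drawing_edge(2,3)[OF d xz(1)] by auto
   show ?thesis
   proof (cases "t = y")
    case True
    show ?thesis
    proof (cases "x = y")
     case xy: True
     then show ?thesis using at_y[of z] xz(1) True by auto
    next
     case False
     then have "y \<notin> closed_segment x z" using drawing_point[OF d xz(1)] xz(2) yP by blast
     then have "closed_segment w t Int closed_segment x z = {}" using True xzP by (intro E[OF t]) auto
     then show ?thesis by blast
    qed
   next
    case False
    then have tQ: "t \<in> Q" using t by blast
    show ?thesis
    proof (cases "x = y")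
     case xy: True
     show ?thesis
     proof (cases "z = t")
      case True then show ?thesis using at_r[OF tQ] xy by auto
     next
      case False then show ?thesis using at_yx[OF tQ, of z] xz(1) xy by auto
     qed
    next
     case xy: False
     then have zy: "z ~= y" "x ~= t" using xz(2) by auto
     show ?thesis
     proof (cases "z = t")
      case True
      have "cross (w - t) (x - t) ~= 0" by (rule tr[OF tQ xzP(1) zy(2)])
      from segments_meet_at_end[OF this] show ?thesis using True by blast
     next
      case False
      have "{y, t} ~= {x, z}" "{y, t} Int {x, z} = {}" using xy zy False by auto
      then have "closed_segment y t Int closed_segment x z = {}"
       using drawing_disjoint[OF d Q(1)[OF tQ] xz(1)] by blast
      from E[OF t xzP this] show ?thesis by blast
     qed
    qed
   qed
  qed
  consider "x = y \<or> z ~= y \<and> x ~= t" | "z = y \<or> x ~= y \<and> z ~= t" using drawing_edge(4)[OF d xz] by auto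
  then show "closed_segment w t Int closed_segment x z \<subseteq> {t} Int {x, z}"
  proof cases
   case 1 then show ?thesis by (rule key[OF xz])
  next
   case 2
   from key[OF drawing_edge(1)[OF d xz] 2] show ?thesis by (simp add: closed_segment_commute insert_commute)
  qed
 next
  fix t t' assume "t \<in> S" "t' \<in> S" and tt: "t ~= t'"
  then have t: "t \<in> ?S" "t' \<in> ?S" using S by blast+
  have "cross (t - w) (t' - w) ~= 0"
  proof -
   consider "t = y" "t' \<in> Q" | "t' = y" "t \<in> Q" | "t \<in> Q" "t' \<in> Q" using t tt by blast
   then show ?thesis
   proof cases
    case 1 then show ?thesis using sp' by simp
   next
    case 2 then show ?thesis using sp'[of t] cross_commute[of "t - w" "t' - w"] by simp
   next
    case 3 then show ?thesis using sp tt by simp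
   qed
  qed
  from segments_meet_at_end[OF this]
  show "closed_segment w t Int closed_segment w t' \<subseteq> {w}" by (simp add: closed_segment_commute)
 qed
 moreover have "spread w ?S" unfolding spread_def
 proof (intro ballI impI)
  fix t t' assume t: "t \<in> ?S" "t' \<in> ?S" and tt: "t ~= t'"
  consider "t = y" "t' \<in> Q" | "t' = y" "t \<in> Q" | "t \<in> Q" "t' \<in> Q" using t tt by blast
  then show "cross (t - w) (t' - w) ~= 0"
  proof cases
   case 1 then show ?thesis using sp' by simp
  next
   case 2 then show ?thesis using sp'[of t] cross_commute[of "t - w" "t' - w"] by simp
  next
   case 3 then show ?thesis using sp tt by simp
  qed
 qed
 ultimately show ?thesis using e wP unfolding w_def by blast
qed

section \<open>Directions around a point and insertion of auxiliary points\<close>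

lemma cross_nonzero_commute: "cross x y ~= 0 ==> cross y x ~= 0"
 by (metis cross_commute neg_0_equal_iff_equal)

text \<open>u points into an angle at the origin bounded by x and y that is free of S: the cones
  from x to u and from y to u contain none of the other directions.\<close>

definition between :: "complex => complex => complex => complex set => bool" where
 "between x y u S \<longleftrightarrow> cross x u ~= 0 \<and> cross y u ~= 0 \<and>
  (\<forall>z\<in>insert y S. \<not> incone z x u) \<and> (\<forall>z\<in>insert x S. \<not> incone z y u)"

definition directions where
 "directions a b c u v w \<longleftrightarrow> between a b u {c, v, w} \<and> between b c v {a, u, w} \<and> between a c w {b, u, v}"

lemma between_commute: "between x y u S \<longleftrightarrow> between y x u S"
 unfolding between_def by blast

lemma directions_rotate: "directions a b c u v w ==> directions b c a v w u"
 unfolding directions_def by (simp add: between_commute[of c a] between_commute[of b a] insert_commute)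

text \<open>Here c lies between a and b, so the angle of a and b that is free of c is the large one,
  and -(a + b) points into it.\<close>

lemma directions_pos:
 assumes k: "cross a b ~= 0" and rs: "0 < r" "0 < s" and c: "c = r *\<^sub>R a + s *\<^sub>R b"
 shows "\<exists>u v w. directions a b c u v w"
proof -
 define u where "u = - (a + b)"
 define v where "v = b + c"
 define w where "w = a + c"
 define D where "D x y = cross x y / cross a b" for x y
 \<comment> \<open>All determinants relative to \<open>cross a b\<close>; the signs of r and s then
   decide every condition.\<close>
 have D: "D a b = 1" "D b a = - (1)" "D a c = s" "D c a = - (s)" "D a u = -1" "D u a = - (-1)" "D a v = 1 + s" "D v a = - (1 + s)" "D a w = s" "D w a = - (s)" "D b c = - r" "D c b = - (- r)" "D b u = 1" "D u b = - (1)" "D b v = - r" "D v b = - (- r)" "D b w = - (1 + r)" "D w b = - (- (1 + r))" "D c u = s - r" "D u c = - (s - r)" "D c v = r" "D v c = - (r)" "D c w = - s" "D w c = - (- s)" "D u v = r - s - 1" "D v u = - (r - s - 1)" "D u w = 1 + r - s" "D w u = - (1 + r - s)" "D v w = - (1 + r + s)" "D w v = - (- (1 + r + s))"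
  unfolding D_def u_def v_def w_def c using k by (simp_all add: cross_commute[of b a] field_simps)
 have nz: "cross x y ~= 0" if "D x y ~= 0" for x y using that by (auto simp: D_def)
 have nc: "\<not> incone x p q" if "D p x * D p q < 0 \<or> D x q * D p q < 0" for x p q
  by (rule not_incone) (use that k in \<open>auto simp: D_def mult_less_0_iff divide_less_0_iff zero_less_divide_iff\<close>)
 have "directions a b c u v w" unfolding directions_def between_def ball_simps simp_thms
  by (intro conjI; (rule nz | rule nc); use rs in \<open>auto simp: D mult_less_0_iff zero_less_mult_iff\<close>)
 then show ?thesis by blast
qed

text \<open>Here -c lies between a and b, all three angles are smaller than a half turn, and sums of
  neighbouring directions point into them.\<close>

lemma directions_neg:
 assumes k: "cross a b ~= 0" and rs: "0 < r" "0 < s" and c: "c = - (r *\<^sub>R a + s *\<^sub>R b)"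
 shows "\<exists>u v w. directions a b c u v w"
proof -
 define u where "u = a + b"
 define v where "v = b + c"
 define w where "w = a + c"
 define D where "D x y = cross x y / cross a b" for x y
 have D: "D a b = 1" "D b a = - (1)" "D a c = - s" "D c a = - (- s)" "D a u = 1" "D u a = - (1)" "D a v = 1 - s" "D v a = - (1 - s)" "D a w = - s" "D w a = - (- s)" "D b c = r" "D c b = - (r)" "D b u = -1" "D u b = - (-1)" "D b v = r" "D v b = - (r)" "D b w = r - 1" "D w b = - (r - 1)" "D c u = s - r" "D u c = - (s - r)" "D c v = - r" "D v c = - (- r)" "D c w = s" "D w c = - (s)" "D u v = 1 + r - s" "D v u = - (1 + r - s)" "D u w = r - s - 1" "D w u = - (r - s - 1)" "D v w = r + s - 1" "D w v = - (r + s - 1)"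
  unfolding D_def u_def v_def w_def c using k by (simp_all add: cross_commute[of b a] field_simps)
 have nz: "cross x y ~= 0" if "D x y ~= 0" for x y using that by (auto simp: D_def)
 have nc: "\<not> incone x p q" if "D p x * D p q < 0 \<or> D x q * D p q < 0" for x p q
  by (rule not_incone) (use that k in \<open>auto simp: D_def mult_less_0_iff divide_less_0_iff zero_less_divide_iff\<close>)
 have "directions a b c u v w" unfolding directions_def between_def ball_simps simp_thms
  by (intro conjI; (rule nz | rule nc); use rs in \<open>auto simp: D mult_less_0_iff zero_less_mult_iff\<close>)
 then show ?thesis by blast
qed

text \<open>Cramer's rule gives c = r a + s b. For mixed signs a or b lies between the other two,
  and the directions are renamed cyclically.\<close>

lemma directions_exist:
 assumes ab: "cross a b ~= 0" and ac: "cross a c ~= 0" and bc: "cross b c ~= 0"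
 shows "\<exists>u v w. directions a b c u v w"
proof -
 define r where "r = cross c b / cross a b"
 define s where "s = cross a c / cross a b"
 have r0: "r ~= 0" using ab bc cross_commute[of b c] by (simp add: r_def)
 have s0: "s ~= 0" using ab ac by (simp add: s_def)
 have "cross a b *\<^sub>R c = cross c b *\<^sub>R a + cross a c *\<^sub>R b"
  by (simp add: complex_eq_iff cross_def algebra_simps)
 then have "(1 / cross a b) *\<^sub>R (cross a b *\<^sub>R c) = (1 / cross a b) *\<^sub>R (cross c b *\<^sub>R a + cross a c *\<^sub>R b)" by simp
 then have c: "c = r *\<^sub>R a + s *\<^sub>R b" using ab by (simp add: r_def s_def scaleR_add_right)
 consider "0 < r" "0 < s" | "r < 0" "s < 0" | "0 < r" "s < 0" | "r < 0" "0 < s" using r0 s0 by linarith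
 then show ?thesis
 proof cases
  case 1 then show ?thesis by (rule directions_pos[OF ab _ _ c])
 next
  case 2
  have "c = - ((- r) *\<^sub>R a + (- s) *\<^sub>R b)" using c by simp
  then show ?thesis using directions_neg[OF ab, of "- r" "- s" c] 2 by simp
 next
  case 3
  have "r *\<^sub>R a = c + (- s) *\<^sub>R b" using c by simp
  then have "(1 / r) *\<^sub>R (r *\<^sub>R a) = (1 / r) *\<^sub>R (c + (- s) *\<^sub>R b)" by simp
  then have "a = (- s / r) *\<^sub>R b + (1 / r) *\<^sub>R c" using r0 by (simp add: scaleR_add_right scaleR_diff_right)
  moreover have "0 < - s / r" "0 < 1 / r" using 3 by (simp_all add: divide_neg_pos)
  ultimately have "\<exists>u v w. directions b c a u v w" by (intro directions_pos[OF bc])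
  then show ?thesis using directions_rotate by blast
 next
  case 4
  have ca: "cross c a ~= 0" using ac cross_commute[of c a] by simp
  have "s *\<^sub>R b = c + (- r) *\<^sub>R a" using c by simp
  then have "(1 / s) *\<^sub>R (s *\<^sub>R b) = (1 / s) *\<^sub>R (c + (- r) *\<^sub>R a)" by simp
  then have "b = (1 / s) *\<^sub>R c + (- r / s) *\<^sub>R a" using s0 by (simp add: scaleR_add_right scaleR_diff_right)
  moreover have "0 < - r / s" "0 < 1 / s" using 4 by (simp_all add: divide_neg_pos)
  ultimately have "\<exists>u v w. directions c a b u v w" by (intro directions_pos[OF ca])
  then show ?thesis using directions_rotate by blast
 qed
qed

lemma attach_new:
 assumes "drawing P L" "w \<notin> P"
 shows "{z. attach L w S w z} = S Un (if w \<in> S then S else {})"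
 using drawing_edge(2,3)[OF assms(1)] assms(2) unfolding attach_def by auto

lemma attach_old: "x ~= w ==> {z. attach L w S x z} = {z. L x z} Un (if x \<in> S then {w} else {})"
 unfolding attach_def by auto

lemma directionsD:
 assumes "directions a b c u v w"
 shows "between a b u {c, v, w}" "between b c v {a, u, w}" "between a c w {b, u, v}"
 using assms unfolding directions_def by simp_all

lemma insert_between:
 assumes d: "drawing P L" and ab: "L y a" "L y b" "a ~= b" "cross (a - y) (b - y) ~= 0"
  and bt: "between (a - y) (b - y) u Z"
  and rest: "\<And>x. L y x ==> x = a \<or> x = b \<or> (\<exists>z\<in>Z. \<exists>e>0. x - y = e *\<^sub>R z)"
 shows "\<exists>e>0. y + e *\<^sub>R u \<notin> P \<and> drawing (insert (y + e *\<^sub>R u) P) (attach L (y + e *\<^sub>R u) {y, a, b}) \<and>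
  spread (y + e *\<^sub>R u) {y, a, b}"
proof (rule drawing_insert[OF d, where Q = "{a, b}"])
 have "cross (b - y) (a - y) ~= 0" by (rule cross_nonzero_commute[OF ab(4)])
 then show "spread y {a, b}" using ab(4) by (auto simp: spread_def simp del: cross_linear)
 note b = bt[unfolded between_def]
 show "cross (r - y) u ~= 0" if "r \<in> {a, b}" for r using that b by blast
 show "\<not> incone (x - y) (r - y) u" if r: "r \<in> {a, b}" and x: "L y x" "x ~= r" for r x
 proof -
  have in_Z: "\<not> incone z (r - y) u" if "z \<in> Z" for z using that r b by blast
  consider "x = a" "r = b" | "x = b" "r = a" | z e where "z \<in> Z" "e > 0" "x - y = e *\<^sub>R z"
   using rest[OF x(1)] r x(2) by blast
  then show ?thesis
  proof cases
   case 1 then show ?thesis using b by blast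
  next
   case 2 then show ?thesis using b by blast
  next
   case (3 z e) then show ?thesis using not_incone_scale[OF in_Z[OF 3(1)] 3(2)] by simp
  qed
 qed
qed (use ab in auto)

text \<open>One auxiliary point goes into each of the three angles at y. Points inserted earlier
  have become neighbours of y in the directions u and v, which \<open>directions\<close> already
  keeps out of the later cones.\<close>

lemma surround:
 assumes d: "drawing P L" and N: "{x. L y x} = {a, b, c}" and ne: "a ~= b" "a ~= c" "b ~= c"
  and spr: "spread y {a, b, c}"
 shows "\<exists>w1 w2 w3. w1 \<notin> P \<and> w2 \<notin> insert w1 P \<and> w3 \<notin> insert w2 (insert w1 P) \<and>
  drawing (insert w1 P) (attach L w1 {y, a, b}) \<and>
  drawing (insert w2 (insert w1 P)) (attach (attach L w1 {y, a, b}) w2 {y, b, c}) \<and>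
  drawing (insert w3 (insert w2 (insert w1 P))) (attach (attach (attach L w1 {y, a, b}) w2 {y, b, c}) w3 {y, a, c}) \<and>
  spread w1 {y, a, b} \<and> spread w2 {y, b, c} \<and> spread w3 {y, a, c}"
proof -
 have L: "L y x \<longleftrightarrow> x \<in> {a, b, c}" for x using N by blast
 have c: "cross (a - y) (b - y) ~= 0" "cross (a - y) (c - y) ~= 0" "cross (b - y) (c - y) ~= 0"
  by (rule spreadD[OF spr]; use ne in simp)+
 obtain u v w where dir: "directions (a - y) (b - y) (c - y) u v w" using directions_exist[OF c] by blast
 note bt = directionsD[OF dir]
 have "\<exists>e>0. x - y = e *\<^sub>R (x - y)" for x by (intro exI[of _ 1]) simp
 note self = this
 have "x = a \<or> x = b \<or> (\<exists>z\<in>{c - y, v, w}. \<exists>e>0. x - y = e *\<^sub>R z)" if "L y x" for x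
  using that self unfolding L by blast
 from insert_between[OF d _ _ ne(1) c(1) bt(1) this] L
 obtain e1 where e1: "e1 > 0" "y + e1 *\<^sub>R u \<notin> P" "drawing (insert (y + e1 *\<^sub>R u) P) (attach L (y + e1 *\<^sub>R u) {y, a, b})"
  "spread (y + e1 *\<^sub>R u) {y, a, b}" by auto
 define w1 where "w1 = y + e1 *\<^sub>R u"
 define L1 where "L1 = attach L w1 {y, a, b}"
 note e1' = e1(2-4)[folded w1_def, folded L1_def]
 have w1y: "w1 - y = e1 *\<^sub>R u" by (simp add: w1_def)
 have yP: "y \<in> P" using drawing_edge(2)[OF d] L by blast
 have L1: "L1 y x \<longleftrightarrow> x \<in> {a, b, c, w1}" for x
  using L[of x] yP e1'(1) unfolding L1_def attach_def by blast
 have "x = b \<or> x = c \<or> (\<exists>z\<in>{a - y, u, w}. \<exists>e>0. x - y = e *\<^sub>R z)" if "L1 y x" for x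
  using that self e1(1) w1y unfolding L1 by blast
 from insert_between[OF e1'(2) _ _ ne(3) c(3) bt(2) this] L1
 obtain e2 where e2: "e2 > 0" "y + e2 *\<^sub>R v \<notin> insert w1 P" "drawing (insert (y + e2 *\<^sub>R v) (insert w1 P)) (attach L1 (y + e2 *\<^sub>R v) {y, b, c})"
  "spread (y + e2 *\<^sub>R v) {y, b, c}" by auto
 define w2 where "w2 = y + e2 *\<^sub>R v"
 define L2 where "L2 = attach L1 w2 {y, b, c}"
 note e2' = e2(2-4)[folded w2_def, folded L2_def]
 have w2y: "w2 - y = e2 *\<^sub>R v" by (simp add: w2_def)
 have L2: "L2 y x \<longleftrightarrow> x \<in> {a, b, c, w1, w2}" for x
  using L1[of x] yP e2'(1) unfolding L2_def attach_def by blast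
 have "x = a \<or> x = c \<or> (\<exists>z\<in>{b - y, u, v}. \<exists>e>0. x - y = e *\<^sub>R z)" if "L2 y x" for x
  using that self e1(1) w1y e2(1) w2y unfolding L2 by blast
 from insert_between[OF e2'(2) _ _ ne(2) c(2) bt(3) this] L2
 obtain w3 where w3: "w3 \<notin> insert w2 (insert w1 P)" "drawing (insert w3 (insert w2 (insert w1 P))) (attach L2 w3 {y, a, c})"
  "spread w3 {y, a, c}" by blast
 show ?thesis using w3 e1' e2' unfolding L2_def L1_def by blast
qed

text \<open>With only two neighbours at y, the sum of their offsets points into the angle. The new
  point leaves y with three spread neighbours, as \<open>surround\<close> requires.\<close>

lemma attach_corner:
 assumes d: "drawing P L" and N: "{x. L y x} = {a, b}" and ab: "a ~= b" "cross (a - y) (b - y) ~= 0"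
 shows "\<exists>w. w \<notin> P \<and> drawing (insert w P) (attach L w {y, a, b}) \<and> spread w {y, a, b} \<and> spread y {a, b, w}"
proof -
 have L: "L y x \<longleftrightarrow> x \<in> {a, b}" for x using N by blast
 define p where "p = a - y"
 define q where "q = b - y"
 have k: "cross p q ~= 0" "cross q p = - cross p q"
  unfolding p_def q_def by (rule ab(2), rule cross_commute)
 have kk: "0 < cross p q * cross p q" using k(1) not_real_square_gt_zero by blast
 have nc: "\<not> incone q p (p + q)" "\<not> incone p q (p + q)"
  by (rule not_incone, use kk in \<open>simp add: k(2)\<close>)+
 have "between p q (p + q) {}" unfolding between_def
 proof (intro conjI)
  show "\<forall>z\<in>insert q {}. \<not> incone z p (p + q)" "\<forall>z\<in>insert p {}. \<not> incone z q (p + q)"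
   using nc by simp_all
 qed (use k in simp_all)
 from insert_between[OF d _ _ ab this[unfolded p_def q_def], folded p_def q_def] L
 obtain e where e: "e > 0" "y + e *\<^sub>R (p + q) \<notin> P" "drawing (insert (y + e *\<^sub>R (p + q)) P) (attach L (y + e *\<^sub>R (p + q)) {y, a, b})"
  "spread (y + e *\<^sub>R (p + q)) {y, a, b}" by auto
 define w where "w = y + e *\<^sub>R (p + q)"
 have "w - y = e *\<^sub>R (p + q)" by (simp add: w_def)
 then have x: "cross (w - y) p = - (e * cross p q)" "cross (w - y) q = e * cross p q"
  "cross p (w - y) = e * cross p q" "cross q (w - y) = - (e * cross p q)"
  using k(2) by (simp_all only: cross_linear) (simp_all add: algebra_simps)
 then have "spread y {a, b, w}" using k e(1) unfolding spread_def p_def q_def by (auto simp del: cross_linear)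
 then show ?thesis using e unfolding w_def by blast
qed

text \<open>The new point leaves y in a direction turned slightly away from r, before any other edge
  at y is reached. No other edge leaves y in the direction of r itself, since it would overlap the
  edge y r.\<close>

lemma attach_edge:
 assumes d: "drawing P L" and r: "L y r" and S: "S \<subseteq> {y, r}"
 shows "\<exists>w. w \<notin> P \<and> drawing (insert w P) (attach L w S) \<and> spread w {y, r}"
proof -
 define N where "N = {x. L y x} - {r}"
 have "N \<subseteq> P" using drawing_edge(3)[OF d] by (auto simp: N_def)
 then have finN: "finite N" using drawing_finite[OF d] by (rule finite_subset)
 \<comment> \<open>Coordinates in which r - y is 1; e is chosen so that the direction 1 + i e stays
   below every neighbour in the upper half-plane.\<close>
 define q where "q x = (x - y) / (r - y)" for x
 have ry: "r - y ~= 0" using drawing_edge(4)[OF d r] by simp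
 have "eventually (\<lambda>e. \<forall>x\<in>N. 0 < Im (q x) --> e * Re (q x) < Im (q x)) (at_right 0)"
 proof (intro eventually_ball_finite ballI finN)
  fix x assume "x \<in> N"
  show "eventually (\<lambda>e. 0 < Im (q x) --> e * Re (q x) < Im (q x)) (at_right 0)"
  proof (cases "0 < Im (q x)")
   case True
   show ?thesis
   proof (rule eventually_at_rightI)
    show "0 < Im (q x) / (\<bar>Re (q x)\<bar> + 1)" using True by simp
    fix e assume "e \<in> {0<..<Im (q x) / (\<bar>Re (q x)\<bar> + 1)}"
    then have e: "0 < e" "e * (\<bar>Re (q x)\<bar> + 1) < Im (q x)" by (auto simp: pos_less_divide_eq)
    have "e * Re (q x) \<le> e * \<bar>Re (q x)\<bar>" using e(1) by (intro mult_left_mono) auto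
    then have "e * Re (q x) < Im (q x)" using e unfolding distrib_left by linarith
    then show "0 < Im (q x) --> e * Re (q x) < Im (q x)" ..
   qed
  qed simp
 qed
 moreover have "eventually (\<lambda>e::real. 0 < e) (at_right 0)" by (rule eventually_at_right_less)
 ultimately have "eventually (\<lambda>e. 0 < e \<and> (\<forall>x\<in>N. 0 < Im (q x) --> e * Re (q x) < Im (q x))) (at_right 0)"
  by eventually_elim simp
 then have "\<exists>e. 0 < e \<and> (\<forall>x\<in>N. 0 < Im (q x) --> e * Re (q x) < Im (q x))"
  by (rule eventually_happens'[OF trivial_limit_at_right_real])
 then obtain e where e: "0 < e" and small: "\<And>x. x \<in> N ==> 0 < Im (q x) ==> e * Re (q x) < Im (q x)" by blast
 define u where "u = (r - y) * Complex 1 e"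
 have "\<exists>d>0. y + d *\<^sub>R u \<notin> P \<and> drawing (insert (y + d *\<^sub>R u) P) (attach L (y + d *\<^sub>R u) S) \<and>
   spread (y + d *\<^sub>R u) {y, r}"
 proof (rule drawing_insert[OF d, where Q = "{r}"])
  have "cross (r - y) u = e * ((Re (r - y))\<^sup>2 + (Im (r - y))\<^sup>2)"
   unfolding cross_def u_def by (simp add: algebra_simps power2_eq_square)
  also have "\<dots> = e * (cmod (r - y))\<^sup>2" by (simp only: cmod_power2)
  finally have "cross (r - y) u ~= 0" using e ry by (simp del: cross_linear)
  then show "cross (x - y) u ~= 0" if "x \<in> {r}" for x using that by blast
  show "\<not> incone (x - y) (r' - y) u" if r': "r' \<in> {r}" and x: "L y x" "x ~= r'" for r' x
  proof
   have xN: "x \<in> N" using x r' by (auto simp: N_def)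
   assume "incone (x - y) (r' - y) u"
   then obtain s t where st: "0 \<le> s" "0 \<le> t" "x - y = s *\<^sub>R (r - y) + t *\<^sub>R u" using r' by (auto simp: incone_def)
   have "x - y = (r - y) * (of_real s + of_real t * Complex 1 e)"
    unfolding st(3) u_def scaleR_conv_of_real by (simp add: algebra_simps)
   then have "q x = of_real s + of_real t * Complex 1 e" using ry by (simp add: q_def)
   then have qx: "Re (q x) = s + t" "Im (q x) = t * e" by simp_all
   have "t = 0"
   proof (rule ccontr)
    assume "t ~= 0"
    then have "0 < Im (q x)" using st e qx by simp
    from small[OF xN this] have "e * s < 0" using qx by (simp add: algebra_simps)
    then show False using e st by (simp add: mult_less_0_iff)
   qed
   then have xs: "x - y = s *\<^sub>R (r - y)" using st by simp
   then have s0: "0 < s" using st(1) drawing_edge(4)[OF d x(1)] by (cases "s = 0") auto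
   define m where "m = min 1 s"
   have m: "0 < m" "m \<le> 1" "m / s \<le> 1" using s0 by (auto simp: m_def)
   define z where "z = y + m *\<^sub>R (r - y)"
   have "z = (1 - m) *\<^sub>R y + m *\<^sub>R r" by (simp add: z_def algebra_simps)
   then have z1: "z \<in> closed_segment y r" using m unfolding in_segment by (intro exI[of _ m]) auto
   have "m *\<^sub>R (r - y) = (m / s) *\<^sub>R (x - y)" unfolding xs using s0 by simp
   then have "z = y + (m / s) *\<^sub>R (x - y)" by (simp only: z_def)
   also have "\<dots> = (1 - m / s) *\<^sub>R y + (m / s) *\<^sub>R x" by (simp add: algebra_simps)
   finally have z2: "z \<in> closed_segment y x" using m s0 unfolding in_segment by (intro exI[of _ "m / s"]) auto
   have "{y, r} ~= {y, x}" "{y, r} Int {y, x} = {y}" using x r' drawing_edge(4)[OF d x(1)] drawing_edge(4)[OF d r] by auto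
   then have "z = y" using drawing_disjoint[OF d r x(1)] z1 z2 by blast
   then show False using m(1) ry by (simp add: z_def)
  qed
 qed (use r S in \<open>auto simp: spread_def\<close>)
 then show ?thesis by blast
qed

text \<open>Besides the vertices of the graph \<open>A\<close> on \<open>B\<close> the drawing has auxiliary points: every triangle in
  \<open>R\<close> has one of its own, joined exactly to its corners, which can serve as a further vertex attached to
  this triangle. Isolated vertices of \<open>A\<close> are placed next to \<open>o1\<close>, which is never a corner.\<close>

definition placed :: "('v => 'v => bool) => complex set => (complex => complex => bool) => complex => complex =>
  ('v => complex) => 'v set => 'v set set => bool" where
 "placed A P L o1 o2 p B R \<longleftrightarrow> drawing P L \<and> L o1 o2 \<and> o1 \<notin> p ` B \<and> o2 \<notin> p ` B \<and> inj_on p B \<and> p ` B \<subseteq> P \<and>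
  (\<forall>u\<in>B. \<forall>v\<in>B. A u v --> L (p u) (p v)) \<and> (\<forall>x\<in>P. \<exists>z. L x z) \<and>
  (\<forall>T\<in>R. T \<subseteq> B \<and> card T = 3 \<and> (\<exists>x\<in>P - p ` B. {z. L x z} = p ` T \<and> spread x (p ` T)))"

lemma placedD:
 assumes "placed A P L o1 o2 p B R"
 shows placed_drawing: "drawing P L" and "L o1 o2" and "o1 \<notin> p ` B" and "o2 \<notin> p ` B" and "inj_on p B"
  and "p ` B \<subseteq> P" and placed_edge: "u \<in> B ==> v \<in> B ==> A u v ==> L (p u) (p v)"
  and "x \<in> P ==> \<exists>z. L x z"
  and "T \<in> R ==> T \<subseteq> B" "T \<in> R ==> card T = 3"
  and "T \<in> R ==> \<exists>x\<in>P - p ` B. {z. L x z} = p ` T \<and> spread x (p ` T)"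
 using assms unfolding placed_def by simp_all

lemma placed_attach:
 assumes pl: "placed A P L o1 o2 p B R" and w: "w \<notin> P" and d: "drawing (insert w P) (attach L w S)"
  and S: "S \<subseteq> insert o1 (p ` B)" "S ~= {}"
  and R': "\<And>T. T \<in> R' ==> T \<in> R \<or> T \<subseteq> B \<and> card T = 3 \<and> p ` T = S \<and> spread w S"
 shows "placed A (insert w P) (attach L w S) o1 o2 p B R'"
proof -
 note D = placedD[OF pl]
 have o1: "o1 \<in> P" by (rule drawing_edge(2)[OF D(1,2)])
 have SP: "S \<subseteq> P" using S(1) D(6) o1 by blast
 have wS: "w \<notin> S" and wB: "w \<notin> p ` B" using SP w D(6) by blast+
 have new: "{z. attach L w S w z} = S" using attach_new[OF D(1) w] wS by simp
 show ?thesis unfolding placed_def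
 proof (intro conjI ballI impI)
  fix x assume x: "x \<in> insert w P"
  show "\<exists>z. attach L w S x z"
  proof (cases "x = w")
   case True then show ?thesis using S(2) by (auto simp: attach_def)
  next
   case False
   then obtain z where "L x z" using D(8)[of x] x by blast
   then show ?thesis unfolding attach_def by blast
  qed
 next
  fix T assume T: "T \<in> R'"
  show "T \<subseteq> B" "card T = 3" using R'[OF T] D(9,10)[of T] by blast+
  show "\<exists>x\<in>insert w P - p ` B. {z. attach L w S x z} = p ` T \<and> spread x (p ` T)"
   using R'[OF T]
  proof
   assume "T \<in> R"
   then obtain x where x: "x \<in> P" "x \<notin> p ` B" "{z. L x z} = p ` T" "spread x (p ` T)" and TB: "T \<subseteq> B"
    using D(9,11)[of T] by blast
   have "x ~= o1"
   proof
    assume "x = o1"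
    then have "o2 \<in> p ` T" using x(3) D(2) by blast
    then show False using D(4) TB by blast
   qed
   then have "x \<notin> S" using S(1) x(2) by blast
   moreover have "x ~= w" using x(1) w by blast
   ultimately have "{z. attach L w S x z} = p ` T" using attach_old[of x w L S] x(3) by simp
   then show ?thesis using x by blast
  next
   assume *: "T \<subseteq> B \<and> card T = 3 \<and> p ` T = S \<and> spread w S"
   show ?thesis by (rule bexI[of _ w]) (use * new wB in auto)
  qed
 qed (use D(2-7) d in \<open>auto simp: attach_def\<close>)
qed

text \<open>An auxiliary point x turns into the vertex v. A triangle of R' that was served by x must
  have a second auxiliary point.\<close>

lemma placed_promote:
 assumes pl: "placed A P L o1 o2 p B R" and sym: "\<And>u v. A u v ==> A v u" and irrefl: "\<And>u. \<not> A u u"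
  and v: "v \<notin> B" and x: "x \<in> P" "x \<notin> p ` B" "x ~= o1" "x ~= o2"
  and nb: "\<And>u. u \<in> B ==> A v u ==> L x (p u)"
  and R': "\<And>T. T \<in> R' ==> T \<in> R \<and> ({z. L x z} ~= p ` T \<or>
    (\<exists>x'\<in>P - p ` B. x' ~= x \<and> {z. L x' z} = p ` T \<and> spread x' (p ` T)))"
 shows "placed A P L o1 o2 (p(v := x)) (insert v B) R'"
proof -
 note D = placedD[OF pl]
 have im: "(p(v := x)) ` T = p ` T" if "T \<subseteq> B" for T using that v by (intro image_cong) auto
 have im': "(p(v := x)) ` insert v B = insert x (p ` B)"
  unfolding image_insert fun_upd_same im[OF order_refl] by (rule refl)
 show ?thesis unfolding placed_def
 proof (intro conjI ballI impI)
  show "inj_on (p(v := x)) (insert v B)" using D(5) v x(2) by (auto simp: inj_on_def)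
  show "o1 \<notin> (p(v := x)) ` insert v B" "o2 \<notin> (p(v := x)) ` insert v B" "(p(v := x)) ` insert v B \<subseteq> P"
   unfolding im' using D(3,4,6) x by blast+
 next
  fix s t assume st: "s \<in> insert v B" "t \<in> insert v B" and A: "A s t"
  consider "s = v" "t \<in> B" "t ~= v" | "t = v" "s \<in> B" "s ~= v" | "s \<in> B" "t \<in> B" "s ~= v" "t ~= v"
   using st A irrefl v by blast
  then show "L ((p(v := x)) s) ((p(v := x)) t)"
  proof cases
   case 1
   have "L x (p t)" by (rule nb[OF 1(2)]) (use A 1(1) in simp)
   then show ?thesis using 1 by simp
  next
   case 2
   have "L x (p s)" by (rule nb[OF 2(2) sym]) (use A 2(1) in simp)
   then show ?thesis using drawing_edge(1)[OF D(1)] 2 by simp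
  next
   case 3
   then show ?thesis using D(7)[OF 3(1,2) A] by simp
  qed
 next
  fix T assume T: "T \<in> R'"
  have TR: "T \<in> R" using R'[OF T] by blast
  have TB: "T \<subseteq> B" by (rule D(9)[OF TR])
  show "T \<subseteq> insert v B" using TB by blast
  show "card T = 3" by (rule D(10)[OF TR])
  have "\<exists>x'\<in>P - p ` B. x' ~= x \<and> {z. L x' z} = p ` T \<and> spread x' (p ` T)"
  proof (cases "{z. L x z} = p ` T")
   case True then show ?thesis using R'[OF T] by blast
  next
   case False
   obtain x' where x': "x' \<in> P - p ` B" "{z. L x' z} = p ` T" "spread x' (p ` T)" using D(11)[OF TR] by blast
   have "x' ~= x" using False x'(2) by metis
   then show ?thesis using x' by (intro bexI[of _ x'] conjI)
  qed
  then show "\<exists>x'\<in>P - (p(v := x)) ` insert v B. {z. L x' z} = (p(v := x)) ` T \<and> spread x' ((p(v := x)) ` T)"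
   unfolding im' im[OF TB] by blast
 qed (use D(1,2,8) in simp_all)
qed

text \<open>The promoted point is joined to at most two points, so it is not the auxiliary point of
  any triangle.\<close>

lemma placed_small:
 assumes pl: "placed A P L o1 o2 p B R" and sym: "\<And>u v. A u v ==> A v u" and irrefl: "\<And>u. \<not> A u u"
  and v: "v \<notin> B" and w: "w \<notin> P" and d: "drawing (insert w P) (attach L w S)"
  and S: "S \<subseteq> insert o1 (p ` B)" "S ~= {}" "finite S" "card S \<le> 2" and nb: "\<And>u. u \<in> B ==> A v u ==> p u \<in> S"
 shows "placed A (insert w P) (attach L w S) o1 o2 (p(v := w)) (insert v B) R"
proof (rule placed_promote[OF placed_attach[OF pl w d S(1,2)] sym irrefl v])
 note D = placedD[OF pl]
 have o: "o1 \<in> P" "o2 \<in> P" using drawing_edge(2,3)[OF D(1,2)] by blast+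
 show "w \<notin> p ` B" "w ~= o1" "w ~= o2" using w o D(6) by blast+
 have wS: "w \<notin> S" using S(1) w o(1) D(6) by blast
 show "attach L w S w (p u)" if "u \<in> B" "A v u" for u using nb[OF that] by (auto simp: attach_def)
 fix T assume T: "T \<in> R"
 have "card (p ` T) = 3" using D(9,10)[OF T] inj_on_subset[OF D(5)] card_image by metis
 then have "S ~= p ` T" using S(4) by auto
 then show "T \<in> R \<and> ({z. attach L w S w z} ~= p ` T \<or>
    (\<exists>x'\<in>insert w P - p ` B. x' ~= w \<and> {z. attach L w S x' z} = p ` T \<and> spread x' (p ` T)))"
  using T attach_new[OF D(1) w] wS by simp
qed simp_all

text \<open>Once v is joined exactly to the corners a, b, c, \<open>surround\<close> provides the
  auxiliary points of the three triangles at v.\<close>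

lemma placed_K4:
 assumes pl: "placed A P L o1 o2 p B R" and B: "a \<in> B" "b \<in> B" "c \<in> B" "v \<in> B" and dist: "distinct [a, b, c, v]"
  and N: "{z. L (p v) z} = {p a, p b, p c}" and spr: "spread (p v) {p a, p b, p c}"
 shows "\<exists>P' L'. placed A P' L' o1 o2 p B (R Un {{a, b, v}, {a, c, v}, {b, c, v}})"
proof -
 note D = placedD[OF pl]
 have ne: "p a ~= p b" "p a ~= p c" "p b ~= p c" using inj_onD[OF D(5)] B dist by auto
 obtain w1 w2 w3 where w: "w1 \<notin> P" "w2 \<notin> insert w1 P" "w3 \<notin> insert w2 (insert w1 P)"
  and d: "drawing (insert w1 P) (attach L w1 {p v, p a, p b})"
   "drawing (insert w2 (insert w1 P)) (attach (attach L w1 {p v, p a, p b}) w2 {p v, p b, p c})"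
   "drawing (insert w3 (insert w2 (insert w1 P)))
    (attach (attach (attach L w1 {p v, p a, p b}) w2 {p v, p b, p c}) w3 {p v, p a, p c})"
  and s: "spread w1 {p v, p a, p b}" "spread w2 {p v, p b, p c}" "spread w3 {p v, p a, p c}"
  using surround[OF D(1) N ne spr] by blast
 have im: "p ` {a, b, v} = {p v, p a, p b}" "p ` {b, c, v} = {p v, p b, p c}" "p ` {a, c, v} = {p v, p a, p c}"
  by auto
 have card: "card {a, b, v} = 3" "card {b, c, v} = 3" "card {a, c, v} = 3" using dist by auto
 have sub: "{p v, p a, p b} \<subseteq> insert o1 (p ` B)" "{p v, p b, p c} \<subseteq> insert o1 (p ` B)" "{p v, p a, p c} \<subseteq> insert o1 (p ` B)"
  and sub': "{a, b, v} \<subseteq> B" "{b, c, v} \<subseteq> B" "{a, c, v} \<subseteq> B" using B by auto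
 have 1: "placed A (insert w1 P) (attach L w1 {p v, p a, p b}) o1 o2 p B (insert {a, b, v} R)"
  by (rule placed_attach[OF pl w(1) d(1) sub(1)]) (use im(1) card(1) sub'(1) s(1) in auto)
 have 2: "placed A (insert w2 (insert w1 P)) (attach (attach L w1 {p v, p a, p b}) w2 {p v, p b, p c}) o1 o2 p B
   (insert {b, c, v} (insert {a, b, v} R))"
  by (rule placed_attach[OF 1 w(2) d(2) sub(2)]) (use im(2) card(2) sub'(2) s(2) in auto)
 have 3: "placed A (insert w3 (insert w2 (insert w1 P)))
   (attach (attach (attach L w1 {p v, p a, p b}) w2 {p v, p b, p c}) w3 {p v, p a, p c}) o1 o2 p B
   (insert {a, c, v} (insert {b, c, v} (insert {a, b, v} R)))"
  by (rule placed_attach[OF 2 w(3) d(3) sub(3)]) (use im(3) card(3) sub'(3) s(3) in auto)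
 have "insert {a, c, v} (insert {b, c, v} (insert {a, b, v} R)) = R Un {{a, b, v}, {a, c, v}, {b, c, v}}" by auto
 then show ?thesis using 3 by metis
qed

lemma ctree_placed:
 assumes sym: "\<And>u v. A u v ==> A v u" and irrefl: "\<And>u. \<not> A u u" and "ctree A V R"
 shows "\<exists>P L o1 o2 p. placed A P L o1 o2 p V R"
 using assms(3)
proof (induction rule: ctree.induct)
 case ct0
 \<comment> \<open>The drawing starts with the anchor edge o1 o2 alone; no vertex is placed
   yet.\<close>
 define L where "L x y \<longleftrightarrow> {x, y} = {0, 1::complex}" for x y
 have "drawing {0, 1} L" unfolding drawing_def L_def by (auto simp: doubleton_eq_iff)
 then have "placed A {0, 1} L 0 1 (\<lambda>_. 0) {} {}" by (auto simp: placed_def L_def)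
 then show ?case by blast
next
 case (ct1 V R v)
 then obtain P L o1 o2 p where pl: "placed A P L o1 o2 p V R" by blast
 note D = placedD[OF pl]
 obtain w where w: "w \<notin> P" "drawing (insert w P) (attach L w {o1})"
  using attach_edge[OF D(1,2), of "{o1}"] by blast
 show ?case using placed_small[OF pl sym irrefl ct1.hyps(2) w] ct1.hyps(3) by fastforce
next
 case (ct2 V R v a)
 then obtain P L o1 o2 p where pl: "placed A P L o1 o2 p V R" by blast
 note D = placedD[OF pl]
 have a: "a \<in> V" using ct2.hyps(3) by blast
 then obtain r where "L (p a) r" using D(6,8) by blast
 from attach_edge[OF D(1) this, of "{p a}"]
 obtain w where w: "w \<notin> P" "drawing (insert w P) (attach L w {p a})" by blast
 have nb: "p u \<in> {p a}" if "u \<in> V" "A v u" for u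
 proof -
  have "u \<in> {a}" unfolding ct2.hyps(3)[symmetric] using that by simp
  then show ?thesis by simp
 qed
 show ?case using placed_small[OF pl sym irrefl ct2.hyps(2) w _ _ _ _ nb] a by fastforce
next
 case (ct3 V R v a b)
 then obtain P L o1 o2 p where pl: "placed A P L o1 o2 p V R" by blast
 note D = placedD[OF pl]
 have ab: "a \<in> V" "b \<in> V" using ct3.hyps(3) by blast+
 from attach_edge[OF D(1) D(7)[OF ab ct3.hyps(5)] order_refl]
 obtain w where w: "w \<notin> P" "drawing (insert w P) (attach L w {p a, p b})" by blast
 have nb: "p u \<in> {p a, p b}" if "u \<in> V" "A v u" for u
 proof -
  have "u \<in> {a, b}" unfolding ct3.hyps(3)[symmetric] using that by simp
  then show ?thesis by auto
 qed
 have "card {p a, p b} \<le> 2" by (simp add: card_insert_if)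
 then show ?case using placed_small[OF pl sym irrefl ct3.hyps(2) w _ _ _ _ nb] ab by fastforce
next
 case (ct4 V R v w a b)
 \<comment> \<open>v is placed at x beside the edge a b. Two auxiliary points y and w1 are made for
   the triangle a, b, v: w1 becomes the vertex w, and y keeps serving the triangle.\<close>
 then obtain P L o1 o2 p where pl: "placed A P L o1 o2 p V R" by blast
 note D = placedD[OF pl]
 have ab: "a \<in> V" "b \<in> V" using ct4.hyps(6) by blast+
 have pab: "p a ~= p b" using inj_onD[OF D(5)] ab ct4.hyps(8) by blast
 have vab: "v ~= a" "v ~= b" "w ~= a" "w ~= b" using ab ct4.hyps(2,3) by blast+
 obtain x where x: "x \<notin> P" "drawing (insert x P) (attach L x {p a, p b})" "spread x {p a, p b}"
  using attach_edge[OF D(1) D(7)[OF ab ct4.hyps(9)] order_refl] by blast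
 have nb: "p u \<in> {p a, p b}" if "u \<in> V" "A v u" for u
 proof -
  have "u \<in> {a, b}" unfolding ct4.hyps(6)[symmetric] using that by simp
  then show ?thesis by auto
 qed
 have "card {p a, p b} \<le> 2" by (simp add: card_insert_if)
 then have pl1: "placed A (insert x P) (attach L x {p a, p b}) o1 o2 (p(v := x)) (insert v V) R"
  using placed_small[OF pl sym irrefl ct4.hyps(2) x(1,2) _ _ _ _ nb] ab by fastforce
 define p1 where "p1 = p(v := x)"
 define P1 where "P1 = insert x P"
 define L1 where "L1 = attach L x {p a, p b}"
 have p1: "p1 a = p a" "p1 b = p b" "p1 v = x" using vab by (simp_all add: p1_def)
 have pl1': "placed A P1 L1 o1 o2 p1 (insert v V) R" using pl1 unfolding p1_def P1_def L1_def .
 note D1 = placedD[OF pl1']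
 have pP: "p a \<in> P" "p b \<in> P" using ab D(6) by blast+
 have N1: "{z. L1 x z} = {p a, p b}" using attach_new[OF D(1) x(1)] pP x(1) by (auto simp: L1_def)
 have cr: "cross (p a - x) (p b - x) ~= 0" by (rule spreadD[OF x(3)]) (use pab in auto)
 obtain y where y: "y \<notin> P1" "drawing (insert y P1) (attach L1 y {x, p a, p b})" "spread y {x, p a, p b}"
  "spread x {p a, p b, y}"
  using attach_corner[OF D1(1) N1 pab cr] by blast
 define P2 where "P2 = insert y P1"
 define L2 where "L2 = attach L1 y {x, p a, p b}"
 have im: "p1 ` {a, b, v} = {x, p a, p b}" using p1 by auto
 have card3: "card {a, b, v} = 3" using vab ct4.hyps(8) by auto
 have sub: "{x, p a, p b} \<subseteq> insert o1 (p1 ` insert v V)"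
 proof -
  have "p1 ` {a, b, v} \<subseteq> p1 ` insert v V" using ab by (intro image_mono) auto
  then show ?thesis unfolding im by blast
 qed
 have pl2: "placed A P2 L2 o1 o2 p1 (insert v V) (insert {a, b, v} R)" unfolding P2_def L2_def
 proof (rule placed_attach[OF pl1' y(1,2) sub])
  fix T assume "T \<in> insert {a, b, v} R"
  then show "T \<in> R \<or> T \<subseteq> insert v V \<and> card T = 3 \<and> p1 ` T = {x, p a, p b} \<and> spread y {x, p a, p b}"
   using im card3 y(3) ab by blast
 qed simp
 note D2 = placedD[OF pl2]
 have ny: "x ~= y" "p a ~= y" "p b ~= y" using y(1) pP by (auto simp: P1_def)
 have N2x: "{z. L2 x z} = {p a, p b, y}" using attach_old[OF ny(1), of L1] N1 by (auto simp: L2_def)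
 have N2y: "{z. L2 y z} = {x, p a, p b}" using attach_new[OF D1(1) y(1)] ny by (simp add: L2_def)
 have nab: "p a ~= p b" "p a ~= y" "p b ~= y" using pab ny by auto
 obtain w1 where w1: "w1 \<notin> P2" "drawing (insert w1 P2) (attach L2 w1 {x, p a, p b})" "spread w1 {x, p a, p b}"
  using surround[OF D2(1) N2x nab y(4)] by blast
 define P3 where "P3 = insert w1 P2"
 define L3 where "L3 = attach L2 w1 {x, p a, p b}"
 have pl3: "placed A P3 L3 o1 o2 p1 (insert v V) (insert {a, b, v} R)" unfolding P3_def L3_def
  by (rule placed_attach[OF pl2 w1(1,2) sub]) simp_all
 have nw: "x ~= w1" "p a ~= w1" "p b ~= w1" "y ~= w1" using w1(1) pP by (auto simp: P2_def P1_def)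
 have N3w: "{z. L3 w1 z} = {x, p a, p b}" using attach_new[OF D2(1) w1(1)] nw by (simp add: L3_def)
 have N3y: "{z. L3 y z} = {x, p a, p b}" using attach_old[OF nw(4), of L2] ny N2y by (auto simp: L3_def)
 have w: "w \<notin> insert v V" using ct4.hyps(3,4) by blast
 have pl4: "placed A P3 L3 o1 o2 (p1(w := w1)) (insert w (insert v V)) (insert {a, b, v} R)"
 proof (rule placed_promote[OF pl3 sym irrefl w])
  show "w1 \<in> P3" by (simp add: P3_def)
  show "w1 \<notin> p1 ` insert v V" using w1(1) D2(6) by blast
  show "w1 ~= o1" "w1 ~= o2" using w1(1) drawing_edge(2,3)[OF D2(1,2)] by blast+
 next
  fix u assume u: "u \<in> insert v V" "A w u"
  have "u \<in> {a, b}" if "u \<in> V" unfolding ct4.hyps(7)[symmetric] using that u(2) by simp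
  then have "u \<in> {a, b, v}" using u(1) by blast
  then have "p1 u \<in> p1 ` {a, b, v}" by (rule imageI)
  then show "L3 w1 (p1 u)" using N3w unfolding im by blast
 next
  fix T assume T: "T \<in> insert {a, b, v} R"
  show "T \<in> insert {a, b, v} R \<and> ({z. L3 w1 z} ~= p1 ` T \<or>
    (\<exists>x'\<in>P3 - p1 ` insert v V. x' ~= w1 \<and> {z. L3 x' z} = p1 ` T \<and> spread x' (p1 ` T)))"
  proof (intro conjI T)
   have "y \<in> P3 - p1 ` insert v V" using y(1) D1(6) by (auto simp: P3_def P2_def)
   moreover have "{z. L3 y z} = p1 ` T \<and> spread y (p1 ` T)" if "{z. L3 w1 z} = p1 ` T"
    using that N3w N3y y(3) by simp
   ultimately show "{z. L3 w1 z} ~= p1 ` T \<or>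
     (\<exists>x'\<in>P3 - p1 ` insert v V. x' ~= w1 \<and> {z. L3 x' z} = p1 ` T \<and> spread x' (p1 ` T))"
    using nw(4) by blast
  qed
 qed
 have p2: "(p1(w := w1)) a = p a" "(p1(w := w1)) b = p b" "(p1(w := w1)) v = x" "(p1(w := w1)) w = w1"
  using p1 vab ct4.hyps(4) by auto
 have N4: "{z. L3 ((p1(w := w1)) w) z} = {(p1(w := w1)) a, (p1(w := w1)) b, (p1(w := w1)) v}"
  unfolding p2 N3w by blast
 have "{x, p a, p b} = {p a, p b, x}" by blast
 then have S4: "spread ((p1(w := w1)) w) {(p1(w := w1)) a, (p1(w := w1)) b, (p1(w := w1)) v}"
  unfolding p2 using w1(3) by metis
 have "\<exists>P' L'. placed A P' L' o1 o2 (p1(w := w1)) (insert w (insert v V))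
   (insert {a, b, v} R Un {{a, b, w}, {a, v, w}, {b, v, w}})"
  by (rule placed_K4[OF pl4 _ _ _ _ _ N4 S4]) (use ab vab ct4.hyps(4,8) in auto)
 moreover have "insert {a, b, v} R Un {{a, b, w}, {a, v, w}, {b, v, w}} =
   R Un {{a,b,v}, {a,b,w}, {a,v,w}, {b,v,w}}" by blast
 ultimately show ?case by metis
next
 case (ct5 V R v a b c)
 then obtain P L o1 o2 p where pl: "placed A P L o1 o2 p V R" by blast
 note D = placedD[OF pl]
 obtain x where x: "x \<in> P" "x \<notin> p ` V" "{z. L x z} = p ` {a, b, c}" "spread x (p ` {a, b, c})"
  using D(11)[OF ct5.hyps(4)] by blast
 have abc: "a \<in> V" "b \<in> V" "c \<in> V" using ct5.hyps(3) by blast+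
 have ne: "a ~= b" "a ~= c" "b ~= c" using ct5.hyps(5) by (auto simp: card_insert_if split: if_splits)
 \<comment> \<open>The auxiliary point of a, b, c becomes v. Other triangles are served by other
   points, because p is injective.\<close>
 have "placed A P L o1 o2 (p(v := x)) (insert v V) (R - {{a, b, c}})"
 proof (rule placed_promote[OF pl sym irrefl ct5.hyps(2) x(1,2)])
  have "o1 \<notin> {z. L x z}" "o2 \<notin> {z. L x z}" unfolding x(3) using abc D(3,4) by blast+
  then show "x ~= o1" "x ~= o2" using D(2) drawing_edge(1)[OF D(1,2)] by blast+
 next
  fix u assume "u \<in> V" "A v u"
  then have "u \<in> {a, b, c}" unfolding ct5.hyps(3)[symmetric] by simp
  then have "p u \<in> p ` {a, b, c}" by (rule imageI)
  then show "L x (p u)" using x(3) by blast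
 next
  fix T assume T: "T \<in> R - {{a, b, c}}"
  have "T \<subseteq> V" "{a, b, c} \<subseteq> V" using D(9)[of T] T abc by blast+
  then have "p ` T ~= p ` {a, b, c}" using T inj_on_image_eq_iff[OF D(5)] by blast
  then have "{z. L x z} ~= p ` T" unfolding x(3) by (rule not_sym)
  then show "T \<in> R \<and> ({z. L x z} ~= p ` T \<or>
    (\<exists>x'\<in>P - p ` V. x' ~= x \<and> {z. L x' z} = p ` T \<and> spread x' (p ` T)))" using T by blast
 qed
 moreover have vn: "v ~= a" "v ~= b" "v ~= c" using abc ct5.hyps(2) by blast+
 moreover have "p ` {a, b, c} = {p a, p b, p c}" by simp
 ultimately have "\<exists>P' L'. placed A P' L' o1 o2 (p(v := x)) (insert v V)
   ((R - {{a, b, c}}) Un {{a, b, v}, {a, c, v}, {b, c, v}})"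
  by (intro placed_K4) (use abc ne x(3,4) in auto)
 then show ?case by blast
qed

text \<open>The straight-line drawing is restricted to the images of the vertices and edges of H;
  auxiliary points and the anchor edge are dropped.\<close>

theorem planar_ctree:
 fixes H :: "('v, 'e) mgraph"
 assumes fg: "finite_graph H" and ct: "ctree (adjacent H) (verts H) R"
  and pair: "\<And>e. e \<in> edges H ==> \<exists>a b. ends H e = {a, b} \<and> a ~= b"
  and inj: "\<And>e f. e \<in> edges H ==> f \<in> edges H ==> ends H e = ends H f ==> e = f"
 shows "planar H"
proof -
 interpret H: finite_graph H by (rule fg)
 have sym: "adjacent H v u" if "adjacent H u v" for u v using that by (simp add: adjacent_def insert_commute)
 have irrefl: "\<not> adjacent H u u" for u
 proof
  assume "adjacent H u u"
  then obtain e where e: "e \<in> edges H" "ends H e = {u}" by (auto simp: adjacent_def)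
  then show False using pair[OF e(1)] by auto
 qed
 obtain P L o1 o2 p where pl: "placed (adjacent H) P L o1 o2 p (verts H) R"
  using ctree_placed[of "adjacent H", OF sym irrefl ct] by blast
 note D = placedD[OF pl]
 have "\<exists>ab. ends H e = {fst ab, snd ab} \<and> fst ab ~= snd ab" if "e \<in> edges H" for e
  using pair[OF that] by auto
 then obtain f where f: "\<And>e. e \<in> edges H ==> ends H e = {fst (f e), snd (f e)} \<and> fst (f e) ~= snd (f e)" by metis
 define g where "g e = linepath (p (fst (f e))) (p (snd (f e)))" for e
 have L: "L (p (fst (f e))) (p (snd (f e)))" if e: "e \<in> edges H" for e
 proof (rule D(7))
  show "fst (f e) \<in> verts H" "snd (f e) \<in> verts H" using f[OF e] H.ends_in_verts[OF e] by auto
  show "adjacent H (fst (f e)) (snd (f e))" using f[OF e] e by (auto simp: adjacent_def)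
 qed
 have im: "p ` ends H e = {p (fst (f e)), p (snd (f e))}" if e: "e \<in> edges H" for e using f[OF e] by auto
 have "plane_drawing H p g" unfolding plane_drawing_def
 proof (intro conjI ballI impI)
  show "inj_on p (verts H)" by (rule D(5))
  fix e assume e: "e \<in> edges H"
  have "p (fst (f e)) ~= p (snd (f e))" by (rule drawing_edge(4)[OF D(1) L[OF e]])
  then show "simple_path (g e)" unfolding g_def by (rule simple_path_linepath)
  show "{pathstart (g e), pathfinish (g e)} = p ` ends H e" by (simp add: g_def im[OF e])
  have s: "closed_segment (p (fst (f e))) (p (snd (f e))) Int P \<subseteq> p ` ends H e"
   "p ` ends H e \<subseteq> closed_segment (p (fst (f e))) (p (snd (f e)))"
   unfolding im[OF e] using drawing_point[OF D(1) L[OF e]] by simp_all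
  have "p ` ends H e \<subseteq> p ` verts H" by (rule image_mono[OF H.ends_in_verts[OF e]])
  then show "path_image (g e) Int p ` verts H = p ` ends H e"
   using s D(6) unfolding g_def path_image_linepath by blast
 next
  fix e e' assume e: "e \<in> edges H" "e' \<in> edges H" "e ~= e'"
  have V: "ends H e \<subseteq> verts H" "ends H e' \<subseteq> verts H" using H.ends_in_verts e by blast+
  have "ends H e ~= ends H e'" using inj e by blast
  then have "p ` ends H e ~= p ` ends H e'" using inj_on_image_eq_iff[OF D(5) V] by blast
  then have "path_image (g e) Int path_image (g e') \<subseteq> p ` ends H e Int p ` ends H e'"
   using drawing_disjoint[OF D(1) L[OF e(1)] L[OF e(2)]] unfolding im[OF e(1)] im[OF e(2)] g_def path_image_linepath
   by blast
  also have "\<dots> = p ` (ends H e Int ends H e')" using inj_on_image_Int[OF D(5) V] by simp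
  finally show "path_image (g e) Int path_image (g e') \<subseteq> p ` (ends H e Int ends H e')" .
 qed
 then show ?thesis unfolding planar_def by blast
qed

theorem theorem6p2:
  fixes M :: "'a pre_matroid"
  assumes "matroid M" and "simple_matroid M" and "cographic M"
  shows "(all_roots_integers (characteristic_poly M) \<longleftrightarrow> parallel_connection_of_cliques M) \<and>
    (parallel_connection_of_cliques M \<longleftrightarrow>
      (\<exists>H :: (nat, 'a) mgraph. finite_graph H \<and> planar H \<and> chordal H \<and> M = cycle_matroid H)) \<and>
    ((\<exists>H :: (nat, 'a) mgraph. finite_graph H \<and> planar H \<and> chordal H \<and> M = cycle_matroid H) \<longleftrightarrow>
      supersolvable M)"
proof -
 note M = assms(1) and sim = assms(2)
 obtain G :: "(nat, 'a) mgraph" where G: "finite_graph G" "M = dual (cycle_matroid G)"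
  using assms(3) unfolding cographic_def by blast
 interpret matroid M by (rule M)
 interpret G: finite_graph G by (rule G(1))
 interpret cographic_matroid M G by unfold_locales (rule G(2))
 let ?chain = "(mhstep (flats M))\<^sup>*\<^sup>* {} (ground M)"
 let ?graph = "\<exists>H :: (nat, 'a) mgraph. finite_graph H \<and> planar H \<and> chordal H \<and> M = cycle_matroid H"
 have chained: ?chain if "chained (flats M) (ground M)"
  using that simple_empty_flat[OF sim] by (simp add: chained_def small_def)
 have 1: "all_roots_integers (characteristic_poly M) \<longleftrightarrow> ?chain"
 proof
  assume "all_roots_integers (characteristic_poly M)"
  then show ?chain by (rule chained[OF integral_roots_chained[OF assms]])
 next
  assume ?chain
  then obtain as where "characteristic_poly M = (\<Prod>a\<leftarrow>as. [:- a, 1:])"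
   using chain_characteristic_poly[OF sim, of "ground M"] unfolding restriction_ground by blast
  then show "all_roots_integers (characteristic_poly M)" by (simp only: all_roots_integers_prod)
 qed
 have 2: ?chain if pc: "parallel_connection_of_cliques M"
 proof -
  obtain \<K> \<U> where "assembled M \<K> \<U>" using pc unfolding parallel_connection_of_cliques_def by blast
  from assembled_chained[OF this] show ?thesis using chained by simp
 qed
 have 3: ?chain if gr: ?graph
 proof -
  obtain H :: "(nat, 'a) mgraph" where H: "finite_graph H" "chordal H" "M = cycle_matroid H" using gr by blast
  have "ground M = edges H" unfolding H(3) by (simp add: cycle_matroid_def)
  then show ?thesis using chordal_chain[of H] M sim H by metis
 qed
 have 4: "parallel_connection_of_cliques M \<and> ?graph" if ch: ?chain
 proof -
  obtain H where H: "represents H (ground M)" using chain_represents[OF sim ch] by blast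
  interpret cographic_graph M G H by unfold_locales (use sim H in auto)
  have "planar H" by (rule planar_ctree[OF Hfg graph_ctree]) (use pair_ex ends_inj edgesH in auto)
  moreover have "chordal H" unfolding chordal_iff using peo_no_hole[OF peoH] by blast
  ultimately show ?thesis using parallel_connection_of_cliques Hfg M_cycle by blast
 qed
 have 5: "supersolvable M \<longleftrightarrow> ?chain" by (rule supersolvable_iff[OF sim])
 show ?thesis using 1 2 3 4 5 by argo
qed

end
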